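(* Let $\mathsf Q$ be a Gray presentation such that $\mathsf Q_{\le3}$ is terminating and such that, for every critical branching $(S_1:\phi\Rrightarrow\phi_1,\ S_2:\phi\Rrightarrow\phi_2)$ of $\mathsf Q_{\le3}$, there exist $\psi\in\mathsf Q_2^*$, $3$-cells $F_i:\phi_i\Rrightarrow\psi$ in $\mathsf Q_3^*$ for $i\in\{1,2\}$, and a $4$-generator $G\in\mathsf Q_4$ with source $S_1\ast_2F_1$ and target $S_2\ast_2F_2$. Then $\mathsf Q$ is a coherent Gray presentation.
   Context: **Precategories.** An $n$-precategory is an $n$-globular set $C$ (sets $C_0,\dots,C_n$ with source/target maps $\partial^-_i,\partial^+_i:C_{i+1}\to C_i$ satisfying the globular identities; $\partial^\epsilon_i$ also denotes iterated source/target) with identities $\mathrm{id}:C_{k-1}\to C_k$ and compositions $u\ast_i v\in C_{\max(k,l)}$ for $u\in C_k$, $v\in C_l$, $k,l>0$, $i=\min(k,l)-1$, $\partial^+_i(u)=\partial^-_i(v)$ ("$i$-composable"), such that: $\partial^\pm(\mathrm{id}_u)=u$; $\partial^\epsilon(u\ast_i v)$ is $u\ast_i\partial^\epsilon v$ if $k<l$, $\partial^\epsilon u\ast_i v$ if $k>l$, and $\partial^-u$ (resp. $\partial^+v$) for $\epsilon=-$ (resp. $+$) if $k=l$; composing with an identity on a cell of dimension $i$ via $\ast_i$ is trivial, and $\mathrm{id}_u\ast_i v=\mathrm{id}_{u\ast_i v}$, $v\ast_i\mathrm{id}_u=\mathrm{id}_{v\ast_i u}$ when $\dim u>i$ and $\dim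 v=i+1$; each $\ast_i$ is associative whenever both sides are defined; for $i<j$ and $u$ of dimension $i+1$, $u\ast_i(v\ast_j v')=(u\ast_i v)\ast_j(u\ast_i v')$ and $(v\ast_j v')\ast_i u=(v\ast_i u)\ast_j(v'\ast_i u)$ whenever the left sides are defined. Morphisms preserve all the structure. **Prepolygraphs.** A $0$-prepolygraph is a set $\mathsf P_0$, with $\mathsf P^*_0=\mathsf P_0$. An $(n+1)$-prepolygraph is an $n$-prepolygraph $(\mathsf P_0,\dots,\mathsf P_n)$, generating a free $n$-precategory with $i$-cells $\mathsf P^*_i$, together with a set $\mathsf P_{n+1}$ of $(n+1)$-generators with source and target in $\mathsf P^*_n$ (parallel if $n\ge1$); its free $(n+1)$-precategory $\mathsf P^*$ is obtained by freely adjoining the elements of $\mathsf P_{n+1}$ as $(n+1)$-cells. $\mathsf P_{\le k}$ is the underlying $k$-prepolygraph. Every $2$-cell of $\mathsf P^*$ is uniquely a $\ast_1$-composite of whiskers $l\ast_0\alpha\ast_0 r$ with $\alpha\in\mathsf P_2$, $l,r\in\mathsf P^*_1$. **Presented precategory.** A congruence on an $n$-precategory $C$ is an equivalence relation on $C_n$ relating only cells with the same source and target and stable under $u\mapsto v\ast_i u\ast_i w$ for all $i<n$ and $v,w\in C_{i+1}$. For an $(n+1)$-prepolygraph $\mathsf P$, $\overline{\mathsf P}=(\mathsf P_{\le n})^*/{\sim^{\mathsf P}}$ where $\sim^{\mathsf P}$ is the smallest congruence with $\partial^-(A)\sim^{\mathsf P}\partial^+(A)$ for all $A\in\mathsf P_{n+1}$.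 **Gray presentation.** A $4$-prepolygraph $\mathsf P$ containing the following distinguished generators. (a) For $\alpha:f\Rightarrow f'$, $\beta:h\Rightarrow h'$ in $\mathsf P_2$ and $g\in\mathsf P^*_1$ with $\alpha,g,\beta$ $0$-composable, a $3$-generator (interchange generator) $X_{\alpha,g,\beta}:(\alpha\ast_0 g\ast_0 h)\ast_1(f'\ast_0 g\ast_0\beta)\Rrightarrow(f\ast_0 g\ast_0\beta)\ast_1(\alpha\ast_0 g\ast_0 h')$. (b) For $A:\phi\Rrightarrow\phi'$, $B:\psi\Rrightarrow\psi'$ in $\mathsf P_3$, $e,h,e',h'\in\mathsf P^*_1$, $\chi\in\mathsf P^*_2$ such that $(e\ast_0\phi\ast_0 h)\ast_1\chi\ast_1(e'\ast_0\psi\ast_0 h')$ is defined, a $4$-generator (independence generator) from $((e\ast_0 A\ast_0 h)\ast_1\chi\ast_1(e'\ast_0\psi\ast_0 h'))\ast_2((e\ast_0\phi'\ast_0 h)\ast_1\chi\ast_1(e'\ast_0 B\ast_0 h'))$ to $((e\ast_0\phi\ast_0 h)\ast_1\chi\ast_1(e'\ast_0 B\ast_0 h'))\ast_2((e\ast_0 A\ast_0 h)\ast_1\chi\ast_1(e'\ast_0\psi'\ast_0 h'))$. (c) For $0$-composable $A,g,\beta$ with $A:\phi\Rrightarrow\phi':f\Rightarrow f'$ in $\mathsf P_3$, $g\in\mathsf P^*_1$, $\beta:h\Rightarrow h'$ in $\mathsf P_2$, a $4$-generator (interchange naturality generator) from $((A\ast_0 g\ast_0 h)\ast_1(f'\ast_0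 g\ast_0\beta))\ast_2 X_{\phi',g\ast_0\beta}$ to $X_{\phi,g\ast_0\beta}\ast_2((f\ast_0 g\ast_0\beta)\ast_1(A\ast_0 g\ast_0 h'))$; and for $0$-composable $\alpha,g,B$ with $\alpha:f\Rightarrow f'$ in $\mathsf P_2$, $B:\psi\Rrightarrow\psi':h\Rightarrow h'$ in $\mathsf P_3$, a $4$-generator from $((\alpha\ast_0 g\ast_0 h)\ast_1(f'\ast_0 g\ast_0 B))\ast_2 X_{\alpha\ast_0 g,\psi'}$ to $X_{\alpha\ast_0 g,\psi}\ast_2((f\ast_0 g\ast_0 B)\ast_1(\alpha\ast_0 g\ast_0 h'))$. Here, for $0$-composable $\phi,\psi\in\mathsf P^*_2$ with whisker decompositions $\phi=\phi_1\ast_1\cdots\ast_1\phi_k$, $\psi=\psi_1\ast_1\cdots\ast_1\psi_{k'}$, $\phi_i=f_i\ast_0\alpha_i\ast_0 g_i$, $\psi_j=f'_j\ast_0\beta_j\ast_0 g'_j$, the $3$-cell $X_{\phi,\psi}:(\phi\ast_0\partial^-_1\psi)\ast_1(\partial^+_1\phi\ast_0\psi)\Rrightarrow(\partial^-_1\phi\ast_0\psi)\ast_1(\phi\ast_0\partial^+_1\psi)$ is the $\ast_2$-composite of $kk'$ elementary swaps, which first move $\phi_k$ successively past $\psi_1,\dots,\psi_{k'}$, then $\phi_{k-1}$ past $\psi_1,\dots,\psi_{k'}$, and so on; the elementary swap of consecutive $\phi_i,\psi_j$ in an interleaving is $\lambda\ast_1(f_i\ast_0 X_{\alpha_i,\,g_i\ast_0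 f'_j,\,\beta_j}\ast_0 g'_j)\ast_1\rho$, where $\lambda,\rho$ are the parts of the interleaving before and after. **Coherence.** A $3$-precategory is coherent if any two parallel $3$-cells are equal. For a $3$-precategory $C$, its localization $C^\top$ is the $3$-precategory obtained by formally inverting all $3$-cells (with respect to $\ast_2$), i.e. the image of $C$ under the left adjoint to the inclusion of $3$-precategories with all $3$-cells invertible; it has the same cells as $C$ in dimensions $\le2$. A Gray presentation $\mathsf Q$ is coherent when $\overline{\mathsf Q}^\top$ is coherent. **Rewriting** in a $3$-prepolygraph $\mathsf P$. A rewriting step is a $3$-cell $\lambda\ast_1(l\ast_0 A\ast_0 r)\ast_1\rho$ with $A\in\mathsf P_3$, $l,r\in\mathsf P_1^*$, $\lambda,\rho\in\mathsf P_2^*$. $\mathsf P$ is terminating if there is no infinite sequence of rewriting steps $\phi_0\Rrightarrow\phi_1\Rrightarrow\cdots$. A local branching is a pair of rewriting steps with the same source; the symmetric branching of $(S_1,S_2)$ is $(S_2,S_1)$. **Critical branchings** (for $\mathsf P=\mathsf Q_{\le3}$). A local branching $(S_1,S_2)$ is: trivial if $S_1=S_2$; minimal if whenever $S_i=\lambda\ast_1(l\ast_0S'_i\ast_0r)\ast_1\rho$ ($i=1,2$) for a local branching $(S'_1,S'_2)$, $1$-cells $l,r$ and $2$-cells $\lambda,\rho$, then $l,r,\lambda,\rho$ are identities; independent if $S_1=(l_1\ast_0A_1\ast_0r_1)\ast_1\chi\ast_1(l_2\ast_0\phi_2\ast_0r_2)$ and $S_2=(l_1\ast_0\phi_1\ast_0r_1)\ast_1\chi\ast_1(l_2\ast_0A_2\ast_0r_2)$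 with $A_i:\phi_i\Rrightarrow\phi'_i$ in $\mathsf P_3$; natural if either $S_1=(A\ast_0g\ast_0h)\ast_1(f'\ast_0g\ast_0\psi)$ with $A:\phi\Rrightarrow\phi':f\Rightarrow f'$ in $\mathsf P_3$, $g\in\mathsf P_1^*$, $\psi:h\Rightarrow h'$ in $\mathsf P_2^*$, and $S_2$ is the elementary swap of the last whisker of $\phi$ with the first whisker of $g\ast_0\psi$ in $(\phi\ast_0g\ast_0h)\ast_1(f'\ast_0g\ast_0\psi)$, or, symmetrically, $S_1=(\phi\ast_0g\ast_0h)\ast_1(f'\ast_0g\ast_0B)$ with $\phi:f\Rightarrow f'$ in $\mathsf P_2^*$, $B:\psi\Rrightarrow\psi':h\Rightarrow h'$ in $\mathsf P_3$ and $S_2$ is the elementary swap of the last whisker of $\phi\ast_0g$ with the first whisker of $\psi$. It is critical if it is minimal and neither it nor its symmetric branching is trivial, independent or natural. *)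

theory Defs
  imports Main
begin

section \<open>Precategories\<close>

text \<open>
  \<open>Cel C k\<close> is the set of \<open>k\<close>-cells, \<open>Src C k, Tgt C k : C\<^sub>k\<^sub>+\<^sub>1 \<rightarrow> C\<^sub>k\<close>, \<open>Idt C k : C\<^sub>k \<rightarrow> C\<^sub>k\<^sub>+\<^sub>1\<close>, and
  \<open>Cmp C k l u v\<close> is the composite \<open>u *\<^sub>i v\<close> of a \<open>k\<close>-cell and an \<open>l\<close>-cell, where necessarily
  \<open>i = min k l - 1\<close>.
\<close>

record 'c precat =
  Cel :: "nat \<Rightarrow> 'c set"
  Src :: "nat \<Rightarrow> 'c \<Rightarrow> 'c"
  Tgt :: "nat \<Rightarrow> 'c \<Rightarrow> 'c"
  Idt :: "nat \<Rightarrow> 'c \<Rightarrow> 'c"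
  Cmp :: "nat \<Rightarrow> nat \<Rightarrow> 'c \<Rightarrow> 'c \<Rightarrow> 'c"

text \<open>\<open>Srcs C i k\<close> and \<open>Tgts C i k\<close> are the iterated source and target \<open>C\<^sub>k \<rightarrow> C\<^sub>i\<close>, for \<open>i \<le> k\<close>.\<close>

primrec Srcs :: "('c, 'z) precat_scheme \<Rightarrow> nat \<Rightarrow> nat \<Rightarrow> 'c \<Rightarrow> 'c" where
  "Srcs C i 0 u = u"
| "Srcs C i (Suc k) u = (if k < i then u else Srcs C i k (Src C k u))"

primrec Tgts :: "('c, 'z) precat_scheme \<Rightarrow> nat \<Rightarrow> nat \<Rightarrow> 'c \<Rightarrow> 'c" where
  "Tgts C i 0 u = u"
| "Tgts C i (Suc k) u = (if k < i then u else Tgts C i k (Tgt C k u))"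

definition composable :: "('c, 'z) precat_scheme \<Rightarrow> nat \<Rightarrow> nat \<Rightarrow> 'c \<Rightarrow> 'c \<Rightarrow> bool" where
  "composable C k l u v \<longleftrightarrow>
     0 < k \<and> 0 < l \<and> u \<in> Cel C k \<and> v \<in> Cel C l \<and>
     Tgts C (min k l - 1) k u = Srcs C (min k l - 1) l v"

locale precategory =
  fixes n :: nat and C :: "('c, 'z) precat_scheme"
  assumes Src_cell: "k < n \<Longrightarrow> u \<in> Cel C (Suc k) \<Longrightarrow> Src C k u \<in> Cel C k"
    and Tgt_cell: "k < n \<Longrightarrow> u \<in> Cel C (Suc k) \<Longrightarrow> Tgt C k u \<in> Cel C k"
    and Src_glob: "Suc k < n \<Longrightarrow> u \<in> Cel C (Suc (Suc k)) \<Longrightarrow>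
          Src C k (Src C (Suc k) u) = Src C k (Tgt C (Suc k) u)"
    and Tgt_glob: "Suc k < n \<Longrightarrow> u \<in> Cel C (Suc (Suc k)) \<Longrightarrow>
          Tgt C k (Src C (Suc k) u) = Tgt C k (Tgt C (Suc k) u)"
    and Idt_cell: "k < n \<Longrightarrow> u \<in> Cel C k \<Longrightarrow> Idt C k u \<in> Cel C (Suc k)"
    and Src_Idt: "k < n \<Longrightarrow> u \<in> Cel C k \<Longrightarrow> Src C k (Idt C k u) = u"
    and Tgt_Idt: "k < n \<Longrightarrow> u \<in> Cel C k \<Longrightarrow> Tgt C k (Idt C k u) = u"
    and Cmp_cell: "k \<le> n \<Longrightarrow> l \<le> n \<Longrightarrow> composable C k l u v \<Longrightarrow> Cmp C k l u v \<in> Cel C (max k l)"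
    and Src_Cmp_less: "k \<le> l \<Longrightarrow> l < n \<Longrightarrow> composable C k (Suc l) u v \<Longrightarrow>
          Src C l (Cmp C k (Suc l) u v) = Cmp C k l u (Src C l v)"
    and Tgt_Cmp_less: "k \<le> l \<Longrightarrow> l < n \<Longrightarrow> composable C k (Suc l) u v \<Longrightarrow>
          Tgt C l (Cmp C k (Suc l) u v) = Cmp C k l u (Tgt C l v)"
    and Src_Cmp_greater: "l \<le> k \<Longrightarrow> k < n \<Longrightarrow> composable C (Suc k) l u v \<Longrightarrow>
          Src C k (Cmp C (Suc k) l u v) = Cmp C k l (Src C k u) v"
    and Tgt_Cmp_greater: "l \<le> k \<Longrightarrow> k < n \<Longrightarrow> composable C (Suc k) l u v \<Longrightarrow>
          Tgt C k (Cmp C (Suc k) l u v) = Cmp C k l (Tgt C k u) v"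
    and Src_Cmp_equal: "k < n \<Longrightarrow> composable C (Suc k) (Suc k) u v \<Longrightarrow>
          Src C k (Cmp C (Suc k) (Suc k) u v) = Src C k u"
    and Tgt_Cmp_equal: "k < n \<Longrightarrow> composable C (Suc k) (Suc k) u v \<Longrightarrow>
          Tgt C k (Cmp C (Suc k) (Suc k) u v) = Tgt C k v"
    and Idt_left: "i < l \<Longrightarrow> l \<le> n \<Longrightarrow> w \<in> Cel C i \<Longrightarrow> composable C (Suc i) l (Idt C i w) v \<Longrightarrow>
          Cmp C (Suc i) l (Idt C i w) v = v"
    and Idt_right: "i < k \<Longrightarrow> k \<le> n \<Longrightarrow> w \<in> Cel C i \<Longrightarrow> composable C k (Suc i) u (Idt C i w) \<Longrightarrow>
          Cmp C k (Suc i) u (Idt C i w) = u"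
    and Idt_Cmp_left: "i < k \<Longrightarrow> k < n \<Longrightarrow> composable C k (Suc i) u v \<Longrightarrow>
          Cmp C (Suc k) (Suc i) (Idt C k u) v = Idt C k (Cmp C k (Suc i) u v)"
    and Idt_Cmp_right: "i < k \<Longrightarrow> k < n \<Longrightarrow> composable C (Suc i) k v u \<Longrightarrow>
          Cmp C (Suc i) (Suc k) v (Idt C k u) = Idt C k (Cmp C (Suc i) k v u)"
    and Cmp_assoc: "k \<le> n \<Longrightarrow> l \<le> n \<Longrightarrow> m \<le> n \<Longrightarrow>
          min k l = Suc i \<Longrightarrow> min (max k l) m = Suc i \<Longrightarrow>
          min l m = Suc i \<Longrightarrow> min k (max l m) = Suc i \<Longrightarrow>
          composable C k l u v \<Longrightarrow> composable C (max k l) m (Cmp C k l u v) w \<Longrightarrow>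
          composable C l m v w \<Longrightarrow> composable C k (max l m) u (Cmp C l m v w) \<Longrightarrow>
          Cmp C (max k l) m (Cmp C k l u v) w = Cmp C k (max l m) u (Cmp C l m v w)"
    and Cmp_distrib_left: "i < j \<Longrightarrow> k \<le> n \<Longrightarrow> l \<le> n \<Longrightarrow> min k l = Suc j \<Longrightarrow>
          composable C k l v v' \<Longrightarrow> composable C (Suc i) (max k l) u (Cmp C k l v v') \<Longrightarrow>
          Cmp C (Suc i) (max k l) u (Cmp C k l v v') =
          Cmp C k l (Cmp C (Suc i) k u v) (Cmp C (Suc i) l u v')"
    and Cmp_distrib_right: "i < j \<Longrightarrow> k \<le> n \<Longrightarrow> l \<le> n \<Longrightarrow> min k l = Suc j \<Longrightarrow>
          composable C k l v v' \<Longrightarrow> composable C (max k l) (Suc i) (Cmp C k l v v') u \<Longrightarrow>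
          Cmp C (max k l) (Suc i) (Cmp C k l v v') u =
          Cmp C k l (Cmp C k (Suc i) v u) (Cmp C l (Suc i) v' u)"


section \<open>Congruences, quotients and localization\<close>

definition congruence :: "nat \<Rightarrow> ('c, 'z) precat_scheme \<Rightarrow> ('c \<times> 'c) set \<Rightarrow> bool" where
  "congruence n C R \<longleftrightarrow>
     equiv (Cel C n) R \<and>
     (\<forall>(u, u') \<in> R. \<forall>k. n = Suc k \<longrightarrow> Src C k u = Src C k u' \<and> Tgt C k u = Tgt C k u') \<and>
     (\<forall>(u, u') \<in> R. \<forall>i < n. \<forall>v w.
        composable C (Suc i) n v u \<and> composable C n (Suc i) u w \<longrightarrow>
        (Cmp C n (Suc i) (Cmp C (Suc i) n v u) w, Cmp C n (Suc i) (Cmp C (Suc i) n v u') w) \<in> R)"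

definition congruence_generated ::
  "nat \<Rightarrow> ('c, 'z) precat_scheme \<Rightarrow> ('c \<times> 'c) set \<Rightarrow> ('c \<times> 'c) set" where
  "congruence_generated n C E = \<Inter> {R. congruence n C R \<and> E \<subseteq> R}"

text \<open>
  In the quotient by a relation on \<open>n\<close>-cells, the \<open>n\<close>-cells are the classes and the cells \<open>u\<close> of lower
  dimension become singletons \<open>{u}\<close>; all operations are taken elementwise and then saturated.
\<close>

definition saturate :: "nat \<Rightarrow> ('c \<times> 'c) set \<Rightarrow> nat \<Rightarrow> 'c set \<Rightarrow> 'c set" where
  "saturate n R k U = (if k = n then R `` U else U)"

definition quotient_precat ::
  "nat \<Rightarrow> ('c, 'z) precat_scheme \<Rightarrow> ('c \<times> 'c) set \<Rightarrow> 'c set precat" where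
  "quotient_precat n C R =
     \<lparr> Cel = (\<lambda>k. (\<lambda>u. saturate n R k {u}) ` Cel C k),
       Src = (\<lambda>k U. Src C k ` U),
       Tgt = (\<lambda>k U. Tgt C k ` U),
       Idt = (\<lambda>k U. saturate n R (Suc k) (Idt C k ` U)),
       Cmp = (\<lambda>k l U V. saturate n R (max k l) {Cmp C k l u v |u v. u \<in> U \<and> v \<in> V}) \<rparr>"

text \<open>
  The localization of an \<open>n\<close>-precategory at its \<open>n\<close>-cells: one first replaces the \<open>n\<close>-cells by formal
  zigzags \<open>Zig x es\<close> starting at the \<open>(n-1)\<close>-cell \<open>x\<close>, where an entry \<open>(True, u)\<close> stands for the
  \<open>n\<close>-cell \<open>u\<close> and \<open>(False, u)\<close> for its formal inverse, and then imposes functoriality of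
  \<open>u \<mapsto> (True, u)\<close> and the inverse laws.
\<close>

datatype 'c zcell = Base 'c | Zig 'c "(bool \<times> 'c) list"

fun zsrc :: "nat \<Rightarrow> ('c, 'z) precat_scheme \<Rightarrow> bool \<times> 'c \<Rightarrow> 'c" where
  "zsrc n C (b, u) = (if b then Src C (n - 1) u else Tgt C (n - 1) u)"

fun ztgt :: "nat \<Rightarrow> ('c, 'z) precat_scheme \<Rightarrow> bool \<times> 'c \<Rightarrow> 'c" where
  "ztgt n C (b, u) = (if b then Tgt C (n - 1) u else Src C (n - 1) u)"

primrec zpath :: "nat \<Rightarrow> ('c, 'z) precat_scheme \<Rightarrow> 'c \<Rightarrow> (bool \<times> 'c) list \<Rightarrow> bool" where
  "zpath n C x [] \<longleftrightarrow> x \<in> Cel C (n - 1)"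
| "zpath n C x (e # es) \<longleftrightarrow> snd e \<in> Cel C n \<and> zsrc n C e = x \<and> zpath n C (ztgt n C e) es"

primrec zend :: "nat \<Rightarrow> ('c, 'z) precat_scheme \<Rightarrow> 'c \<Rightarrow> (bool \<times> 'c) list \<Rightarrow> 'c" where
  "zend n C x [] = x"
| "zend n C x (e # es) = zend n C (ztgt n C e) es"

definition zigzag_precat :: "nat \<Rightarrow> ('c, 'z) precat_scheme \<Rightarrow> 'c zcell precat" where
  "zigzag_precat n C =
     \<lparr> Cel = (\<lambda>k. if k < n then Base ` Cel C k
                  else if k = n then {Zig x es |x es. zpath n C x es} else {}),
       Src = (\<lambda>k c. case c of Base u \<Rightarrow> Base (Src C k u) | Zig x es \<Rightarrow> Base x),
       Tgt = (\<lambda>k c. case c of Base u \<Rightarrow> Base (Tgt C k u) | Zig x es \<Rightarrow> Base (zend n C x es)),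
       Idt = (\<lambda>k c. case c of
                Base u \<Rightarrow> if Suc k < n then Base (Idt C k u) else Zig u []
              | Zig x es \<Rightarrow> c),
       Cmp = (\<lambda>k l c d. case (c, d) of
                (Base u, Base v) \<Rightarrow> Base (Cmp C k l u v)
              | (Base u, Zig x es) \<Rightarrow> Zig (Cmp C k (n - 1) u x) (map (apsnd (Cmp C k n u)) es)
              | (Zig x es, Base v) \<Rightarrow> Zig (Cmp C (n - 1) l x v) (map (apsnd (\<lambda>u. Cmp C n l u v)) es)
              | (Zig x es, Zig y es') \<Rightarrow> Zig x (es @ es')) \<rparr>"

inductive_set zigzag_rel :: "nat \<Rightarrow> ('c, 'z) precat_scheme \<Rightarrow> ('c zcell \<times> 'c zcell) set"
  for n :: nat and C :: "('c, 'z) precat_scheme" where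
  ident: "x \<in> Cel C (n - 1) \<Longrightarrow> (Zig x [(True, Idt C (n - 1) x)], Zig x []) \<in> zigzag_rel n C"
| comp: "composable C n n u v \<Longrightarrow>
    (Zig (Src C (n - 1) u) [(True, u), (True, v)], Zig (Src C (n - 1) u) [(True, Cmp C n n u v)])
      \<in> zigzag_rel n C"
| inv_right: "u \<in> Cel C n \<Longrightarrow>
    (Zig (Src C (n - 1) u) [(True, u), (False, u)], Zig (Src C (n - 1) u) []) \<in> zigzag_rel n C"
| inv_left: "u \<in> Cel C n \<Longrightarrow>
    (Zig (Tgt C (n - 1) u) [(False, u), (True, u)], Zig (Tgt C (n - 1) u) []) \<in> zigzag_rel n C"

definition localization :: "nat \<Rightarrow> ('c, 'z) precat_scheme \<Rightarrow> 'c zcell set precat" where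
  "localization n C =
     quotient_precat n (zigzag_precat n C)
       (congruence_generated n (zigzag_precat n C) (zigzag_rel n C))"

definition coherent :: "('c, 'z) precat_scheme \<Rightarrow> bool" where
  "coherent C \<longleftrightarrow>
     (\<forall>F \<in> Cel C 3. \<forall>G \<in> Cel C 3. Src C 2 F = Src C 2 G \<and> Tgt C 2 F = Tgt C 2 G \<longrightarrow> F = G)"


section \<open>Prepolygraphs and free precategories\<close>

text \<open>
  Cells of free precategories are represented by their whisker decompositions.  A \<open>(k+1)\<close>-cell
  \<open>Cell s ws\<close> is the \<open>*\<^sub>k\<close>-composite, starting at the \<open>k\<close>-cell \<open>s\<close>, of the list \<open>ws\<close> of whiskers
  (the identity of \<open>s\<close> if \<open>ws = []\<close>).  A whisker \<open>(A, [(l\<^sub>1,r\<^sub>1), \<dots>, (l\<^sub>k,r\<^sub>k)])\<close> of a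
  \<open>(k+1)\<close>-generator \<open>A\<close>, with \<open>l\<^sub>j, r\<^sub>j\<close> cells of dimension \<open>j\<close>, stands for
  \<open>l\<^sub>k *\<^sub>k\<^sub>-\<^sub>1 (\<dots> (l\<^sub>2 *\<^sub>1 (l\<^sub>1 *\<^sub>0 A *\<^sub>0 r\<^sub>1) *\<^sub>1 r\<^sub>2) \<dots>) *\<^sub>k\<^sub>-\<^sub>1 r\<^sub>k\<close>.
\<close>

datatype 'g cell = Obj 'g | Cell "'g cell" "('g \<times> ('g cell \<times> 'g cell) list) list"

type_synonym 'g whisker = "'g \<times> ('g cell \<times> 'g cell) list"

primrec cdim :: "'g cell \<Rightarrow> nat" where
  "cdim (Obj a) = 0"
| "cdim (Cell s ws) = Suc (cdim s)"

primrec csrc :: "'g cell \<Rightarrow> 'g cell" where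
  "csrc (Obj a) = Obj a"
| "csrc (Cell s ws) = s"

primrec whiskers :: "'g cell \<Rightarrow> 'g whisker list" where
  "whiskers (Obj a) = []"
| "whiskers (Cell s ws) = ws"

definition idc :: "'g cell \<Rightarrow> 'g cell" where
  "idc u = Cell u []"

text \<open>
  \<open>lcomp u v\<close> is \<open>u *\<^sub>i v\<close> for \<open>i + 1 = cdim u \<le> cdim v\<close>, and \<open>rcomp v u\<close> is \<open>v *\<^sub>i u\<close>.  When the
  dimensions are equal the lists of whiskers are concatenated.  Otherwise \<open>u\<close> is distributed over
  the whiskers of \<open>v\<close>: inside \<open>(l\<^sub>1,r\<^sub>1), (l\<^sub>2,r\<^sub>2), \<dots>\<close> it is absorbed by \<open>l\<^sub>i\<^sub>+\<^sub>1\<close> (resp. \<open>r\<^sub>i\<^sub>+\<^sub>1\<close>) and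
  whiskers both components of higher dimension.
\<close>

fun lcomp :: "'g cell \<Rightarrow> 'g cell \<Rightarrow> 'g cell" where
  "lcomp u (Obj a) = Obj a"
| "lcomp u (Cell s ws) =
     (if cdim u = Suc (cdim s) then Cell (csrc u) (whiskers u @ ws)
      else Cell (lcomp u s)
             (map (\<lambda>(A, c). (A, map (\<lambda>(l, r).
                if cdim l < cdim u then (l, r)
                else if cdim l = cdim u then (lcomp u l, r)
                else (lcomp u l, lcomp u r)) c)) ws))"

fun rcomp :: "'g cell \<Rightarrow> 'g cell \<Rightarrow> 'g cell" where
  "rcomp (Obj a) u = Obj a"
| "rcomp (Cell s ws) u =
     (if cdim u = Suc (cdim s) then Cell s (ws @ whiskers u)
      else Cell (rcomp s u)
             (map (\<lambda>(A, c). (A, map (\<lambda>(l, r).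
                if cdim l < cdim u then (l, r)
                else if cdim l = cdim u then (l, rcomp r u)
                else (rcomp l u, rcomp r u)) c)) ws))"

definition ccomp :: "'g cell \<Rightarrow> 'g cell \<Rightarrow> 'g cell" where
  "ccomp u v = (if cdim u \<le> cdim v then lcomp u v else rcomp u v)"

text \<open>
  The index \<open>i\<close> of \<open>u *\<^sub>i v\<close> is determined by the dimensions of \<open>u\<close> and \<open>v\<close>; it is displayed
  for readability only.
\<close>

abbreviation (input) comp0 (infixl "\<star>\<^sub>0" 75) where "u \<star>\<^sub>0 v \<equiv> ccomp u v"
abbreviation (input) comp1 (infixl "\<star>\<^sub>1" 75) where "u \<star>\<^sub>1 v \<equiv> ccomp u v"
abbreviation (input) comp2 (infixl "\<star>\<^sub>2" 75) where "u \<star>\<^sub>2 v \<equiv> ccomp u v"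

primrec plug :: "'g cell \<Rightarrow> ('g cell \<times> 'g cell) list \<Rightarrow> 'g cell" where
  "plug x [] = x"
| "plug x (lr # c) = plug (ccomp (ccomp (fst lr) x) (snd lr)) c"

text \<open>
  \<open>gens P k\<close> is the set of \<open>k\<close>-generators; those with \<open>k > 0\<close> have as source and target the
  \<open>(k-1)\<close>-cells \<open>gsrc P k A\<close> and \<open>gtgt P k A\<close>.
\<close>

record 'g prepolygraph =
  gens :: "nat \<Rightarrow> 'g set"
  gsrc :: "nat \<Rightarrow> 'g \<Rightarrow> 'g cell"
  gtgt :: "nat \<Rightarrow> 'g \<Rightarrow> 'g cell"

definition wsrc :: "('g, 'z) prepolygraph_scheme \<Rightarrow> 'g whisker \<Rightarrow> 'g cell" where
  "wsrc P w = plug (gsrc P (Suc (length (snd w))) (fst w)) (snd w)"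

definition wtgt :: "('g, 'z) prepolygraph_scheme \<Rightarrow> 'g whisker \<Rightarrow> 'g cell" where
  "wtgt P w = plug (gtgt P (Suc (length (snd w))) (fst w)) (snd w)"

primrec ctgt :: "('g, 'z) prepolygraph_scheme \<Rightarrow> 'g cell \<Rightarrow> 'g cell" where
  "ctgt P (Obj a) = Obj a"
| "ctgt P (Cell s ws) = (if ws = [] then s else wtgt P (last ws))"

text \<open>The iterated source and target of dimension \<open>i\<close>.\<close>

definition bsrc :: "nat \<Rightarrow> 'g cell \<Rightarrow> 'g cell" where
  "bsrc i u = (csrc ^^ (cdim u - i)) u"

definition btgt :: "('g, 'z) prepolygraph_scheme \<Rightarrow> nat \<Rightarrow> 'g cell \<Rightarrow> 'g cell" where
  "btgt P i u = (ctgt P ^^ (cdim u - i)) u"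

primrec wchain :: "('g, 'z) prepolygraph_scheme \<Rightarrow> 'g cell \<Rightarrow> 'g whisker list \<Rightarrow> bool" where
  "wchain P s [] \<longleftrightarrow> True"
| "wchain P s (w # ws) \<longleftrightarrow> wsrc P w = s \<and> wchain P (wtgt P w) ws"

text \<open>
  \<open>is_cell P k u\<close> means \<open>u \<in> P\<^sup>*\<^sub>k\<close>.  The judgement \<open>is_context P j x [(l\<^sub>j\<^sub>+\<^sub>1,r\<^sub>j\<^sub>+\<^sub>1), \<dots>]\<close> means that
  the composites in \<open>\<dots> l\<^sub>j\<^sub>+\<^sub>2 *\<^sub>j\<^sub>+\<^sub>1 (l\<^sub>j\<^sub>+\<^sub>1 *\<^sub>j x *\<^sub>j r\<^sub>j\<^sub>+\<^sub>1) *\<^sub>j\<^sub>+\<^sub>1 r\<^sub>j\<^sub>+\<^sub>2 \<dots>\<close> are defined; the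
  composability conditions for the whiskers of a generator are those for its source.
\<close>

inductive is_cell :: "('g, 'z) prepolygraph_scheme \<Rightarrow> nat \<Rightarrow> 'g cell \<Rightarrow> bool"
  and is_context ::
    "('g, 'z) prepolygraph_scheme \<Rightarrow> nat \<Rightarrow> 'g cell \<Rightarrow> ('g cell \<times> 'g cell) list \<Rightarrow> bool"
  for P :: "('g, 'z) prepolygraph_scheme" where
  Obj: "a \<in> gens P 0 \<Longrightarrow> is_cell P 0 (Obj a)"
| Cell: "is_cell P k s \<Longrightarrow>
    (\<And>A c. (A, c) \<in> set ws \<Longrightarrow>
       A \<in> gens P (Suc k) \<and> length c = k \<and> is_context P 0 (gsrc P (Suc k) A) c) \<Longrightarrow>
    wchain P s ws \<Longrightarrow> is_cell P (Suc k) (Cell s ws)"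
| Nil: "is_context P j x []"
| Cons: "is_cell P (Suc j) l \<Longrightarrow> is_cell P (Suc j) r \<Longrightarrow>
    btgt P j l = bsrc j x \<Longrightarrow> btgt P j x = bsrc j r \<Longrightarrow>
    is_context P (Suc j) (ccomp (ccomp l x) r) c \<Longrightarrow> is_context P j x ((l, r) # c)"

definition free_precat :: "nat \<Rightarrow> ('g, 'z) prepolygraph_scheme \<Rightarrow> 'g cell precat" where
  "free_precat n P =
     \<lparr> Cel = (\<lambda>k. if k \<le> n then {u. is_cell P k u} else {}),
       Src = (\<lambda>k. csrc),
       Tgt = (\<lambda>k. ctgt P),
       Idt = (\<lambda>k. idc),
       Cmp = (\<lambda>k l. ccomp) \<rparr>"

definition prepolygraph :: "nat \<Rightarrow> ('g, 'z) prepolygraph_scheme \<Rightarrow> bool" where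
  "prepolygraph n P \<longleftrightarrow>
     (\<forall>k < n. \<forall>A \<in> gens P (Suc k).
        is_cell P k (gsrc P (Suc k) A) \<and> is_cell P k (gtgt P (Suc k) A) \<and>
        (0 < k \<longrightarrow> csrc (gsrc P (Suc k) A) = csrc (gtgt P (Suc k) A) \<and>
                   ctgt P (gsrc P (Suc k) A) = ctgt P (gtgt P (Suc k) A)))"

text \<open>A generator as a cell: the whisker whose context consists of identities.\<close>

fun gen :: "('g, 'z) prepolygraph_scheme \<Rightarrow> nat \<Rightarrow> 'g \<Rightarrow> 'g cell" where
  "gen P 0 a = Obj a"
| "gen P (Suc k) A =
     Cell (gsrc P (Suc k) A)
       [(A, map (\<lambda>j. (idc (bsrc j (gsrc P (Suc k) A)), idc (btgt P j (gsrc P (Suc k) A)))) [0..<k])]"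

definition presented_precat :: "nat \<Rightarrow> ('g, 'z) prepolygraph_scheme \<Rightarrow> 'g cell set precat" where
  "presented_precat n P =
     quotient_precat n (free_precat n P)
       (congruence_generated n (free_precat n P)
          {(gsrc P (Suc n) A, gtgt P (Suc n) A) |A. A \<in> gens P (Suc n)})"


section \<open>Gray presentations\<close>

text \<open>
  A Gray presentation is a 4-prepolygraph together with its distinguished generators:
  \<open>ichg \<alpha> g \<beta>\<close> is \<open>X\<^bsub>\<alpha>,g,\<beta>\<^esub>\<close>, \<open>indep e A h \<chi> e' B h'\<close> are the independence generators, and
  \<open>natl A g \<beta>\<close>, \<open>natr \<alpha> g B\<close> are the two families of interchange naturality generators.  These
  functions are only constrained on arguments satisfying the relevant composability conditions.
\<close>

record 'g gray = "'g prepolygraph" +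
  ichg :: "'g \<Rightarrow> 'g cell \<Rightarrow> 'g \<Rightarrow> 'g"
  indep :: "'g cell \<Rightarrow> 'g \<Rightarrow> 'g cell \<Rightarrow> 'g cell \<Rightarrow> 'g cell \<Rightarrow> 'g \<Rightarrow> 'g cell \<Rightarrow> 'g"
  natl :: "'g \<Rightarrow> 'g cell \<Rightarrow> 'g \<Rightarrow> 'g"
  natr :: "'g \<Rightarrow> 'g cell \<Rightarrow> 'g \<Rightarrow> 'g"

definition composable3 ::
  "('g, 'z) prepolygraph_scheme \<Rightarrow> nat \<Rightarrow> 'g cell \<Rightarrow> 'g cell \<Rightarrow> 'g cell \<Rightarrow> bool" where
  "composable3 P i u v w \<longleftrightarrow> btgt P i u = bsrc i v \<and> btgt P i v = bsrc i w"

definition wcell :: "('g, 'z) prepolygraph_scheme \<Rightarrow> 'g whisker \<Rightarrow> 'g cell" where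
  "wcell P w = Cell (wsrc P w) [w]"

text \<open>
  For whiskers \<open>w = l *\<^sub>0 \<alpha> *\<^sub>0 r\<close> and \<open>v = l' *\<^sub>0 \<beta> *\<^sub>0 r'\<close>, \<open>swap Q w v\<close> is the 3-cell
  \<open>l *\<^sub>0 X\<^bsub>\<alpha>, r *\<^sub>0 l', \<beta>\<^esub> *\<^sub>0 r'\<close>.
\<close>

definition swap :: "('g, 'z) gray_scheme \<Rightarrow> 'g whisker \<Rightarrow> 'g whisker \<Rightarrow> 'g cell" where
  "swap Q w v =
     (let (l, r) = hd (snd w); (l', r') = hd (snd v)
      in l \<star>\<^sub>0 gen Q 3 (ichg Q (fst w) (r \<star>\<^sub>0 l') (fst v)) \<star>\<^sub>0 r')"

text \<open>
  \<open>move_whisker Q w k vs\<close> moves the whisker \<open>w\<close> successively past the whiskers of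
  \<open>\<psi> = Cell k vs\<close>; \<open>move_whiskers Q f ws \<psi>\<close> does so for the whiskers of \<open>Cell f ws\<close>, starting with
  the last one.
\<close>

primrec move_whisker ::
  "('g, 'z) gray_scheme \<Rightarrow> 'g whisker \<Rightarrow> 'g cell \<Rightarrow> 'g whisker list \<Rightarrow> 'g cell" where
  "move_whisker Q w k [] = idc (wcell Q w \<star>\<^sub>0 k)"
| "move_whisker Q w k (v # vs) =
     (swap Q w v \<star>\<^sub>1 (wtgt Q w \<star>\<^sub>0 Cell (wtgt Q v) vs)) \<star>\<^sub>2
     ((wsrc Q w \<star>\<^sub>0 wcell Q v) \<star>\<^sub>1 move_whisker Q w (wtgt Q v) vs)"

primrec move_whiskers ::
  "('g, 'z) gray_scheme \<Rightarrow> 'g cell \<Rightarrow> 'g whisker list \<Rightarrow> 'g cell \<Rightarrow> 'g cell" where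
  "move_whiskers Q f [] \<psi> = idc (f \<star>\<^sub>0 \<psi>)"
| "move_whiskers Q f (w # ws) \<psi> =
     ((wcell Q w \<star>\<^sub>0 csrc \<psi>) \<star>\<^sub>1 move_whiskers Q (wtgt Q w) ws \<psi>) \<star>\<^sub>2
     (move_whisker Q w (csrc \<psi>) (whiskers \<psi>) \<star>\<^sub>1 (Cell (wtgt Q w) ws \<star>\<^sub>0 ctgt Q \<psi>))"

definition interchange :: "('g, 'z) gray_scheme \<Rightarrow> 'g cell \<Rightarrow> 'g cell \<Rightarrow> 'g cell" where
  "interchange Q \<phi> \<psi> = move_whiskers Q (csrc \<phi>) (whiskers \<phi>) \<psi>"

definition has_interchange_generators :: "('g, 'z) gray_scheme \<Rightarrow> bool" where
  "has_interchange_generators Q \<longleftrightarrow>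
     (\<forall>\<alpha> \<in> gens Q 2. \<forall>\<beta> \<in> gens Q 2. \<forall>g.
        is_cell Q 1 g \<and> composable3 Q 0 (gen Q 2 \<alpha>) g (gen Q 2 \<beta>) \<longrightarrow>
        (let f = gsrc Q 2 \<alpha>; f' = gtgt Q 2 \<alpha>; h = gsrc Q 2 \<beta>; h' = gtgt Q 2 \<beta>;
             X = ichg Q \<alpha> g \<beta>
         in X \<in> gens Q 3 \<and>
            gsrc Q 3 X = (gen Q 2 \<alpha> \<star>\<^sub>0 g \<star>\<^sub>0 h) \<star>\<^sub>1 (f' \<star>\<^sub>0 g \<star>\<^sub>0 gen Q 2 \<beta>) \<and>
            gtgt Q 3 X = (f \<star>\<^sub>0 g \<star>\<^sub>0 gen Q 2 \<beta>) \<star>\<^sub>1 (gen Q 2 \<alpha> \<star>\<^sub>0 g \<star>\<^sub>0 h')))"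

definition has_independence_generators :: "('g, 'z) gray_scheme \<Rightarrow> bool" where
  "has_independence_generators Q \<longleftrightarrow>
     (\<forall>A \<in> gens Q 3. \<forall>B \<in> gens Q 3. \<forall>e h e' h' \<chi>.
        let \<phi> = gsrc Q 3 A; \<phi>' = gtgt Q 3 A; \<psi> = gsrc Q 3 B; \<psi>' = gtgt Q 3 B;
            I = indep Q e A h \<chi> e' B h'
        in is_cell Q 1 e \<and> is_cell Q 1 h \<and> is_cell Q 1 e' \<and> is_cell Q 1 h' \<and> is_cell Q 2 \<chi> \<and>
           composable3 Q 0 e \<phi> h \<and> composable3 Q 0 e' \<psi> h' \<and>
           composable3 Q 1 (e \<star>\<^sub>0 \<phi> \<star>\<^sub>0 h) \<chi> (e' \<star>\<^sub>0 \<psi> \<star>\<^sub>0 h') \<longrightarrow>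
           I \<in> gens Q 4 \<and>
           gsrc Q 4 I =
             ((e \<star>\<^sub>0 gen Q 3 A \<star>\<^sub>0 h) \<star>\<^sub>1 \<chi> \<star>\<^sub>1 (e' \<star>\<^sub>0 \<psi> \<star>\<^sub>0 h')) \<star>\<^sub>2
             ((e \<star>\<^sub>0 \<phi>' \<star>\<^sub>0 h) \<star>\<^sub>1 \<chi> \<star>\<^sub>1 (e' \<star>\<^sub>0 gen Q 3 B \<star>\<^sub>0 h')) \<and>
           gtgt Q 4 I =
             ((e \<star>\<^sub>0 \<phi> \<star>\<^sub>0 h) \<star>\<^sub>1 \<chi> \<star>\<^sub>1 (e' \<star>\<^sub>0 gen Q 3 B \<star>\<^sub>0 h')) \<star>\<^sub>2
             ((e \<star>\<^sub>0 gen Q 3 A \<star>\<^sub>0 h) \<star>\<^sub>1 \<chi> \<star>\<^sub>1 (e' \<star>\<^sub>0 \<psi>' \<star>\<^sub>0 h')))"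

definition has_naturality_generators :: "('g, 'z) gray_scheme \<Rightarrow> bool" where
  "has_naturality_generators Q \<longleftrightarrow>
     (\<forall>A \<in> gens Q 3. \<forall>\<beta> \<in> gens Q 2. \<forall>g.
        is_cell Q 1 g \<and> composable3 Q 0 (gen Q 3 A) g (gen Q 2 \<beta>) \<longrightarrow>
        (let \<phi> = gsrc Q 3 A; \<phi>' = gtgt Q 3 A; f = csrc \<phi>; f' = ctgt Q \<phi>;
             h = gsrc Q 2 \<beta>; h' = gtgt Q 2 \<beta>; N = natl Q A g \<beta>
         in N \<in> gens Q 4 \<and>
            gsrc Q 4 N =
              ((gen Q 3 A \<star>\<^sub>0 g \<star>\<^sub>0 h) \<star>\<^sub>1 (f' \<star>\<^sub>0 g \<star>\<^sub>0 gen Q 2 \<beta>)) \<star>\<^sub>2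
              interchange Q \<phi>' (g \<star>\<^sub>0 gen Q 2 \<beta>) \<and>
            gtgt Q 4 N =
              interchange Q \<phi> (g \<star>\<^sub>0 gen Q 2 \<beta>) \<star>\<^sub>2
              ((f \<star>\<^sub>0 g \<star>\<^sub>0 gen Q 2 \<beta>) \<star>\<^sub>1 (gen Q 3 A \<star>\<^sub>0 g \<star>\<^sub>0 h')))) \<and>
     (\<forall>\<alpha> \<in> gens Q 2. \<forall>B \<in> gens Q 3. \<forall>g.
        is_cell Q 1 g \<and> composable3 Q 0 (gen Q 2 \<alpha>) g (gen Q 3 B) \<longrightarrow>
        (let \<psi> = gsrc Q 3 B; \<psi>' = gtgt Q 3 B; f = gsrc Q 2 \<alpha>; f' = gtgt Q 2 \<alpha>;
             h = csrc \<psi>; h' = ctgt Q \<psi>; N = natr Q \<alpha> g B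
         in N \<in> gens Q 4 \<and>
            gsrc Q 4 N =
              ((gen Q 2 \<alpha> \<star>\<^sub>0 g \<star>\<^sub>0 h) \<star>\<^sub>1 (f' \<star>\<^sub>0 g \<star>\<^sub>0 gen Q 3 B)) \<star>\<^sub>2
              interchange Q (gen Q 2 \<alpha> \<star>\<^sub>0 g) \<psi>' \<and>
            gtgt Q 4 N =
              interchange Q (gen Q 2 \<alpha> \<star>\<^sub>0 g) \<psi> \<star>\<^sub>2
              ((f \<star>\<^sub>0 g \<star>\<^sub>0 gen Q 3 B) \<star>\<^sub>1 (gen Q 2 \<alpha> \<star>\<^sub>0 g \<star>\<^sub>0 h'))))"

definition gray_presentation :: "('g, 'z) gray_scheme \<Rightarrow> bool" where
  "gray_presentation Q \<longleftrightarrow>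
     prepolygraph 4 Q \<and> has_interchange_generators Q \<and> has_independence_generators Q \<and>
     has_naturality_generators Q"

definition coherent_gray_presentation :: "('g, 'z) gray_scheme \<Rightarrow> bool" where
  "coherent_gray_presentation Q \<longleftrightarrow>
     gray_presentation Q \<and> coherent (localization 3 (presented_precat 3 Q))"


section \<open>Rewriting and critical branchings\<close>

text \<open>
  The notions below for a prepolygraph \<open>P\<close> only involve its generators of dimension at most 3, so that for
  a 4-prepolygraph \<open>Q\<close> they are those of \<open>Q\<^bsub>\<le>3\<^esub>\<close>.  The predicate \<open>in_context P \<mu> l u r \<rho>\<close> says
  that the composite \<open>context \<mu> l u r \<rho>\<close> is defined, for \<open>u\<close> of dimension 2 or 3.
\<close>

definition in_context ::
  "('g, 'z) prepolygraph_scheme \<Rightarrow> 'g cell \<Rightarrow> 'g cell \<Rightarrow> 'g cell \<Rightarrow> 'g cell \<Rightarrow> 'g cell \<Rightarrow> bool" where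
  "in_context P \<mu> l u r \<rho> \<longleftrightarrow>
     is_cell P 1 l \<and> is_cell P 1 r \<and> is_cell P 2 \<mu> \<and> is_cell P 2 \<rho> \<and>
     composable3 P 0 l u r \<and> composable3 P 1 \<mu> (l \<star>\<^sub>0 u \<star>\<^sub>0 r) \<rho>"

definition whisker_context ::
  "'g cell \<Rightarrow> 'g cell \<Rightarrow> 'g cell \<Rightarrow> 'g cell \<Rightarrow> 'g cell \<Rightarrow> 'g cell" where
  "whisker_context \<mu> l u r \<rho> = \<mu> \<star>\<^sub>1 (l \<star>\<^sub>0 u \<star>\<^sub>0 r) \<star>\<^sub>1 \<rho>"

definition rewriting_step :: "('g, 'z) prepolygraph_scheme \<Rightarrow> 'g cell \<Rightarrow> bool" where
  "rewriting_step P S \<longleftrightarrow>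
     (\<exists>A \<in> gens P 3. \<exists>\<mu> l r \<rho>.
        in_context P \<mu> l (gen P 3 A) r \<rho> \<and> S = whisker_context \<mu> l (gen P 3 A) r \<rho>)"

definition terminating :: "('g, 'z) prepolygraph_scheme \<Rightarrow> bool" where
  "terminating P \<longleftrightarrow>
     \<not> (\<exists>S :: nat \<Rightarrow> 'g cell. \<forall>i. rewriting_step P (S i) \<and> ctgt P (S i) = csrc (S (Suc i)))"

definition local_branching :: "('g, 'z) prepolygraph_scheme \<Rightarrow> 'g cell \<Rightarrow> 'g cell \<Rightarrow> bool" where
  "local_branching P S\<^sub>1 S\<^sub>2 \<longleftrightarrow> rewriting_step P S\<^sub>1 \<and> rewriting_step P S\<^sub>2 \<and> csrc S\<^sub>1 = csrc S\<^sub>2"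

definition is_identity :: "'g cell \<Rightarrow> bool" where
  "is_identity u \<longleftrightarrow> (\<exists>v. u = idc v)"

definition minimal_branching :: "('g, 'z) prepolygraph_scheme \<Rightarrow> 'g cell \<Rightarrow> 'g cell \<Rightarrow> bool" where
  "minimal_branching P S\<^sub>1 S\<^sub>2 \<longleftrightarrow>
     (\<forall>S\<^sub>1' S\<^sub>2' \<mu> l r \<rho>.
        local_branching P S\<^sub>1' S\<^sub>2' \<and>
        in_context P \<mu> l S\<^sub>1' r \<rho> \<and> S\<^sub>1 = whisker_context \<mu> l S\<^sub>1' r \<rho> \<and>
        in_context P \<mu> l S\<^sub>2' r \<rho> \<and> S\<^sub>2 = whisker_context \<mu> l S\<^sub>2' r \<rho> \<longrightarrow>
        is_identity l \<and> is_identity r \<and> is_identity \<mu> \<and> is_identity \<rho>)"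

definition trivial_branching :: "'g cell \<Rightarrow> 'g cell \<Rightarrow> bool" where
  "trivial_branching S\<^sub>1 S\<^sub>2 \<longleftrightarrow> S\<^sub>1 = S\<^sub>2"

definition independent_branching ::
  "('g, 'z) prepolygraph_scheme \<Rightarrow> 'g cell \<Rightarrow> 'g cell \<Rightarrow> bool" where
  "independent_branching P S\<^sub>1 S\<^sub>2 \<longleftrightarrow>
     (\<exists>A\<^sub>1 \<in> gens P 3. \<exists>A\<^sub>2 \<in> gens P 3. \<exists>l\<^sub>1 r\<^sub>1 \<chi> l\<^sub>2 r\<^sub>2.
        let \<phi>\<^sub>1 = gsrc P 3 A\<^sub>1; \<phi>\<^sub>2 = gsrc P 3 A\<^sub>2
        in is_cell P 1 l\<^sub>1 \<and> is_cell P 1 r\<^sub>1 \<and> is_cell P 1 l\<^sub>2 \<and> is_cell P 1 r\<^sub>2 \<and> is_cell P 2 \<chi> \<and>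
           composable3 P 0 l\<^sub>1 \<phi>\<^sub>1 r\<^sub>1 \<and> composable3 P 0 l\<^sub>2 \<phi>\<^sub>2 r\<^sub>2 \<and>
           composable3 P 1 (l\<^sub>1 \<star>\<^sub>0 \<phi>\<^sub>1 \<star>\<^sub>0 r\<^sub>1) \<chi> (l\<^sub>2 \<star>\<^sub>0 \<phi>\<^sub>2 \<star>\<^sub>0 r\<^sub>2) \<and>
           S\<^sub>1 = (l\<^sub>1 \<star>\<^sub>0 gen P 3 A\<^sub>1 \<star>\<^sub>0 r\<^sub>1) \<star>\<^sub>1 \<chi> \<star>\<^sub>1 (l\<^sub>2 \<star>\<^sub>0 \<phi>\<^sub>2 \<star>\<^sub>0 r\<^sub>2) \<and>
           S\<^sub>2 = (l\<^sub>1 \<star>\<^sub>0 \<phi>\<^sub>1 \<star>\<^sub>0 r\<^sub>1) \<star>\<^sub>1 \<chi> \<star>\<^sub>1 (l\<^sub>2 \<star>\<^sub>0 gen P 3 A\<^sub>2 \<star>\<^sub>0 r\<^sub>2))"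

text \<open>
  \<open>middle_swap Q \<phi> \<psi> S\<close>: the 3-cell \<open>S\<close> is the elementary swap of the last whisker of \<open>\<phi>\<close> with the
  first whisker of \<open>\<psi>\<close> in \<open>(\<phi> *\<^sub>0 \<partial>\<^sup>-\<psi>) *\<^sub>1 (\<partial>\<^sup>+\<phi> *\<^sub>0 \<psi>)\<close>; there is none when \<open>\<phi>\<close> or \<open>\<psi>\<close> is an identity.
\<close>

definition middle_swap :: "('g, 'z) gray_scheme \<Rightarrow> 'g cell \<Rightarrow> 'g cell \<Rightarrow> 'g cell \<Rightarrow> bool" where
  "middle_swap Q \<phi> \<psi> S \<longleftrightarrow>
     (\<exists>f ws w k v vs. \<phi> = Cell f (ws @ [w]) \<and> \<psi> = Cell k (v # vs) \<and>
        S = (Cell f ws \<star>\<^sub>0 k) \<star>\<^sub>1 swap Q w v \<star>\<^sub>1 (ctgt Q \<phi> \<star>\<^sub>0 Cell (wtgt Q v) vs))"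

definition natural_branching :: "('g, 'z) gray_scheme \<Rightarrow> 'g cell \<Rightarrow> 'g cell \<Rightarrow> bool" where
  "natural_branching Q S\<^sub>1 S\<^sub>2 \<longleftrightarrow>
     (\<exists>A \<in> gens Q 3. \<exists>g \<psi>.
        let \<phi> = gsrc Q 3 A; f' = ctgt Q \<phi>; h = csrc \<psi>
        in is_cell Q 1 g \<and> is_cell Q 2 \<psi> \<and> composable3 Q 0 \<phi> g \<psi> \<and>
           S\<^sub>1 = (gen Q 3 A \<star>\<^sub>0 g \<star>\<^sub>0 h) \<star>\<^sub>1 (f' \<star>\<^sub>0 g \<star>\<^sub>0 \<psi>) \<and>
           middle_swap Q \<phi> (g \<star>\<^sub>0 \<psi>) S\<^sub>2) \<or>
     (\<exists>B \<in> gens Q 3. \<exists>g \<phi>.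
        let \<psi> = gsrc Q 3 B; f' = ctgt Q \<phi>; h = csrc \<psi>
        in is_cell Q 1 g \<and> is_cell Q 2 \<phi> \<and> composable3 Q 0 \<phi> g \<psi> \<and>
           S\<^sub>1 = (\<phi> \<star>\<^sub>0 g \<star>\<^sub>0 h) \<star>\<^sub>1 (f' \<star>\<^sub>0 g \<star>\<^sub>0 gen Q 3 B) \<and>
           middle_swap Q (\<phi> \<star>\<^sub>0 g) \<psi> S\<^sub>2)"

definition critical_branching :: "('g, 'z) gray_scheme \<Rightarrow> 'g cell \<Rightarrow> 'g cell \<Rightarrow> bool" where
  "critical_branching Q S\<^sub>1 S\<^sub>2 \<longleftrightarrow>
     local_branching Q S\<^sub>1 S\<^sub>2 \<and> minimal_branching Q S\<^sub>1 S\<^sub>2 \<and>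
     \<not> trivial_branching S\<^sub>1 S\<^sub>2 \<and> \<not> trivial_branching S\<^sub>2 S\<^sub>1 \<and>
     \<not> independent_branching Q S\<^sub>1 S\<^sub>2 \<and> \<not> independent_branching Q S\<^sub>2 S\<^sub>1 \<and>
     \<not> natural_branching Q S\<^sub>1 S\<^sub>2 \<and> \<not> natural_branching Q S\<^sub>2 S\<^sub>1"


section \<open>Basic properties of free precategories\<close>

definition lact :: "'g cell \<Rightarrow> 'g cell \<times> 'g cell \<Rightarrow> 'g cell \<times> 'g cell" where
  "lact u = (\<lambda>(l, r). if cdim l < cdim u then (l, r)
                else if cdim l = cdim u then (lcomp u l, r)
                else (lcomp u l, lcomp u r))"

definition ract :: "'g cell \<Rightarrow> 'g cell \<times> 'g cell \<Rightarrow> 'g cell \<times> 'g cell" where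
  "ract u = (\<lambda>(l, r). if cdim l < cdim u then (l, r)
                else if cdim l = cdim u then (l, rcomp r u)
                else (rcomp l u, rcomp r u))"

definition lwact :: "'g cell \<Rightarrow> 'g whisker \<Rightarrow> 'g whisker" where
  "lwact u w = (fst w, map (lact u) (snd w))"

definition rwact :: "'g cell \<Rightarrow> 'g whisker \<Rightarrow> 'g whisker" where
  "rwact u w = (fst w, map (ract u) (snd w))"

lemma lcomp_Cell: "lcomp u (Cell s ws) =
     (if cdim u = Suc (cdim s) then Cell (csrc u) (whiskers u @ ws)
      else Cell (lcomp u s) (map (lwact u) ws))"
  by (auto simp: lact_def lwact_def fun_eq_iff split: prod.splits if_splits)

lemma rcomp_Cell: "rcomp (Cell s ws) u =
     (if cdim u = Suc (cdim s) then Cell s (ws @ whiskers u)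
      else Cell (rcomp s u) (map (rwact u) ws))"
  by (auto simp: ract_def rwact_def fun_eq_iff split: prod.splits if_splits)

declare lcomp.simps(2) [simp del] rcomp.simps(2) [simp del]
declare lcomp_Cell [simp] rcomp_Cell [simp]

text \<open>All cells in whiskers have the right dimensions.\<close>

fun well_dim :: "'g cell \<Rightarrow> bool" where
  "well_dim (Obj a) \<longleftrightarrow> True"
| "well_dim (Cell s ws) \<longleftrightarrow> well_dim s \<and>
     (\<forall>(A, c) \<in> set ws. map (cdim \<circ> fst) c = [1..<Suc (cdim s)] \<and> map (cdim \<circ> snd) c = [1..<Suc (cdim s)] \<and>
        (\<forall>(l, r) \<in> set c. well_dim l \<and> well_dim r))"

lemma well_dim_induct [consumes 1, case_names Obj Cell]:
  assumes "well_dim u"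
    and "\<And>a. Q (Obj a)"
    and "\<And>s ws. well_dim s \<Longrightarrow> Q s \<Longrightarrow>
      (\<And>A c l r. (A, c) \<in> set ws \<Longrightarrow> (l, r) \<in> set c \<Longrightarrow>
        well_dim l \<and> well_dim r \<and> Q l \<and> Q r \<and> cdim l = cdim r \<and> 0 < cdim l \<and> cdim l \<le> cdim s) \<Longrightarrow>
      well_dim (Cell s ws) \<Longrightarrow> Q (Cell s ws)"
  shows "Q u"
  using assms(1)
proof (induction u rule: well_dim.induct)
  case (1 a) then show ?case using assms(2) by blast
next
  case (2 s ws)
  show ?case
  proof (rule assms(3))
    show "well_dim s" "Q s" "well_dim (Cell s ws)" using 2 by auto
    fix A c l r assume h: "(A, c) \<in> set ws" "(l, r) \<in> set c"
    have m: "map (cdim \<circ> fst) c = [1..<Suc (cdim s)]" "map (cdim \<circ> snd) c = [1..<Suc (cdim s)]"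
      and w: "well_dim l \<and> well_dim r"
      using 2(4) h by fastforce+
    have "map (cdim \<circ> fst) c = map (cdim \<circ> snd) c" using m by simp
    then have "cdim l = cdim r" using h(2) by (auto simp: list_eq_iff_nth_eq in_set_conv_nth)
    moreover have "cdim l \<in> set (map (cdim \<circ> fst) c)" using h(2) by force
    then have "0 < cdim l \<and> cdim l \<le> cdim s" unfolding m by auto
    moreover have "Q l" "Q r" using 2(2,3)[OF h(1) _ h(2)] w by auto
    ultimately show "well_dim l \<and> well_dim r \<and> Q l \<and> Q r \<and> cdim l = cdim r \<and> 0 < cdim l \<and> cdim l \<le> cdim s"
      using w by auto
  qed
qed

lemma dim_pos: "0 < cdim u \<Longrightarrow> \<exists>s ws. u = Cell s ws"
  by (cases u) auto

lemma dim_lcomp [simp]: "0 < cdim u \<Longrightarrow> cdim (lcomp u v) = cdim v"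
  by (induction v) (auto dest!: dim_pos)

lemma dim_rcomp [simp]: "0 < cdim u \<Longrightarrow> cdim (rcomp v u) = cdim v"
  by (induction v) (auto dest!: dim_pos)

lemma lcomp_eq_rcomp: "0 < cdim u \<Longrightarrow> cdim u = cdim v \<Longrightarrow> lcomp u v = rcomp u v"
  by (cases u; cases v) auto

lemma lact_simps:
  "cdim l < cdim u \<Longrightarrow> lact u (l, r) = (l, r)"
  "cdim l = cdim u \<Longrightarrow> lact u (l, r) = (lcomp u l, r)"
  "cdim l > cdim u \<Longrightarrow> lact u (l, r) = (lcomp u l, lcomp u r)"
  by (auto simp: lact_def)

lemma ract_simps:
  "cdim l < cdim u \<Longrightarrow> ract u (l, r) = (l, r)"
  "cdim l = cdim u \<Longrightarrow> ract u (l, r) = (l, rcomp r u)"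
  "cdim l > cdim u \<Longrightarrow> ract u (l, r) = (rcomp l u, rcomp r u)"
  by (auto simp: ract_def)

lemma dim_lact [simp]: "0 < cdim u \<Longrightarrow> cdim (fst (lact u p)) = cdim (fst p)"
   "0 < cdim u \<Longrightarrow> cdim (snd (lact u p)) = cdim (snd p)"
  by (auto simp: lact_def split: prod.splits)

lemma dim_ract [simp]: "0 < cdim u \<Longrightarrow> cdim (fst (ract u p)) = cdim (fst p)"
   "0 < cdim u \<Longrightarrow> cdim (snd (ract u p)) = cdim (snd p)"
  by (auto simp: ract_def split: prod.splits)

lemma lwact_comp: "lwact u (lwact v w) = (fst w, map (lact u \<circ> lact v) (snd w))"
  "rwact u (lwact v w) = (fst w, map (ract u \<circ> lact v) (snd w))"
  "lwact u (rwact v w) = (fst w, map (lact u \<circ> ract v) (snd w))"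
  "rwact u (rwact v w) = (fst w, map (ract u \<circ> ract v) (snd w))"
  by (auto simp: lwact_def rwact_def)

lemma wact_cong:
  assumes "\<And>l r. (l, r) \<in> set (snd w) \<Longrightarrow> f (l, r) = g (l, r)"
  shows "(fst w, map f (snd w)) = (fst w, map g (snd w))"
  using assms by auto

lemma well_dim_act_ctx:
  assumes c: "map (cdim \<circ> fst) c = [1..<Suc k]" "map (cdim \<circ> snd) c = [1..<Suc k]"
    and wd: "\<And>l r. (l, r) \<in> set c \<Longrightarrow> well_dim (fst (f (l, r))) \<and> well_dim (snd (f (l, r)))"
    and f: "\<And>p. cdim (fst (f p)) = cdim (fst p)" "\<And>p. cdim (snd (f p)) = cdim (snd p)"
  shows "map (cdim \<circ> fst) (map f c) = [1..<Suc k] \<and> map (cdim \<circ> snd) (map f c) = [1..<Suc k] \<and>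
    (\<forall>(l, r) \<in> set (map f c). well_dim l \<and> well_dim r)"
proof (intro conjI)
  have "(cdim \<circ> fst) \<circ> f = cdim \<circ> fst" "(cdim \<circ> snd) \<circ> f = cdim \<circ> snd" using f by auto
  then show "map (cdim \<circ> fst) (map f c) = [1..<Suc k]" "map (cdim \<circ> snd) (map f c) = [1..<Suc k]"
    unfolding map_map c by (simp_all only: c)
  show "\<forall>(l, r) \<in> set (map f c). well_dim l \<and> well_dim r"
  proof clarify
    fix l r assume "(l, r) \<in> set (map f c)"
    then obtain l' r' where "(l', r') \<in> set c" "f (l', r') = (l, r)" by auto
    with wd[OF this(1)] show "well_dim l \<and> well_dim r" by simp
  qed
qed

lemma well_dim_lcomp:
  assumes "well_dim v" "well_dim u" "0 < cdim u" "cdim u \<le> cdim v"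
  shows "well_dim (lcomp u v)"
  using assms
proof (induction v rule: well_dim_induct)
  case (Obj a) then show ?case by simp
next
  case (Cell s ws)
  show ?case
  proof (cases "cdim u = Suc (cdim s)")
    case True
    obtain s' ws' where u: "u = Cell s' ws'" using dim_pos[OF \<open>0 < cdim u\<close>] by blast
    then have "cdim s' = cdim s" using True by simp
    with Cell.hyps(2) Cell.prems(1) True show ?thesis unfolding u by auto
  next
    case False
    then have d: "cdim u \<le> cdim s" using Cell by simp
    have h: "well_dim (lcomp u s)" using Cell d by blast
    have "well_dim (fst (lact u (l, r))) \<and> well_dim (snd (lact u (l, r)))"
      if "(A, c) \<in> set ws" "(l, r) \<in> set c" for A c l r
      using Cell.IH(2)[OF that] Cell.prems d by (auto simp: lact_def)
    then have *: "map (cdim \<circ> fst) (map (lact u) c) = [1..<Suc (cdim s)] \<and>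
        map (cdim \<circ> snd) (map (lact u) c) = [1..<Suc (cdim s)] \<and>
        (\<forall>(l, r) \<in> set (map (lact u) c). well_dim l \<and> well_dim r)" if "(A, c) \<in> set ws" for A c
      using Cell.hyps(2) that Cell.prems(2) by (intro well_dim_act_ctx) auto
    have **: "case w of (A, c) \<Rightarrow> map (cdim \<circ> fst) c = [1..<Suc (cdim s)] \<and>
        map (cdim \<circ> snd) c = [1..<Suc (cdim s)] \<and> (\<forall>(l, r) \<in> set c. well_dim l \<and> well_dim r)"
      if "w \<in> set (map (lwact u) ws)" for w
    proof -
      from that have "w \<in> lwact u ` set ws" by simp
      then obtain w' where w': "w' \<in> set ws" "w = lwact u w'" by blast
      then have "(fst w', snd w') \<in> set ws" "w = (fst w', map (lact u) (snd w'))"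
        by (simp_all add: lwact_def)
      then show ?thesis using * by blast
    qed
    have "cdim (lcomp u s) = cdim s" using Cell.prems by simp
    then show ?thesis using False h ** by (simp only: lcomp_Cell if_False well_dim.simps) blast
  qed
qed

lemma lcomp_lcomp_equal:
  assumes "well_dim v" "0 < cdim u" "cdim u = cdim u'" "cdim u \<le> cdim v"
  shows "lcomp u (lcomp u' v) = lcomp (lcomp u u') v"
  using assms
proof (induction v rule: well_dim_induct)
  case (Obj a) then show ?case by simp
next
  case (Cell s ws)
  obtain s' ws' where u: "u = Cell s' ws'" using dim_pos[OF \<open>0 < cdim u\<close>] by blast
  obtain t' vs' where u': "u' = Cell t' vs'" using dim_pos Cell.prems by metis
  show ?case
  proof (cases "cdim u = Suc (cdim s)")
    case True
    then show ?thesis using Cell.prems by (auto simp: u u')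
  next
    case False
    then have d: "cdim u \<le> cdim s" "cdim u' \<le> cdim s" using Cell.prems by simp_all
    have dd: "cdim (lcomp u u') = cdim u'" using Cell.prems by simp
    have "(lact u \<circ> lact u') (l, r) = lact (lcomp u u') (l, r)" if "(A, c) \<in> set ws" "(l, r) \<in> set c" for A c l r
      using Cell.IH(2)[OF that] Cell.prems(1,2) dd by (auto simp: lact_def)
    then have "lwact u (lwact u' w) = lwact (lcomp u u') w" if "w \<in> set ws" for w
      unfolding lwact_comp lwact_def using that by (cases w) auto
    then show ?thesis using d False Cell dd by auto
  qed
qed

lemma rcomp_lcomp_equal:
  assumes "well_dim v" "0 < cdim u" "cdim u = cdim u'" "cdim u \<le> cdim v"
  shows "rcomp (lcomp u v) u' = lcomp u (rcomp v u')"
  using assms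
proof (induction v rule: well_dim_induct)
  case (Obj a) then show ?case by simp
next
  case (Cell s ws)
  obtain s' ws' where u: "u = Cell s' ws'" using dim_pos[OF \<open>0 < cdim u\<close>] by blast
  obtain t' vs' where u': "u' = Cell t' vs'" using dim_pos Cell.prems by metis
  show ?case
  proof (cases "cdim u = Suc (cdim s)")
    case True
    then show ?thesis using Cell.prems by (auto simp: u u')
  next
    case False
    then have d: "cdim u \<le> cdim s" "cdim u' \<le> cdim s" using Cell.prems by simp_all
    have "(ract u' \<circ> lact u) (l, r) = (lact u \<circ> ract u') (l, r)" if "(A, c) \<in> set ws" "(l, r) \<in> set c" for A c l r
      using Cell.IH(2)[OF that] Cell.prems(1,2) by (auto simp: lact_def ract_def)
    then have "rwact u' (lwact u w) = lwact u (rwact u' w)" if "w \<in> set ws" for w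
      unfolding lwact_comp using that by (cases w) auto
    then show ?thesis using d False Cell by auto
  qed
qed

lemma lcomp_lcomp_less:
  assumes "well_dim v'" "0 < cdim u" "cdim u < cdim v" "cdim v \<le> cdim v'"
  shows "lcomp u (lcomp v v') = lcomp (lcomp u v) (lcomp u v')"
  using assms
proof (induction v' rule: well_dim_induct)
  case (Obj a) then show ?case by simp
next
  case (Cell s ws)
  obtain t' vs' where v: "v = Cell t' vs'" using dim_pos Cell.prems by (metis less_trans)
  show ?case
  proof (cases "cdim v = Suc (cdim s)")
    case True
    then show ?thesis using Cell.prems by (auto simp: v)
  next
    case False
    then have d: "cdim v \<le> cdim s" "cdim u \<le> cdim s" using Cell.prems by simp_all
    have dd: "cdim (lcomp u v) = cdim v" using Cell.prems by simp
    have "(lact u \<circ> lact v) (l, r) = (lact (lcomp u v) \<circ> lact u) (l, r)"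
      if "(A, c) \<in> set ws" "(l, r) \<in> set c" for A c l r
      using Cell.IH(2)[OF that] Cell.prems(1,2) dd by (auto simp: lact_def)
    then have "lwact u (lwact v w) = lwact (lcomp u v) (lwact u w)" if "w \<in> set ws" for w
      unfolding lwact_comp using that by (cases w) auto
    then show ?thesis using d False Cell dd by auto
  qed
qed

lemma lcomp_rcomp_less:
  assumes "well_dim v'" "0 < cdim u" "cdim u < cdim v" "cdim v \<le> cdim v'"
  shows "lcomp u (rcomp v' v) = rcomp (lcomp u v') (lcomp u v)"
  using assms
proof (induction v' rule: well_dim_induct)
  case (Obj a) then show ?case by simp
next
  case (Cell s ws)
  obtain t' vs' where v: "v = Cell t' vs'" using dim_pos Cell.prems by (metis less_trans)
  show ?case
  proof (cases "cdim v = Suc (cdim s)")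
    case True
    then show ?thesis using Cell.prems by (auto simp: v)
  next
    case False
    then have d: "cdim v \<le> cdim s" "cdim u \<le> cdim s" using Cell.prems by simp_all
    have dd: "cdim (lcomp u v) = cdim v" using Cell.prems by simp
    have "(lact u \<circ> ract v) (l, r) = (ract (lcomp u v) \<circ> lact u) (l, r)"
      if "(A, c) \<in> set ws" "(l, r) \<in> set c" for A c l r
      using Cell.IH(2)[OF that] Cell.prems(1,2) dd by (auto simp: lact_def ract_def)
    then have "lwact u (rwact v w) = rwact (lcomp u v) (lwact u w)" if "w \<in> set ws" for w
      unfolding lwact_comp using that by (cases w) auto
    then show ?thesis using d False Cell dd by auto
  qed
qed
lemma well_dim_rcomp:
  assumes "well_dim v" "well_dim u" "0 < cdim u" "cdim u \<le> cdim v"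
  shows "well_dim (rcomp v u)"
  using assms
proof (induction v rule: well_dim_induct)
  case (Obj a) then show ?case by simp
next
  case (Cell s ws)
  show ?case
  proof (cases "cdim u = Suc (cdim s)")
    case True
    obtain s' ws' where u: "u = Cell s' ws'" using dim_pos[OF \<open>0 < cdim u\<close>] by blast
    then have "cdim s' = cdim s" using True by simp
    with Cell.hyps(2) Cell.prems(1) True show ?thesis unfolding u by auto
  next
    case False
    then have d: "cdim u \<le> cdim s" using Cell by simp
    have h: "well_dim (rcomp s u)" using Cell d by blast
    have "well_dim (fst (ract u (l, r))) \<and> well_dim (snd (ract u (l, r)))"
      if "(A, c) \<in> set ws" "(l, r) \<in> set c" for A c l r
      using Cell.IH(2)[OF that] Cell.prems d by (auto simp: ract_def)
    then have *: "map (cdim \<circ> fst) (map (ract u) c) = [1..<Suc (cdim s)] \<and>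
        map (cdim \<circ> snd) (map (ract u) c) = [1..<Suc (cdim s)] \<and>
        (\<forall>(l, r) \<in> set (map (ract u) c). well_dim l \<and> well_dim r)" if "(A, c) \<in> set ws" for A c
      using Cell.hyps(2) that Cell.prems(2) by (intro well_dim_act_ctx) auto
    have **: "case w of (A, c) \<Rightarrow> map (cdim \<circ> fst) c = [1..<Suc (cdim s)] \<and>
        map (cdim \<circ> snd) c = [1..<Suc (cdim s)] \<and> (\<forall>(l, r) \<in> set c. well_dim l \<and> well_dim r)"
      if "w \<in> set (map (rwact u) ws)" for w
    proof -
      from that have "w \<in> rwact u ` set ws" by simp
      then obtain w' where w': "w' \<in> set ws" "w = rwact u w'" by blast
      then have "(fst w', snd w') \<in> set ws" "w = (fst w', map (ract u) (snd w'))"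
        by (simp_all add: rwact_def)
      then show ?thesis using * by blast
    qed
    have "cdim (rcomp s u) = cdim s" using Cell.prems by simp
    then show ?thesis using False h ** by (simp only: rcomp_Cell if_False well_dim.simps) blast
  qed
qed

lemma rcomp_rcomp_equal:
  assumes "well_dim v" "0 < cdim u" "cdim u = cdim u'" "cdim u \<le> cdim v"
  shows "rcomp (rcomp v u') u = rcomp v (rcomp u' u)"
  using assms
proof (induction v rule: well_dim_induct)
  case (Obj a) then show ?case by simp
next
  case (Cell s ws)
  obtain s' ws' where u: "u = Cell s' ws'" using dim_pos[OF \<open>0 < cdim u\<close>] by blast
  obtain t' vs' where u': "u' = Cell t' vs'" using dim_pos Cell.prems by metis
  show ?case
  proof (cases "cdim u = Suc (cdim s)")
    case True
    then show ?thesis using Cell.prems by (auto simp: u u')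
  next
    case False
    then have d: "cdim u \<le> cdim s" "cdim u' \<le> cdim s" using Cell.prems by simp_all
    have dd: "cdim (rcomp u' u) = cdim u'" using Cell.prems by simp
    have "(ract u \<circ> ract u') (l, r) = ract (rcomp u' u) (l, r)" if "(A, c) \<in> set ws" "(l, r) \<in> set c" for A c l r
      using Cell.IH(2)[OF that] Cell.prems(1,2) dd by (auto simp: ract_def)
    then have "rwact u (rwact u' w) = rwact (rcomp u' u) w" if "w \<in> set ws" for w
      unfolding lwact_comp rwact_def using that by (cases w) auto
    then show ?thesis using d False Cell dd by auto
  qed
qed

lemma rcomp_rcomp_less:
  assumes "well_dim v'" "0 < cdim u" "cdim u < cdim v" "cdim v \<le> cdim v'"
  shows "rcomp (rcomp v' v) u = rcomp (rcomp v' u) (rcomp v u)"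
  using assms
proof (induction v' rule: well_dim_induct)
  case (Obj a) then show ?case by simp
next
  case (Cell s ws)
  obtain t' vs' where v: "v = Cell t' vs'" using dim_pos Cell.prems by (metis less_trans)
  show ?case
  proof (cases "cdim v = Suc (cdim s)")
    case True
    then show ?thesis using Cell.prems by (auto simp: v)
  next
    case False
    then have d: "cdim v \<le> cdim s" "cdim u \<le> cdim s" using Cell.prems by simp_all
    have dd: "cdim (rcomp v u) = cdim v" using Cell.prems by simp
    have "(ract u \<circ> ract v) (l, r) = (ract (rcomp v u) \<circ> ract u) (l, r)"
      if "(A, c) \<in> set ws" "(l, r) \<in> set c" for A c l r
      using Cell.IH(2)[OF that] Cell.prems(1,2) dd by (auto simp: ract_def)
    then have "rwact u (rwact v w) = rwact (rcomp v u) (rwact u w)" if "w \<in> set ws" for w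
      unfolding lwact_comp using that by (cases w) auto
    then show ?thesis using d False Cell dd by auto
  qed
qed

lemma rcomp_lcomp_less:
  assumes "well_dim v'" "0 < cdim u" "cdim u < cdim v" "cdim v \<le> cdim v'"
  shows "rcomp (lcomp v v') u = lcomp (rcomp v u) (rcomp v' u)"
  using assms
proof (induction v' rule: well_dim_induct)
  case (Obj a) then show ?case by simp
next
  case (Cell s ws)
  obtain t' vs' where v: "v = Cell t' vs'" using dim_pos Cell.prems by (metis less_trans)
  show ?case
  proof (cases "cdim v = Suc (cdim s)")
    case True
    then show ?thesis using Cell.prems by (auto simp: v)
  next
    case False
    then have d: "cdim v \<le> cdim s" "cdim u \<le> cdim s" using Cell.prems by simp_all
    have dd: "cdim (rcomp v u) = cdim v" using Cell.prems by simp
    have "(ract u \<circ> lact v) (l, r) = (lact (rcomp v u) \<circ> ract u) (l, r)"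
      if "(A, c) \<in> set ws" "(l, r) \<in> set c" for A c l r
      using Cell.IH(2)[OF that] Cell.prems(1,2) dd by (auto simp: ract_def lact_def)
    then have "rwact u (lwact v w) = lwact (rcomp v u) (rwact u w)" if "w \<in> set ws" for w
      unfolding lwact_comp using that by (cases w) auto
    then show ?thesis using d False Cell dd by auto
  qed
qed

lemma ccomp_left: "cdim u \<le> cdim v \<Longrightarrow> ccomp u v = lcomp u v"
  by (simp add: ccomp_def)

lemma ccomp_right: "0 < cdim u \<Longrightarrow> cdim u \<le> cdim v \<Longrightarrow> ccomp v u = rcomp v u"
  by (auto simp: ccomp_def lcomp_eq_rcomp)

primrec ctx_dim :: "nat \<Rightarrow> ('g cell \<times> 'g cell) list \<Rightarrow> bool" where
  "ctx_dim j [] \<longleftrightarrow> True"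
| "ctx_dim j (p # c) \<longleftrightarrow> cdim (fst p) = Suc j \<and> cdim (snd p) = Suc j \<and>
     well_dim (fst p) \<and> well_dim (snd p) \<and> ctx_dim (Suc j) c"

lemma ctx_dim_map:
  "ctx_dim j c \<Longrightarrow> map (cdim \<circ> fst) c = [Suc j..<Suc j + length c] \<and>
     map (cdim \<circ> snd) c = [Suc j..<Suc j + length c] \<and> (\<forall>(l, r) \<in> set c. well_dim l \<and> well_dim r)"
proof (induction c arbitrary: j)
  case Nil then show ?case by simp
next
  case (Cons p c)
  have e: "[Suc j..<Suc j + length (p # c)] = Suc j # [Suc (Suc j)..<Suc (Suc j) + length c]"
    by (simp add: upt_rec del: upt_Suc)
  have f: "map (cdim \<circ> fst) (p # c) = Suc j # map (cdim \<circ> fst) c"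
    "map (cdim \<circ> snd) (p # c) = Suc j # map (cdim \<circ> snd) c" using Cons.prems by simp_all
  have "ctx_dim (Suc j) c" "well_dim (fst p)" "well_dim (snd p)" using Cons.prems by simp_all
  with Cons.IH[of "Suc j"] show ?case unfolding e f by (cases p) (simp add: comp_def del: upt_Suc)
qed

lemma is_cell_dim:
  "is_cell P k u \<Longrightarrow> cdim u = k \<and> well_dim u"
  "is_context P j x c \<Longrightarrow> ctx_dim j c"
proof (induction rule: is_cell_is_context.inducts)
  case (Obj a) then show ?case by simp
next
  case (Cell k s ws)
  have "map (cdim \<circ> fst) c = [1..<Suc (cdim s)] \<and> map (cdim \<circ> snd) c = [1..<Suc (cdim s)] \<and>
        (\<forall>(l, r) \<in> set c. well_dim l \<and> well_dim r)" if "(A, c) \<in> set ws" for A c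
    using ctx_dim_map[of 0 c] Cell.IH(3)[OF that] Cell.IH(2) by (simp del: upt_Suc)
  then show ?case using Cell.IH(2) by (simp only: well_dim.simps cdim.simps) blast
next
  case (Nil j x) then show ?case by simp
next
  case (Cons j l r x c) then show ?case by simp
qed

lemma well_dim_plug_step:
  assumes "well_dim x" "well_dim l" "well_dim r" "0 < cdim l" "cdim l = cdim r" "cdim l \<le> cdim x"
  shows "ccomp (ccomp l x) r = rcomp (lcomp l x) r" "well_dim (ccomp (ccomp l x) r)"
    "cdim (ccomp (ccomp l x) r) = cdim x"
  using assms by (auto simp: ccomp_left ccomp_right well_dim_lcomp well_dim_rcomp)

lemma plug_lact_above:
  assumes "well_dim x" "well_dim u" "0 < cdim u" "cdim u \<le> j" "ctx_dim j c" "j + length c \<le> cdim x"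
  shows "plug (lcomp u x) (map (lact u) c) = lcomp u (plug x c)"
  using assms
proof (induction c arbitrary: j x)
  case Nil then show ?case by simp
next
  case (Cons p c)
  obtain l r where p: "p = (l, r)" by fastforce
  have d: "cdim l = Suc j" "cdim r = Suc j" "well_dim l" "well_dim r" "ctx_dim (Suc j) c"
    using Cons.prems by (auto simp: p)
  have j: "Suc j \<le> cdim x" using Cons.prems by simp
  have a: "lact u (l, r) = (lcomp u l, lcomp u r)" using d Cons.prems by (simp add: lact_simps)
  have s: "ccomp (ccomp (lcomp u l) (lcomp u x)) (lcomp u r) = lcomp u (ccomp (ccomp l x) r)"
    using d j Cons.prems
    by (subst (1 2) well_dim_plug_step(1))
      (auto simp: well_dim_lcomp well_dim_rcomp lcomp_rcomp_less lcomp_lcomp_less)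
  have "plug (lcomp u (ccomp (ccomp l x) r)) (map (lact u) c) = lcomp u (plug (ccomp (ccomp l x) r) c)"
    using Cons.prems d j by (intro Cons.IH[of _ "Suc j"]) (auto simp: well_dim_plug_step(2,3))
  then show ?case by (simp add: p a s)
qed

lemma plug_lact:
  assumes "well_dim x" "well_dim u" "j < cdim u" "ctx_dim j c" "cdim u \<le> j + length c" "j + length c \<le> cdim x"
  shows "plug x (map (lact u) c) = lcomp u (plug x c)"
  using assms
proof (induction c arbitrary: j x)
  case Nil then show ?case by simp
next
  case (Cons p c)
  obtain l r where p: "p = (l, r)" by fastforce
  have d: "cdim l = Suc j" "cdim r = Suc j" "well_dim l" "well_dim r" "ctx_dim (Suc j) c"
    using Cons.prems by (auto simp: p)
  have j: "Suc j \<le> cdim x" using Cons.prems by simp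
  show ?case
  proof (cases "cdim u = Suc j")
    case True
    have a: "lact u (l, r) = (lcomp u l, r)" using d True by (simp add: lact_simps)
    have s: "ccomp (ccomp (lcomp u l) x) r = lcomp u (ccomp (ccomp l x) r)"
      using d j Cons.prems True
      by (subst (1 2) well_dim_plug_step(1))
        (auto simp: well_dim_lcomp well_dim_rcomp lcomp_lcomp_equal[symmetric] rcomp_lcomp_equal)
    have "plug (lcomp u (ccomp (ccomp l x) r)) (map (lact u) c) = lcomp u (plug (ccomp (ccomp l x) r) c)"
      using Cons.prems d j True by (intro plug_lact_above[of _ _ "Suc j"]) (auto simp: well_dim_plug_step(2,3))
    then show ?thesis by (simp add: p a s)
  next
    case False
    then have a: "lact u (l, r) = (l, r)" using d Cons.prems by (simp add: lact_simps)
    have "plug (ccomp (ccomp l x) r) (map (lact u) c) = lcomp u (plug (ccomp (ccomp l x) r) c)"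
      using Cons.prems d j False by (intro Cons.IH[of _ "Suc j"]) (auto simp: well_dim_plug_step(2,3))
    then show ?thesis by (simp add: p a)
  qed
qed

lemma plug_ract_above:
  assumes "well_dim x" "well_dim u" "0 < cdim u" "cdim u \<le> j" "ctx_dim j c" "j + length c \<le> cdim x"
  shows "plug (rcomp x u) (map (ract u) c) = rcomp (plug x c) u"
  using assms
proof (induction c arbitrary: j x)
  case Nil then show ?case by simp
next
  case (Cons p c)
  obtain l r where p: "p = (l, r)" by fastforce
  have d: "cdim l = Suc j" "cdim r = Suc j" "well_dim l" "well_dim r" "ctx_dim (Suc j) c"
    using Cons.prems by (auto simp: p)
  have j: "Suc j \<le> cdim x" using Cons.prems by simp
  have a: "ract u (l, r) = (rcomp l u, rcomp r u)" using d Cons.prems by (simp add: ract_simps)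
  have s: "ccomp (ccomp (rcomp l u) (rcomp x u)) (rcomp r u) = rcomp (ccomp (ccomp l x) r) u"
    using d j Cons.prems
    by (subst (1 2) well_dim_plug_step(1))
      (auto simp: well_dim_lcomp well_dim_rcomp rcomp_rcomp_less rcomp_lcomp_less)
  have "plug (rcomp (ccomp (ccomp l x) r) u) (map (ract u) c) = rcomp (plug (ccomp (ccomp l x) r) c) u"
    using Cons.prems d j by (intro Cons.IH[of _ "Suc j"]) (auto simp: well_dim_plug_step(2,3))
  then show ?case by (simp add: p a s)
qed

lemma plug_ract:
  assumes "well_dim x" "well_dim u" "j < cdim u" "ctx_dim j c" "cdim u \<le> j + length c" "j + length c \<le> cdim x"
  shows "plug x (map (ract u) c) = rcomp (plug x c) u"
  using assms
proof (induction c arbitrary: j x)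
  case Nil then show ?case by simp
next
  case (Cons p c)
  obtain l r where p: "p = (l, r)" by fastforce
  have d: "cdim l = Suc j" "cdim r = Suc j" "well_dim l" "well_dim r" "ctx_dim (Suc j) c"
    using Cons.prems by (auto simp: p)
  have j: "Suc j \<le> cdim x" using Cons.prems by simp
  show ?case
  proof (cases "cdim u = Suc j")
    case True
    have a: "ract u (l, r) = (l, rcomp r u)" using d True by (simp add: ract_simps)
    have s: "ccomp (ccomp l x) (rcomp r u) = rcomp (ccomp (ccomp l x) r) u"
      using d j Cons.prems True
      by (subst (1 2) well_dim_plug_step(1))
        (auto simp: well_dim_lcomp well_dim_rcomp rcomp_rcomp_equal[symmetric])
    have "plug (rcomp (ccomp (ccomp l x) r) u) (map (ract u) c) = rcomp (plug (ccomp (ccomp l x) r) c) u"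
      using Cons.prems d j True by (intro plug_ract_above[of _ _ "Suc j"]) (auto simp: well_dim_plug_step(2,3))
    then show ?thesis by (simp add: p a s)
  next
    case False
    then have a: "ract u (l, r) = (l, r)" using d Cons.prems by (simp add: ract_simps)
    have "plug (ccomp (ccomp l x) r) (map (ract u) c) = rcomp (plug (ccomp (ccomp l x) r) c) u"
      using Cons.prems d j False by (intro Cons.IH[of _ "Suc j"]) (auto simp: well_dim_plug_step(2,3))
    then show ?thesis by (simp add: p a)
  qed
qed

lemma ctx_dim_lact: "ctx_dim j c \<Longrightarrow> well_dim u \<Longrightarrow> 0 < cdim u \<Longrightarrow> ctx_dim j (map (lact u) c)"
  by (induction c arbitrary: j) (auto simp: lact_def well_dim_lcomp split: prod.splits)

lemma ctx_dim_ract: "ctx_dim j c \<Longrightarrow> well_dim u \<Longrightarrow> 0 < cdim u \<Longrightarrow> ctx_dim j (map (ract u) c)"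
  by (induction c arbitrary: j) (auto simp: ract_def well_dim_rcomp split: prod.splits)

definition is_whisker :: "('g, 'z) prepolygraph_scheme \<Rightarrow> nat \<Rightarrow> 'g whisker \<Rightarrow> bool" where
  "is_whisker P k w \<longleftrightarrow> fst w \<in> gens P (Suc k) \<and> length (snd w) = k \<and>
     is_context P 0 (gsrc P (Suc k) (fst w)) (snd w)"

lemma is_cell_Suc_iff:
  "is_cell P (Suc k) u \<longleftrightarrow> (\<exists>s ws. u = Cell s ws \<and> is_cell P k s \<and> (\<forall>w \<in> set ws. is_whisker P k w) \<and> wchain P s ws)"
proof
  assume "is_cell P (Suc k) u"
  then show "\<exists>s ws. u = Cell s ws \<and> is_cell P k s \<and> (\<forall>w \<in> set ws. is_whisker P k w) \<and> wchain P s ws"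
    by cases (auto simp: is_whisker_def)
next
  assume "\<exists>s ws. u = Cell s ws \<and> is_cell P k s \<and> (\<forall>w \<in> set ws. is_whisker P k w) \<and> wchain P s ws"
  then show "is_cell P (Suc k) u"
    by (auto simp: is_whisker_def intro!: is_cell_is_context.Cell)
qed

lemma is_cell_Cell [simp]:
  "is_cell P (Suc k) (Cell s ws) \<longleftrightarrow> is_cell P k s \<and> (\<forall>w \<in> set ws. is_whisker P k w) \<and> wchain P s ws"
  by (simp add: is_cell_Suc_iff)

lemma bsrc_eq [simp]: "cdim u \<le> i \<Longrightarrow> bsrc i u = u"
  by (simp add: bsrc_def)

lemma btgt_eq [simp]: "cdim u \<le> i \<Longrightarrow> btgt P i u = u"
  by (simp add: btgt_def)

lemma bsrc_csrc: "i < cdim u \<Longrightarrow> bsrc i u = bsrc i (csrc u)"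
  by (cases u) (auto simp: bsrc_def Suc_diff_le funpow_swap1)

lemma btgt_ctgt: "i < cdim u \<Longrightarrow> Suc (cdim (ctgt P u)) = cdim u \<Longrightarrow> btgt P i u = btgt P i (ctgt P u)"
  by (cases u) (auto simp: btgt_def Suc_diff_le funpow_swap1)

lemma wchain_append: "wchain P s (ws @ vs) \<longleftrightarrow> wchain P s ws \<and> wchain P (ctgt P (Cell s ws)) vs"
  by (induction ws arbitrary: s) auto

context
  fixes P :: "('g, 'z) prepolygraph_scheme" and n :: nat
  assumes P: "prepolygraph n P"
begin

lemma gen_boundary:
  assumes "A \<in> gens P (Suc k)" "k < n"
  shows "is_cell P k (gsrc P (Suc k) A)" "is_cell P k (gtgt P (Suc k) A)"
    "0 < k \<Longrightarrow> csrc (gsrc P (Suc k) A) = csrc (gtgt P (Suc k) A)"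
    "0 < k \<Longrightarrow> ctgt P (gsrc P (Suc k) A) = ctgt P (gtgt P (Suc k) A)"
  using assms P unfolding prepolygraph_def by blast+

lemma wsrc_lwact:
  assumes w: "is_whisker P k w" and k: "k < n" and u: "well_dim u" "0 < cdim u" "cdim u \<le> k"
  shows "wsrc P (lwact u w) = lcomp u (wsrc P w)" "wtgt P (lwact u w) = lcomp u (wtgt P w)"
proof -
  have A: "fst w \<in> gens P (Suc k)" "length (snd w) = k" "ctx_dim 0 (snd w)"
    using w is_cell_dim(2) unfolding is_whisker_def by blast+
  note g = gen_boundary(1)[OF A(1) k, THEN is_cell_dim(1)] gen_boundary(2)[OF A(1) k, THEN is_cell_dim(1)]
  have "plug (gsrc P (Suc k) (fst w)) (map (lact u) (snd w)) = lcomp u (plug (gsrc P (Suc k) (fst w)) (snd w))"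
    "plug (gtgt P (Suc k) (fst w)) (map (lact u) (snd w)) = lcomp u (plug (gtgt P (Suc k) (fst w)) (snd w))"
    using A g u by (auto intro!: plug_lact[where j = 0])
  then show "wsrc P (lwact u w) = lcomp u (wsrc P w)" "wtgt P (lwact u w) = lcomp u (wtgt P w)"
    using A(2) by (simp_all add: wsrc_def wtgt_def lwact_def)
qed

lemma wsrc_rwact:
  assumes w: "is_whisker P k w" and k: "k < n" and u: "well_dim u" "0 < cdim u" "cdim u \<le> k"
  shows "wsrc P (rwact u w) = rcomp (wsrc P w) u" "wtgt P (rwact u w) = rcomp (wtgt P w) u"
proof -
  have A: "fst w \<in> gens P (Suc k)" "length (snd w) = k" "ctx_dim 0 (snd w)"
    using w is_cell_dim(2) unfolding is_whisker_def by blast+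
  note g = gen_boundary(1)[OF A(1) k, THEN is_cell_dim(1)] gen_boundary(2)[OF A(1) k, THEN is_cell_dim(1)]
  have "plug (gsrc P (Suc k) (fst w)) (map (ract u) (snd w)) = rcomp (plug (gsrc P (Suc k) (fst w)) (snd w)) u"
    "plug (gtgt P (Suc k) (fst w)) (map (ract u) (snd w)) = rcomp (plug (gtgt P (Suc k) (fst w)) (snd w)) u"
    using A g u by (auto intro!: plug_ract[where j = 0])
  then show "wsrc P (rwact u w) = rcomp (wsrc P w) u" "wtgt P (rwact u w) = rcomp (wtgt P w) u"
    using A(2) by (simp_all add: wsrc_def wtgt_def rwact_def)
qed

lemma ctgt_lcomp_less:
  assumes v: "is_cell P (Suc k) v" and k: "k < n" and u: "well_dim u" "0 < cdim u" "cdim u \<le> k"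
  shows "ctgt P (lcomp u v) = lcomp u (ctgt P v)"
proof -
  obtain s ws where v': "v = Cell s ws" "is_cell P k s" "\<forall>w \<in> set ws. is_whisker P k w"
    using v unfolding is_cell_Suc_iff by blast
  have "cdim s = k" using is_cell_dim v' by blast
  show ?thesis
  proof (cases "ws = []")
    case True then show ?thesis using \<open>cdim s = k\<close> u v' by auto
  next
    case False
    then have "is_whisker P k (last ws)" using v' by simp
    from wsrc_lwact(2)[OF this k u] show ?thesis using False \<open>cdim s = k\<close> u v'(1) by (simp add: last_map)
  qed
qed

lemma ctgt_rcomp_less:
  assumes v: "is_cell P (Suc k) v" and k: "k < n" and u: "well_dim u" "0 < cdim u" "cdim u \<le> k"
  shows "ctgt P (rcomp v u) = rcomp (ctgt P v) u"
proof -
  obtain s ws where v': "v = Cell s ws" "is_cell P k s" "\<forall>w \<in> set ws. is_whisker P k w"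
    using v unfolding is_cell_Suc_iff by blast
  have "cdim s = k" using is_cell_dim v' by blast
  show ?thesis
  proof (cases "ws = []")
    case True then show ?thesis using \<open>cdim s = k\<close> u v' by auto
  next
    case False
    then have "is_whisker P k (last ws)" using v' by simp
    from wsrc_rwact(2)[OF this k u] show ?thesis using False \<open>cdim s = k\<close> u v'(1) by (simp add: last_map)
  qed
qed

lemma ctgt_lcomp_equal:
  assumes "is_cell P (Suc k) u" "is_cell P (Suc k) v" "ctgt P u = csrc v"
  shows "ctgt P (lcomp u v) = ctgt P v"
  using assms is_cell_dim(1)[OF assms(1)] is_cell_dim(1)[OF assms(2)]
  unfolding is_cell_Suc_iff by auto

lemma csrc_lcomp: "0 < cdim u \<Longrightarrow> 0 < cdim v \<Longrightarrow> csrc (lcomp u v) = (if cdim u = cdim v then csrc u else lcomp u (csrc v))"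
  by (cases v) auto

lemma csrc_rcomp: "0 < cdim u \<Longrightarrow> 0 < cdim v \<Longrightarrow> csrc (rcomp v u) = (if cdim u = cdim v then csrc v else rcomp (csrc v) u)"
  by (cases v) auto

definition globular :: "nat \<Rightarrow> bool" where
  "globular m \<longleftrightarrow> (\<forall>k<m. \<forall>u. is_cell P (Suc k) u \<longrightarrow> is_cell P k (ctgt P u) \<and>
     (0 < k \<longrightarrow> csrc (csrc u) = csrc (ctgt P u) \<and> ctgt P (csrc u) = ctgt P (ctgt P u)))"

lemma globularD:
  assumes "globular m" "k < m" "is_cell P (Suc k) u"
  shows "is_cell P k (ctgt P u)" "0 < k \<Longrightarrow> csrc (csrc u) = csrc (ctgt P u)"
    "0 < k \<Longrightarrow> ctgt P (csrc u) = ctgt P (ctgt P u)"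
  using assms unfolding globular_def by blast+

lemma is_cell_csrc: "is_cell P (Suc k) u \<Longrightarrow> is_cell P k (csrc u)"
  unfolding is_cell_Suc_iff by auto

lemma bound_step:
  assumes "globular m" "k < m" "is_cell P (Suc k) u"
  shows "i \<le> k \<Longrightarrow> btgt P i (ctgt P u) = btgt P i u" "i \<le> k \<Longrightarrow> bsrc i (csrc u) = bsrc i u"
    "i < k \<Longrightarrow> btgt P i (csrc u) = btgt P i u" "i < k \<Longrightarrow> bsrc i (ctgt P u) = bsrc i u"
proof -
  have d: "cdim u = Suc k" "cdim (ctgt P u) = k" "cdim (csrc u) = k"
    using globularD(1)[OF assms, THEN is_cell_dim(1)] is_cell_csrc[OF assms(3), THEN is_cell_dim(1)]
      is_cell_dim(1)[OF assms(3)] by blast+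
  show a: "btgt P i (ctgt P u) = btgt P i u" if "i \<le> k" using btgt_ctgt[of i u P] d that by simp
  show b: "bsrc i (csrc u) = bsrc i u" if "i \<le> k" using bsrc_csrc[of i u] d that by simp
  show "btgt P i (csrc u) = btgt P i u" "bsrc i (ctgt P u) = bsrc i u" if "i < k"
  proof -
    from that have "k \<noteq> 0" by simp
    then obtain k' where k': "k = Suc k'" using not0_implies_Suc by blast
    have c: "is_cell P (Suc k') (csrc u)" "is_cell P (Suc k') (ctgt P u)"
      using globularD(1)[OF assms] assms is_cell_csrc k' by auto
    have d': "cdim (ctgt P (csrc u)) = k'" "cdim (ctgt P (ctgt P u)) = k'"
      using globularD(1)[OF assms(1) _ c(1)] globularD(1)[OF assms(1) _ c(2)] assms(2) k' is_cell_dim by auto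
    have "btgt P i (csrc u) = btgt P i (ctgt P (csrc u))" using btgt_ctgt[of i "csrc u" P] d d' that k' by simp
    also have "\<dots> = btgt P i (ctgt P (ctgt P u))" using globularD(3)[OF assms] that by simp
    also have "\<dots> = btgt P i (ctgt P u)" using btgt_ctgt[of i "ctgt P u" P] d d' that k' by simp
    finally show "btgt P i (csrc u) = btgt P i u" using a that by simp
    have "bsrc i (ctgt P u) = bsrc i (csrc (ctgt P u))" using bsrc_csrc[of i "ctgt P u"] d that by simp
    also have "\<dots> = bsrc i (csrc (csrc u))" using globularD(2)[OF assms] that by simp
    also have "\<dots> = bsrc i (csrc u)" using bsrc_csrc[of i "csrc u"] d that by simp
    finally show "bsrc i (ctgt P u) = bsrc i u" using b that by simp
  qed
qed

lemma is_cell_0: "is_cell P 0 u \<Longrightarrow> cdim u = 0"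
  using is_cell_dim by blast

lemma bound_cell:
  assumes "globular m" "k \<le> m" "is_cell P k u" "i \<le> k"
  shows "is_cell P i (bsrc i u) \<and> is_cell P i (btgt P i u)"
  using assms(2-)
proof (induction k arbitrary: u)
  case 0 then show ?case using is_cell_0 by simp
next
  case (Suc k)
  show ?case
  proof (cases "i = Suc k")
    case True then show ?thesis using Suc.prems is_cell_dim(1)[OF Suc.prems(2)] by simp
  next
    case False
    then have i: "i \<le> k" "k < m" using Suc.prems by auto
    have "is_cell P k (csrc u)" "is_cell P k (ctgt P u)"
      using is_cell_csrc globularD(1)[OF assms(1)] Suc.prems i by auto
    then show ?thesis using Suc.IH[of "csrc u"] Suc.IH[of "ctgt P u"] i Suc.prems
        bound_step(1,2)[OF assms(1), of k u i] by auto
  qed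
qed

lemma bound_bound:
  assumes "globular m" "k \<le> m" "is_cell P k u" "i < j"
  shows "bsrc i (bsrc j u) = bsrc i u \<and> bsrc i (btgt P j u) = bsrc i u \<and>
    btgt P i (bsrc j u) = btgt P i u \<and> btgt P i (btgt P j u) = btgt P i u"
  using assms(2-)
proof (induction k arbitrary: u)
  case 0 then show ?case using is_cell_0 by simp
next
  case (Suc k)
  show ?case
  proof (cases "Suc k \<le> j")
    case True then show ?thesis using Suc.prems is_cell_dim(1)[OF Suc.prems(2)] by simp
  next
    case False
    then have i: "i < k" "j \<le> k" "k < m" using Suc.prems by auto
    have "is_cell P k (csrc u)" "is_cell P k (ctgt P u)"
      using is_cell_csrc globularD(1)[OF assms(1)] Suc.prems i by auto
    then show ?thesis using Suc.IH[of "csrc u"] Suc.IH[of "ctgt P u"] i Suc.prems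
        bound_step[OF assms(1), of k u i] bound_step(1,2)[OF assms(1), of k u j] by auto
  qed
qed

lemma lcomp_bound:
  assumes g: "globular m" "m \<le> n" and u: "is_cell P (Suc a) u"
    and "a < b" "b \<le> m" "is_cell P b v" "btgt P a u = bsrc a v"
  shows "(i \<le> a \<longrightarrow> bsrc i (lcomp u v) = bsrc i u \<and> btgt P i (lcomp u v) = btgt P i v) \<and>
    (a < i \<longrightarrow> bsrc i (lcomp u v) = lcomp u (bsrc i v) \<and> btgt P i (lcomp u v) = lcomp u (btgt P i v))"
  using assms(4-)
proof (induction b arbitrary: v)
  case 0 then show ?case by simp
next
  case (Suc b)
  have du: "cdim u = Suc a" "well_dim u" using u is_cell_dim by auto
  have dv: "cdim v = Suc b" "well_dim v" using Suc.prems is_cell_dim by auto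
  have bm: "b < m" using Suc.prems by simp
  have cv: "is_cell P b (csrc v)" "is_cell P b (ctgt P v)"
    using is_cell_csrc globularD(1)[OF g(1) bm] Suc.prems by auto
  then have dcv: "cdim (csrc v) = b" "cdim (ctgt P v) = b" using is_cell_dim by blast+
  have cs: "csrc (lcomp u v) = (if b = a then csrc u else lcomp u (csrc v))"
    using csrc_lcomp[of u v] du dv by auto
  show ?case
  proof (cases "b = a")
    case True
    have cu: "is_cell P a (ctgt P u)" using globularD(1)[OF g(1) _ u] True bm by simp
    have "ctgt P u = csrc v" using Suc.prems(4) bound_step(1,2)[OF g(1), of a _ a] u Suc.prems(3) True bm
        cu cv is_cell_dim(1)[OF cu] is_cell_dim(1)[OF cv(1)] by (metis bsrc_eq btgt_eq le_refl)
    then have ct: "ctgt P (lcomp u v) = ctgt P v" using ctgt_lcomp_equal u Suc.prems(3) True by blast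
    have d: "cdim (lcomp u v) = Suc b" using du dv by simp
    have "bsrc i (lcomp u v) = bsrc i u" if "i \<le> a"
      using bsrc_csrc[of i "lcomp u v"] bsrc_csrc[of i u] that cs d True du by simp
    moreover have "btgt P i (lcomp u v) = btgt P i v" if "i \<le> a"
      using btgt_ctgt[of i "lcomp u v" P] btgt_ctgt[of i v P] that ct d True dv dcv by simp
    ultimately show ?thesis using du dv d True by auto
  next
    case False
    then have ab: "a < b" using Suc.prems by simp
    have d: "cdim (lcomp u v) = Suc b" using du dv by simp
    have ct: "ctgt P (lcomp u v) = lcomp u (ctgt P v)"
      using ctgt_lcomp_less[OF Suc.prems(3)] bm g du ab by auto
    have dt: "cdim (ctgt P (lcomp u v)) = b" using ct dcv du by simp
    have ih1: "btgt P a u = bsrc a (csrc v)" "btgt P a u = bsrc a (ctgt P v)"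
      using bound_step(2,4)[OF g(1) bm Suc.prems(3)] ab Suc.prems(4) by auto
    note IH1 = Suc.IH[OF ab _ cv(1) ih1(1)] and IH2 = Suc.IH[OF ab _ cv(2) ih1(2)]
    show ?thesis
    proof (cases "i \<le> b")
      case True
      have "bsrc i (lcomp u v) = bsrc i (lcomp u (csrc v))"
        using bsrc_csrc[of i "lcomp u v"] True d cs False by simp
      moreover have "btgt P i (lcomp u v) = btgt P i (lcomp u (ctgt P v))"
        using btgt_ctgt[of i "lcomp u v" P] True d ct dt by simp
      ultimately show ?thesis using IH1 IH2 bm True bound_step(1,2)[OF g(1) bm Suc.prems(3)] by auto
    next
      case False
      then show ?thesis using d dv ab by auto
    qed
  qed
qed

lemma rcomp_bound:
  assumes g: "globular m" "m \<le> n" and u: "is_cell P (Suc a) u"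
    and "a < b" "b \<le> m" "is_cell P b v" "btgt P a v = bsrc a u"
  shows "(i \<le> a \<longrightarrow> bsrc i (rcomp v u) = bsrc i v \<and> btgt P i (rcomp v u) = btgt P i u) \<and>
    (a < i \<longrightarrow> bsrc i (rcomp v u) = rcomp (bsrc i v) u \<and> btgt P i (rcomp v u) = rcomp (btgt P i v) u)"
  using assms(4-)
proof (induction b arbitrary: v)
  case 0 then show ?case by simp
next
  case (Suc b)
  have du: "cdim u = Suc a" "well_dim u" using u is_cell_dim by auto
  have dv: "cdim v = Suc b" "well_dim v" using Suc.prems is_cell_dim by auto
  have bm: "b < m" using Suc.prems by simp
  have cv: "is_cell P b (csrc v)" "is_cell P b (ctgt P v)"
    using is_cell_csrc globularD(1)[OF g(1) bm] Suc.prems by auto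
  then have dcv: "cdim (csrc v) = b" "cdim (ctgt P v) = b" using is_cell_dim by blast+
  have cs: "csrc (rcomp v u) = (if b = a then csrc v else rcomp (csrc v) u)"
    using csrc_rcomp[of u v] du dv by auto
  show ?case
  proof (cases "b = a")
    case True
    have cu: "is_cell P a (ctgt P u)" using globularD(1)[OF g(1) _ u] True bm by simp
    then have dcu: "cdim (ctgt P u) = a" using is_cell_dim by blast
    have csu: "is_cell P a (csrc u)" using is_cell_csrc u by blast
    have "ctgt P v = csrc u" using Suc.prems(4) bound_step(1,2)[OF g(1), of a _ a] u Suc.prems(3) True bm
        dcv is_cell_dim(1)[OF csu] by (metis bsrc_eq btgt_eq le_refl)
    then have ct: "ctgt P (rcomp v u) = ctgt P u"
      using ctgt_lcomp_equal[of a v u] u Suc.prems(3) True du dv lcomp_eq_rcomp[of v u] by simp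
    have d: "cdim (rcomp v u) = Suc b" using du dv by simp
    have "bsrc i (rcomp v u) = bsrc i v" if "i \<le> a"
      using bsrc_csrc[of i "rcomp v u"] bsrc_csrc[of i v] that cs d True dv by simp
    moreover have "btgt P i (rcomp v u) = btgt P i u" if "i \<le> a"
      using btgt_ctgt[of i "rcomp v u" P] btgt_ctgt[of i u P] that ct d True du dcu by simp
    ultimately show ?thesis using du dv d True by auto
  next
    case False
    then have ab: "a < b" using Suc.prems by simp
    have d: "cdim (rcomp v u) = Suc b" using du dv by simp
    have ct: "ctgt P (rcomp v u) = rcomp (ctgt P v) u"
      using ctgt_rcomp_less[OF Suc.prems(3)] bm g du ab by auto
    have dt: "cdim (ctgt P (rcomp v u)) = b" using ct dcv du by simp
    have ih1: "btgt P a (csrc v) = bsrc a u" "btgt P a (ctgt P v) = bsrc a u"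
      using bound_step(1,3)[OF g(1) bm Suc.prems(3)] ab Suc.prems(4) by auto
    note IH1 = Suc.IH[OF ab _ cv(1) ih1(1)] and IH2 = Suc.IH[OF ab _ cv(2) ih1(2)]
    show ?thesis
    proof (cases "i \<le> b")
      case True
      have "bsrc i (rcomp v u) = bsrc i (rcomp (csrc v) u)"
        using bsrc_csrc[of i "rcomp v u"] True d cs False by simp
      moreover have "btgt P i (rcomp v u) = btgt P i (rcomp (ctgt P v) u)"
        using btgt_ctgt[of i "rcomp v u" P] True d ct dt by simp
      ultimately show ?thesis using IH1 IH2 bm True bound_step(1,2)[OF g(1) bm Suc.prems(3)] by auto
    next
      case False
      then show ?thesis using d dv ab by auto
    qed
  qed
qed

end

context
  fixes P :: "('g, 'z) prepolygraph_scheme" and n :: nat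
  assumes P: "prepolygraph n P"
begin

definition comp_closed :: "nat \<Rightarrow> bool" where
  "comp_closed m \<longleftrightarrow> (\<forall>a b u v. a < b \<and> b \<le> m \<and> is_cell P (Suc a) u \<and> is_cell P b v \<longrightarrow>
     (btgt P a u = bsrc a v \<longrightarrow> is_cell P b (lcomp u v)) \<and>
     (btgt P a v = bsrc a u \<longrightarrow> is_cell P b (rcomp v u)))"

lemma closedD:
  assumes "comp_closed m" "is_cell P (Suc a) u" "a < b" "b \<le> m" "is_cell P b v"
  shows "btgt P a u = bsrc a v \<Longrightarrow> is_cell P b (lcomp u v)"
    "btgt P a v = bsrc a u \<Longrightarrow> is_cell P b (rcomp v u)"
  using assms unfolding comp_closed_def by blast+

definition parallel :: "nat \<Rightarrow> 'g cell \<Rightarrow> 'g cell \<Rightarrow> bool" where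
  "parallel k x y \<longleftrightarrow> is_cell P k x \<and> is_cell P k y \<and> (0 < k \<longrightarrow> csrc x = csrc y \<and> ctgt P x = ctgt P y)"

lemma parallel_bound:
  assumes "globular P m" "k \<le> m" "parallel k x y" "i < k"
  shows "bsrc i x = bsrc i y" "btgt P i x = btgt P i y"
proof -
  obtain k' where k: "k = Suc k'" using assms(4) not0_implies_Suc[of k] by auto
  have x: "is_cell P (Suc k') x" "is_cell P (Suc k') y" "csrc x = csrc y" "ctgt P x = ctgt P y"
    using assms(3) k unfolding parallel_def by auto
  show "bsrc i x = bsrc i y" "btgt P i x = btgt P i y"
    using bound_step(1,2)[OF P assms(1), of k' x i] bound_step(1,2)[OF P assms(1), of k' y i] x k assms(2,4) by auto
qed

lemma ctx_step:
  assumes g: "globular P m" "comp_closed m" "m \<le> n" and x: "is_cell P k x" "k \<le> m" "Suc j \<le> k"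
    and lr: "is_cell P (Suc j) l" "is_cell P (Suc j) r" "btgt P j l = bsrc j x" "btgt P j x = bsrc j r"
  shows "is_cell P k (ccomp (ccomp l x) r)"
    "bsrc j (ccomp (ccomp l x) r) = bsrc j l" "btgt P j (ccomp (ccomp l x) r) = btgt P j r"
    "i < j \<Longrightarrow> bsrc i (ccomp (ccomp l x) r) = bsrc i x" "i < j \<Longrightarrow> btgt P i (ccomp (ccomp l x) r) = btgt P i x"
    "i < j \<Longrightarrow> bsrc i l = bsrc i x" "i < j \<Longrightarrow> bsrc i r = bsrc i x"
    "i < j \<Longrightarrow> btgt P i l = btgt P i x" "i < j \<Longrightarrow> btgt P i r = btgt P i x"
    "ccomp (ccomp l x) r = rcomp (lcomp l x) r"
proof -
  have d: "cdim x = k" "well_dim x" "cdim l = Suc j" "well_dim l" "cdim r = Suc j" "well_dim r"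
    using x lr is_cell_dim by auto
  show e: "ccomp (ccomp l x) r = rcomp (lcomp l x) r"
    using d x(3) by (intro well_dim_plug_step(1)) auto
  have c1: "is_cell P k (lcomp l x)"
    using closedD(1)[OF g(2) lr(1) _ x(2,1) lr(3)] x(3) by simp
  have lb: "\<And>i. i \<le> j \<Longrightarrow> bsrc i (lcomp l x) = bsrc i l \<and> btgt P i (lcomp l x) = btgt P i x"
    using lcomp_bound[OF P g(1,3) lr(1) _ x(2,1) lr(3)] x(3) by auto
  have m: "btgt P j (lcomp l x) = bsrc j r" using lb lr by simp
  show "is_cell P k (ccomp (ccomp l x) r)"
    using closedD(2)[OF g(2) lr(2) _ x(2) c1 m] x(3) unfolding e by simp
  have rb: "\<And>i. i \<le> j \<Longrightarrow> bsrc i (rcomp (lcomp l x) r) = bsrc i (lcomp l x) \<and> btgt P i (rcomp (lcomp l x) r) = btgt P i r"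
    using rcomp_bound[OF P g(1,3) lr(2) _ x(2) c1 m] x(3) by auto
  show "bsrc j (ccomp (ccomp l x) r) = bsrc j l" "btgt P j (ccomp (ccomp l x) r) = btgt P j r"
    using rb lb e by auto
  have jm: "Suc j \<le> m" using x by simp
  have i: "bsrc i l = bsrc i x \<and> bsrc i r = bsrc i x \<and> btgt P i l = btgt P i x \<and> btgt P i r = btgt P i x" if "i < j"
    using bound_bound[OF P g(1) jm lr(1) that] bound_bound[OF P g(1) jm lr(2) that]
      bound_bound[OF P g(1) x(2,1) that] lr(3,4) by metis
  then show "bsrc i l = bsrc i x" "bsrc i r = bsrc i x" "btgt P i l = btgt P i x" "btgt P i r = btgt P i x"
    if "i < j" using that by auto
  show "bsrc i (ccomp (ccomp l x) r) = bsrc i x" "btgt P i (ccomp (ccomp l x) r) = btgt P i x" if "i < j"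
    using rb lb e i that by auto
qed

lemma parallel_lcomp:
  assumes g: "globular P m" "comp_closed m" "m \<le> n" and x: "parallel k x y" "k \<le> m"
    and u: "is_cell P (Suc a) u" "Suc a \<le> k" "btgt P a u = bsrc a x"
  shows "parallel k (lcomp u x) (lcomp u y)"
proof -
  have ux: "is_cell P k x" "is_cell P k y" "btgt P a u = bsrc a y"
    using x(1) parallel_bound(1)[OF g(1) x(2,1)] u by (auto simp: parallel_def)
  have d: "cdim x = k" "cdim y = k" "cdim u = Suc a" "well_dim u" using ux u is_cell_dim by auto
  have c: "is_cell P k (lcomp u x)" "is_cell P k (lcomp u y)"
    using closedD(1)[OF g(2) u(1) _ x(2) ux(1) u(3)] closedD(1)[OF g(2) u(1) _ x(2) ux(2,3)] u(2) by simp_all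
  have "csrc (lcomp u x) = csrc (lcomp u y)"
    using csrc_lcomp[where u = u and v = x, OF P] csrc_lcomp[where u = u and v = y, OF P] d u(2) x(1) by (auto simp: parallel_def)
  moreover have "ctgt P (lcomp u x) = ctgt P (lcomp u y)"
  proof (cases "k = Suc a")
    case True
    have "ctgt P u = csrc z" if "is_cell P (Suc a) z" "btgt P a u = bsrc a z" for z
    proof -
      have "cdim (csrc z) = a" using is_cell_csrc[OF P that(1)] is_cell_dim(1) by blast
      moreover have "cdim (ctgt P u) = a" using globularD(1)[OF P g(1) _ u(1)] True x(2) is_cell_dim(1) by auto
      ultimately show ?thesis
        using that bound_step(1)[OF P g(1), of a u a] bound_step(2)[OF P g(1), of a z a] u(1) True x(2) by auto
    qed
    from this[of x] this[of y] have "ctgt P u = csrc x" "ctgt P u = csrc y" using ux u(3) True by simp_all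
    then show ?thesis using ctgt_lcomp_equal[OF P] u(1) ux x(1) True by (auto simp: parallel_def)
  next
    case False
    obtain k' where k: "k = Suc k'" using u(2) not0_implies_Suc[of k] by auto
    then show ?thesis using ctgt_lcomp_less[where k = k' and v = x and u = u, OF P] ctgt_lcomp_less[where k = k' and v = y and u = u, OF P] ux d False u(2) g(3) x
      by (auto simp: parallel_def)
  qed
  ultimately show ?thesis using c by (simp add: parallel_def)
qed

lemma parallel_rcomp:
  assumes g: "globular P m" "comp_closed m" "m \<le> n" and x: "parallel k x y" "k \<le> m"
    and u: "is_cell P (Suc a) u" "Suc a \<le> k" "btgt P a x = bsrc a u"
  shows "parallel k (rcomp x u) (rcomp y u)"
proof -
  have ux: "is_cell P k x" "is_cell P k y" "btgt P a y = bsrc a u"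
    using x(1) parallel_bound(2)[OF g(1) x(2,1)] u by (auto simp: parallel_def)
  have d: "cdim x = k" "cdim y = k" "cdim u = Suc a" "well_dim u" using ux u is_cell_dim by auto
  have c: "is_cell P k (rcomp x u)" "is_cell P k (rcomp y u)"
    using closedD(2)[OF g(2) u(1) _ x(2) ux(1) u(3)] closedD(2)[OF g(2) u(1) _ x(2) ux(2,3)] u(2) by simp_all
  have "csrc (rcomp x u) = csrc (rcomp y u)"
    using csrc_rcomp[where u = u and v = x, OF P] csrc_rcomp[where u = u and v = y, OF P] d u(2) x(1) by (auto simp: parallel_def)
  moreover have "ctgt P (rcomp x u) = ctgt P (rcomp y u)"
  proof (cases "k = Suc a")
    case True
    have "ctgt P z = csrc u" if "is_cell P (Suc a) z" "btgt P a z = bsrc a u" for z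
    proof -
      have "cdim (csrc u) = a" using is_cell_csrc[OF P u(1)] is_cell_dim(1) by blast
      moreover have "cdim (ctgt P z) = a" using globularD(1)[OF P g(1) _ that(1)] True x(2) is_cell_dim(1) by auto
      ultimately show ?thesis
        using that bound_step(1)[OF P g(1), of a z a] bound_step(2)[OF P g(1), of a u a] u(1) True x(2) by auto
    qed
    from this[of x] this[of y] have "ctgt P x = csrc u" "ctgt P y = csrc u" using ux u(3) True by simp_all
    then show ?thesis using ctgt_lcomp_equal[where k = a and u = x and v = u, OF P] ctgt_lcomp_equal[where k = a and u = y and v = u, OF P] u(1) ux x(1) True d
        lcomp_eq_rcomp[of x u] lcomp_eq_rcomp[of y u] by (auto simp: parallel_def)
  next
    case False
    obtain k' where k: "k = Suc k'" using u(2) not0_implies_Suc[of k] by auto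
    then show ?thesis using ctgt_rcomp_less[where k = k' and v = x and u = u, OF P] ctgt_rcomp_less[where k = k' and v = y and u = u, OF P] ux d False u(2) g(3) x
      by (auto simp: parallel_def)
  qed
  ultimately show ?thesis using c by (simp add: parallel_def)
qed

lemma plug_parallel:
  assumes g: "globular P m" "comp_closed m" "m \<le> n"
  shows "is_context P j x c \<Longrightarrow> k \<le> m \<Longrightarrow> parallel k x y \<Longrightarrow> j + length c \<le> k \<Longrightarrow>
    parallel k (plug x c) (plug y c)"
proof (induction c arbitrary: j x y)
  case Nil then show ?case by simp
next
  case (Cons p c)
  obtain l r where p: "p = (l, r)" by fastforce
  have lr: "is_cell P (Suc j) l" "is_cell P (Suc j) r" "btgt P j l = bsrc j x" "btgt P j x = bsrc j r"
    "is_context P (Suc j) (ccomp (ccomp l x) r) c"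
    using Cons.prems(1) unfolding p by (auto elim: is_context.cases)
  have jk: "Suc j \<le> k" using Cons.prems by simp
  have x: "is_cell P k x" "is_cell P k y" using Cons.prems by (auto simp: parallel_def)
  have y: "btgt P j l = bsrc j y" "btgt P j y = bsrc j r"
    using lr parallel_bound[OF g(1) Cons.prems(2,3), of j] jk by auto
  have "parallel k (lcomp l x) (lcomp l y)"
    using parallel_lcomp[OF g Cons.prems(3,2) lr(1) jk lr(3)] .
  moreover have "btgt P j (lcomp l x) = bsrc j r"
    using lcomp_bound[OF P g(1,3) lr(1) _ Cons.prems(2) x(1) lr(3), of j] jk lr by auto
  ultimately have "parallel k (rcomp (lcomp l x) r) (rcomp (lcomp l y) r)"
    using parallel_rcomp[OF g _ Cons.prems(2) lr(2) jk] by blast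
  then have "parallel k (ccomp (ccomp l x) r) (ccomp (ccomp l y) r)"
    using ctx_step(10)[OF g x(1) Cons.prems(2) jk lr(1-4)] ctx_step(10)[OF g x(2) Cons.prems(2) jk lr(1,2) y] by simp
  then show ?case using Cons.IH[OF lr(5) Cons.prems(2)] Cons.prems(4) by (simp add: p)
qed

lemma parallel_refl: "is_cell P k x \<Longrightarrow> parallel k x x"
  by (simp add: parallel_def)

lemma plug_bsrc:
  assumes g: "globular P m" "comp_closed m" "m \<le> n"
  shows "is_context P j x c \<Longrightarrow> k \<le> m \<Longrightarrow> is_cell P k x \<Longrightarrow> j + length c \<le> k \<Longrightarrow> i < j \<Longrightarrow>
    bsrc i (plug x c) = bsrc i x \<and> btgt P i (plug x c) = btgt P i x"
proof (induction c arbitrary: j x)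
  case Nil then show ?case by simp
next
  case (Cons p c)
  obtain l r where p: "p = (l, r)" by fastforce
  have lr: "is_cell P (Suc j) l" "is_cell P (Suc j) r" "btgt P j l = bsrc j x" "btgt P j x = bsrc j r"
    "is_context P (Suc j) (ccomp (ccomp l x) r) c"
    using Cons.prems(1) unfolding p by (auto elim: is_context.cases)
  have jk: "Suc j \<le> k" using Cons.prems by simp
  note s = ctx_step[OF g Cons.prems(3,2) jk lr(1-4)]
  show ?case using Cons.IH[OF lr(5) Cons.prems(2) s(1)] Cons.prems s(4,5)[of i] by (simp add: p)
qed

lemma wsrc_parallel_wtgt:
  assumes g: "globular P m" "comp_closed m" "m < n" and w: "is_whisker P m w"
  shows "parallel m (wsrc P w) (wtgt P w)"
proof -
  have A: "fst w \<in> gens P (Suc m)" "length (snd w) = m" "is_context P 0 (gsrc P (Suc m) (fst w)) (snd w)"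
    using w unfolding is_whisker_def by auto
  have "parallel m (gsrc P (Suc m) (fst w)) (gtgt P (Suc m) (fst w))"
    using gen_boundary[OF P A(1) g(3)] by (auto simp: parallel_def)
  then show ?thesis using plug_parallel[OF g(1,2) _ A(3), of m] A(2) g(3) by (simp add: wsrc_def wtgt_def)
qed

lemma wchain_parallel:
  assumes g: "globular P m" "comp_closed m" "m < n"
  shows "is_cell P m s \<Longrightarrow> \<forall>w \<in> set ws. is_whisker P m w \<Longrightarrow> wchain P s ws \<Longrightarrow>
    parallel m s (ctgt P (Cell s ws)) \<and> (\<forall>w \<in> set ws. parallel m s (wsrc P w))"
proof (induction ws arbitrary: s)
  case Nil then show ?case by (simp add: parallel_refl)
next
  case (Cons w ws)
  have p: "parallel m (wsrc P w) (wtgt P w)" using wsrc_parallel_wtgt[OF g, of w] Cons.prems by auto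
  have c: "is_cell P m (wtgt P w)" "wchain P (wtgt P w) ws" "s = wsrc P w" "\<forall>w \<in> set ws. is_whisker P m w"
    using p Cons.prems by (simp_all add: parallel_def)
  have i: "parallel m (wtgt P w) (ctgt P (Cell (wtgt P w) ws)) \<and> (\<forall>w' \<in> set ws. parallel m (wtgt P w) (wsrc P w'))"
    by (rule Cons.IH[OF c(1,4,2)])
  have t: "parallel m s z" if "parallel m (wtgt P w) z" for z
    using that p c(3) by (simp add: parallel_def)
  have e: "ctgt P (Cell s (w # ws)) = ctgt P (Cell (wtgt P w) ws)" by simp
  have s: "parallel m s (wsrc P w)" using Cons.prems(1) c(3) by (simp add: parallel_def)
  show ?case unfolding e using i t s by simp
qed

lemma globular_Suc:
  assumes g: "globular P m" "comp_closed m" "m < n"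
  shows "globular P (Suc m)"
  unfolding globular_def[OF P]
proof (intro allI impI, goal_cases)
  case (1 k u)
  show ?case
  proof (cases "k = m")
    case False
    then have "k < m" using 1(1) by simp
    then show ?thesis using globularD[OF P g(1) _ 1(2)] by blast
  next
    case True
    obtain s ws where u: "u = Cell s ws" "is_cell P m s" "\<forall>w \<in> set ws. is_whisker P m w" "wchain P s ws"
      using 1(2) unfolding True is_cell_Suc_iff by blast
    show ?thesis using wchain_parallel[OF g u(2-4)] u(1) True by (auto simp: parallel_def)
  qed
qed

lemma context_lact_above:
  assumes g: "globular P m" "comp_closed m" "m \<le> n" and u: "is_cell P (Suc a) u"
  shows "is_context P j x c \<Longrightarrow> k \<le> m \<Longrightarrow> is_cell P k x \<Longrightarrow> j + length c \<le> k \<Longrightarrow> a < j \<Longrightarrow>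
    btgt P a u = bsrc a x \<Longrightarrow> is_context P j (lcomp u x) (map (lact u) c)"
proof (induction c arbitrary: j x)
  case Nil then show ?case by (simp add: is_cell_is_context.Nil)
next
  case (Cons p c)
  obtain l r where p: "p = (l, r)" by fastforce
  have lr: "is_cell P (Suc j) l" "is_cell P (Suc j) r" "btgt P j l = bsrc j x" "btgt P j x = bsrc j r"
    "is_context P (Suc j) (ccomp (ccomp l x) r) c"
    using Cons.prems(1) unfolding p by (auto elim: is_context.cases)
  have jk: "Suc j \<le> k" and jm: "Suc j \<le> m" using Cons.prems by simp_all
  note s = ctx_step[OF g Cons.prems(3,2) jk lr(1-4)]
  have al: "btgt P a u = bsrc a l" "btgt P a u = bsrc a r" using s(6,7)[of a] Cons.prems by auto
  have cl: "is_cell P (Suc j) (lcomp u l)" "is_cell P (Suc j) (lcomp u r)"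
    using closedD(1)[OF g(2) u _ jm] lr al Cons.prems(5) by simp_all
  have d: "cdim x = k" "well_dim x" "cdim l = Suc j" "well_dim l" "cdim r = Suc j" "well_dim r" "cdim u = Suc a" "well_dim u"
    using Cons.prems lr u is_cell_dim by auto
  have aj: "a < Suc j" and ak: "a < k" using Cons.prems by auto
  note bl = lcomp_bound[OF P g(1,3) u aj jm lr(1) al(1), of j] and br = lcomp_bound[OF P g(1,3) u aj jm lr(2) al(2), of j]
    and bx = lcomp_bound[OF P g(1,3) u ak Cons.prems(2,3,6), of j]
  have "btgt P j (lcomp u l) = bsrc j (lcomp u x)" "btgt P j (lcomp u x) = bsrc j (lcomp u r)"
    using bl br bx Cons.prems(5) lr by auto
  moreover have "ccomp (ccomp (lcomp u l) (lcomp u x)) (lcomp u r) = lcomp u (ccomp (ccomp l x) r)"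
    using d jk Cons.prems(5)
    by (subst (1 2) well_dim_plug_step(1))
      (auto simp: well_dim_lcomp well_dim_rcomp lcomp_rcomp_less lcomp_lcomp_less)
  moreover have "is_context P (Suc j) (lcomp u (ccomp (ccomp l x) r)) (map (lact u) c)"
    using Cons.IH[OF lr(5) Cons.prems(2) s(1)] Cons.prems s(4)[of a] by auto
  moreover have "lact u (l, r) = (lcomp u l, lcomp u r)" using d Cons.prems(5) by (simp add: lact_simps)
  ultimately show ?case using cl by (auto simp: p intro: is_cell_is_context.Cons)
qed

lemma context_ract_above:
  assumes g: "globular P m" "comp_closed m" "m \<le> n" and u: "is_cell P (Suc a) u"
  shows "is_context P j x c \<Longrightarrow> k \<le> m \<Longrightarrow> is_cell P k x \<Longrightarrow> j + length c \<le> k \<Longrightarrow> a < j \<Longrightarrow>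
    btgt P a x = bsrc a u \<Longrightarrow> is_context P j (rcomp x u) (map (ract u) c)"
proof (induction c arbitrary: j x)
  case Nil then show ?case by (simp add: is_cell_is_context.Nil)
next
  case (Cons p c)
  obtain l r where p: "p = (l, r)" by fastforce
  have lr: "is_cell P (Suc j) l" "is_cell P (Suc j) r" "btgt P j l = bsrc j x" "btgt P j x = bsrc j r"
    "is_context P (Suc j) (ccomp (ccomp l x) r) c"
    using Cons.prems(1) unfolding p by (auto elim: is_context.cases)
  have jk: "Suc j \<le> k" and jm: "Suc j \<le> m" using Cons.prems by simp_all
  note s = ctx_step[OF g Cons.prems(3,2) jk lr(1-4)]
  have al: "btgt P a l = bsrc a u" "btgt P a r = bsrc a u" using s(8,9)[of a] Cons.prems by auto
  have cl: "is_cell P (Suc j) (rcomp l u)" "is_cell P (Suc j) (rcomp r u)"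
    using closedD(2)[OF g(2) u _ jm] lr al Cons.prems(5) by simp_all
  have d: "cdim x = k" "well_dim x" "cdim l = Suc j" "well_dim l" "cdim r = Suc j" "well_dim r" "cdim u = Suc a" "well_dim u"
    using Cons.prems lr u is_cell_dim by auto
  have aj: "a < Suc j" and ak: "a < k" using Cons.prems by auto
  note bl = rcomp_bound[OF P g(1,3) u aj jm lr(1) al(1), of j] and br = rcomp_bound[OF P g(1,3) u aj jm lr(2) al(2), of j]
    and bx = rcomp_bound[OF P g(1,3) u ak Cons.prems(2,3,6), of j]
  have "btgt P j (rcomp l u) = bsrc j (rcomp x u)" "btgt P j (rcomp x u) = bsrc j (rcomp r u)"
    using bl br bx Cons.prems(5) lr by auto
  moreover have "ccomp (ccomp (rcomp l u) (rcomp x u)) (rcomp r u) = rcomp (ccomp (ccomp l x) r) u"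
    using d jk Cons.prems(5)
    by (subst (1 2) well_dim_plug_step(1))
      (auto simp: well_dim_lcomp well_dim_rcomp rcomp_rcomp_less rcomp_lcomp_less)
  moreover have "is_context P (Suc j) (rcomp (ccomp (ccomp l x) r) u) (map (ract u) c)"
    using Cons.IH[OF lr(5) Cons.prems(2) s(1)] Cons.prems s(5)[of a] by auto
  moreover have "ract u (l, r) = (rcomp l u, rcomp r u)" using d Cons.prems(5) by (simp add: ract_simps)
  ultimately show ?case using cl by (auto simp: p intro: is_cell_is_context.Cons)
qed

lemma context_lact:
  assumes g: "globular P m" "comp_closed m" "m \<le> n" and u: "is_cell P (Suc a) u"
  shows "is_context P j x c \<Longrightarrow> k \<le> m \<Longrightarrow> is_cell P k x \<Longrightarrow> j + length c \<le> k \<Longrightarrow> j \<le> a \<Longrightarrow>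
    a < j + length c \<Longrightarrow> btgt P a u = bsrc a (plug x c) \<Longrightarrow> is_context P j x (map (lact u) c)"
proof (induction c arbitrary: j x)
  case Nil then show ?case by simp
next
  case (Cons p c)
  obtain l r where p: "p = (l, r)" by fastforce
  have lr: "is_cell P (Suc j) l" "is_cell P (Suc j) r" "btgt P j l = bsrc j x" "btgt P j x = bsrc j r"
    "is_context P (Suc j) (ccomp (ccomp l x) r) c"
    using Cons.prems(1) unfolding p by (auto elim: is_context.cases)
  have jk: "Suc j \<le> k" and jm: "Suc j \<le> m" using Cons.prems by simp_all
  note s = ctx_step[OF g Cons.prems(3,2) jk lr(1-4)]
  have d: "cdim x = k" "well_dim x" "cdim l = Suc j" "well_dim l" "cdim r = Suc j" "well_dim r" "cdim u = Suc a" "well_dim u"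
    using Cons.prems lr u is_cell_dim by auto
  show ?case
  proof (cases "a = j")
    case True
    have bx: "btgt P a u = bsrc j (ccomp (ccomp l x) r)"
      using plug_bsrc[OF g lr(5) Cons.prems(2) s(1), of j] Cons.prems(4,7) True by (simp add: p)
    then have al: "btgt P a u = bsrc j l" using s(2) by simp
    have cl: "is_cell P (Suc j) (lcomp u l)" using closedD(1)[OF g(2) u _ jm lr(1)] al True by simp
    have "btgt P j (lcomp u l) = bsrc j x"
      using lcomp_bound[OF P g(1,3) u, of "Suc j" l j] True jm lr al by auto
    moreover have "ccomp (ccomp (lcomp u l) x) r = lcomp u (ccomp (ccomp l x) r)"
      using d jk True
      by (subst (1 2) well_dim_plug_step(1))
        (auto simp: well_dim_lcomp well_dim_rcomp lcomp_lcomp_equal[symmetric] rcomp_lcomp_equal)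
    moreover have "is_context P (Suc j) (lcomp u (ccomp (ccomp l x) r)) (map (lact u) c)"
      using context_lact_above[OF g u lr(5) Cons.prems(2) s(1)] Cons.prems(4) True bx by auto
    moreover have "lact u (l, r) = (lcomp u l, r)" using d True by (simp add: lact_simps)
    ultimately show ?thesis using cl lr by (auto simp: p intro: is_cell_is_context.Cons)
  next
    case False
    then have "is_context P (Suc j) (ccomp (ccomp l x) r) (map (lact u) c)"
      using Cons.IH[OF lr(5) Cons.prems(2) s(1)] Cons.prems by (auto simp: p)
    moreover have "lact u (l, r) = (l, r)" using d False Cons.prems by (simp add: lact_simps)
    ultimately show ?thesis using lr by (auto simp: p intro: is_cell_is_context.Cons)
  qed
qed

lemma context_ract:
  assumes g: "globular P m" "comp_closed m" "m \<le> n" and u: "is_cell P (Suc a) u"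
  shows "is_context P j x c \<Longrightarrow> k \<le> m \<Longrightarrow> is_cell P k x \<Longrightarrow> j + length c \<le> k \<Longrightarrow> j \<le> a \<Longrightarrow>
    a < j + length c \<Longrightarrow> btgt P a (plug x c) = bsrc a u \<Longrightarrow> is_context P j x (map (ract u) c)"
proof (induction c arbitrary: j x)
  case Nil then show ?case by simp
next
  case (Cons p c)
  obtain l r where p: "p = (l, r)" by fastforce
  have lr: "is_cell P (Suc j) l" "is_cell P (Suc j) r" "btgt P j l = bsrc j x" "btgt P j x = bsrc j r"
    "is_context P (Suc j) (ccomp (ccomp l x) r) c"
    using Cons.prems(1) unfolding p by (auto elim: is_context.cases)
  have jk: "Suc j \<le> k" and jm: "Suc j \<le> m" using Cons.prems by simp_all
  note s = ctx_step[OF g Cons.prems(3,2) jk lr(1-4)]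
  have d: "cdim x = k" "well_dim x" "cdim l = Suc j" "well_dim l" "cdim r = Suc j" "well_dim r" "cdim u = Suc a" "well_dim u"
    using Cons.prems lr u is_cell_dim by auto
  show ?case
  proof (cases "a = j")
    case True
    have bx: "btgt P j (ccomp (ccomp l x) r) = bsrc a u"
      using plug_bsrc[OF g lr(5) Cons.prems(2) s(1), of j] Cons.prems(4,7) True by (simp add: p)
    then have al: "btgt P j r = bsrc a u" using s(3) by simp
    have cl: "is_cell P (Suc j) (rcomp r u)" using closedD(2)[OF g(2) u _ jm lr(2)] al True by simp
    have "btgt P j x = bsrc j (rcomp r u)"
      using rcomp_bound[OF P g(1,3) u, of "Suc j" r j] True jm lr al by auto
    moreover have "ccomp (ccomp l x) (rcomp r u) = rcomp (ccomp (ccomp l x) r) u"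
      using d jk True
      by (subst (1 2) well_dim_plug_step(1))
        (auto simp: well_dim_lcomp well_dim_rcomp rcomp_rcomp_equal[symmetric])
    moreover have "is_context P (Suc j) (rcomp (ccomp (ccomp l x) r) u) (map (ract u) c)"
      using context_ract_above[OF g u lr(5) Cons.prems(2) s(1)] Cons.prems(4) True bx by auto
    moreover have "ract u (l, r) = (l, rcomp r u)" using d True by (simp add: ract_simps)
    ultimately show ?thesis using cl lr by (auto simp: p intro: is_cell_is_context.Cons)
  next
    case False
    then have "is_context P (Suc j) (ccomp (ccomp l x) r) (map (ract u) c)"
      using Cons.IH[OF lr(5) Cons.prems(2) s(1)] Cons.prems by (auto simp: p)
    moreover have "ract u (l, r) = (l, r)" using d False Cons.prems by (simp add: ract_simps)
    ultimately show ?thesis using lr by (auto simp: p intro: is_cell_is_context.Cons)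
  qed
qed

lemma whisker_lact:
  assumes g: "globular P m" "comp_closed m" "m < n" and u: "is_cell P (Suc a) u" "a < m"
    and w: "is_whisker P m w" "btgt P a u = bsrc a (wsrc P w)"
  shows "is_whisker P m (lwact u w)"
proof -
  have A: "fst w \<in> gens P (Suc m)" "length (snd w) = m" "is_context P 0 (gsrc P (Suc m) (fst w)) (snd w)"
    using w unfolding is_whisker_def by auto
  have "is_context P 0 (gsrc P (Suc m) (fst w)) (map (lact u) (snd w))"
    using context_lact[OF g(1,2) _ u(1) A(3), of m] gen_boundary(1)[OF P A(1) g(3)] A(2) g(3) u(2) w(2)
    by (simp add: wsrc_def)
  then show ?thesis using A by (simp add: is_whisker_def lwact_def)
qed

lemma whisker_ract:
  assumes g: "globular P m" "comp_closed m" "m < n" and u: "is_cell P (Suc a) u" "a < m"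
    and w: "is_whisker P m w" "btgt P a (wsrc P w) = bsrc a u"
  shows "is_whisker P m (rwact u w)"
proof -
  have A: "fst w \<in> gens P (Suc m)" "length (snd w) = m" "is_context P 0 (gsrc P (Suc m) (fst w)) (snd w)"
    using w unfolding is_whisker_def by auto
  have "is_context P 0 (gsrc P (Suc m) (fst w)) (map (ract u) (snd w))"
    using context_ract[OF g(1,2) _ u(1) A(3), of m] gen_boundary(1)[OF P A(1) g(3)] A(2) g(3) u(2) w(2)
    by (simp add: wsrc_def)
  then show ?thesis using A by (simp add: is_whisker_def rwact_def)
qed

lemma wchain_map:
  assumes "\<And>w. w \<in> set ws \<Longrightarrow> wsrc P (f w) = h (wsrc P w) \<and> wtgt P (f w) = h (wtgt P w)"
  shows "wchain P s ws \<Longrightarrow> wchain P (h s) (map f ws)"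
  using assms by (induction ws arbitrary: s) auto

lemma is_cell_append:
  assumes g: "globular P (Suc m)" and u: "is_cell P (Suc m) u" and v: "is_cell P (Suc m) v" and uv: "btgt P m u = bsrc m v"
  shows "is_cell P (Suc m) (lcomp u v)"
proof -
  obtain s ws where u': "u = Cell s ws" "is_cell P m s" "\<forall>w \<in> set ws. is_whisker P m w" "wchain P s ws"
    using u unfolding is_cell_Suc_iff by blast
  obtain t vs where v': "v = Cell t vs" "is_cell P m t" "\<forall>w \<in> set vs. is_whisker P m w" "wchain P t vs"
    using v unfolding is_cell_Suc_iff by blast
  have d: "cdim s = m" "cdim t = m" "cdim (ctgt P u) = m"
    using u' v' globularD(1)[OF P g _ u] is_cell_dim by blast+
  have "ctgt P u = t"
    using uv bound_step(1)[OF P g _ u, of m] bound_step(2)[OF P g _ v, of m] d v'(1) by simp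
  then show ?thesis using u' v' d by (auto simp: wchain_append)
qed

lemma closed_Suc:
  assumes g: "globular P m" "comp_closed m" "m < n"
  shows "comp_closed (Suc m)"
  unfolding comp_closed_def
proof (intro allI impI, elim conjE, goal_cases)
  case (1 a b u v)
  note gs = globular_Suc[OF g]
  show ?case
  proof (cases "b = Suc m")
    case False then show ?thesis using 1 g(2) unfolding comp_closed_def by auto
  next
    case b: True
    show ?thesis
    proof (cases "a = m")
      case True
      have "lcomp v u = rcomp v u"
        using is_cell_dim(1)[OF 1(3)] is_cell_dim(1)[OF 1(4)] b True by (intro lcomp_eq_rcomp) auto
      then show ?thesis using is_cell_append[OF gs, of u v] is_cell_append[OF gs, of v u] 1 b True by auto
    next
      case False
      then have am: "a < m" using 1 b by simp
      obtain s ws where v: "v = Cell s ws" "is_cell P m s" "\<forall>w \<in> set ws. is_whisker P m w" "wchain P s ws"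
        using 1(4) unfolding b is_cell_Suc_iff by blast
      have d: "cdim u = Suc a" "well_dim u" "cdim s = m" using 1 v is_cell_dim by auto
      have mn: "m < Suc m" by simp
      have sm: "is_cell P (Suc m) v" using 1 b by simp
      have bs: "bsrc a v = bsrc a s" "btgt P a v = btgt P a s"
        using bound_step(2,3)[OF P gs mn sm, of a] am v(1) by auto
      have par: "\<forall>w \<in> set ws. parallel m s (wsrc P w)" using wchain_parallel[OF g v(2-4)] by blast
      have "is_cell P b (lcomp u v)" if "btgt P a u = bsrc a v"
      proof -
        have "is_cell P m (lcomp u s)" using closedD(1)[OF g(2) 1(3) am _ v(2)] that bs by simp
        moreover have "\<forall>w \<in> set ws. is_whisker P m (lwact u w)"
          using whisker_lact[OF g 1(3) am] v(3) par parallel_bound(1)[OF g(1) _ _ am] that bs by auto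
        moreover have "wchain P (lcomp u s) (map (lwact u) ws)"
          using wsrc_lwact[OF P _ g(3) d(2)] d(1) am v by (intro wchain_map) auto
        ultimately show ?thesis using v b d am by auto
      qed
      moreover have "is_cell P b (rcomp v u)" if "btgt P a v = bsrc a u"
      proof -
        have "is_cell P m (rcomp s u)" using closedD(2)[OF g(2) 1(3) am _ v(2)] that bs by simp
        moreover have "\<forall>w \<in> set ws. is_whisker P m (rwact u w)"
          using whisker_ract[OF g 1(3) am] v(3) par parallel_bound(2)[OF g(1) _ _ am] that bs by auto
        moreover have "wchain P (rcomp s u) (map (rwact u) ws)"
          using wsrc_rwact[OF P _ g(3) d(2)] d(1) am v by (intro wchain_map[where h = "\<lambda>x. rcomp x u"]) auto
        ultimately show ?thesis using v b d am by auto
      qed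
      ultimately show ?thesis by blast
    qed
  qed
qed

lemma globular_closed: "m \<le> n \<Longrightarrow> globular P m \<and> comp_closed m"
proof (induction m)
  case 0 then show ?case by (auto simp: globular_def[OF P] comp_closed_def)
next
  case (Suc m) then show ?case using globular_Suc closed_Suc by auto
qed

end

lemma idc_cell [simp]: "is_cell P (Suc i) (idc w) \<longleftrightarrow> is_cell P i w"
  by (simp add: idc_def)

lemma dim_idc [simp]: "cdim (idc w) = Suc (cdim w)"
  by (simp add: idc_def)

context
  fixes P :: "('g, 'z) prepolygraph_scheme" and n :: nat
  assumes P: "prepolygraph n P"
begin

lemma glob: "m \<le> n \<Longrightarrow> globular P m" and clos: "m \<le> n \<Longrightarrow> comp_closed P m"
  using globular_closed[OF P] by auto

lemma context_idc_left_above: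
  assumes k: "k \<le> n" and IH: "\<And>l v. l \<le> k \<Longrightarrow> i < l \<Longrightarrow> is_cell P l v \<Longrightarrow> lcomp (idc (bsrc i v)) v = v"
  shows "is_context P j x c \<Longrightarrow> is_cell P k x \<Longrightarrow> j + length c \<le> k \<Longrightarrow> i < j \<Longrightarrow> w = bsrc i x \<Longrightarrow>
    map (lact (idc w)) c = c"
proof (induction c arbitrary: j x)
  case Nil then show ?case by simp
next
  case (Cons p c)
  obtain l r where p: "p = (l, r)" by fastforce
  have lr: "is_cell P (Suc j) l" "is_cell P (Suc j) r" "btgt P j l = bsrc j x" "btgt P j x = bsrc j r"
    "is_context P (Suc j) (ccomp (ccomp l x) r) c"
    using Cons.prems(1) unfolding p by (auto elim: is_context.cases)
  have jk: "Suc j \<le> k" using Cons.prems by simp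
  note s = ctx_step[OF P glob[OF k] clos[OF k] k Cons.prems(2) _ jk lr(1-4)]
  have w: "cdim w = i"
    using bound_cell[OF P glob[OF k] _ Cons.prems(2), of i] Cons.prems(4,5) jk is_cell_dim(1) by force
  have "lcomp (idc w) l = l" "lcomp (idc w) r = r"
    using IH[OF jk _ lr(1)] IH[OF jk _ lr(2)] s(6,7)[of i] Cons.prems(4,5) by auto
  then have "lact (idc w) (l, r) = (l, r)" by (simp add: lact_def)
  moreover have "map (lact (idc w)) c = c"
    using Cons.IH[OF lr(5)] s(1,4) Cons.prems(3,4,5) by auto
  ultimately show ?case by (simp add: p)
qed

lemma context_idc_left:
  assumes k: "k \<le> n" and IH: "\<And>l v. l \<le> k \<Longrightarrow> i < l \<Longrightarrow> is_cell P l v \<Longrightarrow> lcomp (idc (bsrc i v)) v = v"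
  shows "is_context P j x c \<Longrightarrow> is_cell P k x \<Longrightarrow> j + length c \<le> k \<Longrightarrow> j \<le> i \<Longrightarrow>
    w = bsrc i (plug x c) \<Longrightarrow> cdim w = i \<Longrightarrow> map (lact (idc w)) c = c"
proof (induction c arbitrary: j x)
  case Nil then show ?case by simp
next
  case (Cons p c)
  obtain l r where p: "p = (l, r)" by fastforce
  have lr: "is_cell P (Suc j) l" "is_cell P (Suc j) r" "btgt P j l = bsrc j x" "btgt P j x = bsrc j r"
    "is_context P (Suc j) (ccomp (ccomp l x) r) c"
    using Cons.prems(1) unfolding p by (auto elim: is_context.cases)
  have jk: "Suc j \<le> k" using Cons.prems by simp
  note s = ctx_step[OF P glob[OF k] clos[OF k] k Cons.prems(2) _ jk lr(1-4)]
  have d: "cdim l = Suc j" using lr(1) is_cell_dim(1) by blast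
  show ?case
  proof (cases "i = j")
    case True
    have w: "w = bsrc i (ccomp (ccomp l x) r)"
      using plug_bsrc[OF P glob[OF k] clos[OF k] k lr(5) _ s(1), of j] Cons.prems True by (simp add: p)
    then have "w = bsrc i l" using s(2) True by simp
    then have "lact (idc w) (l, r) = (l, r)" using IH[OF jk _ lr(1)] True d Cons.prems(6) by (simp add: lact_def)
    moreover have "map (lact (idc w)) c = c"
      using context_idc_left_above[OF k IH lr(5) s(1) _ _ w] Cons.prems True by auto
    ultimately show ?thesis by (simp add: p)
  next
    case False
    then have "lact (idc w) (l, r) = (l, r)" using d Cons.prems by (simp add: lact_def)
    then show ?thesis using Cons.IH[OF lr(5) s(1)] Cons.prems False by (simp add: p)
  qed
qed

lemma lcomp_idc: "l \<le> n \<Longrightarrow> i < l \<Longrightarrow> is_cell P l v \<Longrightarrow> lcomp (idc (bsrc i v)) v = v"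
proof (induction l arbitrary: v rule: less_induct)
  case (less l)
  obtain k where l: "l = Suc k" using less.prems(2) not0_implies_Suc[of l] by auto
  obtain s ws where v: "v = Cell s ws" "is_cell P k s" "\<forall>w \<in> set ws. is_whisker P k w" "wchain P s ws"
    using less.prems(3) unfolding l is_cell_Suc_iff by blast
  have k: "k \<le> n" "k < n" using less.prems(1) l by auto
  have ds: "cdim s = k" using v is_cell_dim by blast
  have dw: "cdim (bsrc i v) = i"
    using bound_cell[OF P glob[OF less.prems(1)] _ less.prems(3), of i] less.prems(2) is_cell_dim(1) by auto
  have bs: "bsrc i v = bsrc i s"
    using bsrc_csrc[of i v] v(1) ds less.prems(2) l by simp
  show ?case
  proof (cases "i = k")
    case True
    then show ?thesis using v(1) ds bs by (simp add: idc_def)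
  next
    case False
    then have ik: "i < k" using less.prems l by simp
    have IH: "\<And>l v. l \<le> k \<Longrightarrow> i < l \<Longrightarrow> is_cell P l v \<Longrightarrow> lcomp (idc (bsrc i v)) v = v"
      using less.IH k l by (simp add: less_Suc_eq_le)
    have par: "\<forall>w \<in> set ws. parallel P k s (wsrc P w)"
      using wchain_parallel[OF P glob[OF k(1)] clos[OF k(1)] k(2) v(2-4)] by blast
    have "lwact (idc (bsrc i v)) w = w" if w: "w \<in> set ws" for w
    proof -
      have A: "fst w \<in> gens P (Suc k)" "length (snd w) = k" "is_context P 0 (gsrc P (Suc k) (fst w)) (snd w)"
        using w v(3) unfolding is_whisker_def by auto
      have "bsrc i v = bsrc i (wsrc P w)"
        using bs parallel_bound(1)[OF P glob[OF k(1)] _ _ ik] par w by auto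
      then have "map (lact (idc (bsrc i v))) (snd w) = snd w"
        using context_idc_left[OF k(1) IH A(3) gen_boundary(1)[OF P A(1) k(2)], where w = "bsrc i v"] A(2) dw
        by (simp add: wsrc_def)
      then show ?thesis by (simp add: lwact_def)
    qed
    then have "map (lwact (idc (bsrc i v))) ws = ws" by (simp add: map_idI)
    moreover have "lcomp (idc (bsrc i v)) s = s" using IH[OF _ ik v(2)] bs by simp
    ultimately show ?thesis using v(1) ds dw False by simp
  qed
qed

lemma context_idc_right_above:
  assumes k: "k \<le> n" and IH: "\<And>l v. l \<le> k \<Longrightarrow> i < l \<Longrightarrow> is_cell P l v \<Longrightarrow> rcomp v (idc (btgt P i v)) = v"
  shows "is_context P j x c \<Longrightarrow> is_cell P k x \<Longrightarrow> j + length c \<le> k \<Longrightarrow> i < j \<Longrightarrow> w = btgt P i x \<Longrightarrow>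
    map (ract (idc w)) c = c"
proof (induction c arbitrary: j x)
  case Nil then show ?case by simp
next
  case (Cons p c)
  obtain l r where p: "p = (l, r)" by fastforce
  have lr: "is_cell P (Suc j) l" "is_cell P (Suc j) r" "btgt P j l = bsrc j x" "btgt P j x = bsrc j r"
    "is_context P (Suc j) (ccomp (ccomp l x) r) c"
    using Cons.prems(1) unfolding p by (auto elim: is_context.cases)
  have jk: "Suc j \<le> k" using Cons.prems by simp
  note s = ctx_step[OF P glob[OF k] clos[OF k] k Cons.prems(2) _ jk lr(1-4)]
  have w: "cdim w = i"
    using bound_cell[OF P glob[OF k] _ Cons.prems(2), of i] Cons.prems(4,5) jk is_cell_dim(1) by force
  have "rcomp l (idc w) = l" "rcomp r (idc w) = r"
    using IH[OF jk _ lr(1)] IH[OF jk _ lr(2)] s(8,9)[of i] Cons.prems(4,5) by auto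
  then have "ract (idc w) (l, r) = (l, r)" by (simp add: ract_def)
  moreover have "map (ract (idc w)) c = c"
    using Cons.IH[OF lr(5)] s(1,5) Cons.prems(3,4,5) by auto
  ultimately show ?case by (simp add: p)
qed

lemma context_idc_right:
  assumes k: "k \<le> n" and IH: "\<And>l v. l \<le> k \<Longrightarrow> i < l \<Longrightarrow> is_cell P l v \<Longrightarrow> rcomp v (idc (btgt P i v)) = v"
  shows "is_context P j x c \<Longrightarrow> is_cell P k x \<Longrightarrow> j + length c \<le> k \<Longrightarrow> j \<le> i \<Longrightarrow>
    w = btgt P i (plug x c) \<Longrightarrow> cdim w = i \<Longrightarrow> map (ract (idc w)) c = c"
proof (induction c arbitrary: j x)
  case Nil then show ?case by simp
next
  case (Cons p c)
  obtain l r where p: "p = (l, r)" by fastforce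
  have lr: "is_cell P (Suc j) l" "is_cell P (Suc j) r" "btgt P j l = bsrc j x" "btgt P j x = bsrc j r"
    "is_context P (Suc j) (ccomp (ccomp l x) r) c"
    using Cons.prems(1) unfolding p by (auto elim: is_context.cases)
  have jk: "Suc j \<le> k" using Cons.prems by simp
  note s = ctx_step[OF P glob[OF k] clos[OF k] k Cons.prems(2) _ jk lr(1-4)]
  have d: "cdim l = Suc j" using lr(1) is_cell_dim(1) by blast
  show ?case
  proof (cases "i = j")
    case True
    have w: "w = btgt P i (ccomp (ccomp l x) r)"
      using plug_bsrc[OF P glob[OF k] clos[OF k] k lr(5) _ s(1), of j] Cons.prems True by (simp add: p)
    then have "w = btgt P i r" using s(3) True by simp
    then have "ract (idc w) (l, r) = (l, r)" using IH[OF jk _ lr(2)] True d Cons.prems(6) by (simp add: ract_def)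
    moreover have "map (ract (idc w)) c = c"
      using context_idc_right_above[OF k IH lr(5) s(1) _ _ w] Cons.prems True by auto
    ultimately show ?thesis by (simp add: p)
  next
    case False
    then have "ract (idc w) (l, r) = (l, r)" using d Cons.prems by (simp add: ract_def)
    then show ?thesis using Cons.IH[OF lr(5) s(1)] Cons.prems False by (simp add: p)
  qed
qed

lemma rcomp_idc: "l \<le> n \<Longrightarrow> i < l \<Longrightarrow> is_cell P l v \<Longrightarrow> rcomp v (idc (btgt P i v)) = v"
proof (induction l arbitrary: v rule: less_induct)
  case (less l)
  obtain k where l: "l = Suc k" using less.prems(2) not0_implies_Suc[of l] by auto
  obtain s ws where v: "v = Cell s ws" "is_cell P k s" "\<forall>w \<in> set ws. is_whisker P k w" "wchain P s ws"
    using less.prems(3) unfolding l is_cell_Suc_iff by blast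
  have k: "k \<le> n" "k < n" using less.prems(1) l by auto
  have ds: "cdim s = k" using v is_cell_dim by blast
  have dw: "cdim (btgt P i v) = i"
    using bound_cell[OF P glob[OF less.prems(1)] _ less.prems(3), of i] less.prems(2) is_cell_dim(1) by auto
  show ?case
  proof (cases "i = k")
    case True
    then show ?thesis using v(1) ds dw by (simp add: idc_def)
  next
    case False
    then have ik: "i < k" using less.prems l by simp
    have bs: "btgt P i v = btgt P i s"
      using bound_step(3)[OF P glob[OF less.prems(1)] _ less.prems(3)[unfolded l] ik] l v(1) by simp
    have IH: "\<And>l v. l \<le> k \<Longrightarrow> i < l \<Longrightarrow> is_cell P l v \<Longrightarrow> rcomp v (idc (btgt P i v)) = v"
      using less.IH k l by (simp add: less_Suc_eq_le)
    have par: "\<forall>w \<in> set ws. parallel P k s (wsrc P w)"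
      using wchain_parallel[OF P glob[OF k(1)] clos[OF k(1)] k(2) v(2-4)] by blast
    have "rwact (idc (btgt P i v)) w = w" if w: "w \<in> set ws" for w
    proof -
      have A: "fst w \<in> gens P (Suc k)" "length (snd w) = k" "is_context P 0 (gsrc P (Suc k) (fst w)) (snd w)"
        using w v(3) unfolding is_whisker_def by auto
      have "btgt P i v = btgt P i (wsrc P w)"
        using bs parallel_bound(2)[OF P glob[OF k(1)] _ _ ik] par w by auto
      then have "map (ract (idc (btgt P i v))) (snd w) = snd w"
        using context_idc_right[OF k(1) IH A(3) gen_boundary(1)[OF P A(1) k(2)], where w = "btgt P i v"] A(2) dw
        by (simp add: wsrc_def)
      then show ?thesis by (simp add: rwact_def)
    qed
    then have "map (rwact (idc (btgt P i v))) ws = ws" by (simp add: map_idI)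
    moreover have "rcomp s (idc (btgt P i v)) = s" using IH[OF _ ik v(2)] bs by simp
    ultimately show ?thesis using v(1) ds dw False by simp
  qed
qed

lemma free_precat_simps:
  "Cel (free_precat n P) k = (if k \<le> n then {u. is_cell P k u} else {})"
  "Src (free_precat n P) k = csrc" "Tgt (free_precat n P) k = ctgt P"
  "Idt (free_precat n P) k = idc" "Cmp (free_precat n P) k l = ccomp"
  by (simp_all add: free_precat_def)

lemma Srcs_free: "k \<le> n \<Longrightarrow> is_cell P k u \<Longrightarrow> Srcs (free_precat n P) i k u = bsrc i u"
proof (induction k arbitrary: u)
  case 0 then show ?case using is_cell_dim(1)[OF 0(2)] by simp
next
  case (Suc k)
  show ?case
  proof (cases "k < i")
    case True then show ?thesis using is_cell_dim(1)[OF Suc.prems(2)] by simp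
  next
    case False
    then show ?thesis using Suc bound_step(2)[OF P glob[OF Suc.prems(1)] _ Suc.prems(2), of i] is_cell_csrc[OF P]
      by (auto simp: free_precat_simps)
  qed
qed

lemma Tgts_free: "k \<le> n \<Longrightarrow> is_cell P k u \<Longrightarrow> Tgts (free_precat n P) i k u = btgt P i u"
proof (induction k arbitrary: u)
  case 0 then show ?case using is_cell_dim(1)[OF 0(2)] by simp
next
  case (Suc k)
  show ?case
  proof (cases "k < i")
    case True then show ?thesis using is_cell_dim(1)[OF Suc.prems(2)] by simp
  next
    case False
    then show ?thesis using Suc bound_step(1)[OF P glob[OF Suc.prems(1)] _ Suc.prems(2), of i]
        globularD(1)[OF P glob[OF Suc.prems(1)] _ Suc.prems(2)]
      by (auto simp: free_precat_simps)
  qed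
qed

lemma composable_free: "k \<le> n \<Longrightarrow> l \<le> n \<Longrightarrow> composable (free_precat n P) k l u v \<longleftrightarrow>
    0 < k \<and> 0 < l \<and> is_cell P k u \<and> is_cell P l v \<and> btgt P (min k l - 1) u = bsrc (min k l - 1) v"
  unfolding composable_def by (auto simp: free_precat_simps Srcs_free Tgts_free)

lemma composable_free_left: "i < l \<Longrightarrow> l \<le> n \<Longrightarrow> composable (free_precat n P) (Suc i) l u v \<longleftrightarrow>
    is_cell P (Suc i) u \<and> is_cell P l v \<and> btgt P i u = bsrc i v"
  by (subst composable_free) (auto simp: min_def)

lemma composable_free_right: "i < k \<Longrightarrow> k \<le> n \<Longrightarrow> composable (free_precat n P) k (Suc i) u v \<longleftrightarrow>
    is_cell P k u \<and> is_cell P (Suc i) v \<and> btgt P i u = bsrc i v"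
  by (subst composable_free) (auto simp: min_absorb2)

lemma Cmp_left: "is_cell P k u \<Longrightarrow> is_cell P l v \<Longrightarrow> k \<le> l \<Longrightarrow> Cmp (free_precat n P) k l u v = lcomp u v"
  using is_cell_dim(1)[of P k u] is_cell_dim(1)[of P l v] by (simp add: free_precat_simps ccomp_left)

lemma Cmp_right: "is_cell P k u \<Longrightarrow> is_cell P l v \<Longrightarrow> 0 < l \<Longrightarrow> l \<le> k \<Longrightarrow> Cmp (free_precat n P) k l u v = rcomp u v"
  using is_cell_dim(1)[of P k u] is_cell_dim(1)[of P l v] by (simp add: free_precat_simps ccomp_right)

theorem precategory_free_precat: "precategory n (free_precat n P)"
proof (unfold_locales, goal_cases)
  case (1 k u) then show ?case using is_cell_csrc[OF P] by (auto simp: free_precat_simps)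
next
  case (2 k u) then show ?case using globularD(1)[OF P glob[of n]] by (auto simp: free_precat_simps)
next
  case (3 k u) then show ?case using globularD(2)[OF P glob[of n]] by (auto simp: free_precat_simps)
next
  case (4 k u) then show ?case using globularD(3)[OF P glob[of n]] by (auto simp: free_precat_simps)
next
  case (5 k u) then show ?case by (auto simp: free_precat_simps)
next
  case (6 k u) then show ?case by (auto simp: free_precat_simps idc_def)
next
  case (7 k u) then show ?case by (auto simp: free_precat_simps idc_def)
next
  case (8 k l u v)
  then have c: "0 < k" "0 < l" "is_cell P k u" "is_cell P l v" "btgt P (min k l - 1) u = bsrc (min k l - 1) v"
    using composable_free by auto
  show ?case
  proof (cases "k \<le> l")
    case True
    obtain i where i: "k = Suc i" using c(1) not0_implies_Suc by blast
    have "is_cell P l (lcomp u v)"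
      using closedD(1)[OF P clos[of n] c(3)[unfolded i] _ _ c(4)] True 8(2) c(5) i by (simp add: min_def)
    then show ?thesis using Cmp_left[OF c(3,4) True] True 8 by (simp add: free_precat_simps max_def)
  next
    case False
    obtain i where i: "l = Suc i" using c(2) not0_implies_Suc by blast
    have "is_cell P k (rcomp u v)"
      using closedD(2)[OF P clos[of n] c(4)[unfolded i] _ _ c(3)] False 8(1) c(5) i by (simp add: min_def)
    then show ?thesis using Cmp_right[OF c(3,4,2)] False 8 by (simp add: free_precat_simps max_def)
  qed
next
  case (9 k l u v)
  obtain i where i: "k = Suc i" using 9(3) by (auto simp: composable_def dest: gr0_implies_Suc)
  have c: "is_cell P k u" "is_cell P (Suc l) v" using 9 i composable_free_left[of i "Suc l" u v] by auto
  have "is_cell P l (csrc v)" using is_cell_csrc[OF P c(2)] .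
  then show ?case using Cmp_left[OF c] Cmp_left[OF c(1)] 9(1) csrc_lcomp[where u = u and v = v, OF P] is_cell_dim(1)[OF c(1)] is_cell_dim(1)[OF c(2)] i
    by (auto simp: free_precat_simps)
next
  case (10 k l u v)
  obtain i where i: "k = Suc i" using 10(3) by (auto simp: composable_def dest: gr0_implies_Suc)
  have c: "is_cell P k u" "is_cell P (Suc l) v" using 10 i composable_free_left[of i "Suc l" u v] by auto
  have "is_cell P l (ctgt P v)" using globularD(1)[OF P glob[of n] 10(2) c(2)] by simp
  then show ?case using Cmp_left[OF c] Cmp_left[OF c(1)] 10(1,2) ctgt_lcomp_less[OF P c(2) 10(2)] is_cell_dim(1)[OF c(1)] i
    by (auto simp: free_precat_simps)
next
  case (11 l k u v)
  obtain i where i: "l = Suc i" using 11(3) by (auto simp: composable_def dest: gr0_implies_Suc)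
  have c: "is_cell P (Suc k) u" "is_cell P l v" using 11 i composable_free_right[of i "Suc k" u v] by auto
  have "is_cell P k (csrc u)" using is_cell_csrc[OF P c(1)] .
  then show ?case using Cmp_right[OF c] Cmp_right[OF _ c(2)] 11(1) csrc_rcomp[where u = v and v = u, OF P] is_cell_dim(1)[OF c(1)] is_cell_dim(1)[OF c(2)] i
    by (auto simp: free_precat_simps)
next
  case (12 l k u v)
  obtain i where i: "l = Suc i" using 12(3) by (auto simp: composable_def dest: gr0_implies_Suc)
  have c: "is_cell P (Suc k) u" "is_cell P l v" using 12 i composable_free_right[of i "Suc k" u v] by auto
  have "is_cell P k (ctgt P u)" using globularD(1)[OF P glob[of n] 12(2) c(1)] by simp
  then show ?case using Cmp_right[OF c] Cmp_right[OF _ c(2)] 12(1,2) ctgt_rcomp_less[OF P c(1) 12(2)] is_cell_dim(1)[OF c(2)] i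
    by (auto simp: free_precat_simps)
next
  case (13 k u v)
  then have c: "is_cell P (Suc k) u" "is_cell P (Suc k) v" using composable_free_left[of k "Suc k" u v] by auto
  then show ?case using Cmp_left[OF c] csrc_lcomp[where u = u and v = v, OF P] is_cell_dim(1)[OF c(1)] is_cell_dim(1)[OF c(2)]
    by (auto simp: free_precat_simps)
next
  case (14 k u v)
  then have c: "is_cell P (Suc k) u" "is_cell P (Suc k) v" "btgt P k u = bsrc k v"
    using composable_free_left[of k "Suc k" u v] by auto
  have kn: "Suc k \<le> n" using 14 by simp
  have "cdim (ctgt P u) = k" "cdim (csrc v) = k"
    using globularD(1)[OF P glob[OF kn] _ c(1)] is_cell_csrc[OF P c(2)] is_cell_dim(1) by auto
  then have "ctgt P u = csrc v"
    using c(3) bound_step(1)[OF P glob[OF kn] _ c(1), of k] bound_step(2)[OF P glob[OF kn] _ c(2), of k] by simp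
  then show ?case using Cmp_left[OF c(1,2)] ctgt_lcomp_equal[OF P c(1,2)] by (auto simp: free_precat_simps)
next
  case (15 i l w v)
  then have c: "is_cell P (Suc i) (idc w)" "is_cell P l v" "btgt P i (idc w) = bsrc i v"
    using composable_free_left[of i l] by (auto simp: free_precat_simps)
  have d: "cdim w = i" using c(1) is_cell_dim(1)[OF c(1)] by simp
  then have "btgt P i (idc w) = w" by (simp add: btgt_def idc_def)
  then show ?case using Cmp_left[OF c(1,2)] lcomp_idc[OF 15(2,1) c(2)] 15(1) c(3) by (simp add: free_precat_simps)
next
  case (16 i k w u)
  then have c: "is_cell P k u" "is_cell P (Suc i) (idc w)" "btgt P i u = bsrc i (idc w)"
    using composable_free_right[of i k] by (auto simp: free_precat_simps)
  have d: "cdim w = i" using c(1) is_cell_dim(1)[OF c(2)] by simp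
  then have "bsrc i (idc w) = w" by (simp add: bsrc_def idc_def)
  then show ?case using Cmp_right[OF c(1,2)] rcomp_idc[OF 16(2,1) c(1)] 16(1) c(3) by (simp add: free_precat_simps)
next
  case (17 i k u v)
  then have c: "is_cell P k u" "is_cell P (Suc i) v" using composable_free_right[of i k] by auto
  then have d: "cdim u = k" "cdim v = Suc i" using is_cell_dim by blast+
  then show ?case using 17(1) by (simp add: free_precat_simps ccomp_right) (simp add: idc_def)
next
  case (18 i k v u)
  then have c: "is_cell P k u" "is_cell P (Suc i) v" using composable_free_left[of i k] by auto
  then have d: "cdim u = k" "cdim v = Suc i" using is_cell_dim by blast+
  then show ?case using 18(1) by (simp add: free_precat_simps ccomp_left) (simp add: idc_def)
next
  case (19 k l m i u v w)
  have c: "is_cell P k u" "is_cell P l v" "is_cell P m w"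
    using 19(8,10) composable_free[of k l u v] composable_free[of l m v w] 19(1,2,3) by auto
  then have d: "cdim u = k" "cdim v = l" "cdim w = m" "well_dim u" "well_dim v" "well_dim w"
    using is_cell_dim by blast+
  consider "k = Suc i" "l = Suc i" "m \<ge> Suc i" | "k = Suc i" "m = Suc i" "l \<ge> Suc i" | "l = Suc i" "m = Suc i" "k \<ge> Suc i"
    using 19(4-7) by (auto simp: min_def max_def split: if_splits)
  then show ?case
  proof cases
    case 1
    then have "ccomp (ccomp u v) w = ccomp u (ccomp v w)"
      using d lcomp_lcomp_equal[of w u v] by (simp add: ccomp_left)
    then show ?thesis by (simp add: free_precat_simps)
  next
    case 2
    then have "ccomp (ccomp u v) w = ccomp u (ccomp v w)"
      using d rcomp_lcomp_equal[of v u w] by (simp add: ccomp_left ccomp_right)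
    then show ?thesis by (simp add: free_precat_simps)
  next
    case 3
    then have "ccomp (ccomp u v) w = ccomp u (ccomp v w)"
      using d rcomp_rcomp_equal[of u w v] by (simp add: ccomp_right)
    then show ?thesis by (simp add: free_precat_simps)
  qed
next
  case (20 i j k l v v' u)
  have c: "is_cell P k v" "is_cell P l v'" using composable_free[of k l] 20(2,3,5) by auto
  have "i < max k l" "max k l \<le> n" using 20 by auto
  then have cu: "is_cell P (Suc i) u" using composable_free_left[of i "max k l"] 20(6) by auto
  have d: "cdim u = Suc i" "cdim v = k" "cdim v' = l" "well_dim v" "well_dim v'" using c cu is_cell_dim by blast+
  have m: "Suc j \<le> k" "Suc j \<le> l" using 20(4) by auto
  have "ccomp u (ccomp v v') = ccomp (ccomp u v) (ccomp u v')"
  proof (cases "k \<le> l")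
    case True
    then show ?thesis using d m 20(1) lcomp_lcomp_less[of v' u v] by (simp add: ccomp_left)
  next
    case False
    then show ?thesis using d m 20(1) lcomp_rcomp_less[of v u v'] by (simp add: ccomp_left ccomp_right)
  qed
  then show ?case by (simp add: free_precat_simps)
next
  case (21 i j k l v v' u)
  have c: "is_cell P k v" "is_cell P l v'" using composable_free[of k l] 21(2,3,5) by auto
  have "i < max k l" "max k l \<le> n" using 21 by auto
  then have cu: "is_cell P (Suc i) u" using composable_free_right[of i "max k l"] 21(6) by auto
  have d: "cdim u = Suc i" "cdim v = k" "cdim v' = l" "well_dim v" "well_dim v'" using c cu is_cell_dim by blast+
  have m: "Suc j \<le> k" "Suc j \<le> l" using 21(4) by auto
  have "ccomp (ccomp v v') u = ccomp (ccomp v u) (ccomp v' u)"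
  proof (cases "k \<le> l")
    case True
    then show ?thesis using d m 21(1) rcomp_lcomp_less[of v' u v] by (simp add: ccomp_left ccomp_right)
  next
    case False
    then show ?thesis using d m 21(1) rcomp_rcomp_less[of v u v'] by (simp add: ccomp_right)
  qed
  then show ?case by (simp add: free_precat_simps)
qed

end

definition identities :: "('g, 'z) prepolygraph_scheme \<Rightarrow> nat \<Rightarrow> nat \<Rightarrow> 'g cell \<Rightarrow> ('g cell \<times> 'g cell) list" where
  "identities P j k x = map (\<lambda>i. (idc (bsrc i x), idc (btgt P i x))) [j..<k]"

context
  fixes P :: "('g, 'z) prepolygraph_scheme" and n :: nat
  assumes P: "prepolygraph n P"
begin

lemma ccomp_idc_context:
  assumes x: "is_cell P k x" "k \<le> n" "i < k"
  shows "ccomp (ccomp (idc (bsrc i x)) x) (idc (btgt P i x)) = x"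
proof -
  have "is_cell P i (bsrc i x)" "is_cell P i (btgt P i x)"
    using bound_cell[OF P glob[OF P x(2)] _ x(1), of i] x(3) by auto
  then have d: "cdim (bsrc i x) = i" "cdim (btgt P i x) = i" "cdim x = k" using is_cell_dim(1) x(1) by blast+
  then show ?thesis
    using x lcomp_idc[OF P x(2,3,1)] rcomp_idc[OF P x(2,3,1)] by (simp add: ccomp_left ccomp_right)
qed

lemma btgt_idc: "is_cell P i x \<Longrightarrow> btgt P i (idc x) = x" and bsrc_idc: "is_cell P i x \<Longrightarrow> bsrc i (idc x) = x"
  using is_cell_dim(1)[of P i x] by (simp_all add: btgt_def bsrc_def idc_def)

lemma identities_context:
  assumes "k \<le> n" "parallel P k x y"
  shows "j \<le> k \<Longrightarrow> is_context P j x (identities P j k x) \<and> plug x (identities P j k x) = x \<and> plug y (identities P j k x) = y"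
proof (induction "k - j" arbitrary: j)
  case 0 then show ?case by (auto simp: identities_def intro: is_cell_is_context.Nil)
next
  case (Suc d)
  then have jk: "j < k" by simp
  have x: "is_cell P k x" "is_cell P k y" using assms(2) by (auto simp: parallel_def[OF P])
  have e: "identities P j k x = (idc (bsrc j x), idc (btgt P j x)) # identities P (Suc j) k x"
    using jk by (simp add: identities_def upt_rec)
  have b: "is_cell P j (bsrc j x)" "is_cell P j (btgt P j x)"
    using bound_cell[OF P glob[OF P assms(1)] _ x(1), of j] jk by auto
  have xy: "bsrc j x = bsrc j y" "btgt P j x = btgt P j y"
    using parallel_bound[OF P glob[OF P assms(1)] _ assms(2) jk] by auto
  note IH = Suc.hyps(1)[of "Suc j"]
  have "ccomp (ccomp (idc (bsrc j x)) x) (idc (btgt P j x)) = x" "ccomp (ccomp (idc (bsrc j x)) y) (idc (btgt P j x)) = y"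
    using ccomp_idc_context[OF x(1) assms(1) jk] ccomp_idc_context[OF x(2) assms(1) jk] xy by auto
  then show ?case unfolding e using IH Suc.hyps(2) jk b btgt_idc bsrc_idc
    by (auto intro!: is_cell_is_context.Cons)
qed

lemma gen_Suc: "gen P (Suc k) A = Cell (gsrc P (Suc k) A) [(A, identities P 0 k (gsrc P (Suc k) A))]"
  by (simp add: identities_def)

theorem is_cell_gen:
  assumes A: "A \<in> gens P (Suc k)" "k < n"
  shows "is_cell P (Suc k) (gen P (Suc k) A)" "csrc (gen P (Suc k) A) = gsrc P (Suc k) A"
    "ctgt P (gen P (Suc k) A) = gtgt P (Suc k) A"
proof -
  have p: "parallel P k (gsrc P (Suc k) A) (gtgt P (Suc k) A)"
    using gen_boundary[OF P A] by (auto simp: parallel_def[OF P])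
  have i: "is_context P 0 (gsrc P (Suc k) A) (identities P 0 k (gsrc P (Suc k) A))"
    "plug (gsrc P (Suc k) A) (identities P 0 k (gsrc P (Suc k) A)) = gsrc P (Suc k) A"
    "plug (gtgt P (Suc k) A) (identities P 0 k (gsrc P (Suc k) A)) = gtgt P (Suc k) A"
    using identities_context[OF _ p, of 0] A(2) by auto
  have l: "length (identities P 0 k (gsrc P (Suc k) A)) = k" by (simp add: identities_def)
  show "is_cell P (Suc k) (gen P (Suc k) A)"
    unfolding gen_Suc using i(1,2) l A gen_boundary[OF P A] by (simp add: is_whisker_def wsrc_def)
  show "csrc (gen P (Suc k) A) = gsrc P (Suc k) A" by simp
  show "ctgt P (gen P (Suc k) A) = gtgt P (Suc k) A"
    unfolding gen_Suc using i(3) l by (simp add: wtgt_def)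
qed

lemma plug_gen_aux:
  assumes k: "k \<le> n"
  shows "is_context P j x c \<Longrightarrow> is_cell P k x \<Longrightarrow> j + length c = k \<Longrightarrow>
    \<forall>(l, r) \<in> set pre. cdim l \<le> j \<Longrightarrow>
    plug (Cell x [(A, pre @ identities P j k x)]) c = Cell (plug x c) [(A, pre @ c)]"
proof (induction c arbitrary: j x pre)
  case Nil then show ?case by (simp add: identities_def)
next
  case (Cons p c)
  obtain l r where p: "p = (l, r)" by fastforce
  have lr: "is_cell P (Suc j) l" "is_cell P (Suc j) r" "btgt P j l = bsrc j x" "btgt P j x = bsrc j r"
    "is_context P (Suc j) (ccomp (ccomp l x) r) c"
    using Cons.prems(1) unfolding p by (auto elim: is_context.cases)
  have jk: "Suc j \<le> k" "j < k" using Cons.prems by simp_all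
  note s = ctx_step[OF P glob[OF P k] clos[OF P k] k Cons.prems(2) _ jk(1) lr(1-4)]
  have d: "cdim x = k" "cdim l = Suc j" "cdim r = Suc j" using Cons.prems lr is_cell_dim by auto
  have bd: "cdim (bsrc i x) = i" "cdim (btgt P i x) = i" if "i \<le> k" for i
    using bound_cell[OF P glob[OF P k] _ Cons.prems(2) that] is_cell_dim(1) by auto
  have pl: "map (lact l) pre = pre" "map (ract r) pre = pre"
    using Cons.prems(4) d by (auto intro!: map_idI simp: lact_def ract_def)
  have e: "identities P j k x = (idc (bsrc j x), idc (btgt P j x)) # identities P (Suc j) k x"
    using jk by (simp add: identities_def upt_rec)
  obtain ls lw rs rw where lC: "l = Cell ls lw" "r = Cell rs rw" using d dim_pos by (metis zero_less_Suc)
  have drs: "cdim rs = j" using d lC by simp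
  then have rs: "rs = btgt P j x" using lr(4) lC(2) by (simp add: bsrc_def)
  have l1: "lact l (idc (bsrc j x), idc (btgt P j x)) = (l, idc (btgt P j x))"
    using d bd[of j] jk by (simp add: lact_def) (simp add: idc_def lC)
  have r1: "ract r (l, idc (btgt P j x)) = (l, r)"
    using d bd[of j] jk by (simp add: ract_def) (simp add: idc_def lC rs)
  have lx: "is_cell P k (lcomp l x)"
    using closedD(1)[OF P clos[OF P k] lr(1) jk(2) _ Cons.prems(2) lr(3)] by simp
  have l2: "map (lact l) (identities P (Suc j) k x) = identities P (Suc j) k (lcomp l x)"
    unfolding identities_def map_map
  proof (rule map_cong[OF refl])
    fix i assume i: "i \<in> set [Suc j..<k]"
    have "bsrc i (lcomp l x) = lcomp l (bsrc i x)" "btgt P i (lcomp l x) = lcomp l (btgt P i x)"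
      using lcomp_bound[OF P glob[OF P k] k lr(1) jk(2) _ Cons.prems(2) lr(3), of i] i by auto
    then show "(lact l \<circ> (\<lambda>i. (idc (bsrc i x), idc (btgt P i x)))) i = (idc (bsrc i (lcomp l x)), idc (btgt P i (lcomp l x)))"
      using i d bd[of i] by (simp add: lact_def) (simp add: idc_def)
  qed
  have m: "btgt P j (lcomp l x) = bsrc j r"
    using lcomp_bound[OF P glob[OF P k] k lr(1) jk(2) _ Cons.prems(2) lr(3), of j] lr(4) by simp
  have bd': "cdim (bsrc i (lcomp l x)) = i" "cdim (btgt P i (lcomp l x)) = i" if "i \<le> k" for i
    using bound_cell[OF P glob[OF P k] _ lx that] is_cell_dim(1) by auto
  have r2: "map (ract r) (identities P (Suc j) k (lcomp l x)) = identities P (Suc j) k (rcomp (lcomp l x) r)"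
    unfolding identities_def map_map
  proof (rule map_cong[OF refl])
    fix i assume i: "i \<in> set [Suc j..<k]"
    have "bsrc i (rcomp (lcomp l x) r) = rcomp (bsrc i (lcomp l x)) r" "btgt P i (rcomp (lcomp l x) r) = rcomp (btgt P i (lcomp l x)) r"
      using rcomp_bound[OF P glob[OF P k] k lr(2) jk(2) _ lx m, of i] i by auto
    then show "(ract r \<circ> (\<lambda>i. (idc (bsrc i (lcomp l x)), idc (btgt P i (lcomp l x))))) i
        = (idc (bsrc i (rcomp (lcomp l x) r)), idc (btgt P i (rcomp (lcomp l x) r)))"
      using i d bd'[of i] by (simp add: ract_def) (simp add: idc_def)
  qed
  have "ccomp (ccomp l (Cell x [(A, pre @ identities P j k x)])) r =
     Cell (rcomp (lcomp l x) r) [(A, (pre @ [(l, r)]) @ identities P (Suc j) k (rcomp (lcomp l x) r))]"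
    using d jk by (simp add: ccomp_left ccomp_right lwact_def rwact_def pl e l1 r1 l2 r2)
  moreover have "plug (Cell (ccomp (ccomp l x) r) [(A, (pre @ [(l, r)]) @ identities P (Suc j) k (ccomp (ccomp l x) r))]) c
     = Cell (plug (ccomp (ccomp l x) r) c) [(A, (pre @ [(l, r)]) @ c)]"
    using Cons.prems(3,4) d by (intro Cons.IH[OF lr(5) s(1)]) force+
  ultimately show ?case using s(10) by (simp add: p)
qed

text \<open>
  A whisker, regarded as a cell, is indeed the composite of its generator with its context, and
  every cell is the composite of its whiskers.
\<close>

theorem plug_gen:
  assumes w: "is_whisker P k w" and k: "k < n"
  shows "plug (gen P (Suc k) (fst w)) (snd w) = wcell P w" "is_cell P (Suc k) (wcell P w)"
proof -
  have A: "fst w \<in> gens P (Suc k)" "length (snd w) = k" "is_context P 0 (gsrc P (Suc k) (fst w)) (snd w)"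
    using w unfolding is_whisker_def by auto
  show "plug (gen P (Suc k) (fst w)) (snd w) = wcell P w"
    using plug_gen_aux[OF _ A(3) gen_boundary(1)[OF P A(1) k], where pre = "[]" and A = "fst w"] k A(2)
    by (simp add: gen_Suc wcell_def wsrc_def del: gen.simps)
  have "parallel P k (wsrc P w) (wtgt P w)"
    using wsrc_parallel_wtgt[OF P glob[OF P] clos[OF P] k w] k by simp
  then show "is_cell P (Suc k) (wcell P w)" using w by (auto simp: wcell_def parallel_def[OF P])
qed

theorem Cell_Cons:
  assumes "is_cell P (Suc k) (Cell s (w # ws))" and k: "k < n"
  shows "Cell s (w # ws) = ccomp (wcell P w) (Cell (wtgt P w) ws)"
    "is_cell P (Suc k) (Cell (wtgt P w) ws)" "wsrc P w = s"
proof -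
  have w: "is_whisker P k w" "s = wsrc P w" "is_cell P k s" using assms by auto
  have "parallel P k (wsrc P w) (wtgt P w)"
    using wsrc_parallel_wtgt[OF P glob[OF P] clos[OF P] k w(1)] k by simp
  then have t: "is_cell P k (wtgt P w)" by (simp add: parallel_def[OF P])
  then show "is_cell P (Suc k) (Cell (wtgt P w) ws)" using assms by simp
  show "Cell s (w # ws) = ccomp (wcell P w) (Cell (wtgt P w) ws)" "wsrc P w = s"
    using w t is_cell_dim(1)[OF t] is_cell_dim(1)[OF w(3)] by (auto simp: wcell_def ccomp_left)
qed

end

lemma dim_ccomp: "0 < cdim u \<Longrightarrow> 0 < cdim v \<Longrightarrow> cdim (ccomp u v) = max (cdim u) (cdim v)"
  by (auto simp: ccomp_def)

lemma well_dim_ccomp: "0 < cdim u \<Longrightarrow> 0 < cdim v \<Longrightarrow> well_dim u \<Longrightarrow> well_dim v \<Longrightarrow> well_dim (ccomp u v)"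
  by (auto simp: ccomp_def well_dim_lcomp well_dim_rcomp)

lemma ccomp_assoc:
  assumes "well_dim u" "well_dim v" "well_dim w"
    and "(cdim u = Suc i \<and> cdim v = Suc i \<and> Suc i \<le> cdim w) \<or> (cdim u = Suc i \<and> cdim w = Suc i \<and> Suc i \<le> cdim v) \<or>
         (cdim v = Suc i \<and> cdim w = Suc i \<and> Suc i \<le> cdim u)"
  shows "ccomp (ccomp u v) w = ccomp u (ccomp v w)"
  using assms(4)
proof (elim disjE conjE)
  assume d: "cdim u = Suc i" "cdim v = Suc i" "Suc i \<le> cdim w"
  then show ?thesis using lcomp_lcomp_equal[of w u v] assms by (simp add: ccomp_left)
next
  assume d: "cdim u = Suc i" "cdim w = Suc i" "Suc i \<le> cdim v"
  then show ?thesis using rcomp_lcomp_equal[of v u w] assms by (simp add: ccomp_left ccomp_right)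
next
  assume d: "cdim v = Suc i" "cdim w = Suc i" "Suc i \<le> cdim u"
  then show ?thesis using rcomp_rcomp_equal[of u w v] assms by (simp add: ccomp_right)
qed

lemma ccomp_distrib:
  assumes "well_dim v" "well_dim v'" "0 < cdim u" "cdim u < cdim v" "cdim u < cdim v'"
  shows "ccomp u (ccomp v v') = ccomp (ccomp u v) (ccomp u v')"
    "ccomp (ccomp v v') u = ccomp (ccomp v u) (ccomp v' u)"
  using assms lcomp_lcomp_less[of v' u v] lcomp_rcomp_less[of v u v'] rcomp_lcomp_less[of v' u v] rcomp_rcomp_less[of v u v']
  by (cases "cdim v \<le> cdim v'"; simp add: ccomp_left ccomp_right)+

context
  fixes P :: "('g, 'z) prepolygraph_scheme" and n :: nat
  assumes P: "prepolygraph n P"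
begin

lemma ccomp_cell:
  assumes u: "is_cell P (Suc a) u" and v: "is_cell P b v" "b \<le> n" "a < b" "btgt P a u = bsrc a v"
  shows "is_cell P b (ccomp u v)"
    "i \<le> a \<Longrightarrow> bsrc i (ccomp u v) = bsrc i u" "i \<le> a \<Longrightarrow> btgt P i (ccomp u v) = btgt P i v"
    "a < i \<Longrightarrow> i \<le> b \<Longrightarrow> bsrc i (ccomp u v) = ccomp u (bsrc i v)"
    "a < i \<Longrightarrow> i \<le> b \<Longrightarrow> btgt P i (ccomp u v) = ccomp u (btgt P i v)"
proof -
  have d: "cdim u = Suc a" "cdim v = b" using u v is_cell_dim by blast+
  have e: "ccomp u v = lcomp u v" using d v(3) by (simp add: ccomp_left)
  have bd: "cdim (bsrc i v) = i" "cdim (btgt P i v) = i" if "i \<le> b" for i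
    using bound_cell[OF P glob[OF P v(2)] _ v(1) that] is_cell_dim(1) by auto
  note lb = lcomp_bound[OF P glob[OF P v(2)] v(2) u v(3) _ v(1) v(4)]
  show "is_cell P b (ccomp u v)" using closedD(1)[OF P clos[OF P v(2)] u v(3) _ v(1) v(4)] e by simp
  show "i \<le> a \<Longrightarrow> bsrc i (ccomp u v) = bsrc i u" "i \<le> a \<Longrightarrow> btgt P i (ccomp u v) = btgt P i v"
    using lb[of i] e by auto
  show "a < i \<Longrightarrow> i \<le> b \<Longrightarrow> bsrc i (ccomp u v) = ccomp u (bsrc i v)"
    "a < i \<Longrightarrow> i \<le> b \<Longrightarrow> btgt P i (ccomp u v) = ccomp u (btgt P i v)"
    using lb[of i] e bd[of i] d by (auto simp: ccomp_left)
qed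

lemma ccomp_cell':
  assumes u: "is_cell P (Suc a) u" and v: "is_cell P b v" "b \<le> n" "a < b" "btgt P a v = bsrc a u"
  shows "is_cell P b (ccomp v u)"
    "i \<le> a \<Longrightarrow> bsrc i (ccomp v u) = bsrc i v" "i \<le> a \<Longrightarrow> btgt P i (ccomp v u) = btgt P i u"
    "a < i \<Longrightarrow> i \<le> b \<Longrightarrow> bsrc i (ccomp v u) = ccomp (bsrc i v) u"
    "a < i \<Longrightarrow> i \<le> b \<Longrightarrow> btgt P i (ccomp v u) = ccomp (btgt P i v) u"
proof -
  have d: "cdim u = Suc a" "cdim v = b" using u v is_cell_dim by blast+
  have e: "ccomp v u = rcomp v u" using d v(3) by (simp add: ccomp_right)
  have bd: "cdim (bsrc i v) = i" "cdim (btgt P i v) = i" if "i \<le> b" for i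
    using bound_cell[OF P glob[OF P v(2)] _ v(1) that] is_cell_dim(1) by auto
  note lb = rcomp_bound[OF P glob[OF P v(2)] v(2) u v(3) _ v(1) v(4)]
  show "is_cell P b (ccomp v u)" using closedD(2)[OF P clos[OF P v(2)] u v(3) _ v(1) v(4)] e by simp
  show "i \<le> a \<Longrightarrow> bsrc i (ccomp v u) = bsrc i v" "i \<le> a \<Longrightarrow> btgt P i (ccomp v u) = btgt P i u"
    using lb[of i] e by auto
  show "a < i \<Longrightarrow> i \<le> b \<Longrightarrow> bsrc i (ccomp v u) = ccomp (bsrc i v) u"
    "a < i \<Longrightarrow> i \<le> b \<Longrightarrow> btgt P i (ccomp v u) = ccomp (btgt P i v) u"
    using lb[of i] e bd[of i] d by (auto simp: ccomp_right)
qed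

lemma src_eq: "is_cell P (Suc k) u \<Longrightarrow> Suc k \<le> n \<Longrightarrow> csrc u = bsrc k u"
  and tgt_eq: "is_cell P (Suc k) u \<Longrightarrow> Suc k \<le> n \<Longrightarrow> ctgt P u = btgt P k u"
  using bound_step(1,2)[OF P glob[OF P, of "Suc k"], of k u k] is_cell_csrc[OF P, of k u]
    globularD(1)[OF P glob[OF P, of "Suc k"], of k u] is_cell_dim(1)[of P k] by (metis bsrc_eq btgt_eq le_refl lessI)+

end

context
  fixes Q :: "('g, 'z) gray_scheme"
  assumes Q: "prepolygraph 3 Q" and X: "has_interchange_generators Q"
begin

lemma whisker2:
  assumes "is_whisker Q 1 w"
  obtains \<alpha> l r where "w = (\<alpha>, [(l, r)])" "\<alpha> \<in> gens Q 2" "is_cell Q 1 l" "is_cell Q 1 r"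
    "is_cell Q 1 (gsrc Q 2 \<alpha>)" "is_cell Q 1 (gtgt Q 2 \<alpha>)" "is_cell Q 2 (gen Q 2 \<alpha>)"
    "csrc (gen Q 2 \<alpha>) = gsrc Q 2 \<alpha>" "ctgt Q (gen Q 2 \<alpha>) = gtgt Q 2 \<alpha>"
    "btgt Q 0 l = bsrc 0 (gsrc Q 2 \<alpha>)" "btgt Q 0 (gsrc Q 2 \<alpha>) = bsrc 0 r"
    "btgt Q 0 l = bsrc 0 (gtgt Q 2 \<alpha>)" "btgt Q 0 (gtgt Q 2 \<alpha>) = bsrc 0 r"
    "btgt Q 0 l = bsrc 0 (gen Q 2 \<alpha>)" "btgt Q 0 (gen Q 2 \<alpha>) = bsrc 0 r"
    "wsrc Q w = ccomp (ccomp l (gsrc Q 2 \<alpha>)) r" "wtgt Q w = ccomp (ccomp l (gtgt Q 2 \<alpha>)) r"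
    "wcell Q w = ccomp (ccomp l (gen Q 2 \<alpha>)) r" "is_cell Q 2 (wcell Q w)"
proof -
  obtain \<alpha> c where w: "w = (\<alpha>, c)" by fastforce
  have A: "\<alpha> \<in> gens Q 2" "length c = 1" "is_context Q 0 (gsrc Q 2 \<alpha>) c"
    using assms by (auto simp: w is_whisker_def numeral_2_eq_2)
  obtain l r where c: "c = [(l, r)]" using A(2) by (cases c) auto
  have lr: "is_cell Q (Suc 0) l" "is_cell Q (Suc 0) r" "btgt Q 0 l = bsrc 0 (gsrc Q 2 \<alpha>)" "btgt Q 0 (gsrc Q 2 \<alpha>) = bsrc 0 r"
    using A(3) unfolding c by (auto elim: is_context.cases)
  have A': "\<alpha> \<in> gens Q (Suc (Suc 0))" using A by (simp add: numeral_2_eq_2)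
  have b: "is_cell Q (Suc 0) (gsrc Q 2 \<alpha>)" "is_cell Q (Suc 0) (gtgt Q 2 \<alpha>)"
    "csrc (gsrc Q 2 \<alpha>) = csrc (gtgt Q 2 \<alpha>)" "ctgt Q (gsrc Q 2 \<alpha>) = ctgt Q (gtgt Q 2 \<alpha>)"
    using gen_boundary[OF Q A'] by (auto simp: numeral_2_eq_2)
  note g = is_cell_gen[OF Q A', folded numeral_2_eq_2]
  have p: "parallel Q (Suc 0) (gsrc Q 2 \<alpha>) (gtgt Q 2 \<alpha>)" using b by (simp add: parallel_def[OF Q])
  note pb = parallel_bound[OF Q glob[OF Q, of "Suc 0"] _ p, of 0]
  have g0: "bsrc 0 (gen Q 2 \<alpha>) = bsrc 0 (gsrc Q 2 \<alpha>)" "btgt Q 0 (gen Q 2 \<alpha>) = btgt Q 0 (gsrc Q 2 \<alpha>)"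
    using bound_step(2,3)[OF Q glob[OF Q, of 2], of 1 "gen Q 2 \<alpha>" 0] g by (auto simp: numeral_2_eq_2)
  have pg: "wcell Q w = ccomp (ccomp l (gen Q 2 \<alpha>)) r" "is_cell Q 2 (wcell Q w)"
    using plug_gen[OF Q, of 1 w] assms by (simp_all add: w c numeral_2_eq_2)
  show thesis
    by (rule that[of \<alpha> l r])
      (use w c A lr b g p pb g0 pg in \<open>auto simp: wsrc_def wtgt_def numeral_2_eq_2\<close>)
qed

lemma swap_cell:
  assumes w: "is_whisker Q 1 w" and v: "is_whisker Q 1 v" and wv: "btgt Q 0 (wsrc Q w) = bsrc 0 (wsrc Q v)"
  shows "is_cell Q 3 (swap Q w v)"
    "csrc (swap Q w v) = (wcell Q w \<star>\<^sub>0 wsrc Q v) \<star>\<^sub>1 (wtgt Q w \<star>\<^sub>0 wcell Q v)"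
    "ctgt Q (swap Q w v) = (wsrc Q w \<star>\<^sub>0 wcell Q v) \<star>\<^sub>1 (wcell Q w \<star>\<^sub>0 wtgt Q v)"
proof -
  obtain \<alpha> l r where W: "w = (\<alpha>, [(l, r)])" "\<alpha> \<in> gens Q 2" "is_cell Q 1 l" "is_cell Q 1 r"
    "is_cell Q 1 (gsrc Q 2 \<alpha>)" "is_cell Q 1 (gtgt Q 2 \<alpha>)" "is_cell Q 2 (gen Q 2 \<alpha>)"
    "csrc (gen Q 2 \<alpha>) = gsrc Q 2 \<alpha>" "ctgt Q (gen Q 2 \<alpha>) = gtgt Q 2 \<alpha>"
    "btgt Q 0 l = bsrc 0 (gsrc Q 2 \<alpha>)" "btgt Q 0 (gsrc Q 2 \<alpha>) = bsrc 0 r"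
    "btgt Q 0 l = bsrc 0 (gtgt Q 2 \<alpha>)" "btgt Q 0 (gtgt Q 2 \<alpha>) = bsrc 0 r"
    "btgt Q 0 l = bsrc 0 (gen Q 2 \<alpha>)" "btgt Q 0 (gen Q 2 \<alpha>) = bsrc 0 r"
    "wsrc Q w = ccomp (ccomp l (gsrc Q 2 \<alpha>)) r" "wtgt Q w = ccomp (ccomp l (gtgt Q 2 \<alpha>)) r"
    "wcell Q w = ccomp (ccomp l (gen Q 2 \<alpha>)) r"
    by (rule whisker2[OF w])
  obtain \<beta> l' r' where V: "v = (\<beta>, [(l', r')])" "\<beta> \<in> gens Q 2" "is_cell Q 1 l'" "is_cell Q 1 r'"
    "is_cell Q 1 (gsrc Q 2 \<beta>)" "is_cell Q 1 (gtgt Q 2 \<beta>)" "is_cell Q 2 (gen Q 2 \<beta>)"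
    "csrc (gen Q 2 \<beta>) = gsrc Q 2 \<beta>" "ctgt Q (gen Q 2 \<beta>) = gtgt Q 2 \<beta>"
    "btgt Q 0 l' = bsrc 0 (gsrc Q 2 \<beta>)" "btgt Q 0 (gsrc Q 2 \<beta>) = bsrc 0 r'"
    "btgt Q 0 l' = bsrc 0 (gtgt Q 2 \<beta>)" "btgt Q 0 (gtgt Q 2 \<beta>) = bsrc 0 r'"
    "btgt Q 0 l' = bsrc 0 (gen Q 2 \<beta>)" "btgt Q 0 (gen Q 2 \<beta>) = bsrc 0 r'"
    "wsrc Q v = ccomp (ccomp l' (gsrc Q 2 \<beta>)) r'" "wtgt Q v = ccomp (ccomp l' (gtgt Q 2 \<beta>)) r'"
    "wcell Q v = ccomp (ccomp l' (gen Q 2 \<beta>)) r'"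
    by (rule whisker2[OF v])
  define f where "f = gsrc Q 2 \<alpha>" define f' where "f' = gtgt Q 2 \<alpha>"
  define h where "h = gsrc Q 2 \<beta>" define h' where "h' = gtgt Q 2 \<beta>"
  define a where "a = gen Q 2 \<alpha>" define b where "b = gen Q 2 \<beta>"
  note defs = f_def[symmetric] f'_def[symmetric] h_def[symmetric] h'_def[symmetric] a_def[symmetric] b_def[symmetric]
  note W = W[unfolded defs] and V = V[unfolded defs]
  note cc = ccomp_cell[OF Q, where a = 0, simplified] and cc' = ccomp_cell'[OF Q, where a = 0, simplified]
  have lf: "is_cell Q 1 (ccomp l f)" "btgt Q 0 (ccomp l f) = bsrc 0 r"
    using cc(1)[of l 1 f] cc(3)[of l 1 f 0] W by auto
  have lh: "is_cell Q 1 (ccomp l' h)" "bsrc 0 (ccomp l' h) = bsrc 0 l'" "btgt Q 0 (ccomp l' h) = bsrc 0 r'"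
    using cc(1)[of l' 1 h] cc(2,3)[of l' 1 h 0] V by auto
  have rl: "btgt Q 0 r = bsrc 0 l'"
  proof -
    have "btgt Q 0 (wsrc Q w) = btgt Q 0 r" using cc(3)[of "ccomp l f" 1 r 0] lf W by simp
    moreover have "bsrc 0 (wsrc Q v) = bsrc 0 l'" using cc(2)[of "ccomp l' h" 1 r' 0] lh V by simp
    ultimately show ?thesis using wv by simp
  qed
  have g: "is_cell Q 1 (ccomp r l')" "bsrc 0 (ccomp r l') = bsrc 0 r" "btgt Q 0 (ccomp r l') = btgt Q 0 l'"
    using cc(1)[of r 1 l'] cc(2,3)[of r 1 l' 0] W V rl by auto
  define x where "x = ichg Q \<alpha> (ccomp r l') \<beta>"
  have xx: "x \<in> gens Q 3" "gsrc Q 3 x = ccomp (ccomp (ccomp a (ccomp r l')) h) (ccomp (ccomp f' (ccomp r l')) b)"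
    "gtgt Q 3 x = ccomp (ccomp (ccomp f (ccomp r l')) b) (ccomp (ccomp a (ccomp r l')) h')"
    using X[unfolded has_interchange_generators_def, rule_format, of \<alpha> \<beta> "ccomp r l'"] W V g
    by (auto simp: composable3_def x_def Let_def defs)
  have x': "x \<in> gens Q (Suc 2)" using xx by simp
  note xg = is_cell_gen[OF Q x', simplified Suc_numeral semiring_norm, simplified]
  have xb: "is_cell Q 2 (gsrc Q 3 x)" using gen_boundary(1)[OF Q x'] by simp
  have d: "cdim l = 1" "cdim r = 1" "cdim l' = 1" "cdim r' = 1" "cdim f = 1" "cdim f' = 1" "cdim h = 1" "cdim h' = 1" "cdim a = 2" "cdim b = 2"
    "well_dim l" "well_dim r" "well_dim l'" "well_dim r'" "well_dim f" "well_dim f'" "well_dim h" "well_dim h'" "well_dim a" "well_dim b"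
    using W V is_cell_dim by blast+
  note gs = glob[OF Q, of 3, simplified]
  define G where "G = gen Q 3 x"
  have G: "is_cell Q 3 G" "csrc G = gsrc Q 3 x" "ctgt Q G = gtgt Q 3 x" using xg by (simp_all add: G_def)
  have G2: "bsrc 2 G = gsrc Q 3 x" "btgt Q 2 G = gtgt Q 3 x"
    using src_eq[OF Q, of 2 G] tgt_eq[OF Q, of 2 G] G by auto
  have G1: "bsrc 0 G = bsrc 0 (gsrc Q 3 x)" "btgt Q 0 G = btgt Q 0 (gsrc Q 3 x)"
    using bound_bound[OF Q gs _ G(1), of 0 2] G2 by auto
  have A1: "is_cell Q 2 (ccomp a (ccomp r l'))" "bsrc 0 (ccomp a (ccomp r l')) = bsrc 0 a" "btgt Q 0 (ccomp a (ccomp r l')) = btgt Q 0 l'"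
    using cc'(1)[of "ccomp r l'" 2 a] cc'(2,3)[of "ccomp r l'" 2 a 0] W g by auto
  have A2: "is_cell Q 2 (ccomp (ccomp a (ccomp r l')) h)" "bsrc 0 (ccomp (ccomp a (ccomp r l')) h) = bsrc 0 a"
    using cc'(1)[of h 2 "ccomp a (ccomp r l')"] cc'(2)[of h 2 "ccomp a (ccomp r l')" 0] A1 V by auto
  have B1: "is_cell Q 1 (ccomp f' (ccomp r l'))" "btgt Q 0 (ccomp f' (ccomp r l')) = btgt Q 0 l'"
    using cc(1)[of f' 1 "ccomp r l'"] cc(3)[of f' 1 "ccomp r l'" 0] W g by auto
  have B2: "is_cell Q 2 (ccomp (ccomp f' (ccomp r l')) b)" "btgt Q 0 (ccomp (ccomp f' (ccomp r l')) b) = btgt Q 0 b"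
    using cc(1)[of "ccomp f' (ccomp r l')" 2 b] cc(3)[of "ccomp f' (ccomp r l')" 2 b 0] B1 V by auto
  define U where "U = ccomp (ccomp a (ccomp r l')) h"
  define V' where "V' = ccomp (ccomp f' (ccomp r l')) b"
  have a1: "btgt Q 1 a = f'" "bsrc 1 b = h"
    using tgt_eq[OF Q, of 1 a] src_eq[OF Q, of 1 b] W V by (auto simp: numeral_2_eq_2)
  have "btgt Q 1 U = ccomp (ccomp f' (ccomp r l')) h"
    using cc'(5)[of "ccomp r l'" 2 a 1] cc'(5)[of h 2 "ccomp a (ccomp r l')" 1] A1 W V g a1 by (auto simp: U_def)
  moreover have "bsrc 1 V' = ccomp (ccomp f' (ccomp r l')) h"
    using cc(4)[of "ccomp f' (ccomp r l')" 2 b 1] B1 V a1 by (auto simp: V'_def)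
  ultimately have UV: "btgt Q 1 U = bsrc 1 V'" by simp
  have "bsrc 0 (ccomp U V') = bsrc 0 U" "btgt Q 0 (ccomp U V') = btgt Q 0 V'"
    using ccomp_cell(2,3)[OF Q, of 1 U 2 V' 0] UV A2 B2 by (auto simp: U_def V'_def numeral_2_eq_2)
  then have GG: "btgt Q 0 l = bsrc 0 G" "btgt Q 0 G = bsrc 0 r'"
    using G1 xx A2 B2 W V by (auto simp: U_def V'_def)
  have c1: "is_cell Q 3 (ccomp l G)" "bsrc 2 (ccomp l G) = ccomp l (bsrc 2 G)" "btgt Q 2 (ccomp l G) = ccomp l (btgt Q 2 G)"
    "btgt Q 0 (ccomp l G) = btgt Q 0 G"
    using cc(1)[of l 3 G] cc(4,5)[of l 3 G 2] cc(3)[of l 3 G 0] W G GG by auto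
  have c2: "is_cell Q 3 (ccomp (ccomp l G) r')" "bsrc 2 (ccomp (ccomp l G) r') = ccomp (ccomp l (bsrc 2 G)) r'"
    "btgt Q 2 (ccomp (ccomp l G) r') = ccomp (ccomp l (btgt Q 2 G)) r'"
    using cc'(1)[of r' 3 "ccomp l G"] cc'(4,5)[of r' 3 "ccomp l G" 2] V c1 GG by auto
  have sw: "swap Q w v = ccomp (ccomp l G) r'" by (simp add: swap_def W(1) V(1) G_def x_def Let_def)
  show "is_cell Q 3 (swap Q w v)" using c2 sw by simp
  note asc = ccomp_assoc[where i = 0] and dst = ccomp_distrib and dm = dim_ccomp well_dim_ccomp
  have "csrc (swap Q w v) = ccomp (ccomp l (gsrc Q 3 x)) r'"
    using src_eq[OF Q, of 2 "swap Q w v"] c2 sw G2 by auto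
  also have "\<dots> = (wcell Q w \<star>\<^sub>0 wsrc Q v) \<star>\<^sub>1 (wtgt Q w \<star>\<^sub>0 wcell Q v)"
    using d by (simp add: xx W(18,17,16) V(16,17,18) asc dst dm)
  finally show "csrc (swap Q w v) = (wcell Q w \<star>\<^sub>0 wsrc Q v) \<star>\<^sub>1 (wtgt Q w \<star>\<^sub>0 wcell Q v)" .
  have "ctgt Q (swap Q w v) = ccomp (ccomp l (gtgt Q 3 x)) r'"
    using tgt_eq[OF Q, of 2 "swap Q w v"] c2 sw G2 by auto
  also have "\<dots> = (wsrc Q w \<star>\<^sub>0 wcell Q v) \<star>\<^sub>1 (wcell Q w \<star>\<^sub>0 wtgt Q v)"
    using d by (simp add: xx W(18,17,16) V(16,17,18) asc dst dm)
  finally show "ctgt Q (swap Q w v) = (wsrc Q w \<star>\<^sub>0 wcell Q v) \<star>\<^sub>1 (wcell Q w \<star>\<^sub>0 wtgt Q v)" .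
qed

end

context
  fixes Q :: "('g, 'z) gray_scheme"
  assumes Q: "prepolygraph 3 Q" and X: "has_interchange_generators Q"
begin

lemma zero_comp_1_2:
  assumes "is_cell Q 1 p" "is_cell Q 2 u" "btgt Q 0 p = bsrc 0 u"
  shows "is_cell Q 2 (ccomp p u)" "bsrc 0 (ccomp p u) = bsrc 0 p" "btgt Q 0 (ccomp p u) = btgt Q 0 u"
    "bsrc 1 (ccomp p u) = ccomp p (csrc u)" "btgt Q 1 (ccomp p u) = ccomp p (ctgt Q u)"
    "csrc (ccomp p u) = ccomp p (csrc u)" "ctgt Q (ccomp p u) = ccomp p (ctgt Q u)"
proof -
  show c: "is_cell Q 2 (ccomp p u)"
    using ccomp_cell(1)[OF Q, of 0 p 2 u] assms by simp
  show "bsrc 0 (ccomp p u) = bsrc 0 p" "btgt Q 0 (ccomp p u) = btgt Q 0 u"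
    using ccomp_cell(2,3)[OF Q, of 0 p 2 u 0] assms by simp_all
  have e: "csrc u = bsrc 1 u" "ctgt Q u = btgt Q 1 u"
    using src_eq[OF Q, of 1 u] tgt_eq[OF Q, of 1 u] assms(2) by (simp_all add: numeral_2_eq_2)
  show b: "bsrc 1 (ccomp p u) = ccomp p (csrc u)" "btgt Q 1 (ccomp p u) = ccomp p (ctgt Q u)"
    using ccomp_cell(4,5)[OF Q, of 0 p 2 u 1] assms e by simp_all
  show "csrc (ccomp p u) = ccomp p (csrc u)" "ctgt Q (ccomp p u) = ccomp p (ctgt Q u)"
    using b src_eq[OF Q, of 1 "ccomp p u"] tgt_eq[OF Q, of 1 "ccomp p u"] c by (simp_all add: numeral_2_eq_2)
qed

lemma zero_comp_2_1:
  assumes "is_cell Q 1 p" "is_cell Q 2 u" "btgt Q 0 u = bsrc 0 p"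
  shows "is_cell Q 2 (ccomp u p)" "bsrc 0 (ccomp u p) = bsrc 0 u" "btgt Q 0 (ccomp u p) = btgt Q 0 p"
    "bsrc 1 (ccomp u p) = ccomp (csrc u) p" "btgt Q 1 (ccomp u p) = ccomp (ctgt Q u) p"
    "csrc (ccomp u p) = ccomp (csrc u) p" "ctgt Q (ccomp u p) = ccomp (ctgt Q u) p"
proof -
  show c: "is_cell Q 2 (ccomp u p)"
    using ccomp_cell'(1)[OF Q, of 0 p 2 u] assms by simp
  show "bsrc 0 (ccomp u p) = bsrc 0 u" "btgt Q 0 (ccomp u p) = btgt Q 0 p"
    using ccomp_cell'(2,3)[OF Q, of 0 p 2 u 0] assms by simp_all
  have e: "csrc u = bsrc 1 u" "ctgt Q u = btgt Q 1 u"
    using src_eq[OF Q, of 1 u] tgt_eq[OF Q, of 1 u] assms(2) by (simp_all add: numeral_2_eq_2)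
  show b: "bsrc 1 (ccomp u p) = ccomp (csrc u) p" "btgt Q 1 (ccomp u p) = ccomp (ctgt Q u) p"
    using ccomp_cell'(4,5)[OF Q, of 0 p 2 u 1] assms e by simp_all
  show "csrc (ccomp u p) = ccomp (csrc u) p" "ctgt Q (ccomp u p) = ccomp (ctgt Q u) p"
    using b src_eq[OF Q, of 1 "ccomp u p"] tgt_eq[OF Q, of 1 "ccomp u p"] c by (simp_all add: numeral_2_eq_2)
qed

lemma bound_2:
  assumes "is_cell Q 2 u"
  shows "csrc u = bsrc 1 u" "ctgt Q u = btgt Q 1 u" "is_cell Q 1 (csrc u)" "is_cell Q 1 (ctgt Q u)"
    "bsrc 0 (csrc u) = bsrc 0 u" "bsrc 0 (ctgt Q u) = bsrc 0 u" "btgt Q 0 (csrc u) = btgt Q 0 u" "btgt Q 0 (ctgt Q u) = btgt Q 0 u"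
  using src_eq[OF Q, of 1 u] tgt_eq[OF Q, of 1 u] assms bound_cell[OF Q glob[OF Q, of 2], of 2 u 1]
    bound_bound[OF Q glob[OF Q, of 2], of 2 u 0 1] by (simp_all add: numeral_2_eq_2)

lemma bound_3:
  assumes "is_cell Q 3 u"
  shows "is_cell Q 2 (csrc u)" "is_cell Q 2 (ctgt Q u)" "csrc u = bsrc 2 u" "ctgt Q u = btgt Q 2 u"
    "bsrc 1 u = csrc (csrc u)" "btgt Q 1 u = ctgt Q (csrc u)" "csrc (ctgt Q u) = csrc (csrc u)" "ctgt Q (ctgt Q u) = ctgt Q (csrc u)"
proof -
  show 1: "csrc u = bsrc 2 u" "ctgt Q u = btgt Q 2 u"
    using src_eq[OF Q, of 2 u] tgt_eq[OF Q, of 2 u] assms by simp_all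
  show 2: "is_cell Q 2 (csrc u)" "is_cell Q 2 (ctgt Q u)"
    using 1 bound_cell[OF Q glob[OF Q, of 3], of 3 u 2] assms by simp_all
  show "bsrc 1 u = csrc (csrc u)" "btgt Q 1 u = ctgt Q (csrc u)" "csrc (ctgt Q u) = csrc (csrc u)" "ctgt Q (ctgt Q u) = ctgt Q (csrc u)"
    using bound_bound[OF Q glob[OF Q, of 3], of 3 u 1 2] assms 1 bound_2(1,2)[OF 2(1)] bound_2(1,2)[OF 2(2)] by simp_all
qed

lemma one_comp_2_2:
  assumes "is_cell Q 2 u" "is_cell Q 2 v" "ctgt Q u = csrc v"
  shows "is_cell Q 2 (ccomp u v)" "csrc (ccomp u v) = csrc u" "ctgt Q (ccomp u v) = ctgt Q v"
proof -
  show c: "is_cell Q 2 (ccomp u v)"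
    using ccomp_cell(1)[OF Q, of 1 u 2 v] assms bound_2 by (simp add: numeral_2_eq_2)
  show "csrc (ccomp u v) = csrc u" "ctgt Q (ccomp u v) = ctgt Q v"
    using ccomp_cell(2,3)[OF Q, of 1 u 2 v 1] assms bound_2(1,2)[OF assms(1)] bound_2(1,2)[OF assms(2)] bound_2(1,2)[OF c]
    by (simp_all add: numeral_2_eq_2)
qed

lemma one_comp_2_3:
  assumes "is_cell Q 2 u" "is_cell Q 3 F" "ctgt Q u = csrc (csrc F)"
  shows "is_cell Q 3 (ccomp u F)" "csrc (ccomp u F) = ccomp u (csrc F)" "ctgt Q (ccomp u F) = ccomp u (ctgt Q F)"
proof -
  have h: "is_cell Q (Suc 1) u" "btgt Q 1 u = bsrc 1 F"
    using assms bound_2(2)[OF assms(1)] bound_3[OF assms(2)] by (auto simp: numeral_2_eq_2)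
  show c: "is_cell Q 3 (ccomp u F)"
    using ccomp_cell(1)[OF Q h(1) assms(2) _ _ h(2)] by simp
  show "csrc (ccomp u F) = ccomp u (csrc F)" "ctgt Q (ccomp u F) = ccomp u (ctgt Q F)"
    using ccomp_cell(4,5)[OF Q h(1) assms(2) _ _ h(2), of 2] bound_3(3,4)[OF c] bound_3(3,4)[OF assms(2)] by simp_all
qed

lemma one_comp_3_2:
  assumes "is_cell Q 2 u" "is_cell Q 3 F" "ctgt Q (csrc F) = csrc u"
  shows "is_cell Q 3 (ccomp F u)" "csrc (ccomp F u) = ccomp (csrc F) u" "ctgt Q (ccomp F u) = ccomp (ctgt Q F) u"
proof -
  have h: "is_cell Q (Suc 1) u" "btgt Q 1 F = bsrc 1 u"
    using assms bound_2(1)[OF assms(1)] bound_3[OF assms(2)] by (auto simp: numeral_2_eq_2)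
  show c: "is_cell Q 3 (ccomp F u)"
    using ccomp_cell'(1)[OF Q h(1) assms(2) _ _ h(2)] by simp
  show "csrc (ccomp F u) = ccomp (csrc F) u" "ctgt Q (ccomp F u) = ccomp (ctgt Q F) u"
    using ccomp_cell'(4,5)[OF Q h(1) assms(2) _ _ h(2), of 2] bound_3(3,4)[OF c] bound_3(3,4)[OF assms(2)] by simp_all
qed

lemma two_comp:
  assumes "is_cell Q 3 F" "is_cell Q 3 G" "ctgt Q F = csrc G"
  shows "is_cell Q 3 (ccomp F G)" "csrc (ccomp F G) = csrc F" "ctgt Q (ccomp F G) = ctgt Q G"
proof -
  have h: "is_cell Q (Suc 2) F" "btgt Q 2 F = bsrc 2 G"
    using assms bound_3(4)[OF assms(1)] bound_3(3)[OF assms(2)] by auto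
  show c: "is_cell Q 3 (ccomp F G)" using ccomp_cell(1)[OF Q h(1) assms(2) _ _ h(2)] by simp
  show "csrc (ccomp F G) = csrc F" "ctgt Q (ccomp F G) = ctgt Q G"
    using ccomp_cell(2,3)[OF Q h(1) assms(2) _ _ h(2), of 2] bound_3(3,4)[OF c] bound_3(3,4)[OF assms(1)] bound_3(3,4)[OF assms(2)]
    by simp_all
qed

lemma zero_assoc: "is_cell Q 2 u \<Longrightarrow> is_cell Q 2 v \<Longrightarrow> is_cell Q 2 w \<Longrightarrow> ccomp (ccomp u v) w = ccomp u (ccomp v w)"
  using ccomp_assoc[of u v w 1] is_cell_dim(1)[of Q 2] is_cell_dim(1)[of Q 2 v] is_cell_dim by (metis One_nat_def Suc_1 le_refl)

lemma zero_distrib: "is_cell Q 1 p \<Longrightarrow> is_cell Q 2 u \<Longrightarrow> is_cell Q 2 v \<Longrightarrow> ccomp p (ccomp u v) = ccomp (ccomp p u) (ccomp p v)"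
   "is_cell Q 1 p \<Longrightarrow> is_cell Q 2 u \<Longrightarrow> is_cell Q 2 v \<Longrightarrow> ccomp (ccomp u v) p = ccomp (ccomp u p) (ccomp v p)"
  using ccomp_distrib[of u v p] is_cell_dim[of Q 1 p] is_cell_dim[of Q 2 u] is_cell_dim[of Q 2 v] by auto

lemma idc_unit_2:
  assumes "is_cell Q 2 u"
  shows "ccomp u (Cell (ctgt Q u) []) = u" "ccomp (Cell (csrc u) []) u = u"
proof -
  obtain s ws where u: "u = Cell s ws" using is_cell_dim(1)[OF assms] dim_pos[of u] by auto
  have "cdim (csrc u) = 1" "cdim (ctgt Q u) = 1" "cdim u = 2"
    using bound_2(3,4)[OF assms] assms is_cell_dim(1) by blast+
  then show "ccomp u (Cell (ctgt Q u) []) = u" "ccomp (Cell (csrc u) []) u = u"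
    by (simp_all add: u ccomp_left)
qed

lemma zero_idc:
  assumes "is_cell Q 1 p"
  shows "is_cell Q 1 q \<Longrightarrow> ccomp p (Cell q []) = Cell (ccomp p q) []"
     "is_cell Q 1 q \<Longrightarrow> ccomp (Cell q []) p = Cell (ccomp q p) []"
  using is_cell_dim(1)[OF assms] is_cell_dim(1)[of Q 1 q]
  by (simp_all add: ccomp_left ccomp_right lcomp_eq_rcomp)

lemma whisker_cell:
  assumes "is_whisker Q 1 w"
  shows "is_cell Q 2 (wcell Q w)" "csrc (wcell Q w) = wsrc Q w" "ctgt Q (wcell Q w) = wtgt Q w"
    "is_cell Q 1 (wsrc Q w)" "is_cell Q 1 (wtgt Q w)"
    "bsrc 0 (wtgt Q w) = bsrc 0 (wsrc Q w)" "btgt Q 0 (wtgt Q w) = btgt Q 0 (wsrc Q w)"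
    "bsrc 0 (wcell Q w) = bsrc 0 (wsrc Q w)" "btgt Q 0 (wcell Q w) = btgt Q 0 (wsrc Q w)"
proof -
  show c: "is_cell Q 2 (wcell Q w)" using plug_gen(2)[OF Q, of 1 w] assms by (simp add: numeral_2_eq_2)
  show s: "csrc (wcell Q w) = wsrc Q w" "ctgt Q (wcell Q w) = wtgt Q w" by (simp_all add: wcell_def)
  show "is_cell Q 1 (wsrc Q w)" "is_cell Q 1 (wtgt Q w)"
    "bsrc 0 (wtgt Q w) = bsrc 0 (wsrc Q w)" "btgt Q 0 (wtgt Q w) = btgt Q 0 (wsrc Q w)"
    "bsrc 0 (wcell Q w) = bsrc 0 (wsrc Q w)" "btgt Q 0 (wcell Q w) = btgt Q 0 (wsrc Q w)"
    using bound_2[OF c] s by auto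
qed

lemma move_whisker_cell:
  assumes w: "is_whisker Q 1 w"
  shows "is_cell Q 2 (Cell k vs) \<Longrightarrow> btgt Q 0 (wsrc Q w) = bsrc 0 k \<Longrightarrow>
    is_cell Q 3 (move_whisker Q w k vs) \<and>
    csrc (move_whisker Q w k vs) = ccomp (ccomp (wcell Q w) k) (ccomp (wtgt Q w) (Cell k vs)) \<and>
    ctgt Q (move_whisker Q w k vs) = ccomp (ccomp (wsrc Q w) (Cell k vs)) (ccomp (wcell Q w) (ctgt Q (Cell k vs)))"
proof (induction vs arbitrary: k)
  case Nil
  note wc = whisker_cell[OF w]
  have k: "is_cell Q 1 k" using Nil(1) by (simp add: numeral_2_eq_2)
  note z = zero_comp_2_1[OF k wc(1)]
  have b: "btgt Q 0 (wcell Q w) = bsrc 0 k" using Nil(2) wc by simp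
  note z = z[OF b]
  have "ccomp (ccomp (wcell Q w) k) (ccomp (wtgt Q w) (Cell k [])) = ccomp (wcell Q w) k"
    using idc_unit_2(1)[OF z(1)] z(7) zero_idc(1)[OF wc(5) k] wc(3) by simp
  moreover have "ccomp (ccomp (wsrc Q w) (Cell k [])) (ccomp (wcell Q w) (ctgt Q (Cell k []))) = ccomp (wcell Q w) k"
    using idc_unit_2(2)[OF z(1)] z(6) zero_idc(1)[OF wc(4) k] wc(2) by simp
  moreover have "is_cell Q 3 (idc (ccomp (wcell Q w) k))"
    using z(1) idc_cell[of Q 2 "ccomp (wcell Q w) k"] by simp
  ultimately show ?case by (simp add: idc_def del: idc_cell)
next
  case (Cons v vs)
  have vv: "is_whisker Q 1 v" using Cons.prems(1) by (simp add: numeral_2_eq_2)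
  note wc = whisker_cell[OF w] and vc = whisker_cell[OF vv]
  have cC: "Cell k (v # vs) = ccomp (wcell Q v) (Cell (wtgt Q v) vs)" "is_cell Q 2 (Cell (wtgt Q v) vs)" "wsrc Q v = k"
    using Cell_Cons[OF Q Cons.prems(1)[folded Suc_1]] by (simp_all only: Suc_1)
  define C where "C = Cell (wtgt Q v) vs"
  have C: "is_cell Q 2 C" "csrc C = wtgt Q v" using cC by (simp_all add: C_def)
  have b: "btgt Q 0 (wsrc Q w) = bsrc 0 (wsrc Q v)" using Cons.prems(2) cC by simp
  have b': "btgt Q 0 (wsrc Q w) = bsrc 0 (wtgt Q v)" using b vc by simp
  define M where "M = move_whisker Q w (wtgt Q v) vs"
  have M: "is_cell Q 3 M" "csrc M = ccomp (ccomp (wcell Q w) (wtgt Q v)) (ccomp (wtgt Q w) C)"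
    "ctgt Q M = ccomp (ccomp (wsrc Q w) C) (ccomp (wcell Q w) (ctgt Q C))"
    using Cons.IH[OF cC(2) b'] by (simp_all add: M_def C_def)
  define S where "S = swap Q w v"
  note S = swap_cell[OF Q X w vv b, folded S_def]
  have C0: "bsrc 0 C = bsrc 0 (wsrc Q v)" "is_cell Q 1 (ctgt Q C)" "bsrc 0 (ctgt Q C) = bsrc 0 (wsrc Q v)"
    using bound_2[OF C(1)] C(2) vc(6) by auto
  have t1: "btgt Q 0 (wtgt Q w) = bsrc 0 C" "btgt Q 0 (wsrc Q w) = bsrc 0 C" "btgt Q 0 (wtgt Q w) = bsrc 0 (wcell Q v)"
     "btgt Q 0 (wsrc Q w) = bsrc 0 (wcell Q v)" "btgt Q 0 (wcell Q w) = bsrc 0 (wsrc Q v)" "btgt Q 0 (wcell Q w) = bsrc 0 (wtgt Q v)"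
    "btgt Q 0 (wcell Q w) = bsrc 0 (ctgt Q C)"
    by (simp_all only: b wc(6-9) vc(6-9) C0)
  note e1 = zero_comp_1_2[OF wc(5) C(1) t1(1)] and e2 = zero_comp_1_2[OF wc(4) C(1) t1(2)]
    and e3 = zero_comp_1_2[OF wc(5) vc(1) t1(3)] and e4 = zero_comp_1_2[OF wc(4) vc(1) t1(4)]
    and e5 = zero_comp_2_1[OF vc(4) wc(1) t1(5)] and e6 = zero_comp_2_1[OF vc(5) wc(1) t1(6)]
    and e7 = zero_comp_2_1[OF C0(2) wc(1) t1(7)]
  note S1 = one_comp_2_2[OF e5(1) e3(1)]
  have "ctgt Q (csrc S) = csrc (ccomp (wtgt Q w) C)" using S(2) S1(3) e3(7,6) e5(7) e1(6) wc vc C by simp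
  note L = one_comp_3_2[OF e1(1) S(1) this]
  have "ctgt Q (ccomp (wsrc Q w) (wcell Q v)) = csrc (csrc M)"
    using M(2) one_comp_2_2(2)[OF e6(1) e1(1)] e4(7) e6(6,7) e1(6) wc vc C by simp
  note R = one_comp_2_3[OF e4(1) M(1) this]
  have LR: "ctgt Q (ccomp S (ccomp (wtgt Q w) C)) = csrc (ccomp (ccomp (wsrc Q w) (wcell Q v)) M)"
    using L(3) R(2) S(3) M(2) zero_assoc[OF e4(1) e6(1) e1(1)] by simp
  note T = two_comp[OF L(1) R(1) LR]
  have mw: "move_whisker Q w k (v # vs) = ccomp (ccomp S (ccomp (wtgt Q w) C)) (ccomp (ccomp (wsrc Q w) (wcell Q v)) M)"
    by (simp add: S_def M_def C_def)
  have "csrc (move_whisker Q w k (v # vs)) = ccomp (ccomp (wcell Q w) k) (ccomp (wtgt Q w) (Cell k (v # vs)))"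
    unfolding mw T(2) L(2) S(2) cC(1) using zero_assoc[OF e5(1) e3(1) e1(1)] zero_distrib(1)[OF wc(5) vc(1) C(1)] cC(3)
    by (simp add: C_def)
  moreover have "ctgt Q (Cell k (v # vs)) = ctgt Q C" by (simp add: C_def)
  then have "ctgt Q (move_whisker Q w k (v # vs)) = ccomp (ccomp (wsrc Q w) (Cell k (v # vs))) (ccomp (wcell Q w) (ctgt Q (Cell k (v # vs))))"
    unfolding mw T(3) R(3) M(3) cC(1) using zero_assoc[OF e4(1) e2(1) e7(1)] zero_distrib(1)[OF wc(4) vc(1) C(1)]
    by (simp add: C_def cC(1)[symmetric])
  ultimately show ?case using T(1) mw by simp
qed

lemma move_whiskers_cell:
  assumes p: "is_cell Q 2 \<psi>"
  shows "is_cell Q 2 (Cell f ws) \<Longrightarrow> btgt Q 0 f = bsrc 0 \<psi> \<Longrightarrow>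
    is_cell Q 3 (move_whiskers Q f ws \<psi>) \<and>
    csrc (move_whiskers Q f ws \<psi>) = ccomp (ccomp (Cell f ws) (csrc \<psi>)) (ccomp (ctgt Q (Cell f ws)) \<psi>) \<and>
    ctgt Q (move_whiskers Q f ws \<psi>) = ccomp (ccomp f \<psi>) (ccomp (Cell f ws) (ctgt Q \<psi>))"
proof (induction ws arbitrary: f)
  case Nil
  note pb = bound_2[OF p]
  have f: "is_cell Q 1 f" using Nil(1) by (simp add: numeral_2_eq_2)
  note z = zero_comp_1_2[OF f p Nil(2)]
  have "ccomp (ccomp (Cell f []) (csrc \<psi>)) (ccomp f \<psi>) = ccomp f \<psi>"
    using idc_unit_2(2)[OF z(1)] z(6) zero_idc(2)[OF pb(3) f] by simp
  moreover have "ccomp (ccomp f \<psi>) (ccomp (Cell f []) (ctgt Q \<psi>)) = ccomp f \<psi>"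
    using idc_unit_2(1)[OF z(1)] z(7) zero_idc(2)[OF pb(4) f] by simp
  moreover have "is_cell Q 3 (idc (ccomp f \<psi>))"
    using z(1) idc_cell[of Q 2 "ccomp f \<psi>"] by simp
  ultimately show ?case by (simp add: idc_def del: idc_cell)
next
  case (Cons w ws)
  have w: "is_whisker Q 1 w" using Cons.prems(1) by (simp add: numeral_2_eq_2)
  note wc = whisker_cell[OF w] and pb = bound_2[OF p]
  have cC: "Cell f (w # ws) = ccomp (wcell Q w) (Cell (wtgt Q w) ws)" "is_cell Q 2 (Cell (wtgt Q w) ws)" "wsrc Q w = f"
    using Cell_Cons[OF Q Cons.prems(1)[folded Suc_1]] by (simp_all only: Suc_1)
  define C where "C = Cell (wtgt Q w) ws"
  have C: "is_cell Q 2 C" "csrc C = wtgt Q w" using cC by (simp_all add: C_def)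
  have b: "btgt Q 0 (wtgt Q w) = bsrc 0 \<psi>" using Cons.prems(2) cC wc by simp
  define M where "M = move_whiskers Q (wtgt Q w) ws \<psi>"
  have M: "is_cell Q 3 M" "csrc M = ccomp (ccomp C (csrc \<psi>)) (ccomp (ctgt Q C) \<psi>)"
    "ctgt Q M = ccomp (ccomp (wtgt Q w) \<psi>) (ccomp C (ctgt Q \<psi>))"
    using Cons.IH[OF cC(2) b] by (simp_all add: M_def C_def)
  define N where "N = move_whisker Q w (csrc \<psi>) (whiskers \<psi>)"
  obtain k vs where psi: "\<psi> = Cell k vs" using is_cell_dim(1)[OF p] dim_pos[of \<psi>] by auto
  have bk: "btgt Q 0 (wsrc Q w) = bsrc 0 (csrc \<psi>)" using b pb wc by simp
  have N: "is_cell Q 3 N" "csrc N = ccomp (ccomp (wcell Q w) (csrc \<psi>)) (ccomp (wtgt Q w) \<psi>)"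
    "ctgt Q N = ccomp (ccomp (wsrc Q w) \<psi>) (ccomp (wcell Q w) (ctgt Q \<psi>))"
    using move_whisker_cell[OF w p[unfolded psi]] bk by (simp_all add: N_def psi)
  note cb = bound_2[OF C(1)]
  have t: "btgt Q 0 (wcell Q w) = bsrc 0 (csrc \<psi>)" "btgt Q 0 C = bsrc 0 (csrc \<psi>)" "btgt Q 0 C = bsrc 0 (ctgt Q \<psi>)"
    "btgt Q 0 (ctgt Q C) = bsrc 0 \<psi>" "btgt Q 0 (wsrc Q w) = bsrc 0 \<psi>" "btgt Q 0 (wcell Q w) = bsrc 0 (ctgt Q \<psi>)"
    using b wc(6-9) pb(5-8) cb(5-8) C(2) by (simp_all only:)
  note e1 = zero_comp_2_1[OF pb(3) wc(1) t(1)] and e2 = zero_comp_2_1[OF pb(3) C(1) t(2)]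
    and e3 = zero_comp_2_1[OF pb(4) C(1) t(3)] and e4 = zero_comp_1_2[OF cb(4) p t(4)]
    and e5 = zero_comp_1_2[OF wc(5) p b] and e6 = zero_comp_1_2[OF wc(4) p t(5)] and e7 = zero_comp_2_1[OF pb(4) wc(1) t(6)]
  have "ctgt Q (ccomp (wcell Q w) (csrc \<psi>)) = csrc (csrc M)"
    using M(2) one_comp_2_2(2)[OF e2(1) e4(1)] e1(7) e2(6,7) e4(6) wc C by simp
  note L = one_comp_2_3[OF e1(1) M(1) this]
  have "ctgt Q (csrc N) = csrc (ccomp C (ctgt Q \<psi>))"
    using N(2) one_comp_2_2(3)[OF e1(1) e5(1)] e1(7) e5(6,7) e3(6) wc C by simp
  note R = one_comp_3_2[OF e3(1) N(1) this]
  have LR: "ctgt Q (ccomp (ccomp (wcell Q w) (csrc \<psi>)) M) = csrc (ccomp N (ccomp C (ctgt Q \<psi>)))"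
    using L(3) R(2) M(3) N(2) zero_assoc[OF e1(1) e5(1) e3(1)] by simp
  note T = two_comp[OF L(1) R(1) LR]
  have mw: "move_whiskers Q f (w # ws) \<psi> = ccomp (ccomp (ccomp (wcell Q w) (csrc \<psi>)) M) (ccomp N (ccomp C (ctgt Q \<psi>)))"
    by (simp add: N_def M_def C_def)
  have ct: "ctgt Q (Cell f (w # ws)) = ctgt Q C" by (simp add: C_def)
  have "csrc (move_whiskers Q f (w # ws) \<psi>) = ccomp (ccomp (Cell f (w # ws)) (csrc \<psi>)) (ccomp (ctgt Q C) \<psi>)"
    unfolding mw T(2) L(2) M(2) cC(1) C_def[symmetric]
    using zero_assoc[OF e1(1) e2(1) e4(1)] zero_distrib(2)[OF pb(3) wc(1) C(1)] by simp
  moreover have "ctgt Q (move_whiskers Q f (w # ws) \<psi>) = ccomp (ccomp f \<psi>) (ccomp (Cell f (w # ws)) (ctgt Q \<psi>))"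
    unfolding mw T(3) R(3) N(3) cC(1) C_def[symmetric] cC(3)
    using zero_assoc[OF e6(1) e7(1) e3(1)] zero_distrib(2)[OF pb(4) wc(1) C(1)] cC(3) by simp
  ultimately show ?case using T(1) mw ct by simp
qed

theorem interchange_cell:
  assumes "is_cell Q 2 \<phi>" "is_cell Q 2 \<psi>" "btgt Q 0 \<phi> = bsrc 0 \<psi>"
  shows "is_cell Q 3 (interchange Q \<phi> \<psi>)"
    "csrc (interchange Q \<phi> \<psi>) = (\<phi> \<star>\<^sub>0 csrc \<psi>) \<star>\<^sub>1 (ctgt Q \<phi> \<star>\<^sub>0 \<psi>)"
    "ctgt Q (interchange Q \<phi> \<psi>) = (csrc \<phi> \<star>\<^sub>0 \<psi>) \<star>\<^sub>1 (\<phi> \<star>\<^sub>0 ctgt Q \<psi>)"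
proof -
  obtain f ws where phi: "\<phi> = Cell f ws" using is_cell_dim(1)[OF assms(1)] dim_pos[of \<phi>] by auto
  have "btgt Q 0 f = bsrc 0 \<psi>" using assms(3) bound_2[OF assms(1)] by (simp add: phi)
  note m = move_whiskers_cell[OF assms(2) assms(1)[unfolded phi] this]
  show "is_cell Q 3 (interchange Q \<phi> \<psi>)"
    "csrc (interchange Q \<phi> \<psi>) = (\<phi> \<star>\<^sub>0 csrc \<psi>) \<star>\<^sub>1 (ctgt Q \<phi> \<star>\<^sub>0 \<psi>)"
    "ctgt Q (interchange Q \<phi> \<psi>) = (csrc \<phi> \<star>\<^sub>0 \<psi>) \<star>\<^sub>1 (\<phi> \<star>\<^sub>0 ctgt Q \<psi>)"
    using m by (simp_all add: interchange_def phi)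
qed

end

end

theory Submission
  imports Defs
begin

text \<open>
  Write \<open>F \<sim> G\<close> for the congruence on the 3-cells of the free precategory generated by the
  4-generators.  A local branching \<open>(S\<^sub>1, S\<^sub>2)\<close> is confluent if \<open>S\<^sub>1 *\<^sub>2 F\<^sub>1 \<sim> S\<^sub>2 *\<^sub>2 F\<^sub>2\<close> for some \<open>F\<^sub>1, F\<^sub>2\<close>.
  Confluence is stable under whiskering, and removing a nontrivial context from a branching makes
  its source smaller, so only minimal branchings matter.  Among them the independent ones are
  confluent by the independence generators, the critical ones by hypothesis, and the natural ones
  because their swap is the first step of the interchange 3-cell, so that they are contexts of
  the branchings filled by the naturality generators.  By Newman's argument, \<open>\<sim>\<close> then identifies all
  3-cells from a given \<open>\<phi>\<close> to a normal form; choosing one such \<open>N\<^sub>\<phi>\<close> for each \<open>\<phi>\<close>, every 3-cell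
  \<open>F : \<phi> \<Rrightarrow> \<psi>\<close> satisfies \<open>F *\<^sub>2 N\<^sub>\<psi> \<sim> N\<^sub>\<phi>\<close>, so that in the localization every zigzag from \<open>\<phi>\<close> to
  \<open>\<psi>\<close> equals \<open>N\<^sub>\<phi> *\<^sub>2 N\<^sub>\<psi>\<^sup>-\<^sup>1\<close>.
\<close>

section \<open>Composition in the free precategory\<close>

text \<open>Dimension and \<open>well_dim\<close> are all that associativity and distributivity ask
  for, so composites can be rearranged without checking that they are composable.\<close>

definition has_dim :: "nat \<Rightarrow> 'g cell \<Rightarrow> bool" where
  "has_dim k u \<longleftrightarrow> cdim u = k \<and> well_dim u"

lemma has_dim_ccomp:
  assumes "has_dim (Suc k) u" "has_dim (Suc l) v"
  shows "has_dim (max (Suc k) (Suc l)) (ccomp u v)"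
  using assms dim_ccomp[of u v] well_dim_ccomp[of u v] by (simp add: has_dim_def)

lemma has_dim_ccomp_simps [simp]:
  "has_dim 1 u \<Longrightarrow> has_dim 1 v \<Longrightarrow> has_dim 1 (ccomp u v)"
  "has_dim 1 u \<Longrightarrow> has_dim 2 v \<Longrightarrow> has_dim 2 (ccomp u v)"
  "has_dim 2 u \<Longrightarrow> has_dim 1 v \<Longrightarrow> has_dim 2 (ccomp u v)"
  "has_dim 2 u \<Longrightarrow> has_dim 2 v \<Longrightarrow> has_dim 2 (ccomp u v)"
  "has_dim 1 u \<Longrightarrow> has_dim 3 v \<Longrightarrow> has_dim 3 (ccomp u v)"
  "has_dim 3 u \<Longrightarrow> has_dim 1 v \<Longrightarrow> has_dim 3 (ccomp u v)"
  "has_dim 2 u \<Longrightarrow> has_dim 3 v \<Longrightarrow> has_dim 3 (ccomp u v)"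
  "has_dim 3 u \<Longrightarrow> has_dim 2 v \<Longrightarrow> has_dim 3 (ccomp u v)"
  "has_dim 3 u \<Longrightarrow> has_dim 3 v \<Longrightarrow> has_dim 3 (ccomp u v)"
  using has_dim_ccomp[of 0 u 0 v] has_dim_ccomp[of 0 u 1 v] has_dim_ccomp[of 1 u 0 v]
    has_dim_ccomp[of 1 u 1 v] has_dim_ccomp[of 0 u 2 v] has_dim_ccomp[of 2 u 0 v]
    has_dim_ccomp[of 1 u 2 v] has_dim_ccomp[of 2 u 1 v] has_dim_ccomp[of 2 u 2 v]
  by (simp_all add: numeral_2_eq_2 numeral_3_eq_3)

lemma has_dim_cell: "is_cell P k u \<Longrightarrow> has_dim k u"
  using is_cell_dim(1) by (auto simp: has_dim_def)

lemma ccomp_assoc_dim: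
  "has_dim 1 u \<Longrightarrow> has_dim 1 v \<Longrightarrow> has_dim k w \<Longrightarrow> 1 \<le> k \<Longrightarrow> ccomp (ccomp u v) w = ccomp u (ccomp v w)"
  "has_dim 1 u \<Longrightarrow> has_dim k v \<Longrightarrow> has_dim 1 w \<Longrightarrow> 1 \<le> k \<Longrightarrow> ccomp (ccomp u v) w = ccomp u (ccomp v w)"
  "has_dim k u \<Longrightarrow> has_dim 1 v \<Longrightarrow> has_dim 1 w \<Longrightarrow> 1 \<le> k \<Longrightarrow> ccomp (ccomp u v) w = ccomp u (ccomp v w)"
  "has_dim 2 u \<Longrightarrow> has_dim 2 v \<Longrightarrow> has_dim k w \<Longrightarrow> 2 \<le> k \<Longrightarrow> ccomp (ccomp u v) w = ccomp u (ccomp v w)"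
  "has_dim 2 u \<Longrightarrow> has_dim k v \<Longrightarrow> has_dim 2 w \<Longrightarrow> 2 \<le> k \<Longrightarrow> ccomp (ccomp u v) w = ccomp u (ccomp v w)"
  "has_dim k u \<Longrightarrow> has_dim 2 v \<Longrightarrow> has_dim 2 w \<Longrightarrow> 2 \<le> k \<Longrightarrow> ccomp (ccomp u v) w = ccomp u (ccomp v w)"
  "has_dim 3 u \<Longrightarrow> has_dim 3 v \<Longrightarrow> has_dim 3 w \<Longrightarrow> ccomp (ccomp u v) w = ccomp u (ccomp v w)"
  using ccomp_assoc[of u v w 0] ccomp_assoc[of u v w 1] ccomp_assoc[of u v w 2]
  by (auto simp: has_dim_def)

text \<open>A rewrite system for composites: brackets move to the right and cells of lower dimension
  are distributed over composites of higher dimension. All side conditions are numerical or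
  instances of \<open>well_dim\<close>, so two bracketings of the same composite are compared by
  simplification alone.\<close>

lemma ccomp_normal_simps:
  "has_dim k u \<longleftrightarrow> cdim u = k \<and> well_dim u"
  "0 < cdim u \<Longrightarrow> 0 < cdim v \<Longrightarrow> cdim (ccomp u v) = (if cdim u \<le> cdim v then cdim v else cdim u)"
  "0 < cdim u \<Longrightarrow> 0 < cdim v \<Longrightarrow> well_dim u \<Longrightarrow> well_dim v \<Longrightarrow> well_dim (ccomp u v)"
  "well_dim u \<Longrightarrow> well_dim v \<Longrightarrow> well_dim w \<Longrightarrow> 0 < cdim u \<Longrightarrow> 0 < cdim v \<Longrightarrow> 0 < cdim w \<Longrightarrow>
    cdim u = cdim v \<and> cdim u \<le> cdim w \<or> cdim u = cdim w \<and> cdim u \<le> cdim v \<or> cdim v = cdim w \<and> cdim v \<le> cdim u \<Longrightarrow>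
    ccomp (ccomp u v) w = ccomp u (ccomp v w)"
  "well_dim u \<Longrightarrow> well_dim v \<Longrightarrow> 0 < cdim p \<Longrightarrow> cdim p < cdim u \<Longrightarrow> cdim p < cdim v \<Longrightarrow>
    ccomp p (ccomp u v) = ccomp (ccomp p u) (ccomp p v)"
  "well_dim u \<Longrightarrow> well_dim v \<Longrightarrow> 0 < cdim p \<Longrightarrow> cdim p < cdim u \<Longrightarrow> cdim p < cdim v \<Longrightarrow>
    ccomp (ccomp u v) p = ccomp (ccomp u p) (ccomp v p)"
  using ccomp_assoc[of u v w "cdim u - 1"] ccomp_assoc[of u v w "cdim v - 1"] dim_ccomp[of u v]
    well_dim_ccomp[of u v] ccomp_distrib[of u v p]
  by (auto simp: has_dim_def max_def)

text \<open>The four regroupings by which a branching for a single whisker, once placed in a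
  one-sided context, becomes a natural branching. The first two serve contexts on the right, the
  last two contexts on the left.\<close>

lemma ccomp_rearrange:
  assumes "has_dim 1 q" "has_dim 1 r" "has_dim 1 f" "has_dim 2 b" "has_dim 2 c" "has_dim 3 F"
  shows "ccomp (ccomp (ccomp (ccomp F q) (ccomp f b)) r) (ccomp f c) =
      ccomp (ccomp F (ccomp q r)) (ccomp f (ccomp (ccomp b r) c))"
    "ccomp (ccomp (ccomp (ccomp b q) F) r) c = ccomp (ccomp (ccomp b (ccomp q r)) (ccomp F r)) c"
    "ccomp (ccomp c r) (ccomp f (ccomp (ccomp b r) (ccomp q F))) = ccomp (ccomp (ccomp c (ccomp f b)) r) (ccomp (ccomp f q) F)"
    "ccomp b (ccomp f (ccomp F (ccomp q c))) = ccomp (ccomp b (ccomp f F)) (ccomp (ccomp f q) c)"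
  using assms by (simp_all add: ccomp_normal_simps)

text \<open>The number of whiskers is a size: it is additive in equal dimensions and unaffected by
  whiskering with cells of lower dimension.\<close>

lemma length_whiskers_ccomp:
  assumes "0 < cdim u" "0 < cdim v"
  shows "length (whiskers (ccomp u v)) =
    (if cdim u < cdim v then length (whiskers v) else if cdim v < cdim u then length (whiskers u)
     else length (whiskers u) + length (whiskers v))"
proof -
  obtain s ws t vs where "u = Cell s ws" "v = Cell t vs" using assms dim_pos by metis
  then show ?thesis by (auto simp: ccomp_def)
qed

lemma is_identity_iff: "0 < cdim u \<Longrightarrow> is_identity u \<longleftrightarrow> whiskers u = []"
  by (cases u) (auto simp: is_identity_def idc_def)

locale gray =
  fixes Q :: "('g, 'z) gray_scheme"
  assumes gray_presentation: "gray_presentation Q"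
begin

lemma poly4: "prepolygraph 4 Q" and ichg_gens: "has_interchange_generators Q"
  using gray_presentation by (auto simp: gray_presentation_def)

lemma poly3: "prepolygraph 3 Q"
  using poly4 by (simp add: prepolygraph_def)

section \<open>Boundaries of composites in dimensions up to 3\<close>

lemma boundary_2:
  assumes "is_cell Q 2 u"
  shows "is_cell Q 1 (csrc u)" "is_cell Q 1 (ctgt Q u)" "bsrc 0 (csrc u) = bsrc 0 u" "bsrc 0 (ctgt Q u) = bsrc 0 u"
    "btgt Q 0 (csrc u) = btgt Q 0 u" "btgt Q 0 (ctgt Q u) = btgt Q 0 u"
  using bound_2[OF poly3 ichg_gens assms] by simp_all

lemma boundary_3:
  assumes "is_cell Q 3 F"
  shows "is_cell Q 2 (csrc F)" "is_cell Q 2 (ctgt Q F)" "csrc (ctgt Q F) = csrc (csrc F)" "ctgt Q (ctgt Q F) = ctgt Q (csrc F)"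
   "bsrc 0 (csrc F) = bsrc 0 F" "bsrc 0 (ctgt Q F) = bsrc 0 F" "btgt Q 0 (csrc F) = btgt Q 0 F" "btgt Q 0 (ctgt Q F) = btgt Q 0 F"
   "bsrc 1 F = csrc (csrc F)" "btgt Q 1 F = ctgt Q (csrc F)" "bsrc 2 F = csrc F" "btgt Q 2 F = ctgt Q F"
  using bound_3[OF poly3 ichg_gens assms] bound_bound[OF poly3 glob[OF poly3 order_refl] order_refl assms, of 0 2]
  by simp_all


lemma comp_0_left:
  assumes "is_cell Q 1 p" "is_cell Q k u" "1 \<le> k" "k \<le> 3" "btgt Q 0 p = bsrc 0 u"
  shows "is_cell Q k (ccomp p u)" "bsrc 0 (ccomp p u) = bsrc 0 p" "btgt Q 0 (ccomp p u) = btgt Q 0 u"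
    "1 < k \<Longrightarrow> csrc (ccomp p u) = ccomp p (csrc u)" "1 < k \<Longrightarrow> ctgt Q (ccomp p u) = ccomp p (ctgt Q u)"
proof -
  obtain l where l: "k = Suc l" using assms(3) by (cases k) auto
  note c = ccomp_cell[OF poly3, of 0 p k u, unfolded One_nat_def[symmetric], OF assms(1,2,4) _ assms(5)]
  show c1: "is_cell Q k (ccomp p u)" using c(1) assms(3) by simp
  show "bsrc 0 (ccomp p u) = bsrc 0 p" "btgt Q 0 (ccomp p u) = btgt Q 0 u"
    using c(2,3)[of 0] assms(3) by simp_all
  show "1 < k \<Longrightarrow> csrc (ccomp p u) = ccomp p (csrc u)" "1 < k \<Longrightarrow> ctgt Q (ccomp p u) = ccomp p (ctgt Q u)"
    using c(4,5)[of l] src_eq[OF poly3, of l] tgt_eq[OF poly3, of l] c1 assms(2,4) by (auto simp: l)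
qed

lemma comp_0_right:
  assumes "is_cell Q 1 p" "is_cell Q k u" "1 \<le> k" "k \<le> 3" "btgt Q 0 u = bsrc 0 p"
  shows "is_cell Q k (ccomp u p)" "bsrc 0 (ccomp u p) = bsrc 0 u" "btgt Q 0 (ccomp u p) = btgt Q 0 p"
    "1 < k \<Longrightarrow> csrc (ccomp u p) = ccomp (csrc u) p" "1 < k \<Longrightarrow> ctgt Q (ccomp u p) = ccomp (ctgt Q u) p"
proof -
  obtain l where l: "k = Suc l" using assms(3) by (cases k) auto
  note c = ccomp_cell'[OF poly3, of 0 p k u, unfolded One_nat_def[symmetric], OF assms(1,2,4) _ assms(5)]
  show c1: "is_cell Q k (ccomp u p)" using c(1) assms(3) by simp
  show "bsrc 0 (ccomp u p) = bsrc 0 u" "btgt Q 0 (ccomp u p) = btgt Q 0 p"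
    using c(2,3)[of 0] assms(3) by simp_all
  show "1 < k \<Longrightarrow> csrc (ccomp u p) = ccomp (csrc u) p" "1 < k \<Longrightarrow> ctgt Q (ccomp u p) = ccomp (ctgt Q u) p"
    using c(4,5)[of l] src_eq[OF poly3, of l] tgt_eq[OF poly3, of l] c1 assms(2,4) by (auto simp: l)
qed

lemma comp_1_22:
  assumes "is_cell Q 2 u" "is_cell Q 2 v" "ctgt Q u = csrc v"
  shows "is_cell Q 2 (ccomp u v)" "csrc (ccomp u v) = csrc u" "ctgt Q (ccomp u v) = ctgt Q v"
    "bsrc 0 (ccomp u v) = bsrc 0 u" "btgt Q 0 (ccomp u v) = btgt Q 0 v"
proof -
  note c = one_comp_2_2[OF poly3 ichg_gens assms]
  show "is_cell Q 2 (ccomp u v)" "csrc (ccomp u v) = csrc u" "ctgt Q (ccomp u v) = ctgt Q v" by (fact c)+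
  show "bsrc 0 (ccomp u v) = bsrc 0 u" "btgt Q 0 (ccomp u v) = btgt Q 0 v"
    using boundary_2(3,6)[OF c(1)] boundary_2(3)[OF assms(1)] boundary_2(6)[OF assms(2)] by (simp_all only: c)
qed

lemma comp_1_23:
  assumes "is_cell Q 2 u" "is_cell Q 3 F" "ctgt Q u = csrc (csrc F)"
  shows "is_cell Q 3 (ccomp u F)" "csrc (ccomp u F) = ccomp u (csrc F)" "ctgt Q (ccomp u F) = ccomp u (ctgt Q F)"
    "bsrc 0 (ccomp u F) = bsrc 0 u" "btgt Q 0 (ccomp u F) = btgt Q 0 F"
proof -
  note c = one_comp_2_3[OF poly3 ichg_gens assms]
  show "is_cell Q 3 (ccomp u F)" "csrc (ccomp u F) = ccomp u (csrc F)" "ctgt Q (ccomp u F) = ccomp u (ctgt Q F)" by (fact c)+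
  show "bsrc 0 (ccomp u F) = bsrc 0 u" "btgt Q 0 (ccomp u F) = btgt Q 0 F"
    using boundary_3[OF c(1)] boundary_3[OF assms(2)] comp_1_22[OF assms(1) boundary_3(1)[OF assms(2)] assms(3)] c by simp_all
qed

lemma comp_1_32:
  assumes "is_cell Q 2 u" "is_cell Q 3 F" "ctgt Q (csrc F) = csrc u"
  shows "is_cell Q 3 (ccomp F u)" "csrc (ccomp F u) = ccomp (csrc F) u" "ctgt Q (ccomp F u) = ccomp (ctgt Q F) u"
    "bsrc 0 (ccomp F u) = bsrc 0 F" "btgt Q 0 (ccomp F u) = btgt Q 0 u"
proof -
  note c = one_comp_3_2[OF poly3 ichg_gens assms]
  show "is_cell Q 3 (ccomp F u)" "csrc (ccomp F u) = ccomp (csrc F) u" "ctgt Q (ccomp F u) = ccomp (ctgt Q F) u" by (fact c)+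
  show "bsrc 0 (ccomp F u) = bsrc 0 F" "btgt Q 0 (ccomp F u) = btgt Q 0 u"
    using boundary_3[OF c(1)] boundary_3[OF assms(2)] comp_1_22[OF boundary_3(1)[OF assms(2)] assms(1,3)] c by simp_all
qed

lemma comp_2:
  assumes "is_cell Q 3 F" "is_cell Q 3 G" "ctgt Q F = csrc G"
  shows "is_cell Q 3 (ccomp F G)" "csrc (ccomp F G) = csrc F" "ctgt Q (ccomp F G) = ctgt Q G"
    "bsrc 0 (ccomp F G) = bsrc 0 F" "btgt Q 0 (ccomp F G) = btgt Q 0 G"
proof -
  note c = two_comp[OF poly3 ichg_gens assms]
  show "is_cell Q 3 (ccomp F G)" "csrc (ccomp F G) = csrc F" "ctgt Q (ccomp F G) = ctgt Q G" by (fact c)+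
  show "bsrc 0 (ccomp F G) = bsrc 0 F" "btgt Q 0 (ccomp F G) = btgt Q 0 G"
    using boundary_3(5,8)[OF c(1)] boundary_3(5)[OF assms(1)] boundary_3(8)[OF assms(2)] by (simp_all only: c)
qed

lemma cell_idc:
  "is_cell Q 1 p \<Longrightarrow> is_cell Q 2 (idc p)" "is_cell Q 2 u \<Longrightarrow> is_cell Q 3 (idc u)"
  using idc_cell[of Q 1 p] idc_cell[of Q 2 u] by (simp_all add: numeral_2_eq_2 numeral_3_eq_3 del: idc_cell)

lemma boundary_idc: "csrc (idc x) = x" "ctgt Q (idc x) = x"
  by (simp_all add: idc_def)

lemma boundary0_idc:
   "is_cell Q 0 x \<Longrightarrow> bsrc 0 (idc x) = x" "is_cell Q 0 x \<Longrightarrow> btgt Q 0 (idc x) = x"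
   "is_cell Q 1 p \<Longrightarrow> bsrc 0 (idc p) = bsrc 0 p" "is_cell Q 1 p \<Longrightarrow> btgt Q 0 (idc p) = btgt Q 0 p"
  using boundary_2[OF cell_idc(1), of p] bsrc_idc[OF poly3, of 0 x] btgt_idc[OF poly3, of 0 x] by (simp_all add: boundary_idc)

lemma boundary_cells:
  assumes "is_cell Q k u" "k \<le> 3"
  shows "is_cell Q 0 (bsrc 0 u)" "is_cell Q 0 (btgt Q 0 u)"
  using bound_cell[OF poly3 glob[OF poly3 order_refl] _ assms(1), of 0] assms(2) by auto


section \<open>Unit laws and whiskered identities\<close>

lemma unit:
  assumes "is_cell Q k u" "i < k" "k \<le> 3"
  shows "ccomp u (idc (btgt Q i u)) = u" "ccomp (idc (bsrc i u)) u = u"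
proof -
  have "cdim (bsrc i u) = i" "cdim (btgt Q i u) = i" "cdim u = k"
    using bound_cell[OF poly3 glob[OF poly3 order_refl] assms(3,1), of i] assms(1,2) is_cell_dim(1) by fastforce+
  then show "ccomp u (idc (btgt Q i u)) = u" "ccomp (idc (bsrc i u)) u = u"
    using rcomp_idc[OF poly3 assms(3,2,1)] lcomp_idc[OF poly3 assms(3,2,1)] assms(2)
    by (simp_all add: ccomp_left ccomp_right)
qed

lemma units:
  "is_cell Q 2 u \<Longrightarrow> ccomp u (idc (ctgt Q u)) = u" "is_cell Q 2 u \<Longrightarrow> ccomp (idc (csrc u)) u = u"
  "is_cell Q 3 F \<Longrightarrow> ccomp F (idc (ctgt Q (csrc F))) = F" "is_cell Q 3 F \<Longrightarrow> ccomp (idc (csrc (csrc F))) F = F"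
  "is_cell Q 3 F \<Longrightarrow> ccomp F (idc (ctgt Q F)) = F" "is_cell Q 3 F \<Longrightarrow> ccomp (idc (csrc F)) F = F"
  using unit[of 2 u 1] bound_2(1,2)[OF poly3 ichg_gens, of u] unit[of 3 F 1] unit[of 3 F 2] boundary_3[of F] by simp_all

lemma idc_whisker:
  "is_cell Q 1 p \<Longrightarrow> is_cell Q 1 q \<Longrightarrow> ccomp p (idc q) = idc (ccomp p q)"
  "is_cell Q 1 p \<Longrightarrow> is_cell Q 1 q \<Longrightarrow> ccomp (idc q) p = idc (ccomp q p)"
  "is_cell Q 1 p \<Longrightarrow> is_cell Q 2 u \<Longrightarrow> ccomp p (idc u) = idc (ccomp p u)"
  "is_cell Q 1 p \<Longrightarrow> is_cell Q 2 u \<Longrightarrow> ccomp (idc u) p = idc (ccomp u p)"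
  "is_cell Q 2 v \<Longrightarrow> is_cell Q 2 u \<Longrightarrow> ccomp v (idc u) = idc (ccomp v u)"
  "is_cell Q 2 v \<Longrightarrow> is_cell Q 2 u \<Longrightarrow> ccomp (idc u) v = idc (ccomp u v)"
  using is_cell_dim(1)[of Q 1 p] is_cell_dim(1)[of Q 1 q] is_cell_dim(1)[of Q 2 u] is_cell_dim(1)[of Q 2 v]
  by (auto simp: idc_def ccomp_left ccomp_right lcomp_eq_rcomp)

section \<open>The congruence generated by the 4-generators\<close>

text \<open>Written with \<open>Suc 3\<close> to agree literally with
  \<open>presented_precat_def\<close>; \<open>sim_I\<close> and \<open>sim_D\<close> restate it with
  the numeral 4.\<close>

definition sim :: "('g cell \<times> 'g cell) set" where
  "sim = congruence_generated 3 (free_precat 3 Q)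
     {(gsrc Q (Suc 3) A, gtgt Q (Suc 3) A) |A. A \<in> gens Q (Suc 3)}"

lemma presented_precat_sim: "presented_precat 3 Q = quotient_precat 3 (free_precat 3 Q) sim"
  by (simp add: presented_precat_def sim_def)

lemma parallel_whisker:
  assumes "parallel Q 3 u u'" "i < 3"
    and "is_cell Q (Suc i) v" "btgt Q i v = bsrc i u" "is_cell Q (Suc i) w" "btgt Q i u = bsrc i w"
  shows "parallel Q 3 (ccomp (ccomp v u) w) (ccomp (ccomp v u') w)"
proof -
  note g = glob[OF poly3 order_refl] clos[OF poly3 order_refl] order_refl
  note pb = parallel_bound[OF poly3 g(1) order_refl assms(1,2)]
  have u: "is_cell Q 3 u" "is_cell Q 3 u'" using assms(1) by (auto simp: parallel_def[OF poly3])
  note s = ctx_step[OF poly3 g u(1) order_refl _ assms(3,5,4,6)]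
    and s' = ctx_step[OF poly3 g u(2) order_refl _ assms(3,5), unfolded pb[symmetric], OF _ assms(4,6)]
  have l: "parallel Q 3 (lcomp v u) (lcomp v u')"
    using parallel_lcomp[OF poly3 g assms(1) order_refl assms(3) _ assms(4)] assms(2) by simp
  have "btgt Q i (lcomp v u) = bsrc i w"
    using lcomp_bound[OF poly3 g(1) order_refl assms(3) _ order_refl u(1) assms(4), of i] assms(2,6) by auto
  from parallel_rcomp[OF poly3 g l order_refl assms(5) _ this]
  show ?thesis using s(10) s'(10) assms(2) by simp
qed

text \<open>Parallelism is itself a congruence and contains the boundary pairs of the 4-generators.
  Hence the intersection defining \<open>sim\<close> is over a nonempty family, and
  \<open>sim\<close> relates only parallel 3-cells.\<close>

lemma congruence_parallel: "congruence 3 (free_precat 3 Q) {(u, u'). parallel Q 3 u u'}"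
proof -
  have "equiv (Cel (free_precat 3 Q) 3) {(u, u'). parallel Q 3 u u'}"
    by (rule equivI) (auto simp: refl_on_def sym_def trans_def free_precat_simps[OF poly3] parallel_def[OF poly3])
  then show ?thesis
    using parallel_whisker
    by (auto simp: congruence_def composable_free_left[OF poly3] composable_free_right[OF poly3] free_precat_simps[OF poly3]
        parallel_def[OF poly3])
qed

text \<open>\<open>sim\<close> is an intersection and not an inductive set: each of its closure
  properties is checked in every congruence \<open>R\<close> containing the generating
  pairs.\<close>

lemma sim_I: "(\<And>R. congruence 3 (free_precat 3 Q) R \<Longrightarrow>
    {(gsrc Q 4 A, gtgt Q 4 A) |A. A \<in> gens Q 4} \<subseteq> R \<Longrightarrow> (u, v) \<in> R) \<Longrightarrow> (u, v) \<in> sim"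
  by (simp add: sim_def congruence_generated_def)

lemma sim_D: "(u, v) \<in> sim \<Longrightarrow> congruence 3 (free_precat 3 Q) R \<Longrightarrow>
    {(gsrc Q 4 A, gtgt Q 4 A) |A. A \<in> gens Q 4} \<subseteq> R \<Longrightarrow> (u, v) \<in> R"
  by (auto simp: sim_def congruence_generated_def)

lemma sim_parallel: "(u, v) \<in> sim \<Longrightarrow> parallel Q 3 u v"
proof -
  have "parallel Q 3 (gsrc Q 4 A) (gtgt Q 4 A)" if "A \<in> gens Q 4" for A
    using gen_boundary[OF poly4, of A 3] that by (simp add: parallel_def[OF poly3])
  then show "(u, v) \<in> sim \<Longrightarrow> parallel Q 3 u v" using sim_D[OF _ congruence_parallel] by blast
qed

lemma sim_gen: "A \<in> gens Q 4 \<Longrightarrow> (gsrc Q 4 A, gtgt Q 4 A) \<in> sim"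
  by (auto intro: sim_I)

lemma sim_refl: "is_cell Q 3 F \<Longrightarrow> (F, F) \<in> sim"
  by (rule sim_I) (auto simp: congruence_def equiv_def refl_on_def free_precat_simps[OF poly3])

lemma sim_sym: "(F, G) \<in> sim \<Longrightarrow> (G, F) \<in> sim"
  by (rule sim_I, drule sim_D) (auto simp: congruence_def equiv_def dest: symD)

lemma sim_trans [trans]: "(F, G) \<in> sim \<Longrightarrow> (G, H) \<in> sim \<Longrightarrow> (F, H) \<in> sim"
  by (rule sim_I) (auto simp: congruence_def equiv_def dest!: sim_D elim: transD)

lemma equiv_sim: "equiv {F. is_cell Q 3 F} sim"
  using sim_parallel
  by (intro equivI) (auto simp: refl_on_def parallel_def[OF poly3] intro: sim_refl sim_sym symI transI sim_trans)

lemma sim_whisker: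
  assumes "(F, G) \<in> sim" "i < 3"
    and "is_cell Q (Suc i) u" "btgt Q i u = bsrc i F" "is_cell Q (Suc i) v" "btgt Q i F = bsrc i v"
  shows "(ccomp (ccomp u F) v, ccomp (ccomp u G) v) \<in> sim"
proof (rule sim_I)
  fix R assume R: "congruence 3 (free_precat 3 Q) R" "{(gsrc Q 4 A, gtgt Q 4 A) |A. A \<in> gens Q 4} \<subseteq> R"
  have "(F, G) \<in> R" by (rule sim_D[OF assms(1) R])
  moreover have "is_cell Q 3 F" using sim_parallel[OF assms(1)] by (simp add: parallel_def[OF poly3])
  then have "composable (free_precat 3 Q) (Suc i) 3 u F" "composable (free_precat 3 Q) 3 (Suc i) F v"
    using assms by (simp_all add: composable_free_left[OF poly3] composable_free_right[OF poly3])
  ultimately show "(ccomp (ccomp u F) v, ccomp (ccomp u G) v) \<in> R"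
    using R(1) assms(2) unfolding congruence_def by (auto simp: free_precat_simps[OF poly3])
qed

lemma sim_comp:
  assumes "(F, F') \<in> sim" "(G, G') \<in> sim" "ctgt Q F = csrc G"
  shows "(ccomp F G, ccomp F' G') \<in> sim"
proof -
  have c: "is_cell Q 3 F" "is_cell Q 3 F'" "is_cell Q 3 G" "is_cell Q 3 G'"
    "csrc F = csrc F'" "ctgt Q F = ctgt Q F'" "csrc G = csrc G'" "ctgt Q G = ctgt Q G'"
    using sim_parallel[OF assms(1)] sim_parallel[OF assms(2)] by (simp_all add: parallel_def[OF poly3])
  \<comment> \<open>Stability of a congruence is stated for two-sided contexts, so the missing side
    is filled by an identity. First \<open>F\<close> is replaced next to \<open>G\<close>, then
    \<open>G\<close> next to \<open>F'\<close>.\<close>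
  have "(ccomp (ccomp (idc (csrc F)) F) G, ccomp (ccomp (idc (csrc F)) F') G) \<in> sim"
    using sim_whisker[OF assms(1), of 2 "idc (csrc F)" G] c assms(3)
    by (simp add: cell_idc boundary_3 boundary_idc flip: numeral_3_eq_3)
  moreover have "(ccomp (ccomp F' G) (idc (ctgt Q G)), ccomp (ccomp F' G') (idc (ctgt Q G))) \<in> sim"
    using sim_whisker[OF assms(2), of 2 F' "idc (ctgt Q G)"] c assms(3)
    by (simp add: cell_idc boundary_3 boundary_idc flip: numeral_3_eq_3)
  ultimately show ?thesis
    using c assms(3) units(5)[OF comp_2(1), of F' G] units(5)[OF comp_2(1), of F' G'] comp_2(3)[of F' G] comp_2(3)[of F' G']
      units(6)[of F] units(6)[of F']
    by (auto intro: sim_trans)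
qed

end

text \<open>Keeps dimension 1 in the numeral form of the boundary facts instead of letting it become
  \<open>Suc 0\<close>.\<close>

declare One_nat_def [simp del]

context gray begin

lemmas comp_0 =
  comp_0_left[where k = 1, simplified] comp_0_left[where k = 2, simplified] comp_0_left[where k = 3, simplified]
  comp_0_right[where k = 2, simplified] comp_0_right[where k = 3, simplified]
lemmas comp_cells = comp_0 comp_1_22 comp_1_23 comp_1_32 comp_2

lemmas boundary_cell = boundary_2 boundary_3(1-8)

section \<open>Two-sided contexts of 2-cells and 3-cells\<close>

lemma bound_1_cell2: "is_cell Q 2 u \<Longrightarrow> bsrc 1 u = csrc u" "is_cell Q 2 u \<Longrightarrow> btgt Q 1 u = ctgt Q u"
  using bound_2(1,2)[OF poly3 ichg_gens, of u] by simp_all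

lemma in_context_2: "is_cell Q 2 u \<Longrightarrow> in_context Q \<mu> l u r \<rho> \<longleftrightarrow>
    is_cell Q 1 l \<and> is_cell Q 1 r \<and> is_cell Q 2 \<mu> \<and> is_cell Q 2 \<rho> \<and> btgt Q 0 l = bsrc 0 u \<and> btgt Q 0 u = bsrc 0 r \<and>
    ctgt Q \<mu> = ccomp (ccomp l (csrc u)) r \<and> csrc \<rho> = ccomp (ccomp l (ctgt Q u)) r"
  unfolding in_context_def composable3_def
  by (auto simp: comp_cells boundary_cell bound_1_cell2)

text \<open>Whether a context fits depends only on boundaries of dimension at most 1, which a 3-cell
  shares with its source and its target. Contexts can thus be carried along chains of
  3-cells.\<close>

lemma in_context_3: "is_cell Q 3 F \<Longrightarrow> in_context Q \<mu> l F r \<rho> \<longleftrightarrow> in_context Q \<mu> l (csrc F) r \<rho>"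
  unfolding in_context_2[OF boundary_3(1)] unfolding in_context_def composable3_def
  by (auto simp: comp_cells boundary_2 boundary_3 bound_1_cell2)

lemma in_context_3': "is_cell Q 3 F \<Longrightarrow> in_context Q \<mu> l F r \<rho> \<longleftrightarrow> in_context Q \<mu> l (ctgt Q F) r \<rho>"
  by (simp add: in_context_3 in_context_2 boundary_3)

lemma whisker_context_cell:
  assumes "is_cell Q 3 F" "in_context Q \<mu> l F r \<rho>"
  shows "is_cell Q 3 (whisker_context \<mu> l F r \<rho>)"
    "csrc (whisker_context \<mu> l F r \<rho>) = whisker_context \<mu> l (csrc F) r \<rho>"
    "ctgt Q (whisker_context \<mu> l F r \<rho>) = whisker_context \<mu> l (ctgt Q F) r \<rho>"
  using assms by (simp_all add: whisker_context_def in_context_3 in_context_2 comp_cells boundary_cell)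

lemma whisker_context_comp:
  assumes "is_cell Q 3 F" "is_cell Q 3 G" "in_context Q \<mu> l F r \<rho>"
  shows "whisker_context \<mu> l (ccomp F G) r \<rho> = ccomp (whisker_context \<mu> l F r \<rho>) (whisker_context \<mu> l G r \<rho>)"
proof -
  have "has_dim 1 l" "has_dim 1 r" "has_dim 2 \<mu>" "has_dim 2 \<rho>" "has_dim 3 F" "has_dim 3 G"
    using assms by (auto simp: in_context_def intro: has_dim_cell)
  then show ?thesis by (simp add: whisker_context_def ccomp_normal_simps)
qed

lemma sim_whisker_context:
  assumes "(F, G) \<in> sim" "in_context Q \<mu> l F r \<rho>"
  shows "(whisker_context \<mu> l F r \<rho>, whisker_context \<mu> l G r \<rho>) \<in> sim"
proof -
  have "(ccomp (ccomp l F) r, ccomp (ccomp l G) r) \<in> sim"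
    using sim_whisker[OF assms(1), of 0 l r] assms(2) by (simp add: in_context_def composable3_def flip: One_nat_def)
  from sim_whisker[OF this, of 1 \<mu> \<rho>] show ?thesis
    using assms(2) by (simp add: in_context_def composable3_def whisker_context_def flip: numeral_2_eq_2)
qed

section \<open>Rewriting steps and confluence\<close>

lemma gen3:
  assumes "A \<in> gens Q 3"
  shows "is_cell Q 3 (gen Q 3 A)" "csrc (gen Q 3 A) = gsrc Q 3 A" "ctgt Q (gen Q 3 A) = gtgt Q 3 A"
    "is_cell Q 2 (gsrc Q 3 A)" "is_cell Q 2 (gtgt Q 3 A)"
    "csrc (gtgt Q 3 A) = csrc (gsrc Q 3 A)" "ctgt Q (gtgt Q 3 A) = ctgt Q (gsrc Q 3 A)"
    "bsrc 0 (gen Q 3 A) = bsrc 0 (gsrc Q 3 A)" "btgt Q 0 (gen Q 3 A) = btgt Q 0 (gsrc Q 3 A)"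
    "bsrc 0 (gtgt Q 3 A) = bsrc 0 (gsrc Q 3 A)" "btgt Q 0 (gtgt Q 3 A) = btgt Q 0 (gsrc Q 3 A)"
proof -
  show g: "is_cell Q 3 (gen Q 3 A)" "csrc (gen Q 3 A) = gsrc Q 3 A" "ctgt Q (gen Q 3 A) = gtgt Q 3 A"
    using is_cell_gen[OF poly3, of A 2] assms by simp_all
  show "is_cell Q 2 (gsrc Q 3 A)" "is_cell Q 2 (gtgt Q 3 A)"
    "csrc (gtgt Q 3 A) = csrc (gsrc Q 3 A)" "ctgt Q (gtgt Q 3 A) = ctgt Q (gsrc Q 3 A)"
    "bsrc 0 (gen Q 3 A) = bsrc 0 (gsrc Q 3 A)" "btgt Q 0 (gen Q 3 A) = btgt Q 0 (gsrc Q 3 A)"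
    "bsrc 0 (gtgt Q 3 A) = bsrc 0 (gsrc Q 3 A)" "btgt Q 0 (gtgt Q 3 A) = btgt Q 0 (gsrc Q 3 A)"
    using boundary_3[OF g(1)] g by simp_all
qed

lemma rewriting_step_cell: "rewriting_step Q S \<Longrightarrow> is_cell Q 3 S"
  unfolding rewriting_step_def using whisker_context_cell(1) gen3(1) by auto

text \<open>The context of a 3-dimensional whisker is a list of two pairs, \<open>(l, r)\<close> of
  1-cells and \<open>(\<mu>, \<rho>)\<close> of 2-cells. \<open>plug\<close> applies them from the
  inside out, as \<open>whisker_context\<close> does.\<close>

lemma whisker_rewriting_step:
  assumes w: "is_whisker Q 2 w"
  shows "rewriting_step Q (wcell Q w)"
proof -
  obtain A c where Ac: "w = (A, c)" "A \<in> gens Q 3" "length c = 2" "is_context Q 0 (gsrc Q 3 A) c"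
    using w by (cases w) (auto simp: is_whisker_def)
  then obtain l r \<mu> \<rho> where c: "c = [(l, r), (\<mu>, \<rho>)]"
    by (auto simp: numeral_2_eq_2 length_Suc_conv)
  have "in_context Q \<mu> l (gsrc Q 3 A) r \<rho>"
    using Ac(4) unfolding c in_context_def composable3_def
    by (auto elim!: is_context.cases simp: numeral_2_eq_2 One_nat_def)
  then have "in_context Q \<mu> l (gen Q 3 A) r \<rho>" using gen3[OF Ac(2)] by (simp add: in_context_3)
  moreover have "wcell Q w = whisker_context \<mu> l (gen Q 3 A) r \<rho>"
    using plug_gen(1)[OF poly3 w] by (simp add: Ac(1) c whisker_context_def)
  ultimately show ?thesis using Ac(2) unfolding rewriting_step_def by blast
qed

text \<open>Splits off the first whisker of the list that represents a 3-cell; this is what makes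
  3-cells sequences of rewriting steps.\<close>

lemma cell3_cases:
  assumes "is_cell Q 3 F"
  obtains "F = idc (csrc F)" | S F' where "rewriting_step Q S" "is_cell Q 3 F'" "csrc F' = ctgt Q S" "F = ccomp S F'"
proof -
  obtain \<phi> ws where F: "F = Cell \<phi> ws" using is_cell_dim(1)[OF assms] dim_pos[of F] by auto
  show thesis
  proof (cases ws)
    case Nil then show ?thesis using F that(1) by (simp add: idc_def)
  next
    case (Cons w ws')
    have c: "is_cell Q (Suc 2) (Cell \<phi> (w # ws'))" using assms F Cons by simp
    note cc = Cell_Cons[OF poly3 c]
    have "is_whisker Q 2 w" using c by (simp only: is_cell_Cell list.set_intros)
    then show ?thesis
      using that(2)[OF whisker_rewriting_step, of w "Cell (wtgt Q w) ws'"] cc F Cons by (simp add: wcell_def)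
  qed
qed

text \<open>Neither a common source of \<open>F\<close> and \<open>G\<close> nor a common end of the
  closing cells is demanded: both follow because \<open>sim\<close> relates only parallel
  cells.\<close>

definition confluent :: "'g cell \<Rightarrow> 'g cell \<Rightarrow> bool" where
  "confluent F G \<longleftrightarrow> is_cell Q 3 F \<and> is_cell Q 3 G \<and> (\<exists>F' G'. is_cell Q 3 F' \<and> csrc F' = ctgt Q F \<and> is_cell Q 3 G' \<and> csrc G' = ctgt Q G \<and>
     (ccomp F F', ccomp G G') \<in> sim)"

lemma confluentI:
  "is_cell Q 3 F \<Longrightarrow> is_cell Q 3 G \<Longrightarrow> is_cell Q 3 F' \<Longrightarrow> csrc F' = ctgt Q F \<Longrightarrow> is_cell Q 3 G' \<Longrightarrow> csrc G' = ctgt Q G \<Longrightarrow>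
   (ccomp F F', ccomp G G') \<in> sim \<Longrightarrow> confluent F G"
  by (auto simp: confluent_def)

lemma confluent_sym: "confluent F G \<Longrightarrow> confluent G F"
  unfolding confluent_def using sim_sym by blast

lemma confluentD:
  assumes "confluent F G"
  shows "is_cell Q 3 F" "is_cell Q 3 G" "csrc F = csrc G"
proof -
  show FG: "is_cell Q 3 F" "is_cell Q 3 G" using assms by (auto simp: confluent_def)
  obtain F' G' where "is_cell Q 3 F'" "csrc F' = ctgt Q F" "is_cell Q 3 G'" "csrc G' = ctgt Q G"
    "(ccomp F F', ccomp G G') \<in> sim"
    using assms by (auto simp: confluent_def)
  then show "csrc F = csrc G"
    using sim_parallel comp_2(2)[OF FG(1), of F'] comp_2(2)[OF FG(2), of G'] by (simp add: parallel_def[OF poly3])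
qed

text \<open>A context distributes over \<open>*\<^sub>2\<close>, so the closing cells of the new
  branching are the old ones in the same context.\<close>

lemma confluent_whisker_context:
  assumes c: "confluent F G" and "in_context Q \<mu> l F r \<rho>"
  shows "confluent (whisker_context \<mu> l F r \<rho>) (whisker_context \<mu> l G r \<rho>)"
proof -
  note FGc = confluentD[OF c]
  obtain F' G' where FG: "is_cell Q 3 F'" "csrc F' = ctgt Q F" "is_cell Q 3 G'" "csrc G' = ctgt Q G"
    "(ccomp F F', ccomp G G') \<in> sim"
    using c by (auto simp: confluent_def)
  have G: "in_context Q \<mu> l G r \<rho>" using assms(2) FGc by (simp add: in_context_3)
  have F': "in_context Q \<mu> l F' r \<rho>" using assms(2) FGc(1) FG(1,2) by (simp add: in_context_3'[of F] in_context_3[of F'])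
  have G': "in_context Q \<mu> l G' r \<rho>" using FGc(2) G FG(3,4) by (simp add: in_context_3'[of G] in_context_3[of G'])
  have "in_context Q \<mu> l (ccomp F F') r \<rho>"
    using assms(2) FGc(1) FG comp_2[of F F'] by (simp add: in_context_3)
  from sim_whisker_context[OF FG(5) this]
  have "(ccomp (whisker_context \<mu> l F r \<rho>) (whisker_context \<mu> l F' r \<rho>),
      ccomp (whisker_context \<mu> l G r \<rho>) (whisker_context \<mu> l G' r \<rho>)) \<in> sim"
    using whisker_context_comp[OF FGc(1) FG(1) assms(2)] whisker_context_comp[OF FGc(2) FG(3) G] by simp
  then show ?thesis
    using whisker_context_cell[OF FGc(1) assms(2)] whisker_context_cell[OF FGc(2) G]
      whisker_context_cell[OF FG(1) F'] whisker_context_cell[OF FG(3) G'] FG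
    by (intro confluentI[of _ _ "whisker_context \<mu> l F' r \<rho>" "whisker_context \<mu> l G' r \<rho>"]) simp_all
qed

end

section \<open>Zigzags and localization\<close>

lemma zpath_end: "zpath n C x es \<Longrightarrow> zend n C x es \<in> Cel C (n - 1)"
  by (induction es arbitrary: x) auto

lemma congruence_stable:
  assumes "congruence n C R" "(u, u') \<in> R" "i < n" "composable C (Suc i) n v u" "composable C n (Suc i) u w"
  shows "(Cmp C n (Suc i) (Cmp C (Suc i) n v u) w, Cmp C n (Suc i) (Cmp C (Suc i) n v u') w) \<in> R"
  using assms unfolding congruence_def by blast

lemma congruence_symD: "congruence n C R \<Longrightarrow> (u, v) \<in> R \<Longrightarrow> (v, u) \<in> R"
  unfolding congruence_def equiv_def by (blast dest: symD)

lemma congruence_transD: "congruence n C R \<Longrightarrow> (u, v) \<in> R \<Longrightarrow> (v, w) \<in> R \<Longrightarrow> (u, w) \<in> R"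
  unfolding congruence_def equiv_def by (blast dest: transD)

lemma congruence_reflD: "congruence n C R \<Longrightarrow> u \<in> Cel C n \<Longrightarrow> (u, u) \<in> R"
  unfolding congruence_def equiv_def refl_on_def by blast

lemma congruence_boundary:
  "congruence (Suc k) C R \<Longrightarrow> (u, v) \<in> R \<Longrightarrow> Src C k u = Src C k v \<and> Tgt C k u = Tgt C k v"
  unfolding congruence_def by blast

text \<open>Top-dimensional composition of zigzags is concatenation, so stability with
  \<open>i = 2\<close> allows a segment inside a zigzag to be replaced.\<close>

lemma congruence_zigzag_concat:
  assumes S: "congruence 3 (zigzag_precat 3 C) S" and "(Zig x es, Zig x es') \<in> S"
    and "zpath 3 C y pre" "zend 3 C y pre = x" "zpath 3 C x es" "zpath 3 C (zend 3 C x es) post"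
  shows "(Zig y (pre @ es @ post), Zig y (pre @ es' @ post)) \<in> S"
proof -
  let ?Z = "zigzag_precat 3 C"
  have ends: "zend 3 C y (pre @ es) = zend 3 C x es" using assms(4) by (induction pre arbitrary: y) auto
  have "composable ?Z (Suc 2) 3 (Zig y pre) (Zig x es)" "composable ?Z 3 (Suc 2) (Zig x es) (Zig (zend 3 C x es) post)"
    using assms(3-6) by (simp_all add: composable_def zigzag_precat_def numeral_3_eq_3 numeral_2_eq_2)
  then have "(Cmp ?Z 3 (Suc 2) (Cmp ?Z (Suc 2) 3 (Zig y pre) (Zig x es)) (Zig (zend 3 C x es) post),
      Cmp ?Z 3 (Suc 2) (Cmp ?Z (Suc 2) 3 (Zig y pre) (Zig x es')) (Zig (zend 3 C x es) post)) \<in> S"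
    using congruence_stable[OF S assms(2), of 2 "Zig y pre" "Zig (zend 3 C x es) post"] by simp
  then show ?thesis by (simp add: zigzag_precat_def)
qed

text \<open>An abstract choice of normalizing 3-cells: \<open>N x\<close> leads from
  \<open>x\<close> to its normal form, and by \<open>NC\<close> prefixing the choice at the target
  of \<open>U\<close> with \<open>U\<close> gives the choice at its source.\<close>

context
  fixes C :: "('c, 'z) precat_scheme" and N :: "'c \<Rightarrow> 'c"
  assumes N: "\<And>x. x \<in> Cel C 2 \<Longrightarrow> N x \<in> Cel C 3 \<and> Src C 2 (N x) = x \<and> Tgt C 2 (N x) \<in> Cel C 2"
    and cell: "\<And>U. U \<in> Cel C 3 \<Longrightarrow> Src C 2 U \<in> Cel C 2 \<and> Tgt C 2 U \<in> Cel C 2"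
    and NT: "\<And>U. U \<in> Cel C 3 \<Longrightarrow> Tgt C 2 (N (Tgt C 2 U)) = Tgt C 2 (N (Src C 2 U))"
    and NC: "\<And>U. U \<in> Cel C 3 \<Longrightarrow> Cmp C 3 3 U (N (Tgt C 2 U)) = N (Src C 2 U)"
begin

text \<open>Induction on the zigzag: the tail from \<open>z\<close> becomes \<open>N z\<close>
  followed by the inverse of \<open>N y\<close>, and the head entry is absorbed into
  \<open>N z\<close>, giving \<open>N x\<close>. The claim is made for every congruence containing
  the relations, so that it passes to their intersection.\<close>

lemma congruence_zigzag_normal:
  assumes S: "congruence 3 (zigzag_precat 3 C) S" "zigzag_rel 3 C \<subseteq> S"
  shows "zpath 3 C x es \<Longrightarrow> zend 3 C x es = y \<Longrightarrow>
    Tgt C 2 (N x) = Tgt C 2 (N y) \<and> (Zig x es, Zig x [(True, N x), (False, N y)]) \<in> S"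
proof (induction es arbitrary: x)
  case Nil
  then have x: "x \<in> Cel C 2" "y = x" by auto
  have "(Zig (Src C (3 - 1) (N x)) [(True, N x), (False, N x)], Zig (Src C (3 - 1) (N x)) []) \<in> S"
    using S(2) N[OF x(1)] by (intro subsetD[OF S(2)] zigzag_rel.inv_right) auto
  then show ?case using N[OF x(1)] x(2) congruence_symD[OF S(1)] by auto
next
  case (Cons e es)
  note sym = congruence_symD[OF S(1)] and trans = congruence_transD[OF S(1)]
  obtain b U where e: "e = (b, U)" by fastforce
  define z where "z = ztgt 3 C e"
  have U: "U \<in> Cel C 3" "zsrc 3 C e = x" "zpath 3 C z es" "zend 3 C z es = y"
    using Cons.prems by (simp_all add: e z_def)
  have y: "y \<in> Cel C 2" using zpath_end[OF U(3)] U(4) by simp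
  have z: "z \<in> Cel C 2" and x: "x \<in> Cel C 2" using cell[OF U(1)] U(2) by (auto simp: z_def e)
  note IH = Cons.IH[OF U(3,4)]
  have xz: "Tgt C 2 (N x) = Tgt C 2 (N z)" using NT[OF U(1)] U(2) by (auto simp: z_def e split: if_splits)
  have pe: "zpath 3 C x [e]" "zend 3 C x [e] = z" using U(1,2) z by (simp_all add: z_def e)
  have "(Zig x ([e] @ es @ []), Zig x ([e] @ [(True, N z), (False, N y)] @ [])) \<in> S"
    using IH U(3,4) y pe by - (rule congruence_zigzag_concat[OF S(1), of z], auto)
  then have 1: "(Zig x (e # es), Zig x [e, (True, N z), (False, N y)]) \<in> S" by simp
  have post: "zpath 3 C (Tgt C 2 (N z)) [(False, N y)]" using N[OF y] y IH by simp
  have "(Zig x [e, (True, N z), (False, N y)], Zig x [(True, N x), (False, N y)]) \<in> S"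
  proof (cases b)
    case True
    have UN: "composable C 3 3 U (N z)"
      using U(1,2) N[OF z] True by (simp add: composable_def numeral_3_eq_3 numeral_2_eq_2 z_def e)
    have "(Zig x [(True, U), (True, N z)], Zig x [(True, Cmp C 3 3 U (N z))]) \<in> S"
      using subsetD[OF S(2) zigzag_rel.comp[OF UN]] U(2) True by (simp add: e)
    moreover have "Cmp C 3 3 U (N z) = N x" using NC[OF U(1)] U(2) True by (simp add: z_def e)
    ultimately have "(Zig x ([] @ [e, (True, N z)] @ [(False, N y)]), Zig x ([] @ [(True, N x)] @ [(False, N y)])) \<in> S"
      using x pe U(1) N[OF z] post True by - (rule congruence_zigzag_concat[OF S(1), of x], auto simp: e z_def)
    then show ?thesis by simp
  next
    case False
    have UN: "composable C 3 3 U (N x)"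
      using U(1,2) N[OF x] False by (simp add: composable_def numeral_3_eq_3 numeral_2_eq_2 z_def e)
    have "(Zig z [(True, U), (True, N x)], Zig z [(True, Cmp C 3 3 U (N x))]) \<in> S"
      using subsetD[OF S(2) zigzag_rel.comp[OF UN]] False by (simp add: e z_def)
    moreover have "Cmp C 3 3 U (N x) = N z" using NC[OF U(1)] U(2) False by (simp add: z_def e)
    \<comment> \<open>For a backward entry, \<open>N z\<close> is expanded into \<open>U\<close>
      followed by \<open>N x\<close> (this relation is read from right to left), after which the
      inverse of \<open>U\<close> cancels against \<open>U\<close>.\<close>
    ultimately have A: "(Zig x ([e] @ [(True, U), (True, N x)] @ [(False, N y)]), Zig x ([e] @ [(True, N z)] @ [(False, N y)])) \<in> S"
      using x pe U(1,2) N[OF x] post xz False by - (rule congruence_zigzag_concat[OF S(1), of z], auto simp: e z_def)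
    have "(Zig x [(False, U), (True, U)], Zig x []) \<in> S"
      using subsetD[OF S(2) zigzag_rel.inv_left[OF U(1)]] U(2) False by (simp add: e)
    then have B: "(Zig x ([] @ [e, (True, U)] @ [(True, N x), (False, N y)]), Zig x ([] @ [] @ [(True, N x), (False, N y)])) \<in> S"
      using x pe U(1,2) N[OF x] post xz False by - (rule congruence_zigzag_concat[OF S(1), of x], auto simp: e z_def)
    show ?thesis using trans[OF sym[OF A[simplified]] B[simplified]] by simp
  qed
  from trans[OF 1 this] show ?case using xz IH by simp
qed

text \<open>Two zigzags with the same ends reduce to the same standard zigzag in every congruence,
  hence have equal classes. It remains to read the ends of a zigzag off the boundary of its
  class.\<close>

lemma coherent_localization: "coherent (localization 3 C)"
  unfolding coherent_def
proof (intro ballI impI)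
  let ?Z = "zigzag_precat 3 C"
  define R where "R = congruence_generated 3 ?Z (zigzag_rel 3 C)"
  have RI: "(a, b) \<in> R" if "\<And>S. congruence 3 ?Z S \<Longrightarrow> zigzag_rel 3 C \<subseteq> S \<Longrightarrow> (a, b) \<in> S" for a b
    using that by (auto simp: R_def congruence_generated_def)
  have RD: "(a, b) \<in> S" if "(a, b) \<in> R" "congruence 3 ?Z S" "zigzag_rel 3 C \<subseteq> S" for a b S
    using that by (auto simp: R_def congruence_generated_def)
  fix F G assume FG: "F \<in> Cel (localization 3 C) 3" "G \<in> Cel (localization 3 C) 3"
    and bd: "Src (localization 3 C) 2 F = Src (localization 3 C) 2 G \<and> Tgt (localization 3 C) 2 F = Tgt (localization 3 C) 2 G"
  obtain x es y fs where F: "F = R `` {Zig x es}" "zpath 3 C x es" and G: "G = R `` {Zig y fs}" "zpath 3 C y fs"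
    using FG by (auto simp: localization_def quotient_precat_def saturate_def zigzag_precat_def R_def)
  show "F = G"
  \<comment> \<open>If no congruence contained \<open>zigzag_rel\<close>, the generated relation would be \<open>UNIV\<close>.\<close>
  proof (cases "\<exists>S. congruence 3 ?Z S \<and> zigzag_rel 3 C \<subseteq> S")
    case False
    then have "(a, b) \<in> R" for a b by (intro RI) blast
    then show ?thesis unfolding F(1) G(1) by blast
  next
    case True
    then obtain S where S: "congruence 3 ?Z S" "zigzag_rel 3 C \<subseteq> S" by blast
    \<comment> \<open>One congruence \<open>S\<close> above \<open>R\<close> shows that related
      zigzags have the same ends. The elementwise source and target of a class are then
      singletons.\<close>
    have par: "Src ?Z 2 a = Src ?Z 2 b \<and> Tgt ?Z 2 a = Tgt ?Z 2 b" if "(a, b) \<in> R" for a b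
      using congruence_boundary[of 2, OF _ RD[OF that S]] S(1) by simp
    have srcs: "Src ?Z 2 ` R `` {Zig x es} = {Base x}" "Tgt ?Z 2 ` R `` {Zig x es} = {Base (zend 3 C x es)}"
      if "zpath 3 C x es" for x es
    proof -
      have "(Zig x es, Zig x es) \<in> R"
        using that by (intro RI) (erule congruence_reflD, simp add: zigzag_precat_def)
      moreover have "Src ?Z 2 b = Base x \<and> Tgt ?Z 2 b = Base (zend 3 C x es)" if "(Zig x es, b) \<in> R" for b
        using par[OF that] by (simp add: zigzag_precat_def)
      ultimately show "Src ?Z 2 ` R `` {Zig x es} = {Base x}" "Tgt ?Z 2 ` R `` {Zig x es} = {Base (zend 3 C x es)}"
        by (auto simp add: image_iff intro!: image_eqI[of _ _ "Zig x es"] simp: zigzag_precat_def)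
    qed
    have "Src ?Z 2 ` F = Src ?Z 2 ` G" "Tgt ?Z 2 ` F = Tgt ?Z 2 ` G"
      using bd by (simp_all add: localization_def quotient_precat_def)
    then have xy: "y = x" "zend 3 C y fs = zend 3 C x es"
      unfolding F(1) G(1) srcs[OF F(2)] srcs[OF G(2)] by simp_all
    have "(Zig x es, Zig y fs) \<in> R"
    proof (rule RI)
      fix S assume S: "congruence 3 ?Z S" "zigzag_rel 3 C \<subseteq> S"
      note n = congruence_zigzag_normal[OF S]
      show "(Zig x es, Zig y fs) \<in> S"
        using congruence_transD[OF S(1) conjunct2[OF n[OF F(2) refl]]
            congruence_symD[OF S(1) conjunct2[OF n[OF G(2)[unfolded xy(1)] xy(2)[unfolded xy(1)]]]]] xy(1) by simp
    qed
    note eq = this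
    have sym: "(b, a) \<in> R" if "(a, b) \<in> R" for a b
      by (rule RI, rule congruence_symD, assumption, rule RD[OF that])
    have trans: "(a, c) \<in> R" if "(a, b) \<in> R" "(b, c) \<in> R" for a b c
      by (rule RI, rule congruence_transD, assumption, rule RD[OF that(1)], assumption+, rule RD[OF that(2)])
    have "(Zig x es, c) \<in> R \<longleftrightarrow> (Zig y fs, c) \<in> R" for c
      using trans[OF eq] trans[OF sym[OF eq]] by (rule iffI[rotated])
    then show ?thesis unfolding F(1) G(1) by auto
  qed
qed


end

section \<open>Normal forms\<close>

context gray begin

text \<open>Pairs are oriented from target to source, so that termination becomes well-foundedness
  and the normal forms are the 2-cells outside \<open>Range reduces\<close>.\<close>

definition reduces :: "('g cell \<times> 'g cell) set" where
  "reduces = {(ctgt Q S, csrc S) |S. rewriting_step Q S}"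

lemma reducesI: "rewriting_step Q S \<Longrightarrow> (ctgt Q S, csrc S) \<in> reduces"
  by (auto simp: reduces_def)

lemma wf_reduces: "terminating Q \<Longrightarrow> wf reduces"
  unfolding wf_iff_no_infinite_down_chain
proof
  assume t: "terminating Q" and "\<exists>f. \<forall>i. (f (Suc i), f i) \<in> reduces"
  then obtain f where f: "\<And>i. (f (Suc i), f i) \<in> reduces" by blast
  have "\<forall>i. \<exists>S. rewriting_step Q S \<and> ctgt Q S = f (Suc i) \<and> csrc S = f i"
    using f by (simp add: reduces_def) metis
  then obtain S where "\<forall>i. rewriting_step Q (S i) \<and> ctgt Q (S i) = f (Suc i) \<and> csrc (S i) = f i"
    using choice[of "\<lambda>i S. rewriting_step Q S \<and> ctgt Q S = f (Suc i) \<and> csrc S = f i"] by blast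
  then have "\<forall>i. rewriting_step Q (S i) \<and> ctgt Q (S i) = csrc (S (Suc i))" by simp
  then show False using t unfolding terminating_def by blast
qed

lemma normal_form_exists:
  assumes "terminating Q"
  shows "is_cell Q 2 \<phi> \<Longrightarrow> \<exists>F. is_cell Q 3 F \<and> csrc F = \<phi> \<and> ctgt Q F \<notin> Range reduces"
proof (induction \<phi> rule: wf_induct_rule[OF wf_reduces[OF assms]])
  case (1 \<phi>)
  show ?case
  proof (cases "\<phi> \<in> Range reduces")
    case False
    then show ?thesis using 1(2) by (intro exI[of _ "idc \<phi>"]) (simp add: cell_idc boundary_idc)
  next
    case True
    then obtain S where S: "rewriting_step Q S" "csrc S = \<phi>" by (auto simp: reduces_def)
    note Sc = rewriting_step_cell[OF S(1)]
    obtain F where "is_cell Q 3 F" "csrc F = ctgt Q S" "ctgt Q F \<notin> Range reduces"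
      using 1(1)[OF _ boundary_3(2)[OF Sc]] reducesI[OF S(1)] S(2) by auto
    then show ?thesis using comp_2[OF Sc, of F] S(2) by (intro exI[of _ "ccomp S F"]) simp
  qed
qed

text \<open>Newman's argument for 3-cells up to \<open>sim\<close>. The conclusion includes
  uniqueness of the normal form, since related cells have the same target.\<close>

lemma sim_normal_forms:
  assumes "terminating Q" and lc: "\<And>S S'. local_branching Q S S' \<Longrightarrow> confluent S S'"
  shows "is_cell Q 3 F \<Longrightarrow> is_cell Q 3 F' \<Longrightarrow> csrc F = \<phi> \<Longrightarrow> csrc F' = \<phi> \<Longrightarrow>
    ctgt Q F \<notin> Range reduces \<Longrightarrow> ctgt Q F' \<notin> Range reduces \<Longrightarrow> (F, F') \<in> sim"
proof (induction \<phi> arbitrary: F F' rule: wf_induct_rule[OF wf_reduces[OF assms(1)]])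
  case (1 \<phi> F F')
  show ?case
  proof (cases "\<phi> \<in> Range reduces")
    case False
    \<comment> \<open>No step leaves \<open>\<phi>\<close>, so its identity is the only 3-cell
      starting there.\<close>
    have "H = idc \<phi>" if "is_cell Q 3 H" "csrc H = \<phi>" for H
      using that(1)
    proof (cases rule: cell3_cases)
      case (2 S H')
      then have "\<phi> = csrc S" using that(2) comp_2(2)[OF rewriting_step_cell[OF 2(1)] 2(2)] by simp
      then show ?thesis using False 2(1) by (auto simp: reduces_def)
    qed (use that(2) in simp)
    then show ?thesis using 1(2-5) sim_refl by metis
  next
    case True
    have step: "\<exists>S H'. rewriting_step Q S \<and> is_cell Q 3 H' \<and> csrc H' = ctgt Q S \<and> H = ccomp S H' \<and> csrc S = \<phi> \<and>
         ctgt Q H' = ctgt Q H"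
      if "is_cell Q 3 H" "csrc H = \<phi>" "ctgt Q H \<notin> Range reduces" for H
      using that(1)
    proof (cases rule: cell3_cases)
      case 1
      have "ctgt Q H = \<phi>" using arg_cong[OF 1, of "ctgt Q"] that(2) by (simp add: boundary_idc)
      then show ?thesis using that(3) True by simp
    next
      case (2 S H')
      then show ?thesis using that(2) comp_2[OF rewriting_step_cell[OF 2(1)] 2(2)] by auto
    qed
    obtain S H where S: "rewriting_step Q S" "is_cell Q 3 H" "csrc H = ctgt Q S" "F = ccomp S H" "csrc S = \<phi>" "ctgt Q H = ctgt Q F"
      using step[OF 1(2,4,6)] by blast
    obtain S' H' where S': "rewriting_step Q S'" "is_cell Q 3 H'" "csrc H' = ctgt Q S'" "F' = ccomp S' H'" "csrc S' = \<phi>" "ctgt Q H' = ctgt Q F'"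
      using step[OF 1(3,5,7)] by blast
    note c = rewriting_step_cell[OF S(1)] rewriting_step_cell[OF S'(1)]
    have "confluent S S'" using S S' by (intro lc) (simp add: local_branching_def)
    then obtain K K' where K: "is_cell Q 3 K" "csrc K = ctgt Q S" "is_cell Q 3 K'" "csrc K' = ctgt Q S'"
      "(ccomp S K, ccomp S' K') \<in> sim"
      unfolding confluent_def by blast
    have KK: "ctgt Q K = ctgt Q K'"
      using sim_parallel[OF K(5)] comp_2(3)[OF c(1) K(1)] comp_2(3)[OF c(2) K(3)] K by (simp add: parallel_def[OF poly3])
    \<comment> \<open>The closing cells \<open>K\<close> and \<open>K'\<close> need not end in a
      normal form. Prolonged by a common \<open>N\<close> they do, and the induction hypotheses at
      the targets of \<open>S\<close> and \<open>S'\<close> compare them with \<open>H\<close> and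
      \<open>H'\<close>.\<close>
    obtain N where N: "is_cell Q 3 N" "csrc N = ctgt Q K" "ctgt Q N \<notin> Range reduces"
      using normal_form_exists[OF assms(1) boundary_3(2)[OF K(1)]] by auto
    have KN: "ctgt Q K = csrc N" "ctgt Q K' = csrc N" using N KK by simp_all
    note KNc = comp_2[OF K(1) N(1) KN(1)] comp_2[OF K(3) N(1) KN(2)]
    have "(H, ccomp K N) \<in> sim" "(H', ccomp K' N) \<in> sim"
      using 1(1)[of "ctgt Q S" H "ccomp K N"] 1(1)[of "ctgt Q S'" H' "ccomp K' N"] S S' KNc N K 1(6,7)
        reducesI[OF S(1)] reducesI[OF S'(1)] by simp_all
    then have FF: "(F, ccomp S (ccomp K N)) \<in> sim" "(F', ccomp S' (ccomp K' N)) \<in> sim"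
      using sim_comp[OF sim_refl[OF c(1)]] sim_comp[OF sim_refl[OF c(2)]] S(3,4) S'(3,4) by simp_all
    have "(ccomp (ccomp S K) N, ccomp (ccomp S' K') N) \<in> sim"
      using sim_comp[OF K(5) sim_refl[OF N(1)]] comp_2(3)[OF c(1) K(1)] K(2) KN(1) by simp
    then have "(ccomp S (ccomp K N), ccomp S' (ccomp K' N)) \<in> sim"
      using ccomp_assoc_dim(7)[OF has_dim_cell has_dim_cell has_dim_cell, OF c(1) K(1) N(1)]
        ccomp_assoc_dim(7)[OF has_dim_cell has_dim_cell has_dim_cell, OF c(2) K(3) N(1)] by simp
    from sim_trans[OF FF(1) sim_trans[OF this sim_sym[OF FF(2)]]] show ?thesis .
  qed
qed

text \<open>The normalizing 3-cells are chosen in the free precategory; the bulk of the proof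
  computes boundaries and composites of their classes in the presented one.\<close>

lemma coherent_if_locally_confluent:
  assumes t: "terminating Q" and lc: "\<And>S S'. local_branching Q S S' \<Longrightarrow> confluent S S'"
  shows "coherent (localization 3 (presented_precat 3 Q))"
proof -
  have "\<exists>N. \<forall>\<phi>. is_cell Q 2 \<phi> \<longrightarrow> is_cell Q 3 (N \<phi>) \<and> csrc (N \<phi>) = \<phi> \<and> ctgt Q (N \<phi>) \<notin> Range reduces"
    by (rule choice) (use normal_form_exists[OF t] in blast)
  then obtain N where N: "\<And>\<phi>. is_cell Q 2 \<phi> \<Longrightarrow> is_cell Q 3 (N \<phi>) \<and> csrc (N \<phi>) = \<phi> \<and> ctgt Q (N \<phi>) \<notin> Range reduces"
    by blast
  let ?C = "presented_precat 3 Q" and ?cls = "\<lambda>F. sim `` {F}"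
  have C2: "Cel ?C 2 = (\<lambda>\<phi>. {\<phi>}) ` {\<phi>. is_cell Q 2 \<phi>}" and C3: "Cel ?C 3 = ?cls ` {F. is_cell Q 3 F}"
    by (simp_all add: presented_precat_sim quotient_precat_def free_precat_simps[OF poly3] saturate_def)
  have par: "csrc F = csrc G" "ctgt Q F = ctgt Q G" if "(F, G) \<in> sim" for F G
    using sim_parallel[OF that] by (simp_all add: parallel_def[OF poly3])
  have ST: "Src ?C 2 (?cls F) = {csrc F}" "Tgt ?C 2 (?cls F) = {ctgt Q F}" if "is_cell Q 3 F" for F
  proof -
    have "f ` ?cls F = {f F}" if "\<And>G. (F, G) \<in> sim \<Longrightarrow> f F = f G" for f :: "'g cell \<Rightarrow> 'g cell"
    proof -
      have "f G = f F" if "G \<in> ?cls F" for G using \<open>\<And>G. (F, G) \<in> sim \<Longrightarrow> f F = f G\<close>[of G] that by simp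
      moreover have "F \<in> ?cls F" using sim_refl[OF \<open>is_cell Q 3 F\<close>] by simp
      ultimately show ?thesis by blast
    qed
    from this[of csrc, OF par(1)] this[of "ctgt Q", OF par(2)]
    have "csrc ` ?cls F = {csrc F}" "ctgt Q ` ?cls F = {ctgt Q F}" by auto
    then show "Src ?C 2 (?cls F) = {csrc F}" "Tgt ?C 2 (?cls F) = {ctgt Q F}"
      by (simp_all add: presented_precat_sim quotient_precat_def free_precat_simps[OF poly3])
  qed
  have cls_eq: "?cls F = ?cls G" if "(F, G) \<in> sim" for F G using equiv_class_eq[OF equiv_sim that] .
  have Cmp: "Cmp ?C 3 3 (?cls F) (?cls G) = ?cls (ccomp F G)" if "is_cell Q 3 F" "is_cell Q 3 G" "ctgt Q F = csrc G" for F G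
  proof -
    have "Cmp ?C 3 3 (?cls F) (?cls G) = sim `` {ccomp F' G' |F' G'. (F, F') \<in> sim \<and> (G, G') \<in> sim}"
      by (simp add: presented_precat_sim quotient_precat_def free_precat_simps[OF poly3] saturate_def)
    also have "\<dots> = ?cls (ccomp F G)"
    proof (intro equalityI subsetI)
      fix H assume "H \<in> sim `` {ccomp F' G' |F' G'. (F, F') \<in> sim \<and> (G, G') \<in> sim}"
      then obtain F' G' where FG: "(F, F') \<in> sim" "(G, G') \<in> sim" and H: "(ccomp F' G', H) \<in> sim" by auto
      show "H \<in> ?cls (ccomp F G)" using sim_trans[OF sim_comp[OF FG that(3)] H] by simp
    next
      fix H assume "H \<in> ?cls (ccomp F G)"
      then show "H \<in> sim `` {ccomp F' G' |F' G'. (F, F') \<in> sim \<and> (G, G') \<in> sim}"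
        using sim_refl[OF that(1)] sim_refl[OF that(2)] by blast
    qed
    finally show ?thesis .
  qed
  \<comment> \<open>Both cells lead from the source of \<open>F\<close> to a normal form.\<close>
  have NF: "(ccomp F (N (ctgt Q F)), N (csrc F)) \<in> sim" if F: "is_cell Q 3 F" for F
    using N[OF boundary_3(1)[OF F]] N[OF boundary_3(2)[OF F]] comp_2[OF F, of "N (ctgt Q F)"] F
    by (intro sim_normal_forms[OF t lc]) auto
  show ?thesis
  \<comment> \<open>The 2-cells of the quotient are singletons \<open>{\<phi>}\<close>, whence
    \<open>the_elem\<close>.\<close>
  proof (rule coherent_localization[where N = "\<lambda>X. ?cls (N (the_elem X))"])
    fix X assume "X \<in> Cel ?C 2"
    then show "?cls (N (the_elem X)) \<in> Cel ?C 3 \<and> Src ?C 2 (?cls (N (the_elem X))) = X \<and>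
        Tgt ?C 2 (?cls (N (the_elem X))) \<in> Cel ?C 2"
      using N ST boundary_3(2) by (auto simp: C2 C3)
  next
    fix U assume "U \<in> Cel ?C 3"
    then obtain F where F: "U = ?cls F" "is_cell Q 3 F" by (auto simp: C3)
    note Nc = N[OF boundary_3(1)[OF F(2)]] N[OF boundary_3(2)[OF F(2)]]
    show "Src ?C 2 U \<in> Cel ?C 2 \<and> Tgt ?C 2 U \<in> Cel ?C 2"
      using boundary_3(1,2)[OF F(2)] ST[OF F(2)] by (auto simp: F(1) C2)
    show "Tgt ?C 2 (?cls (N (the_elem (Tgt ?C 2 U)))) = Tgt ?C 2 (?cls (N (the_elem (Src ?C 2 U))))"
      using ST[OF F(2)] ST Nc par(2)[OF NF[OF F(2)]] comp_2(3)[OF F(2)] by (simp add: F(1))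
    show "Cmp ?C 3 3 U (?cls (N (the_elem (Tgt ?C 2 U)))) = ?cls (N (the_elem (Src ?C 2 U)))"
      using ST[OF F(2)] Cmp[OF F(2)] Nc cls_eq[OF NF[OF F(2)]] by (simp add: F(1))
  qed
qed


section \<open>Generators of dimension 2 and independent branchings\<close>

lemma gen2:
  assumes "\<alpha> \<in> gens Q 2"
  shows "is_cell Q 2 (gen Q 2 \<alpha>)" "csrc (gen Q 2 \<alpha>) = gsrc Q 2 \<alpha>" "ctgt Q (gen Q 2 \<alpha>) = gtgt Q 2 \<alpha>"
    "is_cell Q 1 (gsrc Q 2 \<alpha>)" "is_cell Q 1 (gtgt Q 2 \<alpha>)"
    "bsrc 0 (gen Q 2 \<alpha>) = bsrc 0 (gsrc Q 2 \<alpha>)" "btgt Q 0 (gen Q 2 \<alpha>) = btgt Q 0 (gsrc Q 2 \<alpha>)"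
    "bsrc 0 (gtgt Q 2 \<alpha>) = bsrc 0 (gsrc Q 2 \<alpha>)" "btgt Q 0 (gtgt Q 2 \<alpha>) = btgt Q 0 (gsrc Q 2 \<alpha>)"
proof -
  show g: "is_cell Q 2 (gen Q 2 \<alpha>)" "csrc (gen Q 2 \<alpha>) = gsrc Q 2 \<alpha>" "ctgt Q (gen Q 2 \<alpha>) = gtgt Q 2 \<alpha>"
    using is_cell_gen[OF poly3, of \<alpha> 1] assms by (simp_all add: One_nat_def flip: numeral_2_eq_2)
  show "is_cell Q 1 (gsrc Q 2 \<alpha>)" "is_cell Q 1 (gtgt Q 2 \<alpha>)"
    "bsrc 0 (gen Q 2 \<alpha>) = bsrc 0 (gsrc Q 2 \<alpha>)" "btgt Q 0 (gen Q 2 \<alpha>) = btgt Q 0 (gsrc Q 2 \<alpha>)"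
    "bsrc 0 (gtgt Q 2 \<alpha>) = bsrc 0 (gsrc Q 2 \<alpha>)" "btgt Q 0 (gtgt Q 2 \<alpha>) = btgt Q 0 (gsrc Q 2 \<alpha>)"
    using boundary_2[OF g(1)] g by simp_all
qed

text \<open>The data of an independent branching are those indexing an independence generator, whose
  source and target extend each step by the other one, performed after it.\<close>

lemma confluent_independent:
  assumes "independent_branching Q S\<^sub>1 S\<^sub>2"
  shows "confluent S\<^sub>1 S\<^sub>2"
proof -
  obtain A B e h \<chi> e' h' where AB: "A \<in> gens Q 3" "B \<in> gens Q 3"
    and c: "is_cell Q 1 e" "is_cell Q 1 h" "is_cell Q 1 e'" "is_cell Q 1 h'" "is_cell Q 2 \<chi>"
    and comp: "composable3 Q 0 e (gsrc Q 3 A) h" "composable3 Q 0 e' (gsrc Q 3 B) h'"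
      "composable3 Q 1 (ccomp (ccomp e (gsrc Q 3 A)) h) \<chi> (ccomp (ccomp e' (gsrc Q 3 B)) h')"
    and S: "S\<^sub>1 = ccomp (ccomp (ccomp (ccomp e (gen Q 3 A)) h) \<chi>) (ccomp (ccomp e' (gsrc Q 3 B)) h')"
      "S\<^sub>2 = ccomp (ccomp (ccomp (ccomp e (gsrc Q 3 A)) h) \<chi>) (ccomp (ccomp e' (gen Q 3 B)) h')"
    using assms unfolding independent_branching_def Let_def by blast
  define I where "I = indep Q e A h \<chi> e' B h'"
  define F where "F = ccomp (ccomp (ccomp (ccomp e (gtgt Q 3 A)) h) \<chi>) (ccomp (ccomp e' (gen Q 3 B)) h')"
  define G where "G = ccomp (ccomp (ccomp (ccomp e (gen Q 3 A)) h) \<chi>) (ccomp (ccomp e' (gtgt Q 3 B)) h')"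
  have I: "I \<in> gens Q 4" "gsrc Q 4 I = ccomp S\<^sub>1 F" "gtgt Q 4 I = ccomp S\<^sub>2 G"
    using gray_presentation AB c comp
    unfolding gray_presentation_def has_independence_generators_def Let_def I_def S F_def G_def by blast+
  have b: "btgt Q 0 e = bsrc 0 (gsrc Q 3 A)" "btgt Q 0 (gsrc Q 3 A) = bsrc 0 h"
    "btgt Q 0 e' = bsrc 0 (gsrc Q 3 B)" "btgt Q 0 (gsrc Q 3 B) = bsrc 0 h'"
    using comp by (simp_all add: composable3_def)
  note g = gen3[OF AB(1)] gen3[OF AB(2)]
  have d: "csrc \<chi> = ccomp (ccomp e (ctgt Q (gsrc Q 3 A))) h" "ctgt Q \<chi> = ccomp (ccomp e' (csrc (gsrc Q 3 B))) h'"
    using comp(3) unfolding composable3_def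
    by (simp_all add: bound_1_cell2 comp_cells boundary_cell g b c)
  show ?thesis
  proof (rule confluentI)
    show "(ccomp S\<^sub>1 F, ccomp S\<^sub>2 G) \<in> sim" using sim_gen[OF I(1)] I by simp
    show "is_cell Q 3 S\<^sub>1" "is_cell Q 3 S\<^sub>2" "is_cell Q 3 F" "csrc F = ctgt Q S\<^sub>1" "is_cell Q 3 G" "csrc G = ctgt Q S\<^sub>2"
      by (simp_all add: F_def G_def S comp_cells boundary_cell g b c d)
  qed
qed

section \<open>First and last whiskers of 2-cells\<close>

lemma Cell_Cons_2:
  assumes "is_cell Q 2 (Cell s (w # ws))"
  shows "is_whisker Q 1 w" "wsrc Q w = s" "is_cell Q 2 (Cell (wtgt Q w) ws)"
    "Cell s (w # ws) = ccomp (wcell Q w) (Cell (wtgt Q w) ws)"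
proof -
  have c: "is_cell Q (Suc 1) (Cell s (w # ws))" using assms by (simp add: numeral_2_eq_2 One_nat_def)
  show "is_whisker Q 1 w" using c by (simp only: is_cell_Cell list.set_intros)
  show "wsrc Q w = s" "is_cell Q 2 (Cell (wtgt Q w) ws)" "Cell s (w # ws) = ccomp (wcell Q w) (Cell (wtgt Q w) ws)"
    using Cell_Cons[OF poly3 c] by (simp_all add: numeral_2_eq_2 One_nat_def)
qed

text \<open>Cells are lists read from their first whisker, whereas interchange cells move the last
  whisker first; hence this decomposition from the other end.\<close>

lemma Cell_snoc_2:
  assumes "is_cell Q 2 (Cell s (ws @ [w]))"
  shows "is_whisker Q 1 w" "wsrc Q w = ctgt Q (Cell s ws)" "is_cell Q 2 (Cell s ws)"
    "Cell s (ws @ [w]) = ccomp (Cell s ws) (wcell Q w)" "ctgt Q (Cell s (ws @ [w])) = wtgt Q w"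
proof -
  have c: "is_cell Q (Suc 1) (Cell s (ws @ [w]))" using assms by (simp add: numeral_2_eq_2 One_nat_def)
  have c': "is_cell Q 1 s" "\<forall>v \<in> set (ws @ [w]). is_whisker Q 1 v" "wchain Q s (ws @ [w])"
    using c unfolding is_cell_Cell by blast+
  show w: "is_whisker Q 1 w" using c'(2) by simp
  show e: "wsrc Q w = ctgt Q (Cell s ws)" using c'(3) by (simp add: wchain_append)
  have "is_cell Q (Suc 1) (Cell s ws)" using c' unfolding is_cell_Cell by (simp add: wchain_append)
  then show "is_cell Q 2 (Cell s ws)" by (simp add: numeral_2_eq_2 One_nat_def)
  have "cdim s = 1" "cdim (wsrc Q w) = 1"
    using is_cell_dim(1) c'(1) whisker_cell(4)[OF poly3 ichg_gens w] by blast+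
  then show "Cell s (ws @ [w]) = ccomp (Cell s ws) (wcell Q w)"
    by (simp add: wcell_def ccomp_right rcomp_Cell)
  show "ctgt Q (Cell s (ws @ [w])) = wtgt Q w" by simp
qed

lemmas whisker_facts = whisker_cell[OF poly3 ichg_gens]

section \<open>Interchange cells\<close>

text \<open>\<open>move_whiskers\<close> recurses on the first whisker but performs the recursive
  call before moving it. By induction its initial part \<open>S\<close> is therefore the move of the
  last whisker \<open>w\<close>, framed by the whiskers before it.\<close>

lemma move_whiskers_split_last:
  assumes \<psi>: "is_cell Q 2 \<psi>"
  shows "is_cell Q 2 (Cell f (ws @ [w])) \<Longrightarrow> btgt Q 0 f = bsrc 0 \<psi> \<Longrightarrow>
    let S = ccomp (ccomp (Cell f ws) (csrc \<psi>)) (move_whisker Q w (csrc \<psi>) (whiskers \<psi>)) in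
    \<exists>R. is_cell Q 3 S \<and> is_cell Q 3 R \<and> csrc R = ctgt Q S \<and> move_whiskers Q f (ws @ [w]) \<psi> = ccomp S R"
proof (induction ws arbitrary: f)
  case Nil
  obtain k vs where psi: "\<psi> = Cell k vs" using is_cell_dim(1)[OF \<psi>] dim_pos[of \<psi>] by auto
  note b = boundary_2[OF \<psi>]
  have w: "is_whisker Q 1 w" "wsrc Q w = f" using Cell_Cons_2[of f w "[]"] Nil(1) by simp_all
  note wc = whisker_facts[OF w(1)]
  define M where "M = move_whisker Q w k vs"
  have M: "is_cell Q 3 M" "csrc M = ccomp (ccomp (wcell Q w) (csrc \<psi>)) (ccomp (wtgt Q w) \<psi>)"
    "ctgt Q M = ccomp (ccomp f \<psi>) (ccomp (wcell Q w) (ctgt Q \<psi>))"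
    using move_whisker_cell[OF poly3 ichg_gens w(1) \<psi>[unfolded psi]] Nil(2) w(2) b by (simp_all add: M_def psi)
  have e: "btgt Q 0 (wtgt Q w) = bsrc 0 \<psi>" "btgt Q 0 (wcell Q w) = bsrc 0 \<psi>" using wc Nil(2) w(2) by simp_all
  note s = comp_cells boundary_cell wc[unfolded w(2)] b e Nil(2) \<psi>
  have f: "is_cell Q 1 f" using wc(4) w(2) by simp
  \<comment> \<open>For a single whisker everything around its move \<open>M\<close> is an identity,
    and the remainder \<open>R\<close> is one as well.\<close>
  have 1: "ccomp (ccomp (wcell Q w) (csrc \<psi>)) (idc (ccomp (wtgt Q w) \<psi>)) = idc (csrc M)"
    unfolding M by (subst idc_whisker) (simp_all add: s)
  have tm: "ctgt Q (csrc M) = ccomp (wtgt Q w) (ctgt Q \<psi>)" "csrc (csrc M) = ccomp f (csrc \<psi>)"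
    by (simp_all add: M s)
  have 2: "ccomp M (ccomp (Cell (wtgt Q w) []) (ctgt Q \<psi>)) = M"
    using units(3)[OF M(1)] idc_whisker(2)[of "ctgt Q \<psi>" "wtgt Q w"] by (simp add: tm s flip: idc_def)
  have 3: "ccomp (ccomp (Cell f []) (csrc \<psi>)) M = M"
    using units(4)[OF M(1)] idc_whisker(2)[of "csrc \<psi>" f] by (simp add: tm s f flip: idc_def)
  have "move_whiskers Q f ([] @ [w]) \<psi> = M"
    using 1 2 units(6)[OF M(1)] by (simp add: M_def psi)
  then show ?case
    using 3 M(1) units(5)[OF M(1)] boundary_3(2)[OF M(1)]
    by (auto simp: Let_def psi M_def cell_idc boundary_idc intro!: exI[of _ "idc (ctgt Q M)"])
next
  case (Cons v ws)
  obtain k vs where psi: "\<psi> = Cell k vs" using is_cell_dim(1)[OF \<psi>] dim_pos[of \<psi>] by auto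
  note b = boundary_2[OF \<psi>]
  have v: "is_whisker Q 1 v" "wsrc Q v = f" and C: "is_cell Q 2 (Cell (wtgt Q v) (ws @ [w]))"
    using Cell_Cons_2[of f v "ws @ [w]"] Cons.prems(1) by simp_all
  note vc = whisker_facts[OF v(1)]
  have e: "btgt Q 0 (wtgt Q v) = bsrc 0 \<psi>" using vc Cons.prems(2) v(2) by simp
  define M where "M = move_whisker Q w (csrc \<psi>) (whiskers \<psi>)"
  define D where "D = Cell (wtgt Q v) ws"
  define S where "S = ccomp (ccomp D (csrc \<psi>)) M"
  obtain R where R: "is_cell Q 3 S" "is_cell Q 3 R" "csrc R = ctgt Q S"
    "move_whiskers Q (wtgt Q v) (ws @ [w]) \<psi> = ccomp S R"
    using Cons.IH[OF C e] by (auto simp: Let_def S_def M_def D_def)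
  note Dc = Cell_snoc_2[OF C, folded D_def]
  have D: "csrc D = wtgt Q v" by (simp add: D_def)
  define CC where "CC = Cell (wtgt Q v) (ws @ [w])"
  have CC: "is_cell Q 2 CC" "csrc CC = wtgt Q v" using C by (simp_all add: CC_def)
  note CCb = boundary_2[OF CC(1), unfolded CC(2)]
  have MW: "csrc S = ccomp (ccomp CC (csrc \<psi>)) (ccomp (ctgt Q CC) \<psi>)"
    "ctgt Q R = ccomp (ccomp (wtgt Q v) \<psi>) (ccomp CC (ctgt Q \<psi>))"
    using move_whiskers_cell[OF poly3 ichg_gens \<psi> C e] R comp_2(2,3)[OF R(1,2)] by (simp_all add: CC_def)
  define V where "V = move_whisker Q v (csrc \<psi>) (whiskers \<psi>)"
  have V: "is_cell Q 3 V" "csrc V = ccomp (ccomp (wcell Q v) (csrc \<psi>)) (ccomp (wtgt Q v) \<psi>)"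
    "ctgt Q V = ccomp (ccomp f \<psi>) (ccomp (wcell Q v) (ctgt Q \<psi>))"
    using move_whisker_cell[OF poly3 ichg_gens v(1) \<psi>[unfolded psi]] Cons.prems(2) v(2) b by (simp_all add: V_def psi)
  have e': "btgt Q 0 (wcell Q v) = bsrc 0 \<psi>" "btgt Q 0 CC = bsrc 0 \<psi>" "btgt Q 0 D = bsrc 0 \<psi>"
    using vc e Cons.prems(2) v(2) CCb boundary_2(5)[OF Dc(3)] by (simp_all add: D)
  note s = comp_cells boundary_cell vc[unfolded v(2)] b e e' Cons.prems(2) \<psi> CC CCb D Dc(3)
  define P where "P = ccomp (wcell Q v) (csrc \<psi>)"
  have P: "is_cell Q 2 P" "csrc P = ccomp f (csrc \<psi>)" "ctgt Q P = ccomp (wtgt Q v) (csrc \<psi>)"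
    by (simp_all add: P_def s)
  define K where "K = ccomp V (ccomp CC (ctgt Q \<psi>))"
  have sS: "csrc (csrc S) = ccomp (wtgt Q v) (csrc \<psi>)" by (simp add: MW s)
  have sR: "csrc (csrc R) = ccomp (wtgt Q v) (csrc \<psi>)" using sS R(1,3) boundary_3(3) by simp
  have ctV: "ctgt Q (csrc V) = ccomp (wtgt Q v) (ctgt Q \<psi>)" by (simp add: V s)
  have K: "is_cell Q 3 K" "csrc K = ccomp (csrc V) (ccomp CC (ctgt Q \<psi>))"
    by (simp_all add: K_def V(1) ctV s)
  have PS: "is_cell Q 3 (ccomp P S)" "is_cell Q 3 (ccomp P R)" "csrc (ccomp P R) = ccomp P (ctgt Q S)"
      "ctgt Q (ccomp P S) = ccomp P (ctgt Q S)" "ctgt Q (ccomp P R) = ccomp P (ctgt Q R)"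
    using R P sS sR by (simp_all add: comp_cells)
  have dims: "has_dim 2 P" "has_dim 3 S" "has_dim 3 R" "has_dim 3 K" "has_dim 2 (ccomp (wtgt Q v) \<psi>)" "has_dim 2 (ccomp CC (ctgt Q \<psi>))"
    using P R K by (auto intro!: has_dim_cell[of Q] simp: s)
  have "csrc K = ctgt Q (ccomp P R)"
    unfolding K PS V(2) MW(2) P_def[symmetric] using dims by (simp add: ccomp_normal_simps)
  then have PRK: "is_cell Q 3 (ccomp (ccomp P R) K)" "csrc (ccomp (ccomp P R) K) = ctgt Q (ccomp P S)"
    using comp_2(1,2)[OF PS(2) K(1)] PS by simp_all
  have "move_whiskers Q f ((v # ws) @ [w]) \<psi> = ccomp (ccomp P (ccomp S R)) K"
    by (simp add: R(4) P_def K_def V_def CC_def)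
  \<comment> \<open>\<open>P\<close> is distributed over the composite of \<open>S\<close> and
    \<open>R\<close> given by the induction hypothesis; \<open>K\<close>, which moves
    \<open>v\<close>, joins the remainder.\<close>
  also have "\<dots> = ccomp (ccomp P S) (ccomp (ccomp P R) K)"
    using dims by (simp add: ccomp_normal_simps)
  finally have eq: "move_whiskers Q f ((v # ws) @ [w]) \<psi> = ccomp (ccomp P S) (ccomp (ccomp P R) K)" .
  \<comment> \<open>It remains to recognize \<open>P\<close> followed by \<open>S\<close> as the
    prefix in the claim, by splitting \<open>v\<close> off \<open>Cell f (v # ws)\<close>.\<close>
  have "is_cell Q 2 (Cell f (v # ws))"
    using Cell_snoc_2(3)[of f "v # ws" w] Cons.prems(1) by simp
  then have "Cell f (v # ws) = ccomp (wcell Q v) D" using Cell_Cons_2(4) by (simp add: D_def)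
  moreover have "is_cell Q 3 M"
    using move_whisker_cell[OF poly3 ichg_gens Dc(1) \<psi>[unfolded psi]] Dc(2) e'(3) boundary_2(6)[OF Dc(3)] b
    by (simp add: M_def psi)
  then have "has_dim 3 M" "has_dim 2 D" "has_dim 2 (wcell Q v)" "has_dim 1 (csrc \<psi>)"
    using Dc(3) vc(1) b(1) has_dim_cell[of Q] by blast+
  ultimately have "ccomp (ccomp (Cell f (v # ws)) (csrc \<psi>)) M = ccomp P S"
    by (simp add: ccomp_normal_simps P_def S_def)
  then show ?case using eq PS(1) PRK by (auto simp: Let_def M_def)
qed

text \<open>The interchange cell begins by moving the last whisker of \<open>\<phi>\<close>, and
  that move begins by passing the first whisker of \<open>\<psi>\<close>: this is the middle swap.
  \<open>R\<close> collects all later swaps.\<close>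

lemma middle_swap_interchange:
  assumes "middle_swap Q \<phi> \<psi> S" "is_cell Q 2 \<phi>" "is_cell Q 2 \<psi>" "btgt Q 0 \<phi> = bsrc 0 \<psi>"
  obtains R where "is_cell Q 3 S" "is_cell Q 3 R" "csrc R = ctgt Q S" "interchange Q \<phi> \<psi> = ccomp S R"
proof -
  obtain f ws w k v vs where phi: "\<phi> = Cell f (ws @ [w])" and psi: "\<psi> = Cell k (v # vs)"
    and S: "S = ccomp (ccomp (ccomp (Cell f ws) k) (swap Q w v)) (ccomp (ctgt Q \<phi>) (Cell (wtgt Q v) vs))"
    using assms(1) unfolding middle_swap_def by blast
  note wc = Cell_snoc_2[OF assms(2)[unfolded phi]] and vc = Cell_Cons_2[OF assms(3)[unfolded psi]]
  define M where "M = move_whisker Q w k (v # vs)"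
  define L where "L = ccomp (Cell f ws) k"
  define U where "U = ccomp (swap Q w v) (ccomp (wtgt Q w) (Cell (wtgt Q v) vs))"
  define W where "W = ccomp (ccomp (wsrc Q w) (wcell Q v)) (move_whisker Q w (wtgt Q v) vs)"
  have M: "M = ccomp U W" by (simp add: M_def U_def W_def)
  have f: "btgt Q 0 f = bsrc 0 \<psi>" using boundary_2(5)[OF assms(2)] assms(4) by (simp add: phi)
  obtain R where R: "is_cell Q 3 (ccomp L M)" "is_cell Q 3 R" "csrc R = ctgt Q (ccomp L M)"
    "interchange Q \<phi> \<psi> = ccomp (ccomp L M) R"
    using move_whiskers_split_last[OF assms(3) assms(2)[unfolded phi] f]
    by (auto simp: Let_def L_def M_def interchange_def phi psi)
  note wf = whisker_facts[OF wc(1)] and vf = whisker_facts[OF vc(1)]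
  have k: "is_cell Q 1 k" "bsrc 0 k = bsrc 0 \<psi>" using boundary_2(1,3)[OF assms(3)] by (simp_all add: psi)
  define C where "C = Cell (wtgt Q v) vs"
  have C: "is_cell Q 2 C" "csrc C = wtgt Q v" using vc(3) by (simp_all add: C_def)
  have e: "btgt Q 0 (wsrc Q w) = bsrc 0 \<psi>" "btgt Q 0 (Cell f ws) = bsrc 0 \<psi>" "bsrc 0 C = bsrc 0 \<psi>"
    using boundary_2(5,6)[OF wc(3)] wc(2) f boundary_2(3)[OF C(1)] C(2) vf(6) vc(2) k(2) by simp_all
  have sw: "is_cell Q 3 (swap Q w v)" "csrc (swap Q w v) = ccomp (ccomp (wcell Q w) k) (ccomp (wtgt Q w) (wcell Q v))"
    "ctgt Q (swap Q w v) = ccomp (ccomp (wsrc Q w) (wcell Q v)) (ccomp (wcell Q w) (wtgt Q v))"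
    using swap_cell[OF poly3 ichg_gens wc(1) vc(1)] e(1) k(2) vc(2) by simp_all
  define m where "m = move_whisker Q w (wtgt Q v) vs"
  have m: "is_cell Q 3 m" "csrc m = ccomp (ccomp (wcell Q w) (wtgt Q v)) (ccomp (wtgt Q w) C)"
    using move_whisker_cell[OF poly3 ichg_gens wc(1) vc(3)] e(1) k(2) vc(2) vf(6) by (simp_all add: m_def C_def)
  note s = comp_cells boundary_cell wf vf[unfolded vc(2)] k e C f wc(3) sw(1)
  have b3: "ctgt Q (csrc (swap Q w v)) = ccomp (wtgt Q w) (wtgt Q v)" "csrc (csrc (swap Q w v)) = ccomp (wsrc Q w) k"
    "csrc (csrc m) = ccomp (wsrc Q w) (wtgt Q v)"
    by (simp_all add: sw(2) m(2) s)
  have L: "is_cell Q 2 L" "ctgt Q L = ccomp (wsrc Q w) k"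
    using comp_0_right(1,5)[OF k(1) wc(3)] e(2) k(2) unfolding wc(2) L_def by simp_all
  have U: "is_cell Q 3 U" "csrc (csrc U) = ccomp (wsrc Q w) k" "ctgt Q U = ccomp (ctgt Q (swap Q w v)) (ccomp (wtgt Q w) C)"
    unfolding U_def C_def[symmetric] by (simp_all add: s b3)
  have W: "is_cell Q 3 W" "csrc W = ccomp (ccomp (wsrc Q w) (wcell Q v)) (csrc m)"
    unfolding W_def m_def[symmetric] by (simp_all add: s b3 m(1))
  have dims: "has_dim 2 L" "has_dim 3 U" "has_dim 3 W" "has_dim 3 R" "has_dim 2 (ccomp (wtgt Q w) C)"
     "has_dim 3 (swap Q w v)" "has_dim 2 (ccomp (wsrc Q w) (wcell Q v))" "has_dim 2 (ccomp (wcell Q w) (wtgt Q v))"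
    using L U W R by (auto intro!: has_dim_cell[of Q] simp: s)
  have UW: "csrc W = ctgt Q U"
    unfolding W(2) U(3) sw(3) m(2) using dims by (simp add: ccomp_normal_simps)
  have LU: "is_cell Q 3 (ccomp L U)" "ctgt Q (ccomp L U) = ccomp L (ctgt Q U)"
    using comp_1_23[OF L(1) U(1)] L U by simp_all
  have "csrc (csrc W) = ccomp (wsrc Q w) k" using UW boundary_3(3)[OF U(1)] U(2) by simp
  then have LW: "is_cell Q 3 (ccomp L W)" "csrc (ccomp L W) = ccomp L (csrc W)" "ctgt Q (ccomp L W) = ccomp L (ctgt Q W)"
    using comp_1_23[OF L(1) W(1)] L by simp_all
  have LM: "ccomp L M = ccomp (ccomp L U) (ccomp L W)" unfolding M using dims by (simp add: ccomp_normal_simps)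
  have S': "S = ccomp L U"
    unfolding S U_def L_def[symmetric] using dims wc(5) by (simp add: phi C_def ccomp_normal_simps)
  have cR: "csrc R = ctgt Q (ccomp L W)"
    using R(3) comp_2(3)[OF LU(1) LW(1)] LU(2) LW(2) UW by (simp add: LM)
  show thesis
  proof (rule that)
    show "is_cell Q 3 S" using LU by (simp add: S')
    show "is_cell Q 3 (ccomp (ccomp L W) R)" "csrc (ccomp (ccomp L W) R) = ctgt Q S"
      using comp_2[OF LW(1) R(2)] cR LU LW(2) UW by (simp_all add: S')
    show "interchange Q \<phi> \<psi> = ccomp S (ccomp (ccomp L W) R)"
      unfolding R(4) LM S' using dims by (simp add: ccomp_normal_simps)
  qed
qed

section \<open>Fillings by the naturality generators\<close>

lemma interchange_facts:
  assumes "is_cell Q 2 \<phi>" "is_cell Q 2 \<psi>" "btgt Q 0 \<phi> = bsrc 0 \<psi>"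
  shows "is_cell Q 3 (interchange Q \<phi> \<psi>)"
    "csrc (interchange Q \<phi> \<psi>) = ccomp (ccomp \<phi> (csrc \<psi>)) (ccomp (ctgt Q \<phi>) \<psi>)"
    "ctgt Q (interchange Q \<phi> \<psi>) = ccomp (ccomp (csrc \<phi>) \<psi>) (ccomp \<phi> (ctgt Q \<psi>))"
  using interchange_cell[OF poly3 ichg_gens assms] by simp_all

text \<open>The generator relates \<open>T\<close> followed by the interchange cell of the target of
  \<open>A\<close> to the interchange cell of its source followed by \<open>Y\<close>. As the latter
  interchange cell is \<open>S\<close> followed by \<open>R\<close>, the branching is closed by the
  former one and by \<open>R\<close> followed by \<open>Y\<close>.\<close>

lemma confluent_natl:
  assumes A: "A \<in> gens Q 3" and \<beta>: "\<beta> \<in> gens Q 2" and g: "is_cell Q 1 g"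
    and b: "btgt Q 0 (gsrc Q 3 A) = bsrc 0 g" "btgt Q 0 g = bsrc 0 (gsrc Q 2 \<beta>)"
    and S: "middle_swap Q (gsrc Q 3 A) (ccomp g (gen Q 2 \<beta>)) S"
  shows "confluent (ccomp (ccomp (gen Q 3 A) (ccomp g (gsrc Q 2 \<beta>))) (ccomp (ctgt Q (gsrc Q 3 A)) (ccomp g (gen Q 2 \<beta>)))) S"
proof -
  note Ac = gen3[OF A] and \<beta>c = gen2[OF \<beta>]
  define N where "N = natl Q A g \<beta>"
  define \<psi> where "\<psi> = ccomp g (gen Q 2 \<beta>)"
  let ?\<phi> = "gsrc Q 3 A" and ?\<phi>' = "gtgt Q 3 A"
  note s = comp_cells boundary_cell Ac \<beta>c g b
  have \<psi>: "is_cell Q 2 \<psi>" "csrc \<psi> = ccomp g (gsrc Q 2 \<beta>)" "ctgt Q \<psi> = ccomp g (gtgt Q 2 \<beta>)" "bsrc 0 \<psi> = bsrc 0 g"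
    by (simp_all add: \<psi>_def s)
  note X = interchange_facts[of ?\<phi> \<psi>] interchange_facts[of ?\<phi>' \<psi>]
  obtain R where R: "is_cell Q 3 S" "is_cell Q 3 R" "csrc R = ctgt Q S" "interchange Q ?\<phi> \<psi> = ccomp S R"
    using middle_swap_interchange[OF S] \<psi> Ac b by (auto simp: \<psi>_def)
  have X': "is_cell Q 3 (ccomp S R)" "ctgt Q R = ctgt Q (interchange Q ?\<phi> \<psi>)"
    using comp_2[OF R(1,2)] R by simp_all
  define Y where "Y = ccomp (ccomp (csrc ?\<phi>) \<psi>) (ccomp (gen Q 3 A) (ctgt Q \<psi>))"
  define T where "T = ccomp (ccomp (gen Q 3 A) (csrc \<psi>)) (ccomp (ctgt Q ?\<phi>) \<psi>)"
  have "composable3 Q 0 (gen Q 3 A) g (gen Q 2 \<beta>)" using b Ac \<beta>c by (simp add: composable3_def)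
  then have N: "N \<in> gens Q 4"
    "gsrc Q 4 N = ccomp (ccomp (ccomp (ccomp (gen Q 3 A) g) (gsrc Q 2 \<beta>)) (ccomp (ccomp (ctgt Q ?\<phi>) g) (gen Q 2 \<beta>))) (interchange Q ?\<phi>' (ccomp g (gen Q 2 \<beta>)))"
    "gtgt Q 4 N = ccomp (interchange Q ?\<phi> (ccomp g (gen Q 2 \<beta>))) (ccomp (ccomp (ccomp (csrc ?\<phi>) g) (gen Q 2 \<beta>)) (ccomp (ccomp (gen Q 3 A) g) (gtgt Q 2 \<beta>)))"
    using gray_presentation A \<beta> g unfolding gray_presentation_def has_naturality_generators_def Let_def N_def by blast+
  have dims: "has_dim 3 (gen Q 3 A)" "has_dim 1 g" "has_dim 1 (gsrc Q 2 \<beta>)" "has_dim 1 (gtgt Q 2 \<beta>)" "has_dim 2 (gen Q 2 \<beta>)"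
    "has_dim 1 (csrc ?\<phi>)" "has_dim 1 (ctgt Q ?\<phi>)"
    by (auto intro!: has_dim_cell[of Q] simp: s)
  \<comment> \<open>The generator composes \<open>A\<close> first with \<open>g\<close>, while
    \<open>T\<close> and \<open>Y\<close> use the boundary of \<open>\<psi>\<close>, into which
    \<open>g\<close> is absorbed.\<close>
  have N': "gsrc Q 4 N = ccomp T (interchange Q ?\<phi>' \<psi>)" "gtgt Q 4 N = ccomp (interchange Q ?\<phi> \<psi>) Y"
    unfolding N T_def Y_def \<psi>(2,3) unfolding \<psi>_def using dims by (simp_all add: ccomp_normal_simps)
  have c: "is_cell Q 3 T" "ctgt Q T = csrc (interchange Q ?\<phi>' \<psi>)" "is_cell Q 3 Y" "csrc Y = ctgt Q (interchange Q ?\<phi> \<psi>)"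
    "is_cell Q 3 (interchange Q ?\<phi>' \<psi>)"
    using X \<psi> by (simp_all add: T_def Y_def s)
  have RY: "is_cell Q 3 (ccomp R Y)" "csrc (ccomp R Y) = ctgt Q S"
    using comp_2[OF R(2) c(3)] X' c(4) R(3) by simp_all
  have "(ccomp T (interchange Q ?\<phi>' \<psi>), ccomp S (ccomp R Y)) \<in> sim"
    using sim_gen[OF N(1)] ccomp_assoc_dim(7)[OF has_dim_cell has_dim_cell has_dim_cell, OF R(1,2) c(3)]
    unfolding N' R(4) by simp
  then have "confluent T S" using c RY R(1) by (intro confluentI) simp_all
  then show ?thesis by (simp add: T_def \<psi>(2)) (simp add: \<psi>_def)
qed

text \<open>As for \<open>confluent_natl\<close> with the two sides exchanged: the closing cells are
  the interchange cell at the target of \<open>B\<close> and \<open>R\<close> followed by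
  \<open>Y\<close>.\<close>

lemma confluent_natr:
  assumes B: "B \<in> gens Q 3" and \<alpha>: "\<alpha> \<in> gens Q 2" and g: "is_cell Q 1 g"
    and b: "btgt Q 0 (gsrc Q 2 \<alpha>) = bsrc 0 g" "btgt Q 0 g = bsrc 0 (gsrc Q 3 B)"
    and S: "middle_swap Q (ccomp (gen Q 2 \<alpha>) g) (gsrc Q 3 B) S"
  shows "confluent (ccomp (ccomp (ccomp (gen Q 2 \<alpha>) g) (csrc (gsrc Q 3 B))) (ccomp (ccomp (gtgt Q 2 \<alpha>) g) (gen Q 3 B))) S"
proof -
  note Bc = gen3[OF B] and \<alpha>c = gen2[OF \<alpha>]
  define N where "N = natr Q \<alpha> g B"
  define \<phi> where "\<phi> = ccomp (gen Q 2 \<alpha>) g"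
  let ?\<psi> = "gsrc Q 3 B" and ?\<psi>' = "gtgt Q 3 B"
  note s = comp_cells boundary_cell Bc \<alpha>c g b
  have \<phi>: "is_cell Q 2 \<phi>" "csrc \<phi> = ccomp (gsrc Q 2 \<alpha>) g" "ctgt Q \<phi> = ccomp (gtgt Q 2 \<alpha>) g" "btgt Q 0 \<phi> = btgt Q 0 g"
    by (simp_all add: \<phi>_def s)
  note X = interchange_facts[of \<phi> ?\<psi>] interchange_facts[of \<phi> ?\<psi>']
  obtain R where R: "is_cell Q 3 S" "is_cell Q 3 R" "csrc R = ctgt Q S" "interchange Q \<phi> ?\<psi> = ccomp S R"
    using middle_swap_interchange[OF S] \<phi> Bc b by (auto simp: \<phi>_def)
  have X': "is_cell Q 3 (ccomp S R)" "ctgt Q R = ctgt Q (interchange Q \<phi> ?\<psi>)"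
    using comp_2[OF R(1,2)] R by simp_all
  define Y where "Y = ccomp (ccomp (csrc \<phi>) (gen Q 3 B)) (ccomp \<phi> (ctgt Q ?\<psi>))"
  define T where "T = ccomp (ccomp \<phi> (csrc ?\<psi>)) (ccomp (ctgt Q \<phi>) (gen Q 3 B))"
  have "composable3 Q 0 (gen Q 2 \<alpha>) g (gen Q 3 B)" using b Bc \<alpha>c by (simp add: composable3_def)
  then have N: "N \<in> gens Q 4"
    "gsrc Q 4 N = ccomp (ccomp (ccomp (ccomp (gen Q 2 \<alpha>) g) (csrc ?\<psi>)) (ccomp (ccomp (gtgt Q 2 \<alpha>) g) (gen Q 3 B))) (interchange Q (ccomp (gen Q 2 \<alpha>) g) ?\<psi>')"
    "gtgt Q 4 N = ccomp (interchange Q (ccomp (gen Q 2 \<alpha>) g) ?\<psi>) (ccomp (ccomp (ccomp (gsrc Q 2 \<alpha>) g) (gen Q 3 B)) (ccomp (ccomp (gen Q 2 \<alpha>) g) (ctgt Q ?\<psi>)))"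
    using gray_presentation B \<alpha> g unfolding gray_presentation_def has_naturality_generators_def Let_def N_def by blast+
  have N': "gsrc Q 4 N = ccomp T (interchange Q \<phi> ?\<psi>')" "gtgt Q 4 N = ccomp (interchange Q \<phi> ?\<psi>) Y"
    unfolding N T_def Y_def \<phi>(2,3) unfolding \<phi>_def by simp_all
  have c: "is_cell Q 3 T" "ctgt Q T = csrc (interchange Q \<phi> ?\<psi>')" "is_cell Q 3 Y" "csrc Y = ctgt Q (interchange Q \<phi> ?\<psi>)"
    "is_cell Q 3 (interchange Q \<phi> ?\<psi>')"
    using X \<phi> by (simp_all add: T_def Y_def s)
  have RY: "is_cell Q 3 (ccomp R Y)" "csrc (ccomp R Y) = ctgt Q S"
    using comp_2[OF R(2) c(3)] X' c(4) R(3) by simp_all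
  have "(ccomp T (interchange Q \<phi> ?\<psi>'), ccomp S (ccomp R Y)) \<in> sim"
    using sim_gen[OF N(1)] ccomp_assoc_dim(7)[OF has_dim_cell has_dim_cell has_dim_cell, OF R(1,2) c(3)]
    unfolding N' R(4) by simp
  then have "confluent T S" using c RY R(1) by (intro confluentI) simp_all
  then show ?thesis by (simp add: T_def \<phi>(3)) (simp add: \<phi>_def)
qed

section \<open>Natural branchings\<close>

text \<open>The case of \<open>confluent_whisker_context\<close> in which the left 1-cell and the
  preceding 2-cell are identities, absorbed by the unit laws.\<close>

lemma confluent_whisker_right:
  assumes c: "confluent F G" and r: "is_cell Q 1 r" "btgt Q 0 F = bsrc 0 r"
    and \<rho>: "is_cell Q 2 \<rho>" "csrc \<rho> = ccomp (ctgt Q (csrc F)) r"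
  shows "confluent (ccomp (ccomp F r) \<rho>) (ccomp (ccomp G r) \<rho>)"
proof -
  note FG = confluentD[OF c]
  have b: "bsrc 0 G = bsrc 0 F" "btgt Q 0 G = btgt Q 0 F"
    using boundary_3(5,7)[OF FG(1)] boundary_3(5,7)[OF FG(2)] FG(3) by simp_all
  \<comment> \<open>\<open>x\<close> and \<open>p\<close> are the cells whose identities serve as
    the empty left part: the source object of \<open>F\<close>, and the source 1-cell of
    \<open>F\<close> whiskered by \<open>r\<close>.\<close>
  define x where "x = bsrc 0 F"
  define p where "p = ccomp (csrc (csrc F)) r"
  have x: "is_cell Q 0 x" using boundary_cells(1)[OF FG(1)] by (simp add: x_def)
  then have ix: "is_cell Q 1 (idc x)" using idc_cell[of Q 0 x] by (simp add: One_nat_def)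
  note s = comp_cells boundary_cell FG(1,2) FG(3)[symmetric] r b \<rho> ix
  have p: "is_cell Q 1 p" "bsrc 0 (csrc (csrc F)) = x" by (simp_all add: p_def s x_def)
  have ux: "ccomp (idc x) F = F" "ccomp (idc x) G = G" "ccomp (idc x) (csrc (csrc F)) = csrc (csrc F)"
      "ccomp (idc x) (ctgt Q (csrc F)) = ctgt Q (csrc F)"
    using unit(2)[OF FG(1), of 0] unit(2)[OF FG(2), of 0] unit(2)[of 1 "csrc (csrc F)" 0] unit(2)[of 1 "ctgt Q (csrc F)" 0]
    by (simp_all add: s x_def)
  have up: "ccomp (idc p) (ccomp F r) = ccomp F r" "ccomp (idc p) (ccomp G r) = ccomp G r"
    using units(4)[of "ccomp F r"] units(4)[of "ccomp G r"] by (simp_all add: s p_def)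
  have "in_context Q (idc p) (idc x) F r \<rho>"
    using FG(1) p x \<rho> r ix by (simp add: in_context_3 in_context_2 s cell_idc boundary_idc boundary0_idc ux) (simp add: x_def p_def)
  from confluent_whisker_context[OF c this] show ?thesis by (simp add: whisker_context_def ux up)
qed

lemma confluent_whisker_left:
  assumes c: "confluent F G" and l: "is_cell Q 1 l" "btgt Q 0 l = bsrc 0 F"
    and \<mu>: "is_cell Q 2 \<mu>" "ctgt Q \<mu> = ccomp l (csrc (csrc F))"
  shows "confluent (ccomp \<mu> (ccomp l F)) (ccomp \<mu> (ccomp l G))"
proof -
  note FG = confluentD[OF c]
  have b: "bsrc 0 G = bsrc 0 F" "btgt Q 0 G = btgt Q 0 F"
    using boundary_3(5,7)[OF FG(1)] boundary_3(5,7)[OF FG(2)] FG(3) by simp_all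
  define x where "x = btgt Q 0 F"
  define p where "p = ccomp l (ctgt Q (csrc F))"
  have x: "is_cell Q 0 x" using boundary_cells(2)[OF FG(1)] by (simp add: x_def)
  then have ix: "is_cell Q 1 (idc x)" using idc_cell[of Q 0 x] by (simp add: One_nat_def)
  note s = comp_cells boundary_cell FG(1,2) FG(3)[symmetric] l b \<mu> ix
  have p: "is_cell Q 1 p" by (simp_all add: p_def s x_def)
  have ux: "ccomp (ccomp l F) (idc x) = ccomp l F" "ccomp (ccomp l G) (idc x) = ccomp l G"
    "ccomp (ccomp l (csrc (csrc F))) (idc x) = ccomp l (csrc (csrc F))" "ccomp (ccomp l (ctgt Q (csrc F))) (idc x) = p"
    using unit(1)[of 3 "ccomp l F" 0] unit(1)[of 3 "ccomp l G" 0] unit(1)[of 1 "ccomp l (csrc (csrc F))" 0]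
      unit(1)[of 1 "ccomp l (ctgt Q (csrc F))" 0]
    by (simp_all add: s x_def p_def)
  have m: "ctgt Q \<mu> = ccomp l (csrc (csrc F))" "ctgt Q \<mu> = ccomp l (csrc (csrc G))" using \<mu> FG(3) by simp_all
  have "is_cell Q 3 (ccomp \<mu> (ccomp l F))" "ctgt Q (csrc (ccomp \<mu> (ccomp l F))) = p"
    "is_cell Q 3 (ccomp \<mu> (ccomp l G))" "ctgt Q (csrc (ccomp \<mu> (ccomp l G))) = p"
    by (simp_all add: s p_def)
  then have up: "ccomp (ccomp \<mu> (ccomp l F)) (idc p) = ccomp \<mu> (ccomp l F)"
     "ccomp (ccomp \<mu> (ccomp l G)) (idc p) = ccomp \<mu> (ccomp l G)"
    using units(3) by metis+
  have "in_context Q \<mu> l F (idc x) (idc p)"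
    using FG(1) p x \<mu> l ix by (simp add: in_context_3 in_context_2 s cell_idc boundary_idc boundary0_idc ux) (simp add: x_def)
  from confluent_whisker_context[OF c this] show ?thesis by (simp add: whisker_context_def ux up)
qed

text \<open>\<open>middle_swap\<close> inspects lists of whiskers, so the list of a whiskered
  generator is needed explicitly; the identity context of the generator absorbs \<open>g\<close> by
  a unit law.\<close>

lemma ccomp_gen2:
  assumes \<alpha>: "\<alpha> \<in> gens Q 2" and g: "is_cell Q 1 g"
  shows "btgt Q 0 g = bsrc 0 (gsrc Q 2 \<alpha>) \<Longrightarrow>
      ccomp g (gen Q 2 \<alpha>) = Cell (ccomp g (gsrc Q 2 \<alpha>)) [(\<alpha>, [(g, idc (btgt Q 0 (gsrc Q 2 \<alpha>)))])]"
    "btgt Q 0 (gsrc Q 2 \<alpha>) = bsrc 0 g \<Longrightarrow>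
      ccomp (gen Q 2 \<alpha>) g = Cell (ccomp (gsrc Q 2 \<alpha>) g) [(\<alpha>, [(idc (bsrc 0 (gsrc Q 2 \<alpha>)), g)])]"
proof -
  note a = gen2(4)[OF \<alpha>]
  have gen: "gen Q 2 \<alpha> = Cell (gsrc Q 2 \<alpha>) [(\<alpha>, [(idc (bsrc 0 (gsrc Q 2 \<alpha>)), idc (btgt Q 0 (gsrc Q 2 \<alpha>)))])]"
    by (simp add: numeral_2_eq_2)
  have d: "cdim g = 1" "cdim (gsrc Q 2 \<alpha>) = 1" "cdim (idc (bsrc 0 (gsrc Q 2 \<alpha>))) = 1" "cdim (idc (btgt Q 0 (gsrc Q 2 \<alpha>))) = 1"
    using is_cell_dim(1)[OF g] is_cell_dim(1)[OF a] is_cell_dim(1)[OF boundary_cells(1)[OF a]] is_cell_dim(1)[OF boundary_cells(2)[OF a]]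
    by (simp_all add: One_nat_def)
  show "ccomp g (gen Q 2 \<alpha>) = Cell (ccomp g (gsrc Q 2 \<alpha>)) [(\<alpha>, [(g, idc (btgt Q 0 (gsrc Q 2 \<alpha>)))])]"
    if "btgt Q 0 g = bsrc 0 (gsrc Q 2 \<alpha>)"
    using unit(1)[OF g, of 0] that d unfolding gen by (simp add: ccomp_left lwact_def lact_def)
  show "ccomp (gen Q 2 \<alpha>) g = Cell (ccomp (gsrc Q 2 \<alpha>) g) [(\<alpha>, [(idc (bsrc 0 (gsrc Q 2 \<alpha>)), g)])]"
    if "btgt Q 0 (gsrc Q 2 \<alpha>) = bsrc 0 g"
    using unit(2)[OF g, of 0] that d lcomp_eq_rcomp[of "idc (bsrc 0 g)" g] unfolding gen
    by (simp add: ccomp_right ccomp_left rwact_def ract_def)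
qed

text \<open>Only the inner 1-cells \<open>r\<close> and \<open>l'\<close> enter the interchange
  generator, so the outer ones \<open>l\<close> and \<open>r'\<close> can be pulled out of the
  swap.\<close>

lemma swap_absorb:
  assumes \<alpha>: "\<alpha> \<in> gens Q 2" and \<beta>: "\<beta> \<in> gens Q 2"
    and c: "is_cell Q 1 l" "is_cell Q 1 r" "is_cell Q 1 l'" "is_cell Q 1 r'"
    and b: "btgt Q 0 l = bsrc 0 (gsrc Q 2 \<alpha>)" "btgt Q 0 (gsrc Q 2 \<alpha>) = bsrc 0 r" "btgt Q 0 r = bsrc 0 l'"
      "btgt Q 0 l' = bsrc 0 (gsrc Q 2 \<beta>)" "btgt Q 0 (gsrc Q 2 \<beta>) = bsrc 0 r'"
  shows "swap Q (\<alpha>, [(l, r)]) (\<beta>, [(l', r')]) = ccomp (swap Q (\<alpha>, [(l, r)]) (\<beta>, [(l', idc (btgt Q 0 (gsrc Q 2 \<beta>)))])) r'"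
    "swap Q (\<alpha>, [(l, r)]) (\<beta>, [(l', r')]) = ccomp l (swap Q (\<alpha>, [(idc (bsrc 0 (gsrc Q 2 \<alpha>)), r)]) (\<beta>, [(l', r')]))"
proof -
  note ac = gen2[OF \<alpha>] and bc = gen2[OF \<beta>]
  define Z where "Z = gen Q 3 (ichg Q \<alpha> (ccomp r l') \<beta>)"
  have "composable3 Q 0 (gen Q 2 \<alpha>) (ccomp r l') (gen Q 2 \<beta>)" "is_cell Q 1 (ccomp r l')"
    by (simp_all add: composable3_def comp_cells ac bc b c)
  then have "ichg Q \<alpha> (ccomp r l') \<beta> \<in> gens Q 3"
    using ichg_gens \<alpha> \<beta> unfolding has_interchange_generators_def Let_def by blast
  then have Z: "has_dim 3 Z" using gen3(1) has_dim_cell unfolding Z_def by blast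
  have ids: "is_cell Q 1 (idc (btgt Q 0 (gsrc Q 2 \<beta>)))" "is_cell Q 1 (idc (bsrc 0 (gsrc Q 2 \<alpha>)))"
    using boundary_cells[OF ac(4)] boundary_cells[OF bc(4)] idc_cell[of Q 0] by (simp_all add: One_nat_def)
  have dims: "has_dim 1 l" "has_dim 1 r'" "has_dim 1 (idc (btgt Q 0 (gsrc Q 2 \<beta>)))" "has_dim 1 (idc (bsrc 0 (gsrc Q 2 \<alpha>)))"
    using c ids by (auto intro: has_dim_cell)
  have u: "ccomp (idc (btgt Q 0 (gsrc Q 2 \<beta>))) r' = r'" "ccomp l (idc (bsrc 0 (gsrc Q 2 \<alpha>))) = l"
    using unit(2)[OF c(4), of 0] unit(1)[OF c(1), of 0] b by simp_all
  have "ccomp (ccomp (ccomp l Z) (idc (btgt Q 0 (gsrc Q 2 \<beta>)))) r' = ccomp (ccomp l Z) r'"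
    using ccomp_assoc_dim(3)[of 3 "ccomp l Z" "idc (btgt Q 0 (gsrc Q 2 \<beta>))" r'] dims Z u by simp
  then show "swap Q (\<alpha>, [(l, r)]) (\<beta>, [(l', r')]) = ccomp (swap Q (\<alpha>, [(l, r)]) (\<beta>, [(l', idc (btgt Q 0 (gsrc Q 2 \<beta>)))])) r'"
    by (simp add: swap_def Z_def del: gen.simps)
  have "ccomp l (ccomp (ccomp (idc (bsrc 0 (gsrc Q 2 \<alpha>))) Z) r') = ccomp (ccomp (ccomp l (idc (bsrc 0 (gsrc Q 2 \<alpha>)))) Z) r'"
    using dims Z by (simp add: ccomp_normal_simps)
  then show "swap Q (\<alpha>, [(l, r)]) (\<beta>, [(l', r')]) = ccomp l (swap Q (\<alpha>, [(idc (bsrc 0 (gsrc Q 2 \<alpha>)), r)]) (\<beta>, [(l', r')]))"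
    unfolding u by (simp add: swap_def Z_def del: gen.simps)
qed

lemma swap_boundary:
  assumes "is_whisker Q 1 w" "is_whisker Q 1 v" "btgt Q 0 (wsrc Q w) = bsrc 0 (wsrc Q v)"
  shows "is_cell Q 3 (swap Q w v)" "csrc (csrc (swap Q w v)) = ccomp (wsrc Q w) (wsrc Q v)"
    "ctgt Q (csrc (swap Q w v)) = ccomp (wtgt Q w) (wtgt Q v)"
proof -
  note sc = swap_cell[OF poly3 ichg_gens assms]
  note wf = whisker_facts[OF assms(1)] and vf = whisker_facts[OF assms(2)]
  show "is_cell Q 3 (swap Q w v)" by (rule sc)
  have b: "btgt Q 0 (wcell Q w) = bsrc 0 (wsrc Q v)" "btgt Q 0 (wtgt Q w) = bsrc 0 (wcell Q v)"
    using wf vf assms(3) by simp_all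
  note l = comp_0_right[OF vf(4) wf(1) _ _ b(1)] and r = comp_0_left[OF wf(5) vf(1) _ _ b(2)]
  have "ctgt Q (ccomp (wcell Q w) (wsrc Q v)) = csrc (ccomp (wtgt Q w) (wcell Q v))"
    using l(5) r(4) wf(3) vf(2) by simp
  from comp_1_22(2,3)[OF _ _ this]
  show "csrc (csrc (swap Q w v)) = ccomp (wsrc Q w) (wsrc Q v)" "ctgt Q (csrc (swap Q w v)) = ccomp (wtgt Q w) (wtgt Q v)"
    using l(1,4) r(1,5) wf(2) vf(3) by (simp_all add: sc(2))
qed

text \<open>Naturality generators involve one whiskered 2-generator, whereas a natural branching
  allows an arbitrary 2-cell \<open>\<psi>\<close>; the passage from one to the other is made
  here.\<close>

lemma confluent_middle_swap_left:
  assumes A: "A \<in> gens Q 3" and \<psi>: "is_cell Q 2 \<psi>" and b: "btgt Q 0 (gsrc Q 3 A) = bsrc 0 \<psi>"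
    and S: "middle_swap Q (gsrc Q 3 A) \<psi> S"
  shows "confluent (ccomp (ccomp (gen Q 3 A) (csrc \<psi>)) (ccomp (ctgt Q (gsrc Q 3 A)) \<psi>)) S"
proof -
  let ?\<phi> = "gsrc Q 3 A"
  note Ac = gen3[OF A]
  obtain f ws w k v vs where phi: "?\<phi> = Cell f (ws @ [w])" and psi: "\<psi> = Cell k (v # vs)"
    and S': "S = ccomp (ccomp (ccomp (Cell f ws) k) (swap Q w v)) (ccomp (ctgt Q ?\<phi>) (Cell (wtgt Q v) vs))"
    using S unfolding middle_swap_def by blast
  note wc = Cell_snoc_2[OF Ac(4)[unfolded phi]] and vc = Cell_Cons_2[OF \<psi>[unfolded psi]]
  obtain \<alpha> l r where w: "w = (\<alpha>, [(l, r)])" "\<alpha> \<in> gens Q 2" "is_cell Q 1 l" "is_cell Q 1 r"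
    "btgt Q 0 l = bsrc 0 (gsrc Q 2 \<alpha>)" "btgt Q 0 (gsrc Q 2 \<alpha>) = bsrc 0 r"
     "wsrc Q w = ccomp (ccomp l (gsrc Q 2 \<alpha>)) r"
    by (rule whisker2[OF poly3 ichg_gens wc(1)])
  obtain \<beta> g r' where v: "v = (\<beta>, [(g, r')])" "\<beta> \<in> gens Q 2" "is_cell Q 1 g" "is_cell Q 1 r'"
    "btgt Q 0 g = bsrc 0 (gsrc Q 2 \<beta>)" "btgt Q 0 (gsrc Q 2 \<beta>) = bsrc 0 r'"
    "wsrc Q v = ccomp (ccomp g (gsrc Q 2 \<beta>)) r'" "wtgt Q v = ccomp (ccomp g (gtgt Q 2 \<beta>)) r'"
    "wcell Q v = ccomp (ccomp g (gen Q 2 \<beta>)) r'"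
    by (rule whisker2[OF poly3 ichg_gens vc(1)])
  note \<beta>c = gen2[OF v(2)] and \<alpha>c = gen2[OF w(2)]
  \<comment> \<open>The first whisker of \<open>\<psi>\<close> with its right 1-cell
    \<open>r'\<close> replaced by an identity; its left 1-cell \<open>g\<close> is the one passed to
    the naturality generator.\<close>
  define v0 where "v0 = (\<beta>, [(g, idc (btgt Q 0 (gsrc Q 2 \<beta>)))])"
  have gb: "ccomp g (gen Q 2 \<beta>) = Cell (ccomp g (gsrc Q 2 \<beta>)) [v0]"
    using ccomp_gen2(1)[OF v(2,3,5)] by (simp add: v0_def)
  have k: "k = ccomp (ccomp g (gsrc Q 2 \<beta>)) r'" using vc(2) v(7) by simp
  have bg: "btgt Q 0 ?\<phi> = bsrc 0 g"
    using b boundary_2(3)[OF \<psi>] by (simp add: psi k comp_cells \<beta>c v(3-6))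
  have br: "btgt Q 0 r = bsrc 0 g"
  proof -
    have "btgt Q 0 (wsrc Q w) = btgt Q 0 ?\<phi>"
      using boundary_2(6)[OF wc(3)] boundary_2(5)[OF wc(3)] boundary_2(5)[OF Ac(4)] wc(2) by (simp add: phi del: ctgt.simps)
    then show ?thesis by (simp add: w(3-) comp_cells \<alpha>c bg)
  qed
  \<comment> \<open>Only the first whisker of \<open>\<psi>\<close> is involved, so the branching is a context of the one for \<open>g *\<^sub>0 \<beta>\<close>.\<close>
  define S0 where "S0 = ccomp (ccomp (ccomp (Cell f ws) (ccomp g (gsrc Q 2 \<beta>))) (swap Q w v0)) (ccomp (ctgt Q ?\<phi>) (Cell (wtgt Q v0) []))"
  have S0: "middle_swap Q ?\<phi> (ccomp g (gen Q 2 \<beta>)) S0"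
    unfolding middle_swap_def S0_def gb using phi by blast
  note c0 = confluent_natl[OF A v(2,3) bg v(5) S0]
  define T0 where "T0 = ccomp (ccomp (gen Q 3 A) (ccomp g (gsrc Q 2 \<beta>))) (ccomp (ctgt Q ?\<phi>) (ccomp g (gen Q 2 \<beta>)))"
  note s = comp_cells boundary_cell Ac \<beta>c v(3-6) bg b
  have T0: "is_cell Q 3 T0" "btgt Q 0 T0 = bsrc 0 r'"
    "ctgt Q (csrc T0) = ccomp (ctgt Q ?\<phi>) (ccomp g (gtgt Q 2 \<beta>))"
    by (simp_all add: T0_def s)
  define C where "C = Cell (wtgt Q v) vs"
  have C: "is_cell Q 2 C" "csrc C = ccomp (ccomp g (gtgt Q 2 \<beta>)) r'" using vc(3) v(8) by (simp_all add: C_def)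
  have bC: "bsrc 0 C = bsrc 0 g" using boundary_2(3)[OF C(1)] C(2) by (simp add: s)
  define \<rho> where "\<rho> = ccomp (ctgt Q ?\<phi>) C"
  have \<rho>: "is_cell Q 2 \<rho>" "csrc \<rho> = ccomp (ctgt Q ?\<phi>) (csrc C)" by (simp_all add: \<rho>_def s C(1) bC)
  have dims: "has_dim 3 (gen Q 3 A)" "has_dim 1 g" "has_dim 1 r'" "has_dim 1 (gsrc Q 2 \<beta>)" "has_dim 1 (gtgt Q 2 \<beta>)"
    "has_dim 2 (gen Q 2 \<beta>)" "has_dim 1 (ctgt Q ?\<phi>)" "has_dim 2 C" "has_dim 2 (Cell f ws)" "has_dim 2 \<rho>"
    by (auto intro!: has_dim_cell[of Q] simp: s C(1) wc(3) \<rho>(1))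
  have "csrc \<rho> = ccomp (ctgt Q (csrc T0)) r'"
    unfolding \<rho> T0 C using dims by (simp add: ccomp_normal_simps)
  from confluent_whisker_right[OF c0[folded T0_def] v(4) T0(2) \<rho>(1) this]
  have conf: "confluent (ccomp (ccomp T0 r') \<rho>) (ccomp (ccomp S0 r') \<rho>)" .
  have \<psi>eq: "\<psi> = ccomp (ccomp (ccomp g (gen Q 2 \<beta>)) r') C" using vc(4) v(9) by (simp add: psi C_def)
  have k\<psi>: "csrc \<psi> = ccomp (ccomp g (gsrc Q 2 \<beta>)) r'" using psi k by simp
  have e1: "ccomp (ccomp T0 r') \<rho> = ccomp (ccomp (gen Q 3 A) (csrc \<psi>)) (ccomp (ctgt Q ?\<phi>) \<psi>)"
    unfolding T0_def k\<psi> \<rho>_def unfolding \<psi>eq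
    by (rule ccomp_rearrange(1)) (use dims in simp_all)
  have gc: "is_cell Q 2 (ccomp g (gen Q 2 \<beta>))" "ctgt Q (ccomp g (gen Q 2 \<beta>)) = ccomp g (gtgt Q 2 \<beta>)" by (simp_all add: s)
  have vw0: "is_whisker Q 1 v0" "wsrc Q v0 = ccomp g (gsrc Q 2 \<beta>)" "wtgt Q v0 = ccomp g (gtgt Q 2 \<beta>)"
    using Cell_Cons_2(1,2)[OF gc(1)[unfolded gb]] gc(2) by (simp_all add: gb)
  have sw: "swap Q w v = ccomp (swap Q w v0) r'"
    using swap_absorb(1)[OF w(2) v(2) w(3,4) v(3,4) w(5,6) br v(5,6)] by (simp add: w(1) v(1) v0_def)
  have wt: "wtgt Q w = ctgt Q ?\<phi>" using wc(5) by (simp add: phi)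
  have bw: "btgt Q 0 (wsrc Q w) = bsrc 0 g" by (simp add: w(3-) comp_cells \<alpha>c br)
  have b0: "bsrc 0 (ccomp g (gsrc Q 2 \<beta>)) = bsrc 0 g" by (simp add: s)
  note sw0 = swap_boundary[OF wc(1) vw0(1), unfolded vw0 wt, unfolded b0, OF bw]
  have L: "is_cell Q 2 (ccomp (Cell f ws) (ccomp g (gsrc Q 2 \<beta>)))"
    "ctgt Q (ccomp (Cell f ws) (ccomp g (gsrc Q 2 \<beta>))) = ccomp (wsrc Q w) (ccomp g (gsrc Q 2 \<beta>))"
    using comp_0_right(1,5)[OF _ wc(3), of "ccomp g (gsrc Q 2 \<beta>)"] boundary_2(6)[OF wc(3)] bw b0
    unfolding wc(2) by (simp_all add: s del: ctgt.simps)
  have X: "is_cell Q 3 (ccomp (ccomp (Cell f ws) (ccomp g (gsrc Q 2 \<beta>))) (swap Q w v0))"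
    "ctgt Q (csrc (ccomp (ccomp (Cell f ws) (ccomp g (gsrc Q 2 \<beta>))) (swap Q w v0))) = ccomp (ctgt Q ?\<phi>) (ccomp g (gtgt Q 2 \<beta>))"
    using L sw0 boundary_3(1)[OF sw0(1)] by (simp_all add: comp_cells)
  \<comment> \<open>No whisker remains after \<open>v0\<close>, so the last factor of
    \<open>S0\<close> is an identity and disappears.\<close>
  have "ccomp (ctgt Q ?\<phi>) (Cell (wtgt Q v0) []) = idc (ccomp (ctgt Q ?\<phi>) (ccomp g (gtgt Q 2 \<beta>)))"
    using idc_whisker(1)[of "ctgt Q ?\<phi>" "ccomp g (gtgt Q 2 \<beta>)"] by (simp add: vw0 s flip: idc_def)
  then have S0': "S0 = ccomp (ccomp (Cell f ws) (ccomp g (gsrc Q 2 \<beta>))) (swap Q w v0)"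
    using units(3)[OF X(1)] unfolding X(2) S0_def by simp
  have e2: "ccomp (ccomp S0 r') \<rho> = S"
    unfolding S0' S' sw k C_def[symmetric] \<rho>_def[symmetric]
    by (rule ccomp_rearrange(2)) (use dims has_dim_cell[OF sw0(1)] in simp_all)
  show ?thesis using conf unfolding e1 e2 .
qed

text \<open>Dually, only the last whisker of \<open>\<phi>\<close> matters: its left 1-cell
  \<open>l\<close> and the earlier whiskers, collected in \<open>\<mu>\<close>, form a left context
  around the branching handled by \<open>confluent_natr\<close>.\<close>

lemma confluent_middle_swap_right:
  assumes B: "B \<in> gens Q 3" and \<phi>: "is_cell Q 2 \<phi>" and b: "btgt Q 0 \<phi> = bsrc 0 (gsrc Q 3 B)"
    and S: "middle_swap Q \<phi> (gsrc Q 3 B) S"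
  shows "confluent (ccomp (ccomp \<phi> (csrc (gsrc Q 3 B))) (ccomp (ctgt Q \<phi>) (gen Q 3 B))) S"
proof -
  let ?\<psi> = "gsrc Q 3 B"
  note Bc = gen3[OF B]
  obtain f ws w k v vs where phi: "\<phi> = Cell f (ws @ [w])" and psi: "?\<psi> = Cell k (v # vs)"
    and S': "S = ccomp (ccomp (ccomp (Cell f ws) k) (swap Q w v)) (ccomp (ctgt Q \<phi>) (Cell (wtgt Q v) vs))"
    using S unfolding middle_swap_def by blast
  note wc = Cell_snoc_2[OF \<phi>[unfolded phi]] and vc = Cell_Cons_2[OF Bc(4)[unfolded psi]]
  obtain \<alpha> l g where w: "w = (\<alpha>, [(l, g)])" "\<alpha> \<in> gens Q 2" "is_cell Q 1 l" "is_cell Q 1 g"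
    "btgt Q 0 l = bsrc 0 (gsrc Q 2 \<alpha>)" "btgt Q 0 (gsrc Q 2 \<alpha>) = bsrc 0 g"
    "wsrc Q w = ccomp (ccomp l (gsrc Q 2 \<alpha>)) g" "wtgt Q w = ccomp (ccomp l (gtgt Q 2 \<alpha>)) g"
    "wcell Q w = ccomp (ccomp l (gen Q 2 \<alpha>)) g"
    by (rule whisker2[OF poly3 ichg_gens wc(1)])
  obtain \<beta> l' r' where v: "v = (\<beta>, [(l', r')])" "\<beta> \<in> gens Q 2" "is_cell Q 1 l'" "is_cell Q 1 r'"
    "btgt Q 0 l' = bsrc 0 (gsrc Q 2 \<beta>)" "btgt Q 0 (gsrc Q 2 \<beta>) = bsrc 0 r'"
    "wsrc Q v = ccomp (ccomp l' (gsrc Q 2 \<beta>)) r'"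
    by (rule whisker2[OF poly3 ichg_gens vc(1)])
  note \<beta>c = gen2[OF v(2)] and \<alpha>c = gen2[OF w(2)]
  define w0 where "w0 = (\<alpha>, [(idc (bsrc 0 (gsrc Q 2 \<alpha>)), g)])"
  have ag: "ccomp (gen Q 2 \<alpha>) g = Cell (ccomp (gsrc Q 2 \<alpha>) g) ([] @ [w0])"
    using ccomp_gen2(2)[OF w(2,4,6)] by (simp add: w0_def)
  have k: "k = csrc ?\<psi>" "is_cell Q 1 k" "bsrc 0 k = bsrc 0 ?\<psi>" using boundary_2(1,3)[OF Bc(4)] by (simp_all add: psi)
  have wt: "wtgt Q w = ctgt Q \<phi>" using wc(5) by (simp add: phi)
  have bg: "btgt Q 0 g = bsrc 0 ?\<psi>"
  proof -
    have "btgt Q 0 (wtgt Q w) = btgt Q 0 \<phi>" using boundary_2(6)[OF \<phi>] wt by simp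
    then show ?thesis using b by (simp add: w(3-) comp_cells \<alpha>c)
  qed
  have bl: "btgt Q 0 g = bsrc 0 l'"
    using k(3) vc(2) by (simp add: bg v(3-) comp_cells \<beta>c flip: vc(2))
  define C where "C = Cell (wtgt Q v) vs"
  define S0 where "S0 = ccomp (ccomp (ccomp (Cell (ccomp (gsrc Q 2 \<alpha>) g) []) k) (swap Q w0 v)) (ccomp (ctgt Q (ccomp (gen Q 2 \<alpha>) g)) C)"
  have S0: "middle_swap Q (ccomp (gen Q 2 \<alpha>) g) ?\<psi> S0"
    unfolding middle_swap_def S0_def C_def using ag psi by blast
  note c0 = confluent_natr[OF B w(2,4,6) bg S0]
  define T0 where "T0 = ccomp (ccomp (ccomp (gen Q 2 \<alpha>) g) (csrc ?\<psi>)) (ccomp (ccomp (gtgt Q 2 \<alpha>) g) (gen Q 3 B))"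
  note s = comp_cells boundary_cell Bc \<alpha>c w(3-6) bg
  have T0: "is_cell Q 3 T0" "bsrc 0 T0 = bsrc 0 (gsrc Q 2 \<alpha>)"
    "csrc (csrc T0) = ccomp (ccomp (gsrc Q 2 \<alpha>) g) k"
    by (simp_all add: T0_def s k(1))
  have C: "is_cell Q 2 C" "csrc C = wtgt Q v" using vc(3) by (simp_all add: C_def)
  have bC: "bsrc 0 C = bsrc 0 ?\<psi>"
    using boundary_2(3)[OF C(1)] C(2) whisker_facts(6)[OF vc(1)] vc(2) k(3) by simp
  define \<mu> where "\<mu> = ccomp (Cell f ws) k"
  have bf: "btgt Q 0 (Cell f ws) = bsrc 0 k"
    using boundary_2(5)[OF wc(3)] boundary_2(5)[OF \<phi>] b k(3) by (simp add: phi)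
  have \<mu>: "is_cell Q 2 \<mu>" "ctgt Q \<mu> = ccomp (wsrc Q w) k"
    using comp_0_right(1,5)[OF k(2) wc(3)] bf unfolding wc(2) \<mu>_def by simp_all
  have dims: "has_dim 3 (gen Q 3 B)" "has_dim 1 g" "has_dim 1 l" "has_dim 1 (gsrc Q 2 \<alpha>)" "has_dim 1 (gtgt Q 2 \<alpha>)"
    "has_dim 2 (gen Q 2 \<alpha>)" "has_dim 1 k" "has_dim 2 C" "has_dim 2 (Cell f ws)" "has_dim 2 \<mu>"
    by (auto intro!: has_dim_cell[of Q] simp: s C(1) wc(3) \<mu>(1) k(2))
  have "ctgt Q \<mu> = ccomp l (csrc (csrc T0))"
    unfolding \<mu> T0 w(7) using dims by (simp add: ccomp_normal_simps)
  from confluent_whisker_left[OF c0[folded T0_def] w(3) _ \<mu>(1) this]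
  have conf: "confluent (ccomp \<mu> (ccomp l T0)) (ccomp \<mu> (ccomp l S0))" using w(5) T0(2) by simp
  have \<phi>eq: "\<phi> = ccomp (Cell f ws) (ccomp (ccomp l (gen Q 2 \<alpha>)) g)" using wc(4) w(9) by (simp add: phi)
  have e1: "ccomp \<mu> (ccomp l T0) = ccomp (ccomp \<phi> (csrc ?\<psi>)) (ccomp (ctgt Q \<phi>) (gen Q 3 B))"
    unfolding T0_def wt[symmetric] w(8) k(1)[symmetric] \<mu>_def unfolding \<phi>eq
    using ccomp_rearrange(3)[of "ccomp (gtgt Q 2 \<alpha>) g" k l "ccomp (gen Q 2 \<alpha>) g" "Cell f ws" "gen Q 3 B"] dims
      ccomp_assoc_dim(2)[of l 2 "gen Q 2 \<alpha>" g] ccomp_assoc_dim(1)[of l "gtgt Q 2 \<alpha>" 1 g] by simp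
  have gc: "is_cell Q 2 (ccomp (gen Q 2 \<alpha>) g)" "ctgt Q (ccomp (gen Q 2 \<alpha>) g) = ccomp (gtgt Q 2 \<alpha>) g"
    "csrc (ccomp (gen Q 2 \<alpha>) g) = ccomp (gsrc Q 2 \<alpha>) g" by (simp_all add: s)
  have vw0: "is_whisker Q 1 w0" "wsrc Q w0 = ccomp (gsrc Q 2 \<alpha>) g" "wtgt Q w0 = ccomp (gtgt Q 2 \<alpha>) g"
    using Cell_snoc_2(1,2,5)[OF gc(1)[unfolded ag]] gc(2,3) by (simp_all add: ag)
  have sw: "swap Q w v = ccomp l (swap Q w0 v)"
    using swap_absorb(2)[OF w(2) v(2) w(3,4) v(3,4) w(5,6) bl v(5,6)] by (simp add: w(1) v(1) w0_def)
  have bw: "btgt Q 0 (ccomp (gsrc Q 2 \<alpha>) g) = bsrc 0 k" by (simp add: s k(3))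
  note sw0 = swap_boundary[OF vw0(1) vc(1), unfolded vw0 vc(2), OF bw]
  have "ccomp (Cell (ccomp (gsrc Q 2 \<alpha>) g) []) k = idc (ccomp (ccomp (gsrc Q 2 \<alpha>) g) k)"
    using idc_whisker(2)[of k "ccomp (gsrc Q 2 \<alpha>) g"] k(2) by (simp add: s flip: idc_def)
  then have S0': "S0 = ccomp (swap Q w0 v) (ccomp (ccomp (gtgt Q 2 \<alpha>) g) C)"
    using units(4)[OF sw0(1)] unfolding sw0(2) S0_def gc(2) by simp
  have e2: "ccomp \<mu> (ccomp l S0) = S"
    unfolding S0' S' sw wt[symmetric] w(8) C_def[symmetric] \<mu>_def[symmetric]
    using ccomp_rearrange(4)[of "ccomp (gtgt Q 2 \<alpha>) g" k l \<mu> C "swap Q w0 v"] dims has_dim_cell[OF sw0(1)]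
      ccomp_assoc_dim(1)[of l "gtgt Q 2 \<alpha>" 1 g] by simp
  show ?thesis using conf unfolding e1 e2 .
qed

lemma confluent_natural:
  assumes "natural_branching Q S\<^sub>1 S\<^sub>2"
  shows "confluent S\<^sub>1 S\<^sub>2"
  using assms unfolding natural_branching_def Let_def
proof (elim disjE bexE exE conjE)
  fix A g \<psi> assume A: "A \<in> gens Q 3" "is_cell Q 1 g" "is_cell Q 2 \<psi>" "composable3 Q 0 (gsrc Q 3 A) g \<psi>"
    and S: "S\<^sub>1 = ccomp (ccomp (ccomp (gen Q 3 A) g) (csrc \<psi>)) (ccomp (ccomp (ctgt Q (gsrc Q 3 A)) g) \<psi>)"
      "middle_swap Q (gsrc Q 3 A) (ccomp g \<psi>) S\<^sub>2"
  note s = comp_cells boundary_cell gen3[OF A(1)] A(2,3) A(4)[unfolded composable3_def]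
  have "has_dim 3 (gen Q 3 A)" "has_dim 1 g" "has_dim 1 (csrc \<psi>)" "has_dim 1 (ctgt Q (gsrc Q 3 A))" "has_dim 2 \<psi>"
    by (auto intro!: has_dim_cell[of Q] simp: s)
  then have "S\<^sub>1 = ccomp (ccomp (gen Q 3 A) (csrc (ccomp g \<psi>))) (ccomp (ctgt Q (gsrc Q 3 A)) (ccomp g \<psi>))"
    by (simp add: S(1) s ccomp_normal_simps)
  then show ?thesis using confluent_middle_swap_left[OF A(1) _ _ S(2)] by (simp add: s)
next
  fix B g \<phi> assume B: "B \<in> gens Q 3" "is_cell Q 1 g" "is_cell Q 2 \<phi>" "composable3 Q 0 \<phi> g (gsrc Q 3 B)"
    and S: "S\<^sub>1 = ccomp (ccomp (ccomp \<phi> g) (csrc (gsrc Q 3 B))) (ccomp (ccomp (ctgt Q \<phi>) g) (gen Q 3 B))"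
      "middle_swap Q (ccomp \<phi> g) (gsrc Q 3 B) S\<^sub>2"
  note s = comp_cells boundary_cell gen3[OF B(1)] B(2,3) B(4)[unfolded composable3_def]
  show ?thesis using confluent_middle_swap_right[OF B(1) _ _ S(2)] by (simp add: S(1) s)
qed

section \<open>Local confluence\<close>

text \<open>The size is lexicographic: the number of whiskers of the source 2-cell, then the length
  of its source 1-cell. A nonidentity \<open>\<mu>\<close> or \<open>\<rho>\<close> increases the
  first component; if both are identities, a nonidentity \<open>l\<close> or \<open>r\<close>
  increases the second and leaves the first unchanged.\<close>

lemma branching_size_less:
  assumes F: "is_cell Q 3 F" and c: "in_context Q \<mu> l F r \<rho>"
    and n: "\<not> (is_identity l \<and> is_identity r \<and> is_identity \<mu> \<and> is_identity \<rho>)"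
  defines "m \<equiv> \<lambda>F. (length (whiskers (csrc F)), length (whiskers (csrc (csrc F))))"
  shows "(m F, m (whisker_context \<mu> l F r \<rho>)) \<in> less_than <*lex*> less_than"
proof -
  have c': "is_cell Q 1 l" "is_cell Q 1 r" "is_cell Q 2 \<mu>" "is_cell Q 2 \<rho>" "btgt Q 0 l = bsrc 0 F" "btgt Q 0 F = bsrc 0 r"
    "ctgt Q \<mu> = ccomp (ccomp l (csrc (csrc F))) r" "csrc \<rho> = ccomp (ccomp l (ctgt Q (csrc F))) r"
    using c F by (simp_all add: in_context_3 in_context_2 boundary_3)
  define \<phi> where "\<phi> = ccomp (ccomp l (csrc F)) r"
  note Fb = boundary_3[OF F]
  have l\<phi>: "is_cell Q 2 (ccomp l (csrc F))" "btgt Q 0 (ccomp l (csrc F)) = bsrc 0 r"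
    "csrc (ccomp l (csrc F)) = ccomp l (csrc (csrc F))" "ctgt Q (ccomp l (csrc F)) = ccomp l (ctgt Q (csrc F))"
    using comp_0_left[OF c'(1) Fb(1)] Fb c'(5,6) by simp_all
  have \<phi>: "is_cell Q 2 \<phi>" "csrc \<phi> = ctgt Q \<mu>" "ctgt Q \<phi> = csrc \<rho>"
    using comp_0_right[OF c'(2) l\<phi>(1)] l\<phi> c' by (simp_all add: \<phi>_def)
  note \<mu>\<phi> = comp_1_22[OF c'(3) \<phi>(1) \<phi>(2)[symmetric]]
  have s: "csrc (whisker_context \<mu> l F r \<rho>) = ccomp (ccomp \<mu> \<phi>) \<rho>"
    using whisker_context_cell(2)[OF F c] by (simp add: whisker_context_def \<phi>_def)
  have ss: "csrc (csrc (whisker_context \<mu> l F r \<rho>)) = csrc \<mu>"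
    using comp_1_22(2)[OF \<mu>\<phi>(1) c'(4)] \<mu>\<phi> \<phi>(3) by (simp add: s)
  have d: "cdim l = 1" "cdim r = 1" "cdim \<mu> = 2" "cdim \<rho> = 2" "cdim (csrc F) = 2" "cdim (ccomp l (csrc F)) = 2"
    "cdim \<phi> = 2" "cdim (ccomp \<mu> \<phi>) = 2" "cdim (csrc (csrc F)) = 1" "cdim (ccomp l (csrc (csrc F))) = 1"
    using c'(1-4)[THEN is_cell_dim(1)] is_cell_dim(1)[OF Fb(1)] is_cell_dim(1)[OF l\<phi>(1)] is_cell_dim(1)[OF \<phi>(1)]
      is_cell_dim(1)[OF \<mu>\<phi>(1)] is_cell_dim(1)[OF boundary_2(1)[OF Fb(1)]] is_cell_dim(1)[OF boundary_2(1)[OF l\<phi>(1)]] l\<phi>(3)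
    by simp_all
  have len: "length (whiskers (csrc (whisker_context \<mu> l F r \<rho>))) = length (whiskers \<mu>) + length (whiskers (csrc F)) + length (whiskers \<rho>)"
    using d by (simp add: s length_whiskers_ccomp) (simp add: \<phi>_def length_whiskers_ccomp)
  show ?thesis
  proof (cases "whiskers \<mu> = [] \<and> whiskers \<rho> = []")
    case False
    then show ?thesis using len by (auto simp: m_def)
  next
    case True
    then have lr: "whiskers l \<noteq> [] \<or> whiskers r \<noteq> []" using n d by (auto simp: is_identity_iff)
    \<comment> \<open>As \<open>\<mu>\<close> is an identity, the source 1-cell of the whole is that
      of \<open>F\<close> whiskered by \<open>l\<close> and \<open>r\<close>.\<close>
    have "csrc \<mu> = ctgt Q \<mu>" using True d(3) by (cases \<mu>) auto
    then have "length (whiskers (csrc \<mu>)) = length (whiskers l) + length (whiskers (csrc (csrc F))) + length (whiskers r)"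
      using d by (simp add: c'(7) length_whiskers_ccomp)
    moreover have "0 < length (whiskers l) + length (whiskers r)" using lr by auto
    ultimately show ?thesis using len True by (simp add: m_def ss)
  qed
qed

text \<open>The induction measures only the first step, whose source is also that of the second.
  Minimal branchings are distributed over the cases excluded in the definition of critical ones, in
  either order.\<close>

lemma locally_confluent:
  assumes critical: "\<And>S\<^sub>1 S\<^sub>2. critical_branching Q S\<^sub>1 S\<^sub>2 \<Longrightarrow> confluent S\<^sub>1 S\<^sub>2"
  shows "local_branching Q S\<^sub>1 S\<^sub>2 \<Longrightarrow> confluent S\<^sub>1 S\<^sub>2"
proof (induction S\<^sub>1 arbitrary: S\<^sub>2 rule: wf_induct_rule[OF wf_inv_image[OF wf_lex_prod[OF wf_less_than wf_less_than],
      of "\<lambda>F. (length (whiskers (csrc F)), length (whiskers (csrc (csrc F))))"]])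
  case (1 S\<^sub>1)
  have cells: "is_cell Q 3 S\<^sub>1" "is_cell Q 3 S\<^sub>2"
    using 1(2) rewriting_step_cell by (auto simp: local_branching_def)
  show ?case
  proof (cases "minimal_branching Q S\<^sub>1 S\<^sub>2")
    case False
    then obtain S\<^sub>1' S\<^sub>2' \<mu> l r \<rho> where S: "local_branching Q S\<^sub>1' S\<^sub>2'"
        "in_context Q \<mu> l S\<^sub>1' r \<rho>" "S\<^sub>1 = whisker_context \<mu> l S\<^sub>1' r \<rho>" "S\<^sub>2 = whisker_context \<mu> l S\<^sub>2' r \<rho>"
        "\<not> (is_identity l \<and> is_identity r \<and> is_identity \<mu> \<and> is_identity \<rho>)"
      unfolding minimal_branching_def by blast
    have "is_cell Q 3 S\<^sub>1'" using S(1) rewriting_step_cell by (simp add: local_branching_def)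
    from branching_size_less[OF this S(2,5)]
    have "confluent S\<^sub>1' S\<^sub>2'" using 1(1)[OF _ S(1)] unfolding S(3) by (simp only: in_inv_image)
    then show ?thesis unfolding S(3,4) by (rule confluent_whisker_context[OF _ S(2)])
  next
    case True
    consider "S\<^sub>1 = S\<^sub>2" | "independent_branching Q S\<^sub>1 S\<^sub>2" | "independent_branching Q S\<^sub>2 S\<^sub>1"
      | "natural_branching Q S\<^sub>1 S\<^sub>2" | "natural_branching Q S\<^sub>2 S\<^sub>1" | "critical_branching Q S\<^sub>1 S\<^sub>2"
      using 1(2) True unfolding critical_branching_def trivial_branching_def by blast
    then show ?thesis
    proof cases
      case 1
      have "confluent S\<^sub>1 S\<^sub>1"
        using cells(1) boundary_3(2)[OF cells(1)]
        by (intro confluentI[of _ _ "idc (ctgt Q S\<^sub>1)" "idc (ctgt Q S\<^sub>1)"]) (simp_all add: cell_idc boundary_idc units sim_refl)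
      then show ?thesis using 1 by simp
    qed (use confluent_independent confluent_natural confluent_sym critical in blast)+
  qed
qed

end

theorem mainTheorem5:
  fixes Q :: "'g gray"
  assumes gray: "gray_presentation Q"
    and termin: "terminating Q"
    and critical: "\<And>S\<^sub>1 S\<^sub>2. critical_branching Q S\<^sub>1 S\<^sub>2 \<Longrightarrow>
      \<exists>\<psi> F\<^sub>1 F\<^sub>2. is_cell Q 2 \<psi> \<and>
        is_cell Q 3 F\<^sub>1 \<and> csrc F\<^sub>1 = ctgt Q S\<^sub>1 \<and> ctgt Q F\<^sub>1 = \<psi> \<and>
        is_cell Q 3 F\<^sub>2 \<and> csrc F\<^sub>2 = ctgt Q S\<^sub>2 \<and> ctgt Q F\<^sub>2 = \<psi> \<and>
        (\<exists>G \<in> gens Q 4. gsrc Q 4 G = S\<^sub>1 \<star>\<^sub>2 F\<^sub>1 \<and> gtgt Q 4 G = S\<^sub>2 \<star>\<^sub>2 F\<^sub>2)"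
  shows "coherent_gray_presentation Q"
proof -
  interpret gray Q by (rule gray.intro[OF gray])
  \<comment> \<open>The 4-generator of the hypothesis is itself one of the generating pairs of
    \<open>sim\<close>.\<close>
  have "confluent S\<^sub>1 S\<^sub>2" if c: "critical_branching Q S\<^sub>1 S\<^sub>2" for S\<^sub>1 S\<^sub>2
  proof -
    have "is_cell Q 3 S\<^sub>1" "is_cell Q 3 S\<^sub>2"
      using c rewriting_step_cell by (auto simp: critical_branching_def local_branching_def)
    moreover obtain F\<^sub>1 F\<^sub>2 G where "is_cell Q 3 F\<^sub>1" "csrc F\<^sub>1 = ctgt Q S\<^sub>1" "is_cell Q 3 F\<^sub>2" "csrc F\<^sub>2 = ctgt Q S\<^sub>2"
      and G: "G \<in> gens Q 4" "gsrc Q 4 G = ccomp S\<^sub>1 F\<^sub>1" "gtgt Q 4 G = ccomp S\<^sub>2 F\<^sub>2"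
      using critical[OF c] by blast
    moreover have "(ccomp S\<^sub>1 F\<^sub>1, ccomp S\<^sub>2 F\<^sub>2) \<in> sim" using sim_gen[OF G(1)] G by simp
    ultimately show ?thesis by (intro confluentI)
  qed
  then have "coherent (localization 3 (presented_precat 3 Q))"
    using coherent_if_locally_confluent[OF termin locally_confluent] by blast
  then show ?thesis using gray by (simp add: coherent_gray_presentation_def)
qed

end
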